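(* Let $(B,g_B)$ be a non-degenerate semi-Riemannian manifold, let $(F_j,g_{F_j})$, $1\le j\le m$, be semi-regular semi-Riemannian manifolds, and let $b_j\in C^\infty(B)$, $1\le j\le m$. Let $\overline R$ be the semi-symmetric metric curvature, with respect to $P$, of the multiply warped product $B\times_{b_1}F_1\times\cdots\times_{b_m}F_m$, where $P\in\Gamma(TB)$. For all $X,Y,Z,T\in\Gamma(TB)$ and all $U_k\in\Gamma(TF_k)$, $V_i\in\Gamma(TF_i)$, $W_j\in\Gamma(TF_j)$, $Q_s\in\Gamma(TF_s)$ (indices $i,j,k,s\in\{1,\dots,m\}$): (1) $\overline R(X,Y,Z,T)=\overline R_B(X,Y,Z,T)$; (2) $\overline R(X,Y,Z,W_j)=\overline R(Z,W_j,X,Y)=0$; (3) if $i=j$: $\overline R(X,Y,V_i,W_j)=\overline R(V_i,W_j,X,Y)=0$; (4) if $i=j$: $\overline R(X,V_i,W_j,Y)=b_jg_B^*(\nabla^\flat_XY,db_j)g_{F_j}(V_j,W_j)-b_jXY(b_j)g_{F_j}(V_j,W_j)-b_j^2g_{F_j}(V_j,W_j)\mathcal K_B(X,P,Y)-b_jP(b_j)g_B(X,Y)g_{F_j}(V_j,W_j)+b_j^2g_B(X,P)g_B(Y,P)g_{F_j}(V_j,W_j)-b_j^2g_B(X,Y)g_B(P,P)g_{F_j}(V_j,W_j)$; (5) if $i\ne j$: $\overline R(X,Y,V_i,W_j)=\overline R(V_i,W_j,X,Y)=\overline R(X,V_i,W_j,Y)=0$; (6) if $i=j=k$: $\overline R(X,V_i,W_j,U_k)=\overline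 R(W_j,U_k,X,V_i)=0$; (7) if $i=j\ne k$: $\overline R(X,V_i,W_j,U_k)=\overline R(X,U_k,V_i,W_j)=\overline R(W_j,U_k,X,V_i)=\overline R(V_i,W_j,X,U_k)=0$; (8) if $i,j,k$ are different: $\overline R(X,V_i,W_j,U_k)=\overline R(W_j,U_k,X,V_i)=0$; (9) if $i=j=k=s$: $\overline R(U_k,V_i,W_j,Q_s)=b_j^2R_{F_j}(U_j,V_j,W_j,Q_j)+\big(b_j^2g_B^*(db_j,db_j)+2b_j^3P(b_j)+b_j^4g_B(P,P)\big)\big(g_{F_j}(U_j,W_j)g_{F_j}(V_j,Q_j)-g_{F_j}(V_j,W_j)g_{F_j}(U_j,Q_j)\big)$; (10) if $i=j=s\ne k$: $\overline R(U_k,V_i,W_j,Q_s)=\overline R(W_j,Q_s,U_k,V_i)=0$; (11) if $j=k\ne i=s$: $\overline R(U_k,V_i,W_j,Q_s)=\big(b_ib_jg_B^*(db_i,db_j)+b_ib_j^2P(b_i)+b_jb_i^2P(b_j)+b_i^2b_j^2g_B(P,P)\big)g_{F_i}(V_i,Q_i)g_{F_j}(U_j,W_j)$; (12) $\overline R(U_k,V_i,W_j,Q_s)=0$ in all other cases.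
   Context: A singular semi-Riemannian manifold $(M,g)$ is a smooth manifold with a smooth symmetric bilinear form $g$ on $TM$, possibly degenerate and of variable signature; it is non-degenerate if $g$ is non-degenerate everywhere. Its Koszul form is $\mathcal K(X,Y,Z)=\frac12\{X(g(Y,Z))+Y(g(Z,X))-Z(g(X,Y))-g(X,[Y,Z])+g(Y,[Z,X])+g(Z,[X,Y])\}$, and $(\nabla^\flat_XY)(Z)=\mathcal K(X,Y,Z)$. Contraction: let $T_p^\bullet M=\{g_p(v,\cdot):v\in T_pM\}\subset T_p^*M$ with inner product $g_p^\bullet(g_p(v,\cdot),g_p(w,\cdot))=g_p(v,w)$. For 1-forms $\omega,\tau$ with values in $T^\bullet M$, $\omega(\bullet)\tau(\bullet)$ is the function $p\mapsto g^\bullet_p(\omega_p,\tau_p)$ on the dense open set where the rank of $g$ is locally constant; it is called smooth if it extends (uniquely) to a smooth function on $M$, and then the same symbol denotes the extension. $(M,g)$ is radical-stationary if $\mathcal K(X,Y,\cdot)$ takes values in $T^\bullet M$ for all vector fields $X,Y$, and semi-regular if moreover all $\mathcal K(X,Y,\bullet)\mathcal K(Z,T,\bullet)$ are smooth. On a semi-regular manifold $R(X,Y,Z,T)=X(\mathcal K(Y,Z,T))-Y(\mathcal K(X,Z,T))-\mathcal K([X,Y],Z,T)+\mathcal K(X,Z,\bullet)\mathcal K(Y,T,\bullet)-\mathcal K(Y,Z,\bullet)\mathcal K(X,T,\bullet)$. For a vector field $P$ on $M$, the semi-symmetric metric Koszul form is $\overline{\mathcal K}(X,Y,Z)=\mathcal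 K(X,Y,Z)+g(Y,P)g(X,Z)-g(X,Y)g(P,Z)$. The semi-symmetric metric curvature $\overline R$ is given by the formula for $R$ with $\mathcal K$ replaced everywhere by $\overline{\mathcal K}$ (well defined on semi-regular manifolds). The multiply warped product $B\times_{b_1}F_1\times\cdots\times_{b_m}F_m$ is $B\times F_1\times\cdots\times F_m$ with $g=\pi_B^*(g_B)+\sum_j(b_j\circ\pi_B)^2\pi_{F_j}^*(g_{F_j})$, where the $\pi$'s are the canonical projections; the $b_j$ may vanish. Under the hypotheses of the claim it is semi-regular. Vector fields in $\Gamma(TB)$, $\Gamma(TF_j)$ are identified with their lifts to the product, and functions and tensors on the factors with their pullbacks. Subscripts $B$, $F_j$ denote objects of that factor ($\overline R_B$ uses $P$ on $B$). When indices coincide, e.g. $i=j$, $V_i$ is also written $V_j$. $g_B^*$ is the inverse metric of $g_B$ on 1-forms of $B$; in $g_B^*(\nabla^\flat_XY,db_j)$, $\nabla^\flat_XY=\mathcal K_B(X,Y,\cdot)$. $XY(f)$ means $X(Y(f))$.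
   Formalization: In (12), "all other cases" also excludes i=j≠k=s: there the curvature is minus the expression of (11) with U_k and V_i interchanged (skew symmetry in the first two arguments), which is nonzero in general, e.g. B=(0,∞), P=0, b_i=b_k=t. *)

theory Defs
  imports "HOL-Analysis.Analysis" "HOL-Library.Function_Algebras"
begin

section \<open>Smooth functions between subsets of Euclidean spaces\<close>

primrec ck_on ::
  "nat \<Rightarrow> 'e::euclidean_space set \<Rightarrow> ('e \<Rightarrow> 'c::real_normed_vector) \<Rightarrow> bool" where
  "ck_on 0 S f \<longleftrightarrow> continuous_on S f"
| "ck_on (Suc k) S f \<longleftrightarrow> (\<forall>x\<in>S. f differentiable (at x)) \<and>
     (\<forall>v. ck_on k S (\<lambda>x. frechet_derivative f (at x) v))"

text \<open>A map on an arbitrary subset is smooth if it extends smoothly near each of its points.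
  Below, the subset is always open in a linear subspace, where this is ordinary smoothness.\<close>

definition smooth_on ::
  "'e::euclidean_space set \<Rightarrow> ('e \<Rightarrow> 'c::real_normed_vector) \<Rightarrow> bool" where
  "smooth_on A f \<longleftrightarrow>
     (\<forall>x\<in>A. \<exists>S h. open S \<and> x \<in> S \<and> (\<forall>k. ck_on k S h) \<and> (\<forall>y\<in>A \<inter> S. h y = f y))"

section \<open>Smooth manifolds\<close>

text \<open>The charts of a manifold take values in a linear subspace \<open>model\<close> of the type \<open>'e\<close>.
  The dimension of the manifold is that of \<open>model\<close>, so that manifolds of different dimensions
  can share the types \<open>'a\<close> and \<open>'e\<close>.\<close>

record ('a, 'e) manifold =
  points :: "'a set"
  model :: "'e set"
  atlas :: "('a set \<times> ('a \<Rightarrow> 'e)) set"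

definition manifold_topology :: "('a, 'e::euclidean_space) manifold \<Rightarrow> 'a topology" where
  "manifold_topology M = topology (\<lambda>S. S \<subseteq> points M \<and>
     (\<forall>(U, \<phi>)\<in>atlas M. openin (top_of_set (model M)) (\<phi> ` (S \<inter> U))))"

definition smooth_manifold :: "('a, 'e::euclidean_space) manifold \<Rightarrow> bool" where
  "smooth_manifold M \<longleftrightarrow>
     subspace (model M) \<and>
     (\<Union>(U, \<phi>)\<in>atlas M. U) = points M \<and>
     (\<forall>(U, \<phi>)\<in>atlas M. inj_on \<phi> U \<and> openin (top_of_set (model M)) (\<phi> ` U)) \<and>
     (\<forall>(U, \<phi>)\<in>atlas M. \<forall>(V, \<psi>)\<in>atlas M.
        openin (top_of_set (model M)) (\<phi> ` (U \<inter> V)) \<and>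
        smooth_on (\<phi> ` (U \<inter> V)) (\<psi> \<circ> inv_into U \<phi>)) \<and>
     Hausdorff_space (manifold_topology M) \<and>
     second_countable (manifold_topology M)"

text \<open>Only the values on \<open>points M\<close> of a member of \<open>smooth_functions M\<close> are meaningful.\<close>

definition smooth_functions :: "('a, 'e::euclidean_space) manifold \<Rightarrow> ('a \<Rightarrow> real) set" where
  "smooth_functions M =
     {f. \<forall>(U, \<phi>)\<in>atlas M. smooth_on (\<phi> ` U) (f \<circ> inv_into U \<phi>)}"

section \<open>Tangent vectors and vector fields\<close>

text \<open>Tangent vectors are derivations of the algebra of smooth functions, normalised to vanish on
  non-smooth functions so that equal derivations are equal as functions.\<close>

type_synonym 'a tvec = "('a \<Rightarrow> real) \<Rightarrow> real"
type_synonym 'a vfield = "'a \<Rightarrow> 'a tvec"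

definition tangent_space :: "('a, 'e::euclidean_space) manifold \<Rightarrow> 'a \<Rightarrow> 'a tvec set" where
  "tangent_space M p = {v.
     (\<forall>f\<in>smooth_functions M. \<forall>h\<in>smooth_functions M. \<forall>a c.
        v (\<lambda>q. a * f q + c * h q) = a * v f + c * v h) \<and>
     (\<forall>f\<in>smooth_functions M. \<forall>h\<in>smooth_functions M.
        v (\<lambda>q. f q * h q) = f p * v h + h p * v f) \<and>
     (\<forall>f. f \<notin> smooth_functions M \<longrightarrow> v f = 0)}"

definition vf_apply :: "'a vfield \<Rightarrow> ('a \<Rightarrow> real) \<Rightarrow> 'a \<Rightarrow> real" where
  "vf_apply X f = (\<lambda>p. X p f)"

definition vector_fields :: "('a, 'e::euclidean_space) manifold \<Rightarrow> 'a vfield set" where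
  "vector_fields M = {X. (\<forall>p\<in>points M. X p \<in> tangent_space M p) \<and>
     (\<forall>f\<in>smooth_functions M. vf_apply X f \<in> smooth_functions M)}"

definition lie_bracket :: "'a vfield \<Rightarrow> 'a vfield \<Rightarrow> 'a vfield" where
  "lie_bracket X Y = (\<lambda>p f. vf_apply X (vf_apply Y f) p - vf_apply Y (vf_apply X f) p)"

definition differential ::
  "('a, 'e::euclidean_space) manifold \<Rightarrow> ('c, 'd::euclidean_space) manifold \<Rightarrow> ('a \<Rightarrow> 'c) \<Rightarrow>
   'a tvec \<Rightarrow> 'c tvec" where
  "differential M N h v = (\<lambda>f. if f \<in> smooth_functions N then v (f \<circ> h) else 0)"

section \<open>1-forms\<close>

text \<open>A 1-form is given by its action on vector fields. Its value at \<open>p\<close> is the covector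
  \<open>\<alpha>\<close> with \<open>\<alpha> (Z p) = \<omega> Z p\<close> for all vector fields \<open>Z\<close>. Covectors are normalised to vanish outside
  the tangent space (rather than to be \<open>undefined\<close> there), so that they form a vector space.\<close>

type_synonym 'a oneform = "'a vfield \<Rightarrow> 'a \<Rightarrow> real"
type_synonym 'a covec = "'a tvec \<Rightarrow> real"

definition covector_at ::
  "('a, 'e::euclidean_space) manifold \<Rightarrow> 'a oneform \<Rightarrow> 'a \<Rightarrow> 'a covec" where
  "covector_at M \<omega> p = (THE \<alpha>. (\<forall>Z\<in>vector_fields M. \<alpha> (Z p) = \<omega> Z p) \<and>
     (\<forall>v. v \<notin> tangent_space M p \<longrightarrow> \<alpha> v = 0))"

definition d_fun :: "('a \<Rightarrow> real) \<Rightarrow> 'a oneform" where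
  "d_fun f = (\<lambda>Z. vf_apply Z f)"

section \<open>Singular semi-Riemannian manifolds\<close>

type_synonym 'a metric = "'a \<Rightarrow> 'a tvec \<Rightarrow> 'a tvec \<Rightarrow> real"

definition metric_apply :: "'a metric \<Rightarrow> 'a vfield \<Rightarrow> 'a vfield \<Rightarrow> 'a \<Rightarrow> real" where
  "metric_apply g X Y = (\<lambda>p. g p (X p) (Y p))"

definition singular_semi_riemannian ::
  "('a, 'e::euclidean_space) manifold \<Rightarrow> 'a metric \<Rightarrow> bool" where
  "singular_semi_riemannian M g \<longleftrightarrow>
     smooth_manifold M \<and>
     (\<forall>p\<in>points M. \<forall>u\<in>tangent_space M p. \<forall>v\<in>tangent_space M p. g p u v = g p v u) \<and>
     (\<forall>p\<in>points M. \<forall>u\<in>tangent_space M p. \<forall>v\<in>tangent_space M p. \<forall>w\<in>tangent_space M p. \<forall>a c.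
        g p (\<lambda>f. a * u f + c * v f) w = a * g p u w + c * g p v w) \<and>
     (\<forall>X\<in>vector_fields M. \<forall>Y\<in>vector_fields M. metric_apply g X Y \<in> smooth_functions M)"

definition nondegenerate :: "('a, 'e::euclidean_space) manifold \<Rightarrow> 'a metric \<Rightarrow> bool" where
  "nondegenerate M g \<longleftrightarrow> (\<forall>p\<in>points M. \<forall>v\<in>tangent_space M p.
     (\<forall>w\<in>tangent_space M p. g p v w = 0) \<longrightarrow> v = (\<lambda>f. 0))"

definition koszul :: "'a metric \<Rightarrow> 'a vfield \<Rightarrow> 'a vfield \<Rightarrow> 'a oneform" where
  "koszul g X Y Z = (\<lambda>p. 1/2 *
     (vf_apply X (metric_apply g Y Z) p
      + vf_apply Y (metric_apply g Z X) p
      - vf_apply Z (metric_apply g X Y) p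
      - metric_apply g X (lie_bracket Y Z) p
      + metric_apply g Y (lie_bracket Z X) p
      + metric_apply g Z (lie_bracket X Y) p))"

definition ssm_koszul :: "'a metric \<Rightarrow> 'a vfield \<Rightarrow> 'a vfield \<Rightarrow> 'a vfield \<Rightarrow> 'a oneform" where
  "ssm_koszul g P X Y Z = (\<lambda>p. koszul g X Y Z p
     + metric_apply g Y P p * metric_apply g X Z p
     - metric_apply g X Y p * metric_apply g P Z p)"

section \<open>Contraction\<close>

definition flat :: "('a, 'e::euclidean_space) manifold \<Rightarrow> 'a metric \<Rightarrow> 'a \<Rightarrow> 'a tvec \<Rightarrow> 'a covec"
  where "flat M g p v = (\<lambda>w. if w \<in> tangent_space M p then g p v w else 0)"

definition cotangent_bullet ::
  "('a, 'e::euclidean_space) manifold \<Rightarrow> 'a metric \<Rightarrow> 'a \<Rightarrow> 'a covec set" where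
  "cotangent_bullet M g p = flat M g p ` tangent_space M p"

text \<open>The preimage under \<open>flat\<close> is unique only up to the radical of the metric; the inner product
  of two preimages does not depend on the choice.\<close>

definition inner_bullet ::
  "('a, 'e::euclidean_space) manifold \<Rightarrow> 'a metric \<Rightarrow> 'a \<Rightarrow> 'a covec \<Rightarrow> 'a covec \<Rightarrow> real" where
  "inner_bullet M g p \<alpha> \<beta> = g p
     (SOME v. v \<in> tangent_space M p \<and> flat M g p v = \<alpha>)
     (SOME w. w \<in> tangent_space M p \<and> flat M g p w = \<beta>)"

text \<open>The rank of the metric at a point is the dimension of the image of \<open>flat\<close>.\<close>

definition metric_rank :: "('a, 'e::euclidean_space) manifold \<Rightarrow> 'a metric \<Rightarrow> 'a \<Rightarrow> nat" where
  "metric_rank M g p =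
     vector_space.dim (\<lambda>(c::real) \<alpha> v. c * \<alpha> v) (cotangent_bullet M g p)"

definition constant_rank_points ::
  "('a, 'e::euclidean_space) manifold \<Rightarrow> 'a metric \<Rightarrow> 'a set" where
  "constant_rank_points M g = {p\<in>points M. \<exists>N. openin (manifold_topology M) N \<and> p \<in> N \<and>
     (\<forall>q\<in>N. metric_rank M g q = metric_rank M g p)}"

definition pointwise_contraction ::
  "('a, 'e::euclidean_space) manifold \<Rightarrow> 'a metric \<Rightarrow> 'a oneform \<Rightarrow> 'a oneform \<Rightarrow> 'a \<Rightarrow> real" where
  "pointwise_contraction M g \<omega> \<tau> =
     (\<lambda>p. inner_bullet M g p (covector_at M \<omega> p) (covector_at M \<tau> p))"

definition extends_contraction ::
  "('a, 'e::euclidean_space) manifold \<Rightarrow> 'a metric \<Rightarrow> 'a oneform \<Rightarrow> 'a oneform \<Rightarrow>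
   ('a \<Rightarrow> real) \<Rightarrow> bool" where
  "extends_contraction M g \<omega> \<tau> f \<longleftrightarrow> f \<in> smooth_functions M \<and>
     (\<forall>p\<in>constant_rank_points M g. f p = pointwise_contraction M g \<omega> \<tau> p)"

definition smooth_contraction ::
  "('a, 'e::euclidean_space) manifold \<Rightarrow> 'a metric \<Rightarrow> 'a oneform \<Rightarrow> 'a oneform \<Rightarrow> bool" where
  "smooth_contraction M g \<omega> \<tau> \<longleftrightarrow> (\<exists>f. extends_contraction M g \<omega> \<tau> f)"

text \<open>The values on \<open>points M\<close> of the extension are unique, by density of
  \<open>constant_rank_points M g\<close>.\<close>

definition contraction ::
  "('a, 'e::euclidean_space) manifold \<Rightarrow> 'a metric \<Rightarrow> 'a oneform \<Rightarrow> 'a oneform \<Rightarrow> 'a \<Rightarrow> real" where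
  "contraction M g \<omega> \<tau> = (SOME f. extends_contraction M g \<omega> \<tau> f)"

text \<open>For a non-degenerate metric, \<open>flat\<close> maps onto the whole cotangent space, and
  \<open>g\<^sup>\<bullet>\<close> is the inverse metric on it.\<close>

abbreviation inverse_metric ::
  "('a, 'e::euclidean_space) manifold \<Rightarrow> 'a metric \<Rightarrow> 'a oneform \<Rightarrow> 'a oneform \<Rightarrow> 'a \<Rightarrow> real" where
  "inverse_metric \<equiv> pointwise_contraction"

section \<open>Semi-regular manifolds and their curvature\<close>

definition radical_stationary :: "('a, 'e::euclidean_space) manifold \<Rightarrow> 'a metric \<Rightarrow> bool" where
  "radical_stationary M g \<longleftrightarrow> singular_semi_riemannian M g \<and>
     (\<forall>X\<in>vector_fields M. \<forall>Y\<in>vector_fields M. \<forall>p\<in>points M.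
        covector_at M (koszul g X Y) p \<in> cotangent_bullet M g p)"

definition semi_regular :: "('a, 'e::euclidean_space) manifold \<Rightarrow> 'a metric \<Rightarrow> bool" where
  "semi_regular M g \<longleftrightarrow> radical_stationary M g \<and>
     (\<forall>X\<in>vector_fields M. \<forall>Y\<in>vector_fields M. \<forall>Z\<in>vector_fields M. \<forall>T\<in>vector_fields M.
        smooth_contraction M g (koszul g X Y) (koszul g Z T))"

definition curvature_of ::
  "('a, 'e::euclidean_space) manifold \<Rightarrow> 'a metric \<Rightarrow> ('a vfield \<Rightarrow> 'a vfield \<Rightarrow> 'a oneform) \<Rightarrow>
   'a vfield \<Rightarrow> 'a vfield \<Rightarrow> 'a vfield \<Rightarrow> 'a vfield \<Rightarrow> 'a \<Rightarrow> real" where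
  "curvature_of M g K X Y Z T = (\<lambda>p.
     vf_apply X (K Y Z T) p - vf_apply Y (K X Z T) p - K (lie_bracket X Y) Z T p
     + contraction M g (K X Z) (K Y T) p - contraction M g (K Y Z) (K X T) p)"

definition curvature ::
  "('a, 'e::euclidean_space) manifold \<Rightarrow> 'a metric \<Rightarrow>
   'a vfield \<Rightarrow> 'a vfield \<Rightarrow> 'a vfield \<Rightarrow> 'a vfield \<Rightarrow> 'a \<Rightarrow> real" where
  "curvature M g = curvature_of M g (koszul g)"

definition ssm_curvature ::
  "('a, 'e::euclidean_space) manifold \<Rightarrow> 'a metric \<Rightarrow> 'a vfield \<Rightarrow>
   'a vfield \<Rightarrow> 'a vfield \<Rightarrow> 'a vfield \<Rightarrow> 'a vfield \<Rightarrow> 'a \<Rightarrow> real" where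
  "ssm_curvature M g P = curvature_of M g (ssm_koszul g P)"

section \<open>Multiply warped products\<close>

text \<open>The fibres are indexed by a finite type \<open>'m\<close>; a point of the product is a pair \<open>(x, y)\<close> with
  \<open>x\<close> in the base and \<open>y j\<close> in the fibre \<open>F j\<close>.\<close>

definition product_manifold ::
  "('a, 'd::euclidean_space) manifold \<Rightarrow> ('m::finite \<Rightarrow> ('c, 'e::euclidean_space) manifold) \<Rightarrow>
   ('a \<times> ('m \<Rightarrow> 'c), 'd \<times> ('e ^ 'm)) manifold" where
  "product_manifold B F = \<lparr>
     points = points B \<times> {y. \<forall>j. y j \<in> points (F j)},
     model = model B \<times> {v. \<forall>j. v $ j \<in> model (F j)},
     atlas = {(U \<times> {y. \<forall>j. y j \<in> V j}, \<lambda>(x, y). (\<phi> x, \<chi> j. \<psi> j (y j))) | U \<phi> V \<psi>.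
       (U, \<phi>) \<in> atlas B \<and> (\<forall>j. (V j, \<psi> j) \<in> atlas (F j))}\<rparr>"

definition warped_metric ::
  "('a, 'd::euclidean_space) manifold \<Rightarrow> 'a metric \<Rightarrow>
   ('m::finite \<Rightarrow> ('c, 'e::euclidean_space) manifold) \<Rightarrow> ('m \<Rightarrow> 'c metric) \<Rightarrow>
   ('m \<Rightarrow> 'a \<Rightarrow> real) \<Rightarrow> ('a \<times> ('m \<Rightarrow> 'c)) metric" where
  "warped_metric B gB F gF b = (\<lambda>p v w.
     (let M = product_manifold B F;
          dB = differential M B fst;
          dF = (\<lambda>j. differential M (F j) (\<lambda>q. snd q j))
      in gB (fst p) (dB v) (dB w)
         + (\<Sum>j\<in>UNIV. (b j (fst p))\<^sup>2 * gF j (snd p j) (dF j v) (dF j w))))"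

text \<open>Lifts of vector fields are obtained by pushing forward along the inclusions of the base and
  of the fibres through a given point of the product.\<close>

definition lift_base ::
  "('a, 'd::euclidean_space) manifold \<Rightarrow> ('m::finite \<Rightarrow> ('c, 'e::euclidean_space) manifold) \<Rightarrow>
   'a vfield \<Rightarrow> ('a \<times> ('m \<Rightarrow> 'c)) vfield" where
  "lift_base B F X = (\<lambda>(x, y). differential B (product_manifold B F) (\<lambda>x'. (x', y)) (X x))"

definition lift_fibre ::
  "('a, 'd::euclidean_space) manifold \<Rightarrow> ('m::finite \<Rightarrow> ('c, 'e::euclidean_space) manifold) \<Rightarrow>
   'm \<Rightarrow> 'c vfield \<Rightarrow> ('a \<times> ('m \<Rightarrow> 'c)) vfield" where
  "lift_fibre B F j V =
     (\<lambda>(x, y). differential (F j) (product_manifold B F) (\<lambda>z. (x, y(j := z))) (V (y j)))"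

end

theory Submission
  imports Defs
begin

text \<open>A contraction of two 1-forms is determined, by density, on the points of constant rank, where it is
  the inner product of any two vectors representing the forms. The rank of the warped product at \<open>(x, y)\<close>
  is the rank of \<open>g\<^sub>B\<close> at \<open>x\<close> plus the ranks of those \<open>g\<^sub>F\<^sub>j\<close> at \<open>y\<^sub>j\<close> with \<open>b\<^sub>j x \<noteq> 0\<close>. As the rank is lower
  semicontinuous, at a point of constant rank either \<open>b\<^sub>j x \<noteq> 0\<close> and \<open>y\<^sub>j\<close> is a point of constant rank of
  \<open>F\<^sub>j\<close>, or \<open>b\<^sub>j x = 0\<close> and then \<open>d b\<^sub>j = 0\<close> at \<open>x\<close> or \<open>g\<^sub>F\<^sub>j = 0\<close> at \<open>y\<^sub>j\<close>. Hence a form such as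
  \<open>K (X, V, \<cdot>) = b\<^sub>j X(b\<^sub>j) g\<^sub>F\<^sub>j(V, \<cdot>)\<close> is represented by \<open>(X(b\<^sub>j) / b\<^sub>j) V\<close>, the division being harmless
  where \<open>b\<^sub>j\<close> vanishes, and all contractions of Koszul forms of lifts become explicit. The curvature
  identities then follow from \<open>K (X, Y, Z) + K (X, Z, Y) = X (g (Y, Z))\<close> and
  \<open>K (X, Y, Z) - K (Y, X, Z) = g ([X, Y], Z)\<close>.\<close>

text \<open>A degenerate metric has in general neither a Levi-Civita connection nor an inverse, so
  curvature terms cannot be computed from covariant derivatives. Since \<open>contraction\<close> is
  a \<open>SOME\<close>, the only handle on it is to exhibit one smooth function with the right
  values; every contraction is therefore given in advance as an explicit expression in pullbacks
  from the factors and then checked. This also settles that the extension exists on the product.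
  Much of the length goes into making the checks legitimate: tangent vectors are derivations of
  globally defined functions, so locality, coordinate expansions and extension of vectors to fields
  rest on bump functions and Hadamard's lemma, and \<open>covector_at\<close>, a \<open>THE\<close>,
  denotes something only because each tangent vector is the value of a vector field. Functions,
  fields and forms are total, with meaningless values off \<open>points\<close>, hence the recurring
  congruence lemmas.\<close>

section \<open>Calculus of C^k functions on open subsets of Euclidean space\<close>

lemma ck_on_SucD_derivative:
  "ck_on (Suc k) S f \<Longrightarrow> x \<in> S \<Longrightarrow> (f has_derivative frechet_derivative f (at x)) (at x)"
  by (simp add: frechet_derivative_works)

text \<open>The successor clause of \<open>ck_on\<close> speaks only of differentiability and of
  directional derivatives, so the lower order of the function itself has to be recovered by
  induction, starting from differentiable implies continuous.\<close>

lemma ck_on_SucD: "ck_on (Suc k) S f \<Longrightarrow> ck_on k S f"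
proof (induction k arbitrary: f)
  case 0
  then show ?case
    by (auto intro!: continuous_at_imp_continuous_on differentiable_imp_continuous_within)
next
  case (Suc k)
  then show ?case by (metis ck_on.simps(2))
qed

text \<open>\<open>frechet_derivative f (at x)\<close> sees all points near \<open>x\<close>;
  openness of \<open>S\<close> is what makes agreement on \<open>S\<close> enough.\<close>

lemma ck_on_cong:
  assumes "open S" "\<And>x. x \<in> S \<Longrightarrow> f x = g x" "ck_on k S f"
  shows "ck_on k S g"
  using assms(2,3)
proof (induction k arbitrary: f g)
  case 0
  then show ?case by (metis ck_on.simps(1) continuous_on_eq)
next
  case (Suc k)
  have der: "(g has_derivative frechet_derivative f (at x)) (at x)" if "x \<in> S" for x
    using has_derivative_transform_within_open[OF ck_on_SucD_derivative[OF Suc.prems(2) that] assms(1) that]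
      Suc.prems(1) by blast
  then have eq: "frechet_derivative f (at x) = frechet_derivative g (at x)" if "x \<in> S" for x
    using frechet_derivative_at that by blast
  have "ck_on k S (\<lambda>x. frechet_derivative g (at x) v)" for v
    using Suc.prems(2) Suc.IH[of "\<lambda>x. frechet_derivative f (at x) v"
        "\<lambda>x. frechet_derivative g (at x) v"] eq by auto
  with der show ?case by (auto simp: differentiable_def)
qed

text \<open>Uniqueness of derivatives allows any explicit derivative \<open>f'\<close> in place of
  \<open>frechet_derivative\<close>; all closure rules below go through this one.\<close>

lemma ck_on_SucI:
  assumes "open S" "\<And>x. x \<in> S \<Longrightarrow> (f has_derivative f' x) (at x)"
    and "\<And>v. ck_on k S (\<lambda>x. f' x v)"
  shows "ck_on (Suc k) S f"
proof -
  have "ck_on k S (\<lambda>x. frechet_derivative f (at x) v)" for v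
    using ck_on_cong[OF assms(1) _ assms(3)] frechet_derivative_at[OF assms(2)] by auto
  with assms(2) show ?thesis by (auto simp: differentiable_def)
qed

lemma ck_on_subset: "ck_on k S f \<Longrightarrow> T \<subseteq> S \<Longrightarrow> ck_on k T f"
  by (induction k arbitrary: f) (auto intro: continuous_on_subset)

lemma ck_on_const: "open S \<Longrightarrow> ck_on k S (\<lambda>x. c)"
proof (induction k arbitrary: c)
  case (Suc k)
  then show ?case by (intro ck_on_SucI[where f' = "\<lambda>x v. 0"]) auto
qed auto

lemma ck_on_bounded_linear:
  assumes "open S" "bounded_linear L"
  shows "ck_on k S L"
proof (cases k)
  case 0
  then show ?thesis using assms linear_continuous_on by auto
next
  case (Suc l)
  then show ?thesis
    using ck_on_SucI[OF assms(1) bounded_linear_imp_has_derivative[OF assms(2)]] ck_on_const[OF assms(1)]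
    by auto
qed

lemma ck_on_add:
  assumes "open S" "ck_on k S f" "ck_on k S g"
  shows "ck_on k S (\<lambda>x. f x + g x)"
  using assms(2,3)
proof (induction k arbitrary: f g)
  case (Suc k)
  show ?case
    using Suc.prems
    by (intro ck_on_SucI[OF assms(1) has_derivative_add[OF ck_on_SucD_derivative[OF Suc.prems(1)]
            ck_on_SucD_derivative[OF Suc.prems(2)]]] Suc.IH) auto
qed (auto intro: continuous_on_add)

lemma ck_on_sum:
  assumes "open S" "\<And>i. i \<in> I \<Longrightarrow> ck_on k S (f i)"
  shows "ck_on k S (\<lambda>x. \<Sum>i\<in>I. f i x)"
  using assms(2)
  by (induction I rule: infinite_finite_induct)
    (auto intro!: ck_on_add ck_on_const assms(1))

lemma ck_on_linear_comp:
  assumes "open S" "bounded_linear L" "ck_on k S f"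
  shows "ck_on k S (\<lambda>x. L (f x))"
  using assms(3)
proof (induction k arbitrary: f)
  case 0
  then show ?case using assms(2) by (auto intro: bounded_linear.continuous_on)
next
  case (Suc k)
  show ?case
    using Suc.prems
    by (intro ck_on_SucI[OF assms(1) bounded_linear.has_derivative[OF assms(2)
            ck_on_SucD_derivative[OF Suc.prems]]] Suc.IH) auto
qed

lemma ck_on_scaleR:
  fixes g :: "'a::euclidean_space \<Rightarrow> 'b::real_normed_vector"
  assumes "open S" "ck_on k S f" "ck_on k S g"
  shows "ck_on k S (\<lambda>x. f x *\<^sub>R g x)"
  using assms(2,3)
proof (induction k arbitrary: f g)
  case (Suc k)
  note fg = ck_on_SucD[OF Suc.prems(1)] ck_on_SucD[OF Suc.prems(2)]
  show ?case
    using Suc.prems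
    by (intro ck_on_SucI[OF assms(1) has_derivative_scaleR[OF ck_on_SucD_derivative[OF Suc.prems(1)]
            ck_on_SucD_derivative[OF Suc.prems(2)]]] Suc.IH ck_on_add assms(1) fg) auto
qed (auto intro: continuous_on_scaleR)

lemma ck_on_inverse:
  fixes f :: "'a::euclidean_space \<Rightarrow> real"
  assumes "open S" "\<And>x. x \<in> S \<Longrightarrow> f x \<noteq> 0"
  shows "ck_on k S f \<Longrightarrow> ck_on k S (\<lambda>x. inverse (f x))"
proof (induction k)
  case 0
  then show ?case using assms by (auto intro: continuous_on_inverse)
next
  case (Suc k)
  note IH = Suc.IH[OF ck_on_SucD[OF Suc.prems]]
  have "((\<lambda>x. inverse (f x)) has_derivative
      (\<lambda>h. - (inverse (f x) *\<^sub>R inverse (f x) *\<^sub>R frechet_derivative f (at x) h))) (at x)" if "x \<in> S" for x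
    using Deriv.has_derivative_inverse[OF assms(2)[OF that] ck_on_SucD_derivative[OF Suc.prems that]]
    by (simp add: mult_ac)
  moreover have "ck_on k S (\<lambda>x. - (inverse (f x) *\<^sub>R inverse (f x) *\<^sub>R frechet_derivative f (at x) v))" for v
    using Suc.prems
    by (intro ck_on_scaleR[OF assms(1)] IH
        ck_on_linear_comp[OF assms(1) bounded_linear_minus[OF bounded_linear_ident]]) auto
  ultimately show ?case by (rule ck_on_SucI[OF assms(1)])
qed

text \<open>In the chain rule the derivative of \<open>f\<close> is applied to a vector that varies
  with \<open>x\<close>, whereas \<open>ck_on\<close> only controls fixed directions. Expanding that
  vector in \<open>Basis\<close> reduces to fixed directions, to which the induction hypothesis
  applies.\<close>

lemma ck_on_compose:
  fixes f :: "'b::euclidean_space \<Rightarrow> 'c::real_normed_vector" and g :: "'a::euclidean_space \<Rightarrow> 'b"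
  assumes "open S" "ck_on k S g" "ck_on k T f" "g ` S \<subseteq> T"
  shows "ck_on k S (\<lambda>x. f (g x))"
  using assms(2-)
proof (induction k arbitrary: f)
  case 0
  then show ?case by (auto intro: continuous_on_compose2)
next
  case (Suc k)
  let ?f' = "\<lambda>x v. \<Sum>b\<in>Basis. (frechet_derivative g (at x) v \<bullet> b) *\<^sub>R frechet_derivative f (at (g x)) b"
  have "((\<lambda>x. f (g x)) has_derivative ?f' x) (at x)" if "x \<in> S" for x
  proof -
    have x: "g x \<in> T" using that Suc.prems(3) by auto
    have df: "(f has_derivative frechet_derivative f (at (g x))) (at (g x))"
      by (rule ck_on_SucD_derivative[OF Suc.prems(2) x])
    interpret F: bounded_linear "frechet_derivative f (at (g x))"
      using df by (rule has_derivative_bounded_linear)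
    have "frechet_derivative f (at (g x)) w = (\<Sum>b\<in>Basis. (w \<bullet> b) *\<^sub>R frechet_derivative f (at (g x)) b)" for w
    proof -
      have "frechet_derivative f (at (g x)) (\<Sum>b\<in>Basis. (w \<bullet> b) *\<^sub>R b)
          = (\<Sum>b\<in>Basis. (w \<bullet> b) *\<^sub>R frechet_derivative f (at (g x)) b)"
        by (simp add: F.sum F.scaleR)
      then show ?thesis by (simp add: euclidean_representation)
    qed
    then have eq: "frechet_derivative f (at (g x)) (frechet_derivative g (at x) v) = ?f' x v" for v .
    show ?thesis
      by (rule has_derivative_eq_rhs[OF has_derivative_compose[OF ck_on_SucD_derivative[OF Suc.prems(1) that] df]])
        (rule ext, rule eq)
  qed
  moreover have "ck_on k S (\<lambda>x. ?f' x v)" for v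
    using Suc.prems
    by (intro ck_on_sum[OF assms(1)] ck_on_scaleR[OF assms(1)]
        ck_on_linear_comp[OF assms(1) bounded_linear_inner_left] Suc.IH ck_on_SucD[OF Suc.prems(1)]) auto
  ultimately show ?case by (rule ck_on_SucI[OF assms(1)])
qed

definition cinf_on :: "'e::euclidean_space set \<Rightarrow> ('e \<Rightarrow> 'c::real_normed_vector) \<Rightarrow> bool" where
  "cinf_on S f \<longleftrightarrow> (\<forall>k. ck_on k S f)"

lemma cinf_on_continuous: "cinf_on S f \<Longrightarrow> continuous_on S f"
  by (metis cinf_on_def ck_on.simps(1))

lemma cinf_on_has_derivative:
  "cinf_on S f \<Longrightarrow> x \<in> S \<Longrightarrow> (f has_derivative frechet_derivative f (at x)) (at x)"
  by (metis cinf_on_def ck_on_SucD_derivative)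

lemma cinf_on_frechet: "cinf_on S f \<Longrightarrow> cinf_on S (\<lambda>x. frechet_derivative f (at x) v)"
  by (metis cinf_on_def ck_on.simps(2))

lemma cinf_on_subset: "cinf_on S f \<Longrightarrow> T \<subseteq> S \<Longrightarrow> cinf_on T f"
  unfolding cinf_on_def using ck_on_subset by blast

lemma cinf_on_const: "open S \<Longrightarrow> cinf_on S (\<lambda>x. c)"
  unfolding cinf_on_def by (simp add: ck_on_const)

lemma cinf_on_bounded_linear: "open S \<Longrightarrow> bounded_linear L \<Longrightarrow> cinf_on S L"
  unfolding cinf_on_def by (simp add: ck_on_bounded_linear)

lemma cinf_on_linear_comp:
  "open S \<Longrightarrow> bounded_linear L \<Longrightarrow> cinf_on S f \<Longrightarrow> cinf_on S (\<lambda>x. L (f x))"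
  unfolding cinf_on_def by (simp add: ck_on_linear_comp)

lemma cinf_on_add: "open S \<Longrightarrow> cinf_on S f \<Longrightarrow> cinf_on S g \<Longrightarrow> cinf_on S (\<lambda>x. f x + g x)"
  unfolding cinf_on_def by (simp add: ck_on_add)

lemma cinf_on_sum:
  "open S \<Longrightarrow> (\<And>i. i \<in> I \<Longrightarrow> cinf_on S (f i)) \<Longrightarrow> cinf_on S (\<lambda>x. \<Sum>i\<in>I. f i x)"
  unfolding cinf_on_def by (simp add: ck_on_sum)

lemma cinf_on_mult:
  fixes f g :: "'e::euclidean_space \<Rightarrow> real"
  shows "open S \<Longrightarrow> cinf_on S f \<Longrightarrow> cinf_on S g \<Longrightarrow> cinf_on S (\<lambda>x. f x * g x)"
  unfolding cinf_on_def using ck_on_scaleR[of S _ f g] by simp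

lemma cinf_on_inverse:
  fixes f :: "'e::euclidean_space \<Rightarrow> real"
  shows "open S \<Longrightarrow> (\<And>x. x \<in> S \<Longrightarrow> f x \<noteq> 0) \<Longrightarrow> cinf_on S f \<Longrightarrow> cinf_on S (\<lambda>x. inverse (f x))"
  unfolding cinf_on_def by (simp add: ck_on_inverse)

lemma cinf_on_compose:
  fixes f :: "'b::euclidean_space \<Rightarrow> 'c::real_normed_vector" and g :: "'a::euclidean_space \<Rightarrow> 'b"
  shows "open S \<Longrightarrow> cinf_on S g \<Longrightarrow> cinf_on T f \<Longrightarrow> g ` S \<subseteq> T \<Longrightarrow> cinf_on S (\<lambda>x. f (g x))"
  unfolding cinf_on_def using ck_on_compose by blast

section \<open>Smooth bump functions\<close>

text \<open>The classical flat function exp(-1/x) with extra powers of 1/x. The powers make the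
  family closed under differentiation, so smoothness of all members follows by one
  induction.\<close>

definition flat_fun :: "nat \<Rightarrow> real \<Rightarrow> real" where
  "flat_fun n x = (if x > 0 then exp (- inverse x) * inverse x ^ n else 0)"

lemma flat_fun_pos: "x > 0 \<Longrightarrow> flat_fun n x > 0" and flat_fun_nonneg: "flat_fun n x \<ge> 0"
  and flat_fun_zero: "x \<le> 0 \<Longrightarrow> flat_fun n x = 0"
  by (auto simp: flat_fun_def)

lemma flat_fun_tendsto_0: "(flat_fun n \<longlongrightarrow> 0) (at 0)"
proof -
  have "((\<lambda>x. inverse x ^ n / exp (inverse x)) \<longlongrightarrow> 0) (at_right (0::real))"
    by (rule filterlim_compose[OF tendsto_power_div_exp_0 filterlim_inverse_at_top_right])
  moreover have "\<forall>\<^sub>F x in at_right 0. inverse x ^ n / exp (inverse x) = flat_fun n x"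
    unfolding eventually_at_right_field
    by (rule exI[of _ 1]) (auto simp: flat_fun_def exp_minus divide_simps)
  ultimately have "(flat_fun n \<longlongrightarrow> 0) (at_right 0)" by (rule Lim_transform_eventually)
  moreover have "(flat_fun n \<longlongrightarrow> 0) (at_left 0)"
    by (rule tendsto_eventually) (auto simp: eventually_at_left_field flat_fun_def intro: exI[of _ "-1"])
  ultimately show ?thesis by (simp add: filterlim_split_at)
qed

lemma flat_fun_deriv:
  "(flat_fun n has_real_derivative flat_fun (n + 2) x - n * flat_fun (n + 1) x) (at x)"
proof -
  consider "x > 0" | "x < 0" | "x = 0" by linarith
  then show ?thesis
  proof cases
    case 1
    have "((\<lambda>x. exp (- inverse x) * inverse x ^ n) has_real_derivative
        flat_fun (n + 2) x - n * flat_fun (n + 1) x) (at x)"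
      using 1 by (auto intro!: derivative_eq_intros simp: flat_fun_def)
        (cases n; simp add: field_simps power2_eq_square)
    then show ?thesis
      by (rule has_field_derivative_transform_within_open[where S = "{0<..}"])
        (use 1 in \<open>auto simp: flat_fun_def\<close>)
  next
    case 2
    have "((\<lambda>x. 0) has_real_derivative flat_fun (n + 2) x - n * flat_fun (n + 1) x) (at x)"
      using 2 by (auto simp: flat_fun_def)
    then show ?thesis
      by (rule has_field_derivative_transform_within_open[where S = "{..<0}"])
        (use 2 in \<open>auto simp: flat_fun_def\<close>)
  next
    \<comment> \<open>At the origin the difference quotient of a member is the next member of the
      family, which tends to 0.\<close>
    case 3
    have "\<forall>\<^sub>F h in at 0. flat_fun (n + 1) h = (flat_fun n (0 + h) - flat_fun n 0) / h"
      by (auto simp: eventually_at flat_fun_def divide_inverse intro!: exI[of _ 1])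
    then have "((\<lambda>h. (flat_fun n (0 + h) - flat_fun n 0) / h) \<longlongrightarrow> 0) (at 0)"
      by (rule Lim_transform_eventually[OF flat_fun_tendsto_0])
    then show ?thesis using 3 by (simp add: DERIV_def flat_fun_def)
  qed
qed

lemma cinf_on_flat_fun: "cinf_on UNIV (flat_fun n)"
proof -
  have "ck_on k UNIV (flat_fun n)" for k
  proof (induction k arbitrary: n)
    case 0
    then show ?case
      using flat_fun_deriv by (auto intro!: continuous_at_imp_continuous_on DERIV_isCont)
  next
    case (Suc k)
    have "(flat_fun n has_derivative (\<lambda>v. v *\<^sub>R (flat_fun (n + 2) x + (- real n) *\<^sub>R flat_fun (n + 1) x))) (at x)" for x
      using flat_fun_deriv[of n x] by (simp add: has_field_derivative_def mult.commute[of _ "_ - _"])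
    then show ?case
      by (rule ck_on_SucI[OF open_UNIV])
        (intro ck_on_scaleR ck_on_add ck_on_const Suc.IH open_UNIV)
  qed
  then show ?thesis by (simp add: cinf_on_def)
qed

text \<open>The quotient f(t) / (f(t) + f(1 - t)), with f the flat function, is 1 for t >= 1 and 0
  for t <= 0; its denominator never vanishes because t and 1 - t are not both nonpositive.\<close>

lemma exists_bump:
  fixes c :: "'e::euclidean_space"
  assumes "r > 0"
  obtains \<beta> :: "'e \<Rightarrow> real" where "cinf_on UNIV \<beta>"
    "\<And>u. u \<in> ball c (r/2) \<Longrightarrow> \<beta> u = 1" "\<And>u. u \<notin> ball c r \<Longrightarrow> \<beta> u = 0"
proof -
  \<comment> \<open>The constants make \<open>t u\<close> at least 3/2 on the ball of half the
    radius and at most 0 outside the full ball. The squared norm is written as a sum over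
    \<open>Basis\<close> so that the closure rules for smooth functions apply.\<close>
  define t where "t u = 2 + (-2 / r^2) * (\<Sum>b\<in>Basis. ((u - c) \<bullet> b) * ((u - c) \<bullet> b))" for u :: 'e
  have t: "t u = 2 - 2 * (norm (u - c))\<^sup>2 / r\<^sup>2" for u
    by (simp add: t_def power2_norm_eq_inner euclidean_inner[of "u - c" "u - c"])
  have t_smooth: "cinf_on UNIV t"
    unfolding t_def
    by (intro cinf_on_add cinf_on_mult cinf_on_const cinf_on_sum open_UNIV
        cinf_on_linear_comp[OF _ bounded_linear_inner_left])
      (simp_all add: cinf_on_add[OF _ cinf_on_bounded_linear[OF _ bounded_linear_ident] cinf_on_const[of _ "- c"], simplified])
  define \<beta> where "\<beta> u = flat_fun 0 (t u) * inverse (flat_fun 0 (t u) + flat_fun 0 (1 + (-1) * t u))" for u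
  have pos: "flat_fun 0 (t u) + flat_fun 0 (1 + (-1) * t u) \<noteq> 0" for u
    using flat_fun_pos[of "t u" 0] flat_fun_pos[of "1 - t u" 0] flat_fun_nonneg[of 0 "t u"]
      flat_fun_nonneg[of 0 "1 - t u"] by (cases "t u > 0") (auto simp: add_nonneg_eq_0_iff)
  show ?thesis
  proof
    have F: "cinf_on UNIV (\<lambda>u. flat_fun 0 (t u))" "cinf_on UNIV (\<lambda>u. flat_fun 0 (1 + (-1) * t u))"
      by (intro cinf_on_compose[OF _ _ cinf_on_flat_fun] cinf_on_add cinf_on_mult cinf_on_const t_smooth; simp)+
    show "cinf_on UNIV \<beta>" unfolding \<beta>_def
      using F pos by (intro cinf_on_mult cinf_on_inverse cinf_on_add open_UNIV) auto
    show "\<beta> u = 1" if "u \<in> ball c (r/2)" for u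
    proof -
      have "norm (u - c) \<le> r / 2" using that by (auto simp: dist_norm norm_minus_commute)
      then have "(norm (u - c))\<^sup>2 \<le> (r / 2)\<^sup>2" by (intro power_mono) auto
      then have "(norm (u - c))\<^sup>2 \<le> r\<^sup>2 / 4" by (simp add: power_divide)
      then have "2 * (norm (u - c))\<^sup>2 \<le> r\<^sup>2" using zero_le_power2[of "norm (u - c)"] by linarith
      then have "t u \<ge> 1" using assms by (simp add: t field_simps)
      then show ?thesis
        using flat_fun_pos[of "t u" 0] flat_fun_zero[of "1 - t u" 0] by (simp add: \<beta>_def)
    qed
    show "\<beta> u = 0" if "u \<notin> ball c r" for u
    proof -
      have "norm (u - c) \<ge> r" using that by (auto simp: dist_norm norm_minus_commute)
      then have "(norm (u - c))\<^sup>2 \<ge> r\<^sup>2" using assms by (intro power_mono) auto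
      then have "t u \<le> 0" using assms by (simp add: t field_simps)
      then show ?thesis by (simp add: \<beta>_def flat_fun_zero)
    qed
  qed
qed

section \<open>Hadamard's lemma\<close>

lemma ray_in_ball:
  fixes c :: "'e::real_normed_vector"
  assumes "u \<in> ball c r" "t \<in> {0..1}"
  shows "c + t *\<^sub>R (u - c) \<in> ball c r"
proof -
  have "t * norm (u - c) \<le> norm (u - c)"
    using assms by (intro mult_left_le_one_le) auto
  then show ?thesis using assms by (auto simp: dist_norm norm_minus_commute)
qed

text \<open>Differentiation under the integral sign. The ray contributes an inner factor t, so the
  weights \<open>t ^ n\<close> make this family of integrals closed under differentiation, which
  drives the smoothness proof that follows.\<close>

lemma has_derivative_ray_integral:
  fixes G :: "'e::euclidean_space \<Rightarrow> real"
  assumes G: "cinf_on (ball c r) G" and u: "u \<in> ball c r"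
  shows "((\<lambda>u. integral {0..1} (\<lambda>t. t ^ n * G (c + t *\<^sub>R (u - c)))) has_derivative
    (\<lambda>v. integral {0..1} (\<lambda>t. t ^ Suc n * frechet_derivative G (at (c + t *\<^sub>R (u - c))) v))) (at u)"
proof -
  let ?B = "ball c r"
  let ?D = "\<lambda>u t v. t ^ Suc n * frechet_derivative G (at (c + t *\<^sub>R (u - c))) v"
  note ray = ray_in_ball
  have der: "((\<lambda>u. t ^ n * G (c + t *\<^sub>R (u - c))) has_derivative ?D u t) (at u)"
    if "u \<in> ?B" "t \<in> {0..1}" for u t
  proof -
    have dG: "(G has_derivative frechet_derivative G (at (c + t *\<^sub>R (u - c)))) (at (c + t *\<^sub>R (u - c)))"
      by (rule cinf_on_has_derivative[OF G ray[OF that]])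
    have "((\<lambda>u. c + t *\<^sub>R (u - c)) has_derivative (\<lambda>v. t *\<^sub>R v)) (at u)"
      by (auto intro!: derivative_eq_intros)
    from has_derivative_compose[OF this dG]
    have "((\<lambda>u. G (c + t *\<^sub>R (u - c))) has_derivative
        (\<lambda>v. t *\<^sub>R frechet_derivative G (at (c + t *\<^sub>R (u - c))) v)) (at u)"
      using linear_scale[OF has_derivative_linear[OF dG]] by simp
    from has_derivative_mult_right[OF this, of "t ^ n"] show ?thesis by (simp add: mult_ac)
  qed
  have bl: "bounded_linear (?D u t)" if "u \<in> ?B" "t \<in> {0..1}" for u t
    using der[OF that] by (rule has_derivative_bounded_linear)
  \<comment> \<open>\<open>leibniz_rule\<close> wants the derivative of the integrand as a
    continuous map into the space of bounded linear operators, hence the passage through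
    \<open>Blinfun\<close>.\<close>
  define fx where "fx u t = Blinfun (?D u t)" for u t
  have fx: "blinfun_apply (fx u t) = ?D u t" if "u \<in> ?B" "t \<in> {0..1}" for u t
    unfolding fx_def by (rule bounded_linear_Blinfun_apply[OF bl[OF that]])
  have contray: "continuous_on (?B \<times> {0..1}) (\<lambda>(u,t). H (c + t *\<^sub>R (u - c)))"
    if "continuous_on ?B H" for H :: "'e \<Rightarrow> real"
    unfolding split_beta
    by (rule continuous_on_compose2[OF that]) (auto intro!: continuous_intros ray)
  have cont: "continuous_on (?B \<times> cbox 0 1) (\<lambda>(u,t). fx u t)"
  proof (rule continuous_on_blinfun_componentwise)
    fix i :: 'e assume "i \<in> Basis"
    have "continuous_on (?B \<times> {0..1}) (\<lambda>z. snd z ^ Suc n *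
        (case z of (u,t) \<Rightarrow> frechet_derivative G (at (c + t *\<^sub>R (u - c))) i))"
      by (intro continuous_intros contray cinf_on_continuous[OF cinf_on_frechet[OF G]])
    then show "continuous_on (?B \<times> cbox 0 1) (\<lambda>x. blinfun_apply (case x of (u,t) \<Rightarrow> fx u t) i)"
      unfolding cbox_interval by (rule continuous_on_eq) (auto simp: fx)
  qed
  have intg: "continuous_on {0..1} (\<lambda>t. t ^ n * G (c + t *\<^sub>R (u - c)))" if "u \<in> ?B" for u
    by (intro continuous_intros continuous_on_compose2[OF cinf_on_continuous[OF G]])
      (use ray[OF that] in auto)
  have "((\<lambda>u. integral (cbox 0 1) (\<lambda>t. t ^ n * G (c + t *\<^sub>R (u - c)))) has_derivative
      blinfun_apply (integral (cbox 0 1) (fx u))) (at u within ?B)"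
  proof (rule leibniz_rule[OF _ _ cont u convex_ball])
    show "((\<lambda>u. t ^ n * G (c + t *\<^sub>R (u - c))) has_derivative blinfun_apply (fx u t)) (at u within ?B)"
      if "u \<in> ?B" "t \<in> cbox 0 1" for u t
      using der[of u t] that fx[of u t] by (auto intro: has_derivative_at_withinI)
    show "(\<lambda>t. t ^ n * G (c + t *\<^sub>R (u - c))) integrable_on cbox 0 1" if "u \<in> ?B" for u
      using intg[OF that] by (simp add: integrable_continuous_real)
  qed
  moreover have "blinfun_apply (integral (cbox 0 1) (fx u)) v = integral {0..1} (\<lambda>t. ?D u t v)" for v
  proof -
    have "continuous_on (cbox 0 1) (\<lambda>t. case (u, t) of (u, t) \<Rightarrow> fx u t)"
      by (rule continuous_on_compose2[OF cont]) (use u in \<open>auto intro!: continuous_intros\<close>)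
    then have "continuous_on (cbox 0 1) (fx u)" by simp
    then have "fx u integrable_on cbox 0 1" by (rule integrable_continuous)
    from blinfun_apply_integral[OF this, of v]
    have "blinfun_apply (integral (cbox 0 1) (fx u)) v = integral (cbox 0 1) (\<lambda>t. blinfun_apply (fx u t) v)" .
    also have "\<dots> = integral (cbox 0 1) (\<lambda>t. ?D u t v)"
      by (rule integral_cong) (use fx u in auto)
    finally show ?thesis by simp
  qed
  then have "blinfun_apply (integral (cbox 0 1) (fx u)) = (\<lambda>v. integral {0..1} (\<lambda>t. ?D u t v))" by blast
  ultimately show ?thesis by (simp add: at_within_open[OF u open_ball])
qed

lemma cinf_on_ray_integral:
  fixes G :: "'e::euclidean_space \<Rightarrow> real"
  assumes "cinf_on (ball c r) G"
  shows "cinf_on (ball c r) (\<lambda>u. integral {0..1} (\<lambda>t. t ^ n * G (c + t *\<^sub>R (u - c))))"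
proof -
  have "ck_on k (ball c r) (\<lambda>u. integral {0..1} (\<lambda>t. t ^ n * G (c + t *\<^sub>R (u - c))))" for k
    using assms
  proof (induction k arbitrary: n G)
    case 0
    then show ?case
      using has_derivative_continuous[OF has_derivative_ray_integral[OF 0]]
      by (auto intro!: continuous_at_imp_continuous_on)
  next
    case (Suc k)
    show ?case
      by (rule ck_on_SucI[OF open_ball has_derivative_ray_integral[OF Suc.prems]])
        (auto intro!: Suc.IH cinf_on_frechet Suc.prems simp del: power_Suc)
  qed
  then show ?thesis by (simp add: cinf_on_def)
qed

text \<open>The fundamental theorem of calculus along the ray from \<open>c\<close> to
  \<open>u\<close>. The set \<open>D\<close> of directions is left open because charts take values
  in a subspace, whose basis need not be contained in \<open>Basis\<close>.\<close>

lemma hadamard: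
  fixes h :: "'e::euclidean_space \<Rightarrow> real"
  assumes h: "cinf_on (ball c r) h" and r: "r > 0" and D: "finite D"
  obtains H where "\<And>d. cinf_on (ball c r) (H d)"
    "\<And>d. H d c = frechet_derivative h (at c) d"
    "\<And>u a. u \<in> ball c r \<Longrightarrow> u - c = (\<Sum>d\<in>D. a d *\<^sub>R d) \<Longrightarrow> h u = h c + (\<Sum>d\<in>D. a d * H d u)"
proof
  define H where "H d u = integral {0..1} (\<lambda>t. t ^ 0 * frechet_derivative h (at (c + t *\<^sub>R (u - c))) d)" for d u
  show "cinf_on (ball c r) (H d)" for d
    unfolding H_def by (intro cinf_on_ray_integral cinf_on_frechet h)
  show "H d c = frechet_derivative h (at c) d" for d
    by (simp add: H_def)
  fix u a assume u: "u \<in> ball c r" and a: "u - c = (\<Sum>d\<in>D. a d *\<^sub>R d)"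
  note ray = ray_in_ball[OF u]
  let ?D = "\<lambda>t. frechet_derivative h (at (c + t *\<^sub>R (u - c)))"
  have dh: "(h has_derivative ?D t) (at (c + t *\<^sub>R (u - c)))" if "t \<in> {0..1}" for t
    by (rule cinf_on_has_derivative[OF h ray[OF that]])
  have "((\<lambda>t. h (c + t *\<^sub>R (u - c))) has_vector_derivative ?D t (u - c)) (at t within {0..1})"
    if "t \<in> {0..1}" for t
  proof -
    have "((\<lambda>t. c + t *\<^sub>R (u - c)) has_derivative (\<lambda>s. s *\<^sub>R (u - c))) (at t)"
      by (auto intro!: derivative_eq_intros)
    from has_derivative_compose[OF this dh[OF that]]
    show ?thesis
      using linear_scale[OF has_derivative_linear[OF dh[OF that]]]
      by (auto simp: has_vector_derivative_def intro: has_derivative_at_withinI)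
  qed
  then have "((\<lambda>t. ?D t (u - c)) has_integral (h (c + 1 *\<^sub>R (u - c)) - h (c + 0 *\<^sub>R (u - c)))) {0..1}"
    by (intro fundamental_theorem_of_calculus) auto
  then have "h u - h c = integral {0..1} (\<lambda>t. ?D t (u - c))"
    by (simp add: integral_unique)
  also have "\<dots> = integral {0..1} (\<lambda>t. \<Sum>d\<in>D. a d * ?D t d)"
  proof (rule integral_cong)
    fix t :: real assume "t \<in> {0..1}"
    from has_derivative_linear[OF dh[OF this]] show "?D t (u - c) = (\<Sum>d\<in>D. a d * ?D t d)"
      by (simp add: a linear_sum linear_scale)
  qed
  also have "\<dots> = (\<Sum>d\<in>D. integral {0..1} (\<lambda>t. a d * ?D t d))"
  proof (rule integral_sum[OF D])
    fix d
    have "continuous_on {0..1} (\<lambda>t. a d * ?D t d)"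
      by (intro continuous_intros continuous_on_compose2[OF cinf_on_continuous[OF cinf_on_frechet[OF h]]])
        (use ray in auto)
    then show "(\<lambda>t. a d * ?D t d) integrable_on {0..1}" by (rule integrable_continuous_real)
  qed
  also have "\<dots> = (\<Sum>d\<in>D. a d * H d u)" by (simp add: H_def)
  finally show "h u = h c + (\<Sum>d\<in>D. a d * H d u)" by simp
qed

section \<open>Smooth functions on manifolds\<close>

definition smooth_in_chart :: "'a set \<Rightarrow> ('a \<Rightarrow> 'e::euclidean_space) \<Rightarrow> 'a \<Rightarrow> ('a \<Rightarrow> real) \<Rightarrow> bool" where
  "smooth_in_chart U \<phi> p f \<longleftrightarrow>
     (\<exists>S h. open S \<and> \<phi> p \<in> S \<and> cinf_on S h \<and> (\<forall>q\<in>U. \<phi> q \<in> S \<longrightarrow> f q = h (\<phi> q)))"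

text \<open>Smoothness of a germ, tested in one chart; \<open>smooth_in_chart_change\<close> shows
  that the chart does not matter. Unlike \<open>smooth_functions\<close>, this form is local and
  free of \<open>inv_into\<close>, so it combines well with cutoffs.\<close>

definition smooth_at :: "('a, 'e::euclidean_space) manifold \<Rightarrow> 'a \<Rightarrow> ('a \<Rightarrow> real) \<Rightarrow> bool" where
  "smooth_at M p f \<longleftrightarrow> (\<exists>U \<phi>. (U, \<phi>) \<in> atlas M \<and> p \<in> U \<and> smooth_in_chart U \<phi> p f)"

lemma smooth_on_continuous:
  fixes f :: "'e::euclidean_space \<Rightarrow> 'c::real_normed_vector"
  assumes "smooth_on A f"
  shows "continuous_on A f"
  unfolding continuous_on_def
proof
  fix x assume x: "x \<in> A"
  then obtain S h where S: "open S" "x \<in> S" "cinf_on S h" "\<And>y. y \<in> A \<inter> S \<Longrightarrow> h y = f y"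
    using assms unfolding smooth_on_def cinf_on_def by metis
  have "isCont h x"
    using S(1,2) cinf_on_continuous[OF S(3)] continuous_on_eq_continuous_at by blast
  then have "(h \<longlongrightarrow> f x) (at x within A)"
    using S(2,4) x by (metis IntI continuous_at tendsto_within_subset subset_UNIV)
  moreover have "\<forall>\<^sub>F y in at x within A. h y = f y"
    unfolding eventually_at_topological using S by blast
  ultimately show "(f \<longlongrightarrow> f x) (at x within A)" by (rule Lim_transform_eventually)
qed

lemma smooth_in_chart_const: "smooth_in_chart U \<phi> p (\<lambda>q. c)"
  unfolding smooth_in_chart_def by (intro exI[of _ UNIV] exI[of _ "\<lambda>u. c"]) (auto intro: cinf_on_const)

lemma smooth_in_chart_linear:
  "bounded_linear L \<Longrightarrow> smooth_in_chart U \<phi> p (\<lambda>q. L (\<phi> q))"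
  unfolding smooth_in_chart_def
  by (intro exI[of _ UNIV] exI[of _ L]) (auto intro: cinf_on_bounded_linear)

lemma smooth_in_chart_binop:
  assumes "smooth_in_chart U \<phi> p f" "smooth_in_chart U \<phi> p g"
    and "\<And>S (a::'e::euclidean_space \<Rightarrow> real) b.
      open S \<Longrightarrow> cinf_on S a \<Longrightarrow> cinf_on S b \<Longrightarrow> cinf_on S (\<lambda>u. F (a u) (b u))"
  shows "smooth_in_chart U (\<phi> :: 'a \<Rightarrow> 'e) p (\<lambda>q. F (f q) (g q))"
proof -
  obtain S h where S: "open S" "\<phi> p \<in> S" "cinf_on S h" "\<forall>q\<in>U. \<phi> q \<in> S \<longrightarrow> f q = h (\<phi> q)"
    using assms(1) unfolding smooth_in_chart_def by blast
  obtain T k where T: "open T" "\<phi> p \<in> T" "cinf_on T k" "\<forall>q\<in>U. \<phi> q \<in> T \<longrightarrow> g q = k (\<phi> q)"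
    using assms(2) unfolding smooth_in_chart_def by blast
  have "cinf_on (S \<inter> T) (\<lambda>u. F (h u) (k u))"
    using S T by (intro assms(3)) (auto intro: cinf_on_subset)
  then show ?thesis
    unfolding smooth_in_chart_def using S T
    by (intro exI[of _ "S \<inter> T"] exI[of _ "\<lambda>u. F (h u) (k u)"]) auto
qed

lemma smooth_in_chart_inverse:
  fixes \<phi> :: "'a \<Rightarrow> 'e::euclidean_space"
  assumes "smooth_in_chart U \<phi> p f" "f p \<noteq> 0" "p \<in> U"
  shows "smooth_in_chart U \<phi> p (\<lambda>q. inverse (f q))"
proof -
  obtain S h where S: "open S" "\<phi> p \<in> S" "cinf_on S h" "\<forall>q\<in>U. \<phi> q \<in> S \<longrightarrow> f q = h (\<phi> q)"
    using assms(1) unfolding smooth_in_chart_def by blast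
  let ?T = "S \<inter> h -` (- {0})"
  have T: "open ?T"
    using continuous_open_preimage[OF cinf_on_continuous[OF S(3)] S(1), of "- {0}"] by auto
  then have "cinf_on ?T (\<lambda>u. inverse (h u))"
    using S(3) by (intro cinf_on_inverse) (auto intro: cinf_on_subset)
  then show ?thesis
    unfolding smooth_in_chart_def using S T assms(2,3)
    by (intro exI[of _ "?T"] exI[of _ "\<lambda>u. inverse (h u)"]) auto
qed

section \<open>Topology of a manifold and germs of smooth functions\<close>

locale mfd =
  fixes M :: "('a, 'e::euclidean_space) manifold"
  assumes subspace_model: "subspace (model M)"
    and Union_charts: "(\<Union>(U, \<phi>)\<in>atlas M. U) = points M"
    and chart: "\<And>U \<phi>. (U, \<phi>) \<in> atlas M \<Longrightarrow> inj_on \<phi> U \<and> openin (top_of_set (model M)) (\<phi> ` U)"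
    and transition: "\<And>U \<phi> V \<psi>. (U, \<phi>) \<in> atlas M \<Longrightarrow> (V, \<psi>) \<in> atlas M \<Longrightarrow>
        openin (top_of_set (model M)) (\<phi> ` (U \<inter> V)) \<and> smooth_on (\<phi> ` (U \<inter> V)) (\<psi> \<circ> inv_into U \<phi>)"
    and Hausdorff: "Hausdorff_space (manifold_topology M)"

lemma smooth_manifold_mfd: "smooth_manifold M \<Longrightarrow> mfd M"
  unfolding smooth_manifold_def by unfold_locales auto

text \<open>\<open>manifold_topology\<close> is made by \<open>topology\<close>, so the axioms of a
  topology must be verified; injectivity of the charts lets images commute with intersections. Only
  injectivity is assumed, so that the criterion is available for a product before the product is
  known to be a manifold.\<close>

lemma openin_manifold_topology_if_inj:
  fixes M :: "('a, 'e::euclidean_space) manifold"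
  assumes inj: "\<And>U \<phi>. (U, \<phi>) \<in> atlas M \<Longrightarrow> inj_on \<phi> U"
  shows "openin (manifold_topology M) S \<longleftrightarrow> S \<subseteq> points M \<and>
     (\<forall>(U, \<phi>)\<in>atlas M. openin (top_of_set (model M)) (\<phi> ` (S \<inter> U)))"
proof -
  let ?P = "\<lambda>S. S \<subseteq> points M \<and> (\<forall>(U, \<phi>)\<in>atlas M. openin (top_of_set (model M)) (\<phi> ` (S \<inter> U)))"
  have "istopology ?P"
    unfolding istopology_def
  proof (intro conjI allI impI)
    fix S T assume ST: "?P S" "?P T"
    have "openin (top_of_set (model M)) (\<phi> ` (S \<inter> T \<inter> U))" if "(U, \<phi>) \<in> atlas M" for U \<phi>
    proof -
      have "\<phi> ` (S \<inter> T \<inter> U) = \<phi> ` (S \<inter> U) \<inter> \<phi> ` (T \<inter> U)"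
        using inj_on_image_Int[OF inj[OF that], of "S \<inter> U" "T \<inter> U"]
        by (simp add: Int_commute Int_left_commute Int_assoc)
      then show ?thesis using ST that by (auto intro!: openin_Int)
    qed
    then show "\<forall>(U, \<phi>)\<in>atlas M. openin (top_of_set (model M)) (\<phi> ` (S \<inter> T \<inter> U))" by auto
    show "S \<inter> T \<subseteq> points M" using ST by auto
  next
    fix K assume K: "\<forall>S\<in>K. ?P S"
    have "openin (top_of_set (model M)) (\<phi> ` (\<Union>K \<inter> U))" if "(U, \<phi>) \<in> atlas M" for U \<phi>
    proof -
      have "\<phi> ` (\<Union>K \<inter> U) = (\<Union>S\<in>K. \<phi> ` (S \<inter> U))" by auto
      then show ?thesis using K that by (auto intro!: openin_Union)
    qed
    then show "\<forall>(U, \<phi>)\<in>atlas M. openin (top_of_set (model M)) (\<phi> ` (\<Union>K \<inter> U))" by auto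
    show "\<Union>K \<subseteq> points M" using K by auto
  qed
  then show ?thesis unfolding manifold_topology_def by (simp add: topology_inverse')
qed

context mfd
begin

abbreviation "T \<equiv> manifold_topology M"

lemma chart_inj: "(U, \<phi>) \<in> atlas M \<Longrightarrow> inj_on \<phi> U"
  and chart_image_openin: "(U, \<phi>) \<in> atlas M \<Longrightarrow> openin (top_of_set (model M)) (\<phi> ` U)"
  using chart by auto

lemma chart_subset: "(U, \<phi>) \<in> atlas M \<Longrightarrow> U \<subseteq> points M"
  using Union_charts by auto

lemma chart_in_model: "(U, \<phi>) \<in> atlas M \<Longrightarrow> q \<in> U \<Longrightarrow> \<phi> q \<in> model M"
  using chart_image_openin openin_imp_subset by blast

lemma obtain_chart:
  assumes "p \<in> points M"
  obtains U \<phi> where "(U, \<phi>) \<in> atlas M" "p \<in> U"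
proof -
  from assms have "p \<in> (\<Union>(U, \<phi>)\<in>atlas M. U)" by (simp only: Union_charts)
  then show ?thesis using that by blast
qed

lemma openin_T: "openin T S \<longleftrightarrow> S \<subseteq> points M \<and>
     (\<forall>(U, \<phi>)\<in>atlas M. openin (top_of_set (model M)) (\<phi> ` (S \<inter> U)))"
  by (rule openin_manifold_topology_if_inj) (rule chart_inj)

lemma openin_T_subset: "openin T S \<Longrightarrow> S \<subseteq> points M"
  by (simp add: openin_T)

lemma openin_T_points: "openin T (points M)"
  unfolding openin_T using chart_image_openin chart_subset by (auto simp: Int_absorb1)

lemma topspace_T: "topspace T = points M"
  using openin_T_points openin_T_subset openin_subset openin_topspace by blast

text \<open>In another chart the set becomes the preimage of \<open>S\<close> under a transition
  map, which is continuous on an open piece of the model space.\<close>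

lemma openin_T_chart_preimage:
  assumes U: "(U, \<phi>) \<in> atlas M" and S: "open S"
  shows "openin T {q\<in>U. \<phi> q \<in> S}"
  unfolding openin_T
proof (intro conjI ballI, goal_cases)
  case 1
  then show ?case using chart_subset[OF U] by auto
next
  case (2 c)
  obtain V \<psi> where c: "c = (V, \<psi>)" by (cases c)
  with 2 have V: "(V, \<psi>) \<in> atlas M" by simp
  let ?A = "\<psi> ` (V \<inter> U)"
  have "openin (top_of_set ?A) (?A \<inter> (\<phi> \<circ> inv_into V \<psi>) -` S)"
    by (rule continuous_openin_preimage_gen[OF smooth_on_continuous S]) (use transition[OF V U] in blast)
  then have "openin (top_of_set (model M)) (?A \<inter> (\<phi> \<circ> inv_into V \<psi>) -` S)"
    using transition[OF V U] openin_trans by blast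
  moreover have "?A \<inter> (\<phi> \<circ> inv_into V \<psi>) -` S = \<psi> ` ({q\<in>U. \<phi> q \<in> S} \<inter> V)"
    using chart_inj[OF V] by (auto simp: inv_into_f_f)
  ultimately show ?case by (simp add: c)
qed

lemma openin_T_chart: "(U, \<phi>) \<in> atlas M \<Longrightarrow> openin T U"
  using openin_T_chart_preimage[of U \<phi> UNIV] by simp

lemma openin_T_ball:
  assumes U: "(U, \<phi>) \<in> atlas M" and "openin T N" "p \<in> N" "p \<in> U"
  obtains r where "r > 0" "ball (\<phi> p) r \<inter> model M \<subseteq> \<phi> ` (N \<inter> U)"
    "\<And>q. q \<in> U \<Longrightarrow> \<phi> q \<in> ball (\<phi> p) r \<Longrightarrow> q \<in> N"
proof -
  have "openin (top_of_set (model M)) (\<phi> ` (N \<inter> U))" using assms(2) U unfolding openin_T by auto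
  moreover have "\<phi> p \<in> \<phi> ` (N \<inter> U)" using assms by auto
  ultimately obtain r where r: "r > 0" "ball (\<phi> p) r \<inter> model M \<subseteq> \<phi> ` (N \<inter> U)"
    unfolding openin_contains_ball by blast
  have "q \<in> N" if q: "q \<in> U" "\<phi> q \<in> ball (\<phi> p) r" for q
  proof -
    have "\<phi> q \<in> \<phi> ` (N \<inter> U)" using r(2) q chart_in_model[OF U] by auto
    then show ?thesis using inj_on_image_mem_iff[OF chart_inj[OF U] q(1), of "N \<inter> U"] by auto
  qed
  with r show ?thesis using that by blast
qed

text \<open>The representative of \<open>f\<close> in the first chart is composed with a smooth
  extension of the transition map.\<close>

lemma smooth_in_chart_change:
  assumes U: "(U, \<phi>) \<in> atlas M" "p \<in> U" and f: "smooth_in_chart U \<phi> p f"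
    and V: "(V, \<psi>) \<in> atlas M" "p \<in> V"
  shows "smooth_in_chart V \<psi> p f"
proof -
  obtain S h where S: "open S" "\<phi> p \<in> S" "cinf_on S h" "\<forall>q\<in>U. \<phi> q \<in> S \<longrightarrow> f q = h (\<phi> q)"
    using f unfolding smooth_in_chart_def by blast
  let ?A = "\<psi> ` (V \<inter> U)"
  have "\<psi> p \<in> ?A" using U V by auto
  then obtain S' k where S': "open S'" "\<psi> p \<in> S'" "cinf_on S' k"
    "\<And>y. y \<in> ?A \<inter> S' \<Longrightarrow> k y = (\<phi> \<circ> inv_into V \<psi>) y"
    using transition[OF V(1) U(1)] unfolding smooth_on_def cinf_on_def by metis
  have k: "k (\<psi> q) = \<phi> q" if "q \<in> V \<inter> U" "\<psi> q \<in> S'" for q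
    using S'(4)[of "\<psi> q"] that chart_inj[OF V(1)] by (auto simp: inv_into_f_f)
  \<comment> \<open>The extension \<open>k\<close> is tied to the transition map on the overlap
    only; the ball forces points of \<open>V\<close> into \<open>U\<close>.\<close>
  obtain r where r: "r > 0" "\<And>q. q \<in> V \<Longrightarrow> \<psi> q \<in> ball (\<psi> p) r \<Longrightarrow> q \<in> U"
    using openin_T_ball[OF V(1) openin_T_chart[OF U(1)] U(2) V(2)] by metis
  let ?S = "(S' \<inter> k -` S) \<inter> ball (\<psi> p) r"
  have "open ?S"
    using continuous_open_preimage[OF cinf_on_continuous[OF S'(3)] S'(1) S(1)] by auto
  moreover have "\<psi> p \<in> ?S" using k[of p] U V S S' r by auto
  moreover have "cinf_on ?S (\<lambda>u. h (k u))"
    using \<open>open ?S\<close> by (rule cinf_on_compose[OF _ _ S(3)]) (auto intro: cinf_on_subset[OF S'(3)])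
  moreover have "\<forall>q\<in>V. \<psi> q \<in> ?S \<longrightarrow> f q = h (k (\<psi> q))"
    using r(2) k S(4) by auto
  ultimately show ?thesis unfolding smooth_in_chart_def by (intro exI[of _ ?S]) blast
qed

lemma smooth_at_chartD:
  "smooth_at M p f \<Longrightarrow> (V, \<psi>) \<in> atlas M \<Longrightarrow> p \<in> V \<Longrightarrow> smooth_in_chart V \<psi> p f"
  unfolding smooth_at_def using smooth_in_chart_change by blast

lemma smooth_atI: "(U, \<phi>) \<in> atlas M \<Longrightarrow> p \<in> U \<Longrightarrow> smooth_in_chart U \<phi> p f \<Longrightarrow> smooth_at M p f"
  unfolding smooth_at_def by blast

lemma smooth_functions_iff: "f \<in> smooth_functions M \<longleftrightarrow> (\<forall>p\<in>points M. smooth_at M p f)"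
proof
  assume f: "f \<in> smooth_functions M"
  show "\<forall>p\<in>points M. smooth_at M p f"
  proof
    fix p assume "p \<in> points M"
    then obtain U \<phi> where U: "(U, \<phi>) \<in> atlas M" "p \<in> U" by (rule obtain_chart)
    then have "smooth_on (\<phi> ` U) (f \<circ> inv_into U \<phi>)"
      using f unfolding smooth_functions_def by auto
    then obtain S h where "open S" "\<phi> p \<in> S" "cinf_on S h" "\<And>y. y \<in> \<phi> ` U \<inter> S \<Longrightarrow> h y = (f \<circ> inv_into U \<phi>) y"
      using U unfolding smooth_on_def cinf_on_def by (metis imageI)
    then have "smooth_in_chart U \<phi> p f"
      unfolding smooth_in_chart_def using chart_inj[OF U(1)]
      by (intro exI[of _ S] exI[of _ h]) (auto simp: inv_into_f_f)
    with U show "smooth_at M p f" by (rule smooth_atI)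
  qed
next
  assume f: "\<forall>p\<in>points M. smooth_at M p f"
  have "smooth_on (\<phi> ` U) (f \<circ> inv_into U \<phi>)" if U: "(U, \<phi>) \<in> atlas M" for U \<phi>
    unfolding smooth_on_def
  proof
    fix x assume "x \<in> \<phi> ` U"
    then obtain p where p: "p \<in> U" "x = \<phi> p" by auto
    then have "smooth_in_chart U \<phi> p f" using f smooth_at_chartD U chart_subset by blast
    then obtain S h where "open S" "\<phi> p \<in> S" "cinf_on S h" "\<forall>q\<in>U. \<phi> q \<in> S \<longrightarrow> f q = h (\<phi> q)"
      unfolding smooth_in_chart_def by blast
    then show "\<exists>S h. open S \<and> x \<in> S \<and> (\<forall>k. ck_on k S h) \<and> (\<forall>y\<in>\<phi> ` U \<inter> S. h y = (f \<circ> inv_into U \<phi>) y)"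
      using p chart_inj[OF U] unfolding cinf_on_def
      by (intro exI[of _ S] exI[of _ h]) (auto simp: inv_into_f_f)
  qed
  then show "f \<in> smooth_functions M" unfolding smooth_functions_def by auto
qed

lemma smooth_functionsD: "f \<in> smooth_functions M \<Longrightarrow> p \<in> points M \<Longrightarrow> smooth_at M p f"
  by (simp add: smooth_functions_iff)

lemma smooth_at_const: "p \<in> points M \<Longrightarrow> smooth_at M p (\<lambda>q. c)"
  by (erule obtain_chart) (rule smooth_atI[OF _ _ smooth_in_chart_const])

lemma smooth_at_binop:
  assumes "smooth_at M p f" "smooth_at M p g"
    and "\<And>S (a::'e \<Rightarrow> real) b.
      open S \<Longrightarrow> cinf_on S a \<Longrightarrow> cinf_on S b \<Longrightarrow> cinf_on S (\<lambda>u. F (a u) (b u))"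
  shows "smooth_at M p (\<lambda>q. F (f q) (g q))"
proof -
  obtain U \<phi> where U: "(U, \<phi>) \<in> atlas M" "p \<in> U" "smooth_in_chart U \<phi> p f"
    using assms(1) unfolding smooth_at_def by blast
  show ?thesis
    by (rule smooth_atI[OF U(1,2) smooth_in_chart_binop[OF U(3) smooth_at_chartD[OF assms(2) U(1,2)]]])
      (rule assms(3))
qed

lemma smooth_at_add: "smooth_at M p f \<Longrightarrow> smooth_at M p g \<Longrightarrow> smooth_at M p (\<lambda>q. f q + g q)"
  by (rule smooth_at_binop[where F = "(+)"]) (auto intro: cinf_on_add)

lemma smooth_at_mult: "smooth_at M p f \<Longrightarrow> smooth_at M p g \<Longrightarrow> smooth_at M p (\<lambda>q. f q * g q)"
  by (rule smooth_at_binop[where F = "(*)"]) (auto intro: cinf_on_mult)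

lemma smooth_at_sum:
  "p \<in> points M \<Longrightarrow> (\<And>i. i \<in> I \<Longrightarrow> smooth_at M p (f i)) \<Longrightarrow> smooth_at M p (\<lambda>q. \<Sum>i\<in>I. f i q)"
  by (induction I rule: infinite_finite_induct) (simp_all add: smooth_at_const smooth_at_add)

lemma smooth_at_inverse: "smooth_at M p f \<Longrightarrow> f p \<noteq> 0 \<Longrightarrow> smooth_at M p (\<lambda>q. inverse (f q))"
  unfolding smooth_at_def by (elim exE conjE) (intro exI conjI smooth_in_chart_inverse)

lemma smooth_at_minus: "smooth_at M p f \<Longrightarrow> smooth_at M p (\<lambda>q. - f q)"
  by (rule smooth_at_binop[where F = "\<lambda>a b. - a" and g = f])
    (auto intro: cinf_on_linear_comp[OF _ bounded_linear_minus[OF bounded_linear_ident]])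

lemma smooth_at_diff: "smooth_at M p f \<Longrightarrow> smooth_at M p g \<Longrightarrow> smooth_at M p (\<lambda>q. f q - g q)"
  by (drule smooth_at_minus[of p g]) (drule (1) smooth_at_add, simp)

lemma smooth_at_divide:
  "smooth_at M p f \<Longrightarrow> smooth_at M p g \<Longrightarrow> g p \<noteq> 0 \<Longrightarrow> smooth_at M p (\<lambda>q. f q / g q)"
  unfolding divide_inverse by (intro smooth_at_mult smooth_at_inverse)

lemma smooth_at_local:
  assumes f: "smooth_at M p f" and N: "openin T N" "p \<in> N" and eq: "\<And>q. q \<in> N \<Longrightarrow> f q = g q"
  shows "smooth_at M p g"
proof -
  obtain U \<phi> S h where U: "(U, \<phi>) \<in> atlas M" "p \<in> U" and
    S: "open S" "\<phi> p \<in> S" "cinf_on S h" "\<forall>q\<in>U. \<phi> q \<in> S \<longrightarrow> f q = h (\<phi> q)"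
    using f unfolding smooth_at_def smooth_in_chart_def by blast
  obtain r where r: "r > 0" "\<And>q. q \<in> U \<Longrightarrow> \<phi> q \<in> ball (\<phi> p) r \<Longrightarrow> q \<in> N"
    using openin_T_ball[OF U(1) N U(2)] by metis
  have "smooth_in_chart U \<phi> p g"
    unfolding smooth_in_chart_def
  proof (intro exI[of _ "S \<inter> ball (\<phi> p) r"] exI[of _ h] conjI ballI impI)
    show "cinf_on (S \<inter> ball (\<phi> p) r) h" by (rule cinf_on_subset[OF S(3)]) simp
    show "g q = h (\<phi> q)" if "q \<in> U" "\<phi> q \<in> S \<inter> ball (\<phi> p) r" for q
      using S(4) r(2)[of q] eq[of q] that by simp
  qed (use S(1,2) r(1) in auto)
  with U show ?thesis by (rule smooth_atI)
qed

lemma smooth_at_nbhd: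
  assumes "smooth_at M p f"
  obtains N where "openin T N" "p \<in> N" "\<And>q. q \<in> N \<Longrightarrow> smooth_at M q f"
proof -
  obtain U \<phi> S h where U: "(U, \<phi>) \<in> atlas M" "p \<in> U" and
    S: "open S" "\<phi> p \<in> S" "cinf_on S h" "\<forall>q\<in>U. \<phi> q \<in> S \<longrightarrow> f q = h (\<phi> q)"
    using assms unfolding smooth_at_def smooth_in_chart_def by blast
  have "smooth_at M q f" if "q \<in> {q\<in>U. \<phi> q \<in> S}" for q
    using that U(1) S(1,3,4) unfolding smooth_at_def smooth_in_chart_def by blast
  then show ?thesis using that[OF openin_T_chart_preimage[OF U(1) S(1)]] U(2) S(2) by simp
qed

lemma smooth_functions_intro: "(\<And>p. p \<in> points M \<Longrightarrow> smooth_at M p f) \<Longrightarrow> f \<in> smooth_functions M"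
  by (simp add: smooth_functions_iff)

lemma smooth_functions_cong:
  assumes "f \<in> smooth_functions M" "\<And>q. q \<in> points M \<Longrightarrow> f q = g q"
  shows "g \<in> smooth_functions M"
  using assms smooth_at_local[OF smooth_functionsD[OF assms(1)] openin_T_points]
  by (auto simp: smooth_functions_iff)

lemma smooth_functions_const: "(\<lambda>q. c) \<in> smooth_functions M"
  by (simp add: smooth_functions_iff smooth_at_const)

lemma smooth_functions_add:
  "f \<in> smooth_functions M \<Longrightarrow> g \<in> smooth_functions M \<Longrightarrow> (\<lambda>q. f q + g q) \<in> smooth_functions M"
  by (simp add: smooth_functions_iff smooth_at_add)

lemma smooth_functions_mult:
  "f \<in> smooth_functions M \<Longrightarrow> g \<in> smooth_functions M \<Longrightarrow> (\<lambda>q. f q * g q) \<in> smooth_functions M"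
  by (simp add: smooth_functions_iff smooth_at_mult)

lemma smooth_functions_minus:
  "f \<in> smooth_functions M \<Longrightarrow> (\<lambda>q. - f q) \<in> smooth_functions M"
  by (simp add: smooth_functions_iff smooth_at_minus)

lemma smooth_functions_diff:
  "f \<in> smooth_functions M \<Longrightarrow> g \<in> smooth_functions M \<Longrightarrow> (\<lambda>q. f q - g q) \<in> smooth_functions M"
  by (simp add: smooth_functions_iff smooth_at_diff)

lemma smooth_functions_sum:
  "(\<And>i. i \<in> I \<Longrightarrow> f i \<in> smooth_functions M) \<Longrightarrow> (\<lambda>q. \<Sum>i\<in>I. f i q) \<in> smooth_functions M"
  by (simp add: smooth_functions_iff smooth_at_sum)

lemma smooth_functions_power:
  "f \<in> smooth_functions M \<Longrightarrow> (\<lambda>q. f q ^ n) \<in> smooth_functions M"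
  by (induction n) (auto intro: smooth_functions_const smooth_functions_mult)

lemmas smooth_intros = smooth_functions_const smooth_functions_add smooth_functions_mult
  smooth_functions_minus smooth_functions_diff smooth_functions_sum smooth_functions_power

section \<open>Cutoff functions\<close>

text \<open>The set is the continuous image of a compact set, hence compact, hence closed in a
  Hausdorff space. Without closedness in the whole manifold, extension by zero out of a chart could
  fail to be smooth.\<close>

lemma closedin_T_chart_cball:
  assumes U: "(U, \<phi>) \<in> atlas M" and sub: "cball c r \<inter> model M \<subseteq> \<phi> ` U"
  shows "closedin T {q\<in>U. \<phi> q \<in> cball c r}"
proof -
  have inv: "inv_into U \<phi> (\<phi> q) = q" if "q \<in> U" for q
    using chart_inj[OF U] that by (simp add: inv_into_f_f)
  have "continuous_map (top_of_set (\<phi> ` U)) T (inv_into U \<phi>)"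
    unfolding continuous_map_def
  proof (intro conjI allI impI)
    show "inv_into U \<phi> \<in> topspace (top_of_set (\<phi> ` U)) \<rightarrow> topspace T"
      using chart_subset[OF U] inv by (auto simp: topspace_T)
    fix N assume "openin T N"
    then have "openin (top_of_set (model M)) (\<phi> ` (N \<inter> U))" using U unfolding openin_T by auto
    then have "openin (top_of_set (\<phi> ` U)) (\<phi> ` (N \<inter> U))"
      using openin_subset_trans[of "model M" "\<phi> ` (N \<inter> U)" "\<phi> ` U"] chart_in_model[OF U] by blast
    moreover have "\<phi> ` (N \<inter> U) = {x \<in> topspace (top_of_set (\<phi> ` U)). inv_into U \<phi> x \<in> N}"
      using inv by auto
    ultimately show "openin (top_of_set (\<phi> ` U)) {x \<in> topspace (top_of_set (\<phi> ` U)). inv_into U \<phi> x \<in> N}"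
      by simp
  qed
  moreover have "compactin (top_of_set (\<phi> ` U)) (cball c r \<inter> model M)"
    using sub compact_Int_closed[OF compact_cball closed_subspace[OF subspace_model]]
    by (simp add: compactin_subtopology)
  ultimately have "compactin T (inv_into U \<phi> ` (cball c r \<inter> model M))"
    by (rule image_compactin[rotated])
  moreover have "inv_into U \<phi> ` (cball c r \<inter> model M) = {q\<in>U. \<phi> q \<in> cball c r}"
    using sub inv chart_in_model[OF U] by (force simp: image_iff)
  ultimately show ?thesis using compactin_imp_closedin[OF Hausdorff] by metis
qed

text \<open>The open sets \<open>N\<close> and the complement of \<open>K\<close> cover the
  manifold, and on the latter the function is identically zero.\<close>

lemma smooth_cutoff_extension:
  assumes \<rho>: "\<rho> \<in> smooth_functions M" and K: "closedin T K" "K \<subseteq> N" "\<And>q. q \<notin> K \<Longrightarrow> \<rho> q = 0"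
    and N: "openin T N" and f: "\<And>q. q \<in> N \<Longrightarrow> smooth_at M q f"
  shows "(\<lambda>q. if q \<in> N then \<rho> q * f q else 0) \<in> smooth_functions M"
proof (rule smooth_functions_intro)
  fix p assume p: "p \<in> points M"
  show "smooth_at M p (\<lambda>q. if q \<in> N then \<rho> q * f q else 0)"
  proof (cases "p \<in> N")
    case True
    show ?thesis
      by (rule smooth_at_local[OF smooth_at_mult[OF smooth_functionsD[OF \<rho> p] f[OF True]] N True]) simp
  next
    case False
    have "openin T (points M - K)" using K(1) by (metis closedin_def topspace_T)
    then show ?thesis
      by (rule smooth_at_local[OF smooth_at_const[OF p, of 0]]) (use False p K in auto)
  qed
qed

lemma bump_function:
  assumes N: "openin T N" and p: "p \<in> N"
  obtains \<rho> K N' where "\<rho> \<in> smooth_functions M" "closedin T K" "K \<subseteq> N" "\<And>q. q \<notin> K \<Longrightarrow> \<rho> q = 0"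
    "openin T N'" "p \<in> N'" "N' \<subseteq> N" "\<And>q. q \<in> N' \<Longrightarrow> \<rho> q = 1"
proof -
  have "p \<in> points M" using assms openin_T_subset by blast
  then obtain U \<phi> where U: "(U, \<phi>) \<in> atlas M" "p \<in> U" by (rule obtain_chart)
  obtain r where r: "r > 0" "ball (\<phi> p) r \<inter> model M \<subseteq> \<phi> ` (N \<inter> U)"
    "\<And>q. q \<in> U \<Longrightarrow> \<phi> q \<in> ball (\<phi> p) r \<Longrightarrow> q \<in> N"
    using openin_T_ball[OF U(1) N p U(2)] by metis
  \<comment> \<open>Halving the radius places the closed ball of radius \<open>s\<close> inside the
    open ball of radius \<open>r\<close>, whose trace on the model space lies in the image of the
    chart.\<close>
  define s where "s = r / 2"
  have s: "s > 0" "cball (\<phi> p) s \<subseteq> ball (\<phi> p) r" using r(1) by (auto simp: s_def)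
  obtain \<beta> :: "'e \<Rightarrow> real" where \<beta>: "cinf_on UNIV \<beta>"
    "\<And>u. u \<in> ball (\<phi> p) (s/2) \<Longrightarrow> \<beta> u = 1" "\<And>u. u \<notin> ball (\<phi> p) s \<Longrightarrow> \<beta> u = 0"
    using exists_bump[OF s(1)] by metis
  define K where "K = {q\<in>U. \<phi> q \<in> cball (\<phi> p) s}"
  have K: "closedin T K" unfolding K_def
    by (rule closedin_T_chart_cball[OF U(1)]) (use s r in blast)
  define \<rho> where "\<rho> q = (if q \<in> U then \<beta> (\<phi> q) else 0)" for q
  have \<rho>0: "\<rho> q = 0" if "q \<notin> K" for q
    using that \<beta>(3)[of "\<phi> q"] by (auto simp: \<rho>_def K_def)
  have "\<rho> \<in> smooth_functions M"
  proof (rule smooth_functions_intro)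
    fix q assume q: "q \<in> points M"
    show "smooth_at M q \<rho>"
    proof (cases "q \<in> U")
      case True
      have "smooth_in_chart U \<phi> q \<rho>" unfolding smooth_in_chart_def
        by (intro exI[of _ UNIV] exI[of _ \<beta>]) (auto simp: \<rho>_def \<beta>)
      then show ?thesis using U(1) True smooth_atI by blast
    next
      case False
      have "openin T (points M - K)" using K by (metis closedin_def topspace_T)
      then show ?thesis
        by (rule smooth_at_local[OF smooth_at_const[OF q, of 0]]) (use False q \<rho>0 in \<open>auto simp: K_def\<close>)
    qed
  qed
  moreover have "K \<subseteq> N" unfolding K_def using r(3) s by blast
  moreover have "{q\<in>U. \<phi> q \<in> ball (\<phi> p) (s/2)} \<subseteq> N"
    using r(3) s subset_ball[of "s/2" r "\<phi> p"] by (auto simp: s_def)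
  moreover have "\<rho> q = 1" if "q \<in> {q\<in>U. \<phi> q \<in> ball (\<phi> p) (s/2)}" for q
    using that \<beta>(2) by (simp add: \<rho>_def)
  ultimately show ?thesis
    using that[of \<rho> K "{q\<in>U. \<phi> q \<in> ball (\<phi> p) (s/2)}"] K \<rho>0 U s
      openin_T_chart_preimage[OF U(1) open_ball, of "\<phi> p" "s/2"] by simp
qed

text \<open>Derivations act on globally smooth functions only, so chart coordinates and other
  locally defined functions have to be replaced by global ones with the same germ.\<close>

lemma smooth_at_globalize:
  assumes "smooth_at M p f"
  obtains h N where "h \<in> smooth_functions M" "openin T N" "p \<in> N" "\<And>q. q \<in> N \<Longrightarrow> h q = f q"
proof -
  obtain N where N: "openin T N" "p \<in> N" "\<And>q. q \<in> N \<Longrightarrow> smooth_at M q f"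
    using smooth_at_nbhd[OF assms] by metis
  obtain \<rho> K N' where \<rho>: "\<rho> \<in> smooth_functions M" "closedin T K" "K \<subseteq> N" "\<And>q. q \<notin> K \<Longrightarrow> \<rho> q = 0"
    "openin T N'" "p \<in> N'" "N' \<subseteq> N" "\<And>q. q \<in> N' \<Longrightarrow> \<rho> q = 1"
    using bump_function[OF N(1,2)] by metis
  have "(\<lambda>q. if q \<in> N then \<rho> q * f q else 0) \<in> smooth_functions M"
    by (rule smooth_cutoff_extension[OF \<rho>(1-4) N(1,3)])
  then show ?thesis by (rule that[OF _ \<rho>(5,6)]) (use \<rho>(7,8) in auto)
qed

end

section \<open>Tangent vectors\<close>

text \<open>A derivative along a curve in the manifold, taken of \<open>f\<close> itself: an
  extension of its chart representative off the model space is not unique. For \<open>w\<close> in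
  the model space the curve stays in the chart for small \<open>t\<close>.\<close>

definition chart_deriv :: "'a set \<Rightarrow> ('a \<Rightarrow> 'e::euclidean_space) \<Rightarrow> 'e \<Rightarrow> 'a \<Rightarrow> ('a \<Rightarrow> real) \<Rightarrow> real" where
  "chart_deriv U \<phi> w q f = deriv (\<lambda>t. f (inv_into U \<phi> (\<phi> q + t *\<^sub>R w))) 0"

lemma vf_apply_apply: "vf_apply X f p = X p f"
  by (simp add: vf_apply_def)

context mfd
begin

abbreviation "Sm \<equiv> smooth_functions M"
abbreviation "TS \<equiv> tangent_space M"
abbreviation "VF \<equiv> vector_fields M"

lemma tangent_add: "v \<in> TS p \<Longrightarrow> f \<in> Sm \<Longrightarrow> h \<in> Sm \<Longrightarrow> v (\<lambda>q. f q + h q) = v f + v h"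
proof -
  assume "v \<in> TS p" "f \<in> Sm" "h \<in> Sm"
  then have "v (\<lambda>q. 1 * f q + 1 * h q) = 1 * v f + 1 * v h" unfolding tangent_space_def by blast
  then show ?thesis by simp
qed

lemma tangent_cmult: "v \<in> TS p \<Longrightarrow> f \<in> Sm \<Longrightarrow> v (\<lambda>q. c * f q) = c * v f"
proof -
  assume "v \<in> TS p" "f \<in> Sm"
  then have "v (\<lambda>q. c * f q + 0 * f q) = c * v f + 0 * v f" unfolding tangent_space_def by blast
  then show ?thesis by simp
qed

lemma tangent_mult: "v \<in> TS p \<Longrightarrow> f \<in> Sm \<Longrightarrow> h \<in> Sm \<Longrightarrow> v (\<lambda>q. f q * h q) = f p * v h + h p * v f"
  unfolding tangent_space_def by blast

lemma tangent_nonsmooth: "v \<in> TS p \<Longrightarrow> f \<notin> Sm \<Longrightarrow> v f = 0"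
  unfolding tangent_space_def by blast

text \<open>The product rule for 1 = 1 * 1 gives v(1) = 2 v(1).\<close>

lemma tangent_const: "v \<in> TS p \<Longrightarrow> v (\<lambda>q. c) = 0"
  using tangent_mult[of v p "\<lambda>q. 1" "\<lambda>q. 1"] tangent_cmult[of v p "\<lambda>q. 1" c]
  by (simp add: smooth_functions_const)

lemma tangent_minus: "v \<in> TS p \<Longrightarrow> f \<in> Sm \<Longrightarrow> v (\<lambda>q. - f q) = - v f"
  using tangent_cmult[of v p f "-1"] by simp

lemma tangent_diff: "v \<in> TS p \<Longrightarrow> f \<in> Sm \<Longrightarrow> h \<in> Sm \<Longrightarrow> v (\<lambda>q. f q - h q) = v f - v h"
  using tangent_add[of v p f "\<lambda>q. - h q"] by (simp add: tangent_minus smooth_functions_minus)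

lemma tangent_sum:
  assumes "v \<in> TS p"
  shows "(\<And>i. i \<in> I \<Longrightarrow> f i \<in> Sm) \<Longrightarrow> v (\<lambda>q. \<Sum>i\<in>I. f i q) = (\<Sum>i\<in>I. v (f i))"
  by (induction I rule: infinite_finite_induct)
    (simp_all add: tangent_const[OF assms] tangent_add[OF assms] smooth_functions_sum)

text \<open>The difference of the two functions, multiplied by a bump function supported in
  \<open>N\<close>, is the zero function; the product rule at \<open>p\<close> then leaves the
  difference of the two derivatives.\<close>

lemma tangent_local:
  assumes v: "v \<in> TS p" and N: "openin T N" "p \<in> N" and f: "f \<in> Sm" and h: "h \<in> Sm"
    and eq: "\<And>q. q \<in> N \<Longrightarrow> f q = h q"
  shows "v f = v h"
proof -
  obtain \<rho> K N' where \<rho>: "\<rho> \<in> Sm" "closedin T K" "K \<subseteq> N" "\<And>q. q \<notin> K \<Longrightarrow> \<rho> q = 0"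
    "p \<in> N'" "\<And>q. q \<in> N' \<Longrightarrow> \<rho> q = 1"
    using bump_function[OF N] by metis
  have "\<rho> q * (f q - h q) = 0" for q using \<rho>(3,4) eq by (cases "q \<in> K") auto
  then have "(\<lambda>q. \<rho> q * (f q - h q)) = (\<lambda>q. 0)" by (rule ext)
  then have "v (\<lambda>q. \<rho> q * (f q - h q)) = 0" using tangent_const[OF v, of 0] by metis
  moreover have "v (\<lambda>q. \<rho> q * (f q - h q)) = \<rho> p * (v f - v h) + (f p - h p) * v \<rho>"
    using tangent_mult[OF v \<rho>(1) smooth_functions_diff[OF f h]] by (simp add: tangent_diff[OF v f h])
  ultimately show ?thesis using \<rho>(5,6) eq[OF N(2)] by simp
qed

text \<open>Membership in \<open>Sm\<close> is itself decided on \<open>points M\<close>, so the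
  convention that a tangent vector is 0 on non-smooth functions treats \<open>f\<close> and
  \<open>h\<close> alike.\<close>

lemma tangent_cong:
  assumes v: "v \<in> TS p" and p: "p \<in> points M" and eq: "\<And>q. q \<in> points M \<Longrightarrow> f q = h q"
  shows "v f = v h"
proof (cases "f \<in> Sm")
  case True
  then have "h \<in> Sm" using eq by (rule smooth_functions_cong)
  then show ?thesis using tangent_local[OF v openin_T_points p True] eq by blast
next
  case False
  moreover have "h \<notin> Sm" using smooth_functions_cong[of h f] eq False by auto
  ultimately show ?thesis using tangent_nonsmooth[OF v] by simp
qed

lemma tangent_lincomb:
  assumes u: "u \<in> TS p" and v: "v \<in> TS p"
  shows "(\<lambda>f. a * u f + c * v f) \<in> TS p"
  unfolding tangent_space_def
proof (intro CollectI conjI ballI allI impI)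
  fix f h k l assume fh: "f \<in> Sm" "h \<in> Sm"
  have "w (\<lambda>q. k * f q + l * h q) = k * w f + l * w h" if "w \<in> TS p" for w
    using that fh unfolding tangent_space_def by blast
  from this[OF u] this[OF v] show "a * u (\<lambda>q. k * f q + l * h q) + c * v (\<lambda>q. k * f q + l * h q) =
    k * (a * u f + c * v f) + l * (a * u h + c * v h)" by (simp add: algebra_simps)
next
  fix f h assume "f \<in> Sm" "h \<in> Sm"
  then show "a * u (\<lambda>q. f q * h q) + c * v (\<lambda>q. f q * h q) =
    f p * (a * u h + c * v h) + h p * (a * u f + c * v f)"
    by (simp add: tangent_mult[OF u] tangent_mult[OF v] algebra_simps)
qed (simp add: tangent_nonsmooth[OF u] tangent_nonsmooth[OF v])

lemma tangent_zero: "(\<lambda>f. 0) \<in> TS p"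
  by (auto simp: tangent_space_def)

lemma tangent_scale: "u \<in> TS p \<Longrightarrow> (\<lambda>f. a * u f) \<in> TS p"
  using tangent_lincomb[of u p u a 0] by simp

lemma tangent_plus: "u \<in> TS p \<Longrightarrow> v \<in> TS p \<Longrightarrow> (\<lambda>f. u f + v f) \<in> TS p"
  using tangent_lincomb[of u p v 1 1] by simp

lemma tangent_sum_vec: "(\<And>i. i \<in> I \<Longrightarrow> u i \<in> TS p) \<Longrightarrow> (\<lambda>f. \<Sum>i\<in>I. u i f) \<in> TS p"
  by (induction I rule: infinite_finite_induct) (simp_all add: tangent_zero tangent_plus)

section \<open>Coordinate vectors of a chart\<close>

lemma chart_deriv_eq:
  assumes U: "(U, \<phi>) \<in> atlas M" "q \<in> U" and w: "w \<in> model M"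
    and S: "open S" "\<phi> q \<in> S" "cinf_on S h" and eq: "\<And>q. q \<in> U \<Longrightarrow> \<phi> q \<in> S \<Longrightarrow> f q = h (\<phi> q)"
  shows "chart_deriv U \<phi> w q f = frechet_derivative h (at (\<phi> q)) w"
proof -
  obtain r where r: "r > 0" "ball (\<phi> q) r \<inter> model M \<subseteq> \<phi> ` (U \<inter> U)"
    using openin_T_ball[OF U(1) openin_T_chart[OF U(1)] U(2) U(2)] by metis
  let ?c = "\<lambda>t::real. \<phi> q + t *\<^sub>R w"
  let ?I = "?c -` (S \<inter> ball (\<phi> q) r)"
  have I: "open ?I" using S(1) by (intro open_vimage) (auto intro!: continuous_intros)
  have dh: "(h has_derivative frechet_derivative h (at (?c 0))) (at (?c 0))"
    using cinf_on_has_derivative[OF S(3,2)] by simp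
  have "(?c has_derivative (\<lambda>s. s *\<^sub>R w)) (at 0)" by (auto intro!: derivative_eq_intros)
  from has_derivative_compose[OF this dh]
  have "((\<lambda>t. h (?c t)) has_real_derivative frechet_derivative h (at (\<phi> q)) w) (at 0)"
    using linear_scale[OF has_derivative_linear[OF dh]]
    by (simp add: has_field_derivative_def mult.commute[of _ "frechet_derivative h (at (\<phi> q)) w"])
  then have "((\<lambda>t. f (inv_into U \<phi> (?c t))) has_real_derivative frechet_derivative h (at (\<phi> q)) w) (at 0)"
  proof (rule has_field_derivative_transform_within_open[OF _ I])
    fix t assume t: "t \<in> ?I"
    have "?c t \<in> model M"
      using chart_in_model[OF U] w subspace_model by (simp add: subspace_add subspace_scale)
    then have c: "?c t \<in> \<phi> ` U" using t r(2) by auto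
    then show "h (?c t) = f (inv_into U \<phi> (?c t))"
      using eq[of "inv_into U \<phi> (?c t)"] t by (simp add: f_inv_into_f inv_into_into)
  qed (use S r in auto)
  then show ?thesis unfolding chart_deriv_def by (rule DERIV_imp_deriv)
qed

lemma smooth_in_chartE:
  assumes "f \<in> Sm" "(U, \<phi>) \<in> atlas M" "q \<in> U"
  obtains S h where "open S" "\<phi> q \<in> S" "cinf_on S h" "\<And>q. q \<in> U \<Longrightarrow> \<phi> q \<in> S \<Longrightarrow> f q = h (\<phi> q)"
  using smooth_at_chartD[OF smooth_functionsD[OF assms(1)] assms(2,3)] chart_subset[OF assms(2)] assms(3)
  unfolding smooth_in_chart_def by blast

lemma smooth_at_chart_deriv:
  assumes f: "f \<in> Sm" and U: "(U, \<phi>) \<in> atlas M" "p \<in> U" and w: "w \<in> model M"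
  shows "smooth_at M p (\<lambda>q. chart_deriv U \<phi> w q f)"
proof -
  obtain S h where S: "open S" "\<phi> p \<in> S" "cinf_on S h" "\<And>q. q \<in> U \<Longrightarrow> \<phi> q \<in> S \<Longrightarrow> f q = h (\<phi> q)"
    using smooth_in_chartE[OF f U] by metis
  have "smooth_in_chart U \<phi> p (\<lambda>q. chart_deriv U \<phi> w q f)"
    unfolding smooth_in_chart_def
    by (intro exI[of _ S] exI[of _ "\<lambda>u. frechet_derivative h (at u) w"] conjI ballI impI S cinf_on_frechet)
      (rule chart_deriv_eq[OF U(1) _ w S(1) _ S(3,4)])
  with U show ?thesis by (rule smooth_atI)
qed

definition coord_vector :: "'a set \<Rightarrow> ('a \<Rightarrow> 'e) \<Rightarrow> 'e \<Rightarrow> 'a \<Rightarrow> 'a tvec" where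
  "coord_vector U \<phi> w q f = (if f \<in> Sm then chart_deriv U \<phi> w q f else 0)"

lemma coord_vector_tangent:
  assumes U: "(U, \<phi>) \<in> atlas M" "q \<in> U" and w: "w \<in> model M"
  shows "coord_vector U \<phi> w q \<in> TS q"
  unfolding tangent_space_def
proof (intro CollectI conjI ballI allI impI)
  fix f g k l assume fg: "f \<in> Sm" "g \<in> Sm"
  obtain S h where S: "open S" "\<phi> q \<in> S" "cinf_on S h" "\<And>q. q \<in> U \<Longrightarrow> \<phi> q \<in> S \<Longrightarrow> f q = h (\<phi> q)"
    using smooth_in_chartE[OF fg(1) U] by metis
  obtain S' h' where S': "open S'" "\<phi> q \<in> S'" "cinf_on S' h'" "\<And>q. q \<in> U \<Longrightarrow> \<phi> q \<in> S' \<Longrightarrow> g q = h' (\<phi> q)"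
    using smooth_in_chartE[OF fg(2) U] by metis
  let ?D = "\<lambda>h. frechet_derivative h (at (\<phi> q))"
  let ?S = "S \<inter> S'"
  have o: "open ?S" "\<phi> q \<in> ?S" "cinf_on ?S h" "cinf_on ?S h'"
    using S S' by (auto intro: cinf_on_subset[OF S(3)] cinf_on_subset[OF S'(3)])
  have h: "(h has_derivative ?D h) (at (\<phi> q))" "(h' has_derivative ?D h') (at (\<phi> q))"
    using cinf_on_has_derivative S S' by blast+
  note f = chart_deriv_eq[OF U w S(1-3), where f = f] and g = chart_deriv_eq[OF U w S'(1-3), where f = g]
  have "chart_deriv U \<phi> w q (\<lambda>q. k * f q + l * g q) = ?D (\<lambda>u. k * h u + l * h' u) w"
    by (rule chart_deriv_eq[OF U w o(1,2)])
      (use S(4) S'(4) in \<open>auto intro!: cinf_on_add cinf_on_mult cinf_on_const o\<close>)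
  also have "?D (\<lambda>u. k * h u + l * h' u) = (\<lambda>w. k * ?D h w + l * ?D h' w)"
    by (rule frechet_derivative_at[symmetric]) (intro has_derivative_add has_derivative_mult_right h)
  finally show "coord_vector U \<phi> w q (\<lambda>q. k * f q + l * g q) =
      k * coord_vector U \<phi> w q f + l * coord_vector U \<phi> w q g"
    using fg f g S(4) S'(4) by (simp add: coord_vector_def smooth_intros)
  have "chart_deriv U \<phi> w q (\<lambda>q. f q * g q) = ?D (\<lambda>u. h u * h' u) w"
    by (rule chart_deriv_eq[OF U w o(1,2)])
      (use S(4) S'(4) in \<open>auto intro!: cinf_on_mult o\<close>)
  also have "?D (\<lambda>u. h u * h' u) = (\<lambda>w. h (\<phi> q) * ?D h' w + ?D h w * h' (\<phi> q))"
    by (rule frechet_derivative_at[symmetric]) (intro has_derivative_mult h)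
  finally show "coord_vector U \<phi> w q (\<lambda>q. f q * g q) =
      f q * coord_vector U \<phi> w q g + g q * coord_vector U \<phi> w q f"
    using fg f g S(4)[OF U(2) S(2)] S'(4)[OF U(2) S'(2)] S(4) S'(4)
    by (simp add: coord_vector_def smooth_intros)
qed (simp add: coord_vector_def)

text \<open>With an orthonormal basis the coordinates of a chart are the inner products
  \<open>\<phi> q \<bullet> d\<close>, so no dual basis is needed.\<close>

definition model_basis :: "'e set" where
  "model_basis = (SOME D. D \<subseteq> model M \<and> pairwise orthogonal D \<and> (\<forall>d\<in>D. norm d = 1) \<and>
     independent D \<and> span D = model M)"

lemma model_basis: "model_basis \<subseteq> model M" "pairwise orthogonal model_basis"
  "\<And>d. d \<in> model_basis \<Longrightarrow> norm d = 1" "independent model_basis" "span model_basis = model M"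
proof -
  have "\<exists>D. D \<subseteq> model M \<and> pairwise orthogonal D \<and> (\<forall>d\<in>D. norm d = 1) \<and>
     independent D \<and> span D = model M"
    using orthonormal_basis_subspace[OF subspace_model] by metis
  from someI_ex[OF this] show "model_basis \<subseteq> model M" "pairwise orthogonal model_basis"
    "\<And>d. d \<in> model_basis \<Longrightarrow> norm d = 1" "independent model_basis" "span model_basis = model M"
    unfolding model_basis_def by blast+
qed

lemma finite_model_basis: "finite model_basis"
  using model_basis(4) by (rule independent_imp_finite)

lemma model_basis_expand: "w \<in> model M \<Longrightarrow> (\<Sum>d\<in>model_basis. (w \<bullet> d) *\<^sub>R d) = w"
  by (rule orthonormal_basis_expand) (use model_basis finite_model_basis in auto)

lemma model_basis_inner:
  "d \<in> model_basis \<Longrightarrow> d' \<in> model_basis \<Longrightarrow> d \<bullet> d' = (if d = d' then 1 else 0)"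
  using model_basis(2,3) by (auto simp: pairwise_def orthogonal_def norm_eq_1)

text \<open>By Hadamard's lemma \<open>f\<close> is near \<open>p\<close> a constant plus a sum of
  products of \<open>x d - x d p\<close> with smooth functions \<open>G d\<close>. The first factor
  vanishes at \<open>p\<close>, so the product rule leaves \<open>v (x d)\<close> times
  \<open>G d p\<close>, which is the partial derivative of \<open>f\<close>.\<close>

lemma tangent_coords:
  assumes U: "(U, \<phi>) \<in> atlas M" "p \<in> U" and x: "\<And>d. d \<in> model_basis \<Longrightarrow> x d \<in> Sm"
    and N: "openin T N" "p \<in> N" "\<And>q d. q \<in> N \<Longrightarrow> d \<in> model_basis \<Longrightarrow> x d q = \<phi> q \<bullet> d"
    and v: "v \<in> TS p" and f: "f \<in> Sm"
  shows "v f = (\<Sum>d\<in>model_basis. v (x d) * coord_vector U \<phi> d p f)"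
proof -
  obtain S h where S: "open S" "\<phi> p \<in> S" "cinf_on S h" "\<And>q. q \<in> U \<Longrightarrow> \<phi> q \<in> S \<Longrightarrow> f q = h (\<phi> q)"
    using smooth_in_chartE[OF f U] by metis
  obtain r where r: "r > 0" "ball (\<phi> p) r \<subseteq> S" using S(1,2) open_contains_ball by blast
  obtain H where H: "\<And>d. cinf_on (ball (\<phi> p) r) (H d)"
    "\<And>d. H d (\<phi> p) = frechet_derivative h (at (\<phi> p)) d"
    "\<And>u a. u \<in> ball (\<phi> p) r \<Longrightarrow> u - \<phi> p = (\<Sum>d\<in>model_basis. a d *\<^sub>R d) \<Longrightarrow>
       h u = h (\<phi> p) + (\<Sum>d\<in>model_basis. a d * H d u)"
    by (rule hadamard[OF cinf_on_subset[OF S(3) r(2)] r(1) finite_model_basis]) blast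
  have sH: "smooth_at M p (\<lambda>q. H d (\<phi> q))" for d
    by (rule smooth_atI[OF U], unfold smooth_in_chart_def, intro exI[of _ "ball (\<phi> p) r"] exI[of _ "H d"])
      (simp add: H(1) r(1))
  have "\<exists>G N. G \<in> Sm \<and> openin T N \<and> p \<in> N \<and> (\<forall>q\<in>N. G q = H d (\<phi> q))" for d
    by (rule smooth_at_globalize[OF sH[of d]]) blast
  then have "\<forall>d. \<exists>G N. G \<in> Sm \<and> openin T N \<and> p \<in> N \<and> (\<forall>q\<in>N. G q = H d (\<phi> q))" by blast
  then obtain G NN where GN:
    "\<forall>d. G d \<in> Sm \<and> openin T (NN d) \<and> p \<in> NN d \<and> (\<forall>q\<in>NN d. G d q = H d (\<phi> q))"
    unfolding choice_iff by blast
  then have G: "\<And>d. G d \<in> Sm" "\<And>d. openin T (NN d)" "\<And>d. p \<in> NN d"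
    "\<And>d q. q \<in> NN d \<Longrightarrow> G d q = H d (\<phi> q)"
    by blast+
  let ?B = "{q\<in>U. \<phi> q \<in> ball (\<phi> p) r}"
  \<comment> \<open>\<open>points M\<close> is included because for a manifold of dimension 0 the
    intersection over \<open>model_basis\<close> is the whole type, which need not be open in the
    manifold.\<close>
  let ?N = "?B \<inter> (N \<inter> (points M \<inter> (\<Inter>d\<in>model_basis. NN d)))"
  have "openin T (points M \<inter> (\<Inter>d\<in>model_basis. NN d))"
    by (rule openin_Int_Inter) (use finite_model_basis G(2) openin_T_points in blast)+
  then have oN: "openin T ?N"
    by (rule openin_Int[OF openin_T_chart_preimage[OF U(1) open_ball] openin_Int[OF N(1)]])
  have pN: "p \<in> ?N" using U G(3) N(2) r(1) chart_subset[OF U(1)] by auto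
  let ?F = "\<lambda>q. f p + (\<Sum>d\<in>model_basis. (x d q - x d p) * G d q)"
  have "f q = ?F q" if "q \<in> ?N" for q
  proof -
    have "\<phi> q - \<phi> p \<in> model M"
      using that U chart_in_model[OF U(1)] subspace_model by (auto intro: subspace_diff)
    from model_basis_expand[OF this]
    have "\<phi> q - \<phi> p = (\<Sum>d\<in>model_basis. ((\<phi> q - \<phi> p) \<bullet> d) *\<^sub>R d)" by simp
    from H(3)[OF _ this]
    have "h (\<phi> q) = h (\<phi> p) + (\<Sum>d\<in>model_basis. ((\<phi> q - \<phi> p) \<bullet> d) * H d (\<phi> q))" using that by auto
    moreover have "f q = h (\<phi> q)" "f p = h (\<phi> p)" using that S(2,4) r U by auto
    moreover have "x d q = \<phi> q \<bullet> d" "x d p = \<phi> p \<bullet> d" "G d q = H d (\<phi> q)" if d: "d \<in> model_basis" for d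
      using N(2,3) G(4) d \<open>q \<in> ?N\<close> by auto
    ultimately show ?thesis by (simp add: inner_diff_left cong: sum.cong)
  qed
  moreover have sm: "(\<lambda>q. (x d q - x d p) * G d q) \<in> Sm" if "d \<in> model_basis" for d
    by (intro smooth_intros x G that)
  ultimately have "v f = v ?F"
    by (intro tangent_local[OF v oN pN f]) (auto intro!: smooth_intros x G(1))
  also have "\<dots> = (\<Sum>d\<in>model_basis. v (\<lambda>q. (x d q - x d p) * G d q))"
    using sm by (simp add: tangent_add[OF v] tangent_const[OF v] tangent_sum[OF v] smooth_intros)
  also have "\<dots> = (\<Sum>d\<in>model_basis. v (x d) * coord_vector U \<phi> d p f)"
  proof (rule sum.cong)
    fix d assume d: "d \<in> model_basis"
    have "v (\<lambda>q. (x d q - x d p) * G d q) = G d p * v (\<lambda>q. x d q - x d p)"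
      using tangent_mult[OF v smooth_functions_diff[OF x[OF d] smooth_functions_const], of "G d" "x d p"] G(1)
      by simp
    also have "v (\<lambda>q. x d q - x d p) = v (x d)"
      by (simp add: tangent_diff[OF v] tangent_const[OF v] x[OF d] smooth_functions_const)
    also have "G d p = frechet_derivative h (at (\<phi> p)) d"
      using G(4)[OF G(3)] H(2) by simp
    also have "\<dots> = coord_vector U \<phi> d p f"
      unfolding coord_vector_def using chart_deriv_eq[OF U subsetD[OF model_basis(1) d] S] f by simp
    finally show "v (\<lambda>q. (x d q - x d p) * G d q) = v (x d) * coord_vector U \<phi> d p f" by simp
  qed simp
  finally show ?thesis .
qed

section \<open>Vector fields\<close>

lemma VF_tangent: "X \<in> VF \<Longrightarrow> p \<in> points M \<Longrightarrow> X p \<in> TS p"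
  and VF_smooth: "X \<in> VF \<Longrightarrow> f \<in> Sm \<Longrightarrow> vf_apply X f \<in> Sm"
  unfolding vector_fields_def by blast+

lemma VF_apply_smooth: "X \<in> VF \<Longrightarrow> f \<in> Sm \<Longrightarrow> (\<lambda>p. X p f) \<in> Sm"
  using VF_smooth by (simp add: vf_apply_def)

lemma VF_intro:
  assumes "\<And>p. p \<in> points M \<Longrightarrow> X p \<in> TS p"
    and "\<And>f p. f \<in> Sm \<Longrightarrow> p \<in> points M \<Longrightarrow> smooth_at M p (\<lambda>q. X q f)"
  shows "X \<in> VF"
  unfolding vector_fields_def vf_apply_def using assms by (auto intro: smooth_functions_intro)

lemma VF_add: "X \<in> VF \<Longrightarrow> Y \<in> VF \<Longrightarrow> (\<lambda>p f. X p f + Y p f) \<in> VF"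
  by (intro VF_intro tangent_plus smooth_at_add) (auto intro: VF_tangent smooth_functionsD VF_apply_smooth)

lemma VF_mult: "f \<in> Sm \<Longrightarrow> X \<in> VF \<Longrightarrow> (\<lambda>p h. f p * X p h) \<in> VF"
  by (intro VF_intro tangent_scale smooth_at_mult) (auto intro: VF_tangent smooth_functionsD VF_apply_smooth)

lemma VF_zero: "(\<lambda>p f. 0) \<in> VF"
  by (intro VF_intro tangent_zero smooth_at_const)

lemma VF_sum: "(\<And>i. i \<in> I \<Longrightarrow> X i \<in> VF) \<Longrightarrow> (\<lambda>p f. \<Sum>i\<in>I. X i p f) \<in> VF"
  by (induction I rule: infinite_finite_induct) (simp_all add: VF_zero VF_add)

text \<open>The mixed first-order terms of X(Y(fh)) are symmetric in X and Y, so they cancel in the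
  commutator and the product rule remains.\<close>

lemma VF_bracket:
  assumes X: "X \<in> VF" and Y: "Y \<in> VF"
  shows "lie_bracket X Y \<in> VF"
proof (rule VF_intro)
  fix p assume p: "p \<in> points M"
  \<comment> \<open>For non-smooth \<open>f\<close> the function \<open>vf_apply Y f\<close> is 0 on
    \<open>points M\<close> but arbitrary elsewhere, so it is compared with the constant 0 by
    \<open>tangent_cong\<close>.\<close>
  have nonsmooth: "X p (vf_apply Y f) = 0" if X: "X \<in> VF" and Y: "Y \<in> VF" and f: "f \<notin> Sm" for X Y f
    using tangent_cong[OF VF_tangent[OF X p] p, of "vf_apply Y f" "\<lambda>q. 0"]
      tangent_const[OF VF_tangent[OF X p], of 0] tangent_nonsmooth[OF VF_tangent[OF Y] f]
    by (simp add: vf_apply_def)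
  show "lie_bracket X Y p \<in> TS p"
    unfolding tangent_space_def
  proof (intro CollectI conjI ballI allI impI)
    fix f h k l assume fh: "f \<in> Sm" "h \<in> Sm"
    have 1: "X p (vf_apply Y (\<lambda>q. k * f q + l * h q)) = k * X p (vf_apply Y f) + l * X p (vf_apply Y h)"
      if X: "X \<in> VF" and Y: "Y \<in> VF" for X Y
    proof -
      have "X p (vf_apply Y (\<lambda>q. k * f q + l * h q)) = X p (\<lambda>q. k * vf_apply Y f q + l * vf_apply Y h q)"
        by (rule tangent_cong[OF VF_tangent[OF X p] p])
          (use fh in \<open>simp add: vf_apply_def tangent_add[OF VF_tangent[OF Y]] tangent_cmult[OF VF_tangent[OF Y]] smooth_intros\<close>)
      then show ?thesis
        using fh VF_smooth[OF Y]
        by (simp add: tangent_add[OF VF_tangent[OF X p]] tangent_cmult[OF VF_tangent[OF X p]] smooth_intros)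
    qed
    show "lie_bracket X Y p (\<lambda>q. k * f q + l * h q) = k * lie_bracket X Y p f + l * lie_bracket X Y p h"
      using 1[OF X Y] 1[OF Y X] by (simp add: lie_bracket_def vf_apply_apply[of _ _ p] algebra_simps)
    have 2: "X p (vf_apply Y (\<lambda>q. f q * h q)) =
        f p * X p (vf_apply Y h) + Y p h * X p f + h p * X p (vf_apply Y f) + Y p f * X p h"
      if X: "X \<in> VF" and Y: "Y \<in> VF" for X Y
    proof -
      have "X p (vf_apply Y (\<lambda>q. f q * h q)) = X p (\<lambda>q. f q * vf_apply Y h q + h q * vf_apply Y f q)"
        by (rule tangent_cong[OF VF_tangent[OF X p] p])
          (use fh in \<open>simp add: vf_apply_def tangent_mult[OF VF_tangent[OF Y]]\<close>)
      then show ?thesis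
        using fh VF_smooth[OF Y]
        by (simp add: tangent_add[OF VF_tangent[OF X p]] tangent_mult[OF VF_tangent[OF X p]] smooth_intros
            vf_apply_apply[of Y _ p])
    qed
    show "lie_bracket X Y p (\<lambda>q. f q * h q) = f p * lie_bracket X Y p h + h p * lie_bracket X Y p f"
      using 2[OF X Y] 2[OF Y X] by (simp add: lie_bracket_def vf_apply_apply[of _ _ p] algebra_simps)
  next
    fix f assume "f \<notin> Sm"
    then show "lie_bracket X Y p f = 0"
      using nonsmooth[OF X Y] nonsmooth[OF Y X] by (simp add: lie_bracket_def vf_apply_apply[of _ _ p])
  qed
  fix f assume "f \<in> Sm"
  then show "smooth_at M p (\<lambda>q. lie_bracket X Y q f)"
    unfolding lie_bracket_def
    by (intro smooth_at_diff smooth_functionsD[OF _ p] VF_smooth X Y)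
qed

text \<open>The fields and coordinates are global objects that behave as a coordinate frame only
  over \<open>N\<close>; in this way the rules for \<open>VF\<close> and \<open>Sm\<close> apply to
  them without relativisation to \<open>N\<close>.\<close>

definition local_frame :: "'a set \<Rightarrow> ('e \<Rightarrow> 'a vfield) \<Rightarrow> ('e \<Rightarrow> 'a \<Rightarrow> real) \<Rightarrow> bool" where
  "local_frame N E x \<longleftrightarrow> openin T N \<and> (\<forall>d\<in>model_basis. E d \<in> VF \<and> x d \<in> Sm) \<and>
     (\<forall>q\<in>N. \<forall>v\<in>TS q. \<forall>f. v f = (\<Sum>d\<in>model_basis. v (x d) * E d q f)) \<and>
     (\<forall>q\<in>N. \<forall>d\<in>model_basis. \<forall>d'\<in>model_basis. E d q (x d') = (if d = d' then 1 else 0))"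

lemma local_frame_open: "local_frame N E x \<Longrightarrow> openin T N"
  and local_frame_VF: "local_frame N E x \<Longrightarrow> d \<in> model_basis \<Longrightarrow> E d \<in> VF"
  and local_frame_coord_smooth: "local_frame N E x \<Longrightarrow> d \<in> model_basis \<Longrightarrow> x d \<in> Sm"
  and local_frame_expand: "local_frame N E x \<Longrightarrow> q \<in> N \<Longrightarrow> v \<in> TS q \<Longrightarrow>
    v f = (\<Sum>d\<in>model_basis. v (x d) * E d q f)"
  and local_frame_dual: "local_frame N E x \<Longrightarrow> q \<in> N \<Longrightarrow> d \<in> model_basis \<Longrightarrow> d' \<in> model_basis \<Longrightarrow>
    E d q (x d') = (if d = d' then 1 else 0)"
  unfolding local_frame_def by blast+

lemma chart_frame:
  assumes U: "(U, \<phi>) \<in> atlas M" "p \<in> U"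
  obtains N E x where "local_frame N E x" "p \<in> N" "N \<subseteq> U"
    "\<And>d q. d \<in> model_basis \<Longrightarrow> q \<in> N \<Longrightarrow> E d q = coord_vector U \<phi> d q"
    "\<And>d q. d \<in> model_basis \<Longrightarrow> q \<in> N \<Longrightarrow> x d q = \<phi> q \<bullet> d"
proof -
  obtain \<rho> K N where \<rho>: "\<rho> \<in> Sm" "closedin T K" "K \<subseteq> U" "\<And>q. q \<notin> K \<Longrightarrow> \<rho> q = 0"
    "openin T N" "p \<in> N" "N \<subseteq> U" "\<And>q. q \<in> N \<Longrightarrow> \<rho> q = 1"
    using bump_function[OF openin_T_chart[OF U(1)] U(2)] by metis
  define x where "x d q = (if q \<in> U then \<rho> q * (\<phi> q \<bullet> d) else 0)" for d q
  define E where "E d q f = (if q \<in> U then \<rho> q * coord_vector U \<phi> d q f else 0)" for d q f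
  have x: "x d \<in> Sm" for d
    unfolding x_def
    by (rule smooth_cutoff_extension[OF \<rho>(1-4) openin_T_chart[OF U(1)]])
      (assumption | rule smooth_atI[OF U(1) _ smooth_in_chart_linear[OF bounded_linear_inner_left]])+
  have E: "E d \<in> VF" if d: "d \<in> model_basis" for d
  proof (rule VF_intro)
    fix q assume q: "q \<in> points M"
    have "E d q = (\<lambda>f. \<rho> q * coord_vector U \<phi> d q f)" if "q \<in> U" using that by (auto simp: E_def)
    moreover have "E d q = (\<lambda>f. 0)" if "q \<notin> U" using that by (auto simp: E_def)
    ultimately show "E d q \<in> TS q"
      using coord_vector_tangent[OF U(1), of q d] d model_basis(1)
      by (cases "q \<in> U") (auto simp: tangent_zero tangent_scale)
    fix f assume f: "f \<in> Sm"
    have "(\<lambda>q. E d q f) \<in> Sm"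
      unfolding E_def
      by (rule smooth_cutoff_extension[OF \<rho>(1-4) openin_T_chart[OF U(1)]])
        (use smooth_at_chart_deriv[OF f U(1)] d model_basis(1) f in \<open>auto simp: coord_vector_def\<close>)
    then show "smooth_at M q (\<lambda>q. E d q f)" using q by (rule smooth_functionsD)
  qed
  have EN: "E d q = coord_vector U \<phi> d q" if "q \<in> N" for d q
    by (rule ext) (use that \<rho>(7,8) in \<open>auto simp: E_def\<close>)
  have xN: "x d q = \<phi> q \<bullet> d" if "q \<in> N" for d q
    using that \<rho>(7,8) by (auto simp: x_def)
  have exp: "v f = (\<Sum>d\<in>model_basis. v (x d) * E d q f)" if q: "q \<in> N" and v: "v \<in> TS q" for v q f
  proof (cases "f \<in> Sm")
    case True
    have "v f = (\<Sum>d\<in>model_basis. v (x d) * coord_vector U \<phi> d q f)"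
      by (rule tangent_coords[OF U(1) _ x \<rho>(5) q _ v True]) (use q \<rho>(7) xN in auto)
    then show ?thesis using EN[OF q] by simp
  next
    case False
    then show ?thesis using tangent_nonsmooth[OF v] EN[OF q] by (simp add: coord_vector_def)
  qed
  have dual: "E d q (x d') = (if d = d' then 1 else 0)"
    if d: "d \<in> model_basis" "d' \<in> model_basis" and q: "q \<in> N" for d d' q
  proof -
    have qU: "q \<in> U" using q \<rho>(7) by auto
    obtain r where r: "r > 0" "\<And>q'. q' \<in> U \<Longrightarrow> \<phi> q' \<in> ball (\<phi> q) r \<Longrightarrow> q' \<in> N"
      using openin_T_ball[OF U(1) \<rho>(5) q qU] by metis
    have dm: "d \<in> model M" using d model_basis(1) by auto
    have "chart_deriv U \<phi> d q (x d') = frechet_derivative (\<lambda>u. u \<bullet> d') (at (\<phi> q)) d"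
      by (rule chart_deriv_eq[OF U(1) qU dm open_ball[of "\<phi> q" r]])
        (use r xN in \<open>auto intro!: cinf_on_bounded_linear bounded_linear_inner_left\<close>)
    also have "frechet_derivative (\<lambda>u. u \<bullet> d') (at (\<phi> q)) = (\<lambda>u. u \<bullet> d')"
      by (rule frechet_derivative_at[symmetric])
        (rule bounded_linear_imp_has_derivative[OF bounded_linear_inner_left])
    finally show ?thesis
      using EN[OF q] x by (simp add: coord_vector_def model_basis_inner[OF d])
  qed
  have "local_frame N E x"
    unfolding local_frame_def using \<rho>(5) E x exp dual by simp
  from that[OF this \<rho>(6,7) EN xN] show ?thesis by blast
qed

lemma obtain_frame:
  assumes "p \<in> points M"
  obtains N E x where "local_frame N E x" "p \<in> N"
  using assms obtain_chart chart_frame by metis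

text \<open>The frame coefficients of \<open>v\<close> are kept constant. Covectors are prescribed
  through values of vector fields, and this guarantees that such values exhaust the tangent
  space.\<close>

lemma tangent_extension:
  assumes p: "p \<in> points M" and v: "v \<in> TS p"
  obtains Z where "Z \<in> VF" "Z p = v"
proof -
  obtain N E x where F: "local_frame N E x" and N: "p \<in> N" by (rule obtain_frame[OF p])
  show ?thesis
  proof
    show "(\<lambda>q f. \<Sum>d\<in>model_basis. v (x d) * E d q f) \<in> VF"
      by (intro VF_sum VF_mult smooth_functions_const local_frame_VF[OF F])
    show "(\<lambda>f. \<Sum>d\<in>model_basis. v (x d) * E d p f) = v"
      by (rule ext) (rule local_frame_expand[OF F N v, symmetric])
  qed
qed

section \<open>Tensorial 1-forms\<close>

text \<open>Linearity over the smooth functions, with smooth values. Insensitivity to values of the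
  fields off \<open>points M\<close> is a clause of its own, since it does not follow from
  linearity.\<close>

definition tensorial :: "'a oneform \<Rightarrow> bool" where
  "tensorial \<omega> \<longleftrightarrow>
     (\<forall>Z\<in>VF. \<forall>Z'\<in>VF. \<forall>p\<in>points M. \<omega> (\<lambda>p f. Z p f + Z' p f) p = \<omega> Z p + \<omega> Z' p) \<and>
     (\<forall>f\<in>Sm. \<forall>Z\<in>VF. \<forall>p\<in>points M. \<omega> (\<lambda>p h. f p * Z p h) p = f p * \<omega> Z p) \<and>
     (\<forall>Z\<in>VF. \<forall>Z'\<in>VF. (\<forall>p\<in>points M. Z p = Z' p) \<longrightarrow> (\<forall>p\<in>points M. \<omega> Z p = \<omega> Z' p)) \<and>
     (\<forall>Z\<in>VF. \<omega> Z \<in> Sm)"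

lemma tensorial_add: "tensorial \<omega> \<Longrightarrow> Z \<in> VF \<Longrightarrow> Z' \<in> VF \<Longrightarrow> p \<in> points M \<Longrightarrow>
    \<omega> (\<lambda>p f. Z p f + Z' p f) p = \<omega> Z p + \<omega> Z' p"
  and tensorial_mult: "tensorial \<omega> \<Longrightarrow> f \<in> Sm \<Longrightarrow> Z \<in> VF \<Longrightarrow> p \<in> points M \<Longrightarrow>
    \<omega> (\<lambda>p h. f p * Z p h) p = f p * \<omega> Z p"
  and tensorial_cong: "tensorial \<omega> \<Longrightarrow> Z \<in> VF \<Longrightarrow> Z' \<in> VF \<Longrightarrow> (\<And>p. p \<in> points M \<Longrightarrow> Z p = Z' p) \<Longrightarrow>
    p \<in> points M \<Longrightarrow> \<omega> Z p = \<omega> Z' p"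
  and tensorial_smooth: "tensorial \<omega> \<Longrightarrow> Z \<in> VF \<Longrightarrow> \<omega> Z \<in> Sm"
  unfolding tensorial_def by blast+

lemma tensorial_zero: "tensorial \<omega> \<Longrightarrow> p \<in> points M \<Longrightarrow> \<omega> (\<lambda>p f. 0) p = 0"
  using tensorial_mult[of \<omega> "\<lambda>q. 0" "\<lambda>p f. 0" p] by (simp add: VF_zero smooth_functions_const)

lemma tensorial_sum:
  assumes "tensorial \<omega>" "p \<in> points M"
  shows "(\<And>i. i \<in> I \<Longrightarrow> Z i \<in> VF) \<Longrightarrow> \<omega> (\<lambda>p f. \<Sum>i\<in>I. Z i p f) p = (\<Sum>i\<in>I. \<omega> (Z i) p)"
  by (induction I rule: infinite_finite_induct)
    (simp_all add: tensorial_zero[OF assms] tensorial_add[OF assms(1) _ _ assms(2)] VF_sum)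

text \<open>The expansion of \<open>Z\<close> holds on \<open>N\<close> only. After multiplication
  with a bump function both sides agree everywhere, and linearity over functions removes the bump
  again at \<open>p\<close>.\<close>

lemma tensorial_frame:
  assumes \<omega>: "tensorial \<omega>" and N: "openin T N" "p \<in> N" and E: "\<And>i. i \<in> I \<Longrightarrow> E i \<in> VF"
    and a: "\<And>i. i \<in> I \<Longrightarrow> a i \<in> Sm" and Z: "Z \<in> VF"
    and eq: "\<And>q f. q \<in> N \<Longrightarrow> Z q f = (\<Sum>i\<in>I. a i q * E i q f)"
  shows "\<omega> Z p = (\<Sum>i\<in>I. a i p * \<omega> (E i) p)"
proof -
  have p: "p \<in> points M" using N openin_T_subset by blast
  obtain \<rho> K N' where \<rho>: "\<rho> \<in> Sm" "K \<subseteq> N" "\<And>q. q \<notin> K \<Longrightarrow> \<rho> q = 0"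
    "p \<in> N'" "\<And>q. q \<in> N' \<Longrightarrow> \<rho> q = 1"
    using bump_function[OF N] by metis
  have VE: "(\<lambda>q f. a i q * E i q f) \<in> VF" if "i \<in> I" for i
    by (intro VF_mult a E that)
  have "\<omega> Z p = \<omega> (\<lambda>q f. \<rho> q * Z q f) p"
    using tensorial_mult[OF \<omega> \<rho>(1) Z p] \<rho>(4,5) by simp
  also have "(\<lambda>q f. \<rho> q * Z q f) = (\<lambda>q f. \<rho> q * (\<Sum>i\<in>I. a i q * E i q f))"
    using \<rho>(2,3) eq by (intro ext) (metis mult_zero_left subsetD)
  also have "\<omega> \<dots> p = \<omega> (\<lambda>q f. \<Sum>i\<in>I. a i q * E i q f) p"
    using tensorial_mult[OF \<omega> \<rho>(1) VF_sum[of I, OF VE] p] \<rho>(4,5) by simp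
  also have "\<dots> = (\<Sum>i\<in>I. \<omega> (\<lambda>q f. a i q * E i q f) p)"
    by (rule tensorial_sum[OF \<omega> p VE])
  also have "\<dots> = (\<Sum>i\<in>I. a i p * \<omega> (E i) p)"
    by (rule sum.cong) (simp_all add: tensorial_mult[OF \<omega> a E p])
  finally show ?thesis .
qed

text \<open>Both fields expand in the same frame with the same coefficients at
  \<open>p\<close>.\<close>

lemma tensorial_pointwise:
  assumes \<omega>: "tensorial \<omega>" and Z: "Z \<in> VF" "Z' \<in> VF" and p: "p \<in> points M" and eq: "Z p = Z' p"
  shows "\<omega> Z p = \<omega> Z' p"
proof -
  obtain N E x where F: "local_frame N E x" and N: "p \<in> N" by (rule obtain_frame[OF p])
  have "\<omega> Z p = (\<Sum>d\<in>model_basis. Z p (x d) * \<omega> (E d) p)" if Z: "Z \<in> VF" for Z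
  proof (rule tensorial_frame[OF \<omega> local_frame_open[OF F] N local_frame_VF[OF F] _ Z])
    show "(\<lambda>q. Z q (x d)) \<in> Sm" if "d \<in> model_basis" for d
      by (rule VF_apply_smooth[OF Z local_frame_coord_smooth[OF F that]])
    show "Z q f = (\<Sum>d\<in>model_basis. Z q (x d) * E d q f)" if "q \<in> N" for q f
      using local_frame_expand[OF F that VF_tangent[OF Z]] openin_T_subset[OF local_frame_open[OF F]] that
      by blast
  qed
  from this[OF Z(1)] this[OF Z(2)] eq show ?thesis by simp
qed

end

section \<open>Metrics and the Koszul form\<close>

lemma metric_apply_apply: "metric_apply g X Y p = g p (X p) (Y p)"
  by (simp add: metric_apply_def)

locale metric_mfd = mfd M for M :: "('a, 'e::euclidean_space) manifold" +
  fixes g :: "'a metric"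
  assumes g_sym: "\<And>p u v. p \<in> points M \<Longrightarrow> u \<in> TS p \<Longrightarrow> v \<in> TS p \<Longrightarrow> g p u v = g p v u"
    and g_lincomb: "\<And>p u v w a c. p \<in> points M \<Longrightarrow> u \<in> TS p \<Longrightarrow> v \<in> TS p \<Longrightarrow> w \<in> TS p \<Longrightarrow>
        g p (\<lambda>f. a * u f + c * v f) w = a * g p u w + c * g p v w"
    and g_smooth: "\<And>X Y. X \<in> VF \<Longrightarrow> Y \<in> VF \<Longrightarrow> metric_apply g X Y \<in> Sm"

lemma singular_semi_riemannian_metric_mfd:
  "singular_semi_riemannian M g \<Longrightarrow> metric_mfd M g"
  unfolding singular_semi_riemannian_def metric_mfd_def metric_mfd_axioms_def
  using smooth_manifold_mfd[of M] by blast

context metric_mfd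
begin

lemma g_add_left: "p \<in> points M \<Longrightarrow> u \<in> TS p \<Longrightarrow> v \<in> TS p \<Longrightarrow> w \<in> TS p \<Longrightarrow>
    g p (\<lambda>f. u f + v f) w = g p u w + g p v w"
  using g_lincomb[of p u v w 1 1] by simp

lemma g_scale_left: "p \<in> points M \<Longrightarrow> u \<in> TS p \<Longrightarrow> w \<in> TS p \<Longrightarrow> g p (\<lambda>f. a * u f) w = a * g p u w"
  using g_lincomb[of p u u w a 0] by simp

lemma g_zero_left: "p \<in> points M \<Longrightarrow> w \<in> TS p \<Longrightarrow> g p (\<lambda>f. 0) w = 0"
  using g_scale_left[of p "\<lambda>f. 0" w 0] by (simp add: tangent_zero)

lemma g_sum_left:
  assumes "p \<in> points M" "w \<in> TS p"
  shows "(\<And>i. i \<in> I \<Longrightarrow> u i \<in> TS p) \<Longrightarrow> g p (\<lambda>f. \<Sum>i\<in>I. u i f) w = (\<Sum>i\<in>I. g p (u i) w)"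
  by (induction I rule: infinite_finite_induct)
    (simp_all add: g_zero_left assms g_add_left tangent_sum_vec)

lemma g_add_right: "p \<in> points M \<Longrightarrow> u \<in> TS p \<Longrightarrow> v \<in> TS p \<Longrightarrow> w \<in> TS p \<Longrightarrow>
    g p w (\<lambda>f. u f + v f) = g p w u + g p w v"
  using g_add_left[of p u v w] g_sym[of p w] by (simp add: tangent_plus)

lemma g_scale_right: "p \<in> points M \<Longrightarrow> u \<in> TS p \<Longrightarrow> w \<in> TS p \<Longrightarrow> g p w (\<lambda>f. a * u f) = a * g p w u"
  using g_scale_left[of p u w a] g_sym[of p w] by (simp add: tangent_scale)

lemma g_zero_right: "p \<in> points M \<Longrightarrow> w \<in> TS p \<Longrightarrow> g p w (\<lambda>f. 0) = 0"
  using g_scale_right[of p "\<lambda>f. 0" w 0] by (simp add: tangent_zero)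

lemma g_minus_right: "p \<in> points M \<Longrightarrow> u \<in> TS p \<Longrightarrow> w \<in> TS p \<Longrightarrow> g p w (\<lambda>f. - u f) = - g p w u"
  using g_scale_right[of p u w "-1"] by simp

lemma g_sum_right:
  assumes "p \<in> points M" "w \<in> TS p"
  shows "(\<And>i. i \<in> I \<Longrightarrow> u i \<in> TS p) \<Longrightarrow> g p w (\<lambda>f. \<Sum>i\<in>I. u i f) = (\<Sum>i\<in>I. g p w (u i))"
  by (induction I rule: infinite_finite_induct)
    (simp_all add: g_zero_right assms g_add_right tangent_sum_vec)

lemma metric_apply_sym: "X \<in> VF \<Longrightarrow> Y \<in> VF \<Longrightarrow> p \<in> points M \<Longrightarrow>
    metric_apply g X Y p = metric_apply g Y X p"
  by (simp add: metric_apply_apply g_sym VF_tangent)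

lemma vf_apply_cong:
  assumes X: "X \<in> VF" and p: "p \<in> points M" and "\<And>q. q \<in> points M \<Longrightarrow> f q = h q"
  shows "vf_apply X f p = vf_apply X h p"
  using tangent_cong[OF VF_tangent[OF X p] p assms(3)] by (simp add: vf_apply_def)

lemma vf_apply_cong2:
  assumes X: "X \<in> VF" and p: "p \<in> points M" and eq: "\<And>q. q \<in> points M \<Longrightarrow> X q = X' q"
    and "\<And>q. q \<in> points M \<Longrightarrow> f q = h q"
  shows "vf_apply X f p = vf_apply X' h p"
  using vf_apply_cong[OF X p assms(4)] eq[OF p] by (simp add: vf_apply_def)

lemma lie_bracket_cong:
  assumes X: "X \<in> VF" "X' \<in> VF" and Y: "Y \<in> VF" "Y' \<in> VF" and p: "p \<in> points M"
    and eq: "\<And>q. q \<in> points M \<Longrightarrow> X q = X' q" "\<And>q. q \<in> points M \<Longrightarrow> Y q = Y' q"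
  shows "lie_bracket X Y p = lie_bracket X' Y' p"
proof
  fix f
  have "vf_apply X (vf_apply Y f) p = vf_apply X' (vf_apply Y' f) p"
    by (rule vf_apply_cong2[OF X(1) p eq(1)]) (simp_all add: vf_apply_def eq)
  moreover have "vf_apply Y (vf_apply X f) p = vf_apply Y' (vf_apply X' f) p"
    by (rule vf_apply_cong2[OF Y(1) p eq(2)]) (simp_all add: vf_apply_def eq)
  ultimately show "lie_bracket X Y p f = lie_bracket X' Y' p f" by (simp add: lie_bracket_def)
qed

lemma lie_bracket_antisym: "lie_bracket X Y p = (\<lambda>f. - lie_bracket Y X p f)"
  by (simp add: lie_bracket_def)

lemma koszul_cong:
  assumes VF: "X \<in> VF" "X' \<in> VF" "Y \<in> VF" "Y' \<in> VF" "Z \<in> VF" "Z' \<in> VF" and p: "p \<in> points M"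
    and eq: "\<And>q. q \<in> points M \<Longrightarrow> X q = X' q" "\<And>q. q \<in> points M \<Longrightarrow> Y q = Y' q"
      "\<And>q. q \<in> points M \<Longrightarrow> Z q = Z' q"
  shows "koszul g X Y Z p = koszul g X' Y' Z' p"
proof -
  note vf_apply_cong2[OF VF(1) p eq(1), of "metric_apply g Y Z" "metric_apply g Y' Z'"]
    vf_apply_cong2[OF VF(3) p eq(2), of "metric_apply g Z X" "metric_apply g Z' X'"]
    vf_apply_cong2[OF VF(5) p eq(3), of "metric_apply g X Y" "metric_apply g X' Y'"]
  moreover note lie_bracket_cong[OF VF(3-6) p eq(2,3)] lie_bracket_cong[OF VF(5,6,1,2) p eq(3,1)]
    lie_bracket_cong[OF VF(1-4) p eq(1,2)]
  ultimately show ?thesis by (simp add: koszul_def metric_apply_apply eq p)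
qed

lemma koszul_smooth: "X \<in> VF \<Longrightarrow> Y \<in> VF \<Longrightarrow> Z \<in> VF \<Longrightarrow> koszul g X Y Z \<in> Sm"
  unfolding koszul_def by (intro smooth_intros VF_smooth g_smooth VF_bracket)

text \<open>The remaining terms cancel in pairs by symmetry of \<open>g\<close> and antisymmetry of
  the bracket. No connection enters, so this metric compatibility survives degeneracy;
  \<open>koszul_torsion\<close> is its companion for the torsion.\<close>

lemma koszul_compat:
  assumes VF: "X \<in> VF" "Y \<in> VF" "Z \<in> VF" and p: "p \<in> points M"
  shows "koszul g X Y Z p + koszul g X Z Y p = vf_apply X (metric_apply g Y Z) p"
proof -
  have a: "metric_apply g A (lie_bracket C D) p = - metric_apply g A (lie_bracket D C) p"
    if "A \<in> VF" "C \<in> VF" "D \<in> VF" for A C D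
    using lie_bracket_antisym[of C D p] g_minus_right[OF p VF_tangent[OF VF_bracket] VF_tangent] that p
    by (simp add: metric_apply_apply)
  have s: "vf_apply A (metric_apply g C D) p = vf_apply A (metric_apply g D C) p"
    if "A \<in> VF" "C \<in> VF" "D \<in> VF" for A C D
    by (rule vf_apply_cong[OF that(1) p]) (simp add: metric_apply_sym that)
  show ?thesis
    unfolding koszul_def
    using s[of X Z Y] s[of Y Z X] s[of Z X Y] a[of X Z Y] a[of Z Y X] a[of Y X Z] VF by (simp add: field_simps)
qed

lemma koszul_torsion:
  assumes VF: "X \<in> VF" "Y \<in> VF" "Z \<in> VF" and p: "p \<in> points M"
  shows "koszul g X Y Z p - koszul g Y X Z p = metric_apply g (lie_bracket X Y) Z p"
proof -
  have a: "metric_apply g A (lie_bracket C D) p = - metric_apply g A (lie_bracket D C) p"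
    if "A \<in> VF" "C \<in> VF" "D \<in> VF" for A C D
    using lie_bracket_antisym[of C D p] g_minus_right[OF p VF_tangent[OF VF_bracket] VF_tangent] that p
    by (simp add: metric_apply_apply)
  have s: "vf_apply A (metric_apply g C D) p = vf_apply A (metric_apply g D C) p"
    if "A \<in> VF" "C \<in> VF" "D \<in> VF" for A C D
    by (rule vf_apply_cong[OF that(1) p]) (simp add: metric_apply_sym that)
  show ?thesis
    unfolding koszul_def metric_apply_sym[OF VF_bracket[OF VF(1,2)] VF(3) p]
    using s[of X Z Y] s[of Y Z X] s[of Z X Y] a[of X Z Y] a[of Z Y X] a[of Y X Z] VF by (simp add: field_simps)
qed

lemma lie_bracket_mult_right:
  assumes Y: "Y \<in> VF" and Z: "Z \<in> VF" and f: "f \<in> Sm" and p: "p \<in> points M"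
  shows "lie_bracket Y (\<lambda>q h. f q * Z q h) p = (\<lambda>h. f p * lie_bracket Y Z p h + Y p f * Z p h)"
proof
  fix h
  show "lie_bracket Y (\<lambda>q h. f q * Z q h) p h = f p * lie_bracket Y Z p h + Y p f * Z p h"
  proof (cases "h \<in> Sm")
    case True
    have "vf_apply Y (vf_apply (\<lambda>q h. f q * Z q h) h) p = Y p (\<lambda>q. f q * vf_apply Z h q)"
      by (simp add: vf_apply_def)
    also have "\<dots> = f p * Y p (vf_apply Z h) + Z p h * Y p f"
      using tangent_mult[OF VF_tangent[OF Y p] f VF_smooth[OF Z True]] by (simp add: vf_apply_apply)
    finally show ?thesis by (simp add: lie_bracket_def vf_apply_apply algebra_simps)
  next
    case False
    then show ?thesis
      using tangent_nonsmooth[OF VF_tangent[OF VF_bracket[OF Y VF_mult[OF f Z]] p] False]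
        tangent_nonsmooth[OF VF_tangent[OF VF_bracket[OF Y Z] p] False]
        tangent_nonsmooth[OF VF_tangent[OF Z p] False] by simp
  qed
qed

lemma lie_bracket_add_right:
  assumes X: "X \<in> VF" and Z: "Z \<in> VF" "Z' \<in> VF" and p: "p \<in> points M"
  shows "lie_bracket X (\<lambda>q h. Z q h + Z' q h) p = (\<lambda>h. lie_bracket X Z p h + lie_bracket X Z' p h)"
proof
  fix h
  show "lie_bracket X (\<lambda>q h. Z q h + Z' q h) p h = lie_bracket X Z p h + lie_bracket X Z' p h"
  proof (cases "h \<in> Sm")
    case True
    have "vf_apply X (vf_apply (\<lambda>q h. Z q h + Z' q h) h) p = X p (\<lambda>q. vf_apply Z h q + vf_apply Z' h q)"
      by (simp add: vf_apply_def)
    also have "\<dots> = X p (vf_apply Z h) + X p (vf_apply Z' h)"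
      using tangent_add[OF VF_tangent[OF X p] VF_smooth[OF Z(1) True] VF_smooth[OF Z(2) True]] .
    finally show ?thesis by (simp add: lie_bracket_def vf_apply_apply algebra_simps)
  next
    case False
    then show ?thesis
      using tangent_nonsmooth[OF VF_tangent[OF VF_bracket[OF X VF_add[OF Z]] p] False]
        tangent_nonsmooth[OF VF_tangent[OF VF_bracket[OF X Z(1)] p] False]
        tangent_nonsmooth[OF VF_tangent[OF VF_bracket[OF X Z(2)] p] False] by simp
  qed
qed

lemma metric_apply_tensorial:
  assumes X: "X \<in> VF"
  shows "tensorial (metric_apply g X)"
  unfolding tensorial_def
  by (auto simp: metric_apply_apply g_add_right g_scale_right VF_tangent X g_smooth)

text \<open>Replacing Z by fZ produces derivatives of f in four terms: those of X(g(Y,fZ)) and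
  g(Y,[fZ,X]) cancel, and so do those of Y(g(fZ,X)) and -g(X,[Y,fZ]).\<close>

lemma koszul_tensorial:
  assumes X: "X \<in> VF" and Y: "Y \<in> VF"
  shows "tensorial (koszul g X Y)"
  unfolding tensorial_def
proof (intro conjI ballI impI)
  fix Z Z' p assume Z: "Z \<in> VF" "Z' \<in> VF" and p: "p \<in> points M"
  let ?Z = "\<lambda>p f. Z p f + Z' p f"
  have Zp: "?Z \<in> VF" by (rule VF_add[OF Z])
  have m: "metric_apply g A ?Z q = metric_apply g A Z q + metric_apply g A Z' q"
    if "A \<in> VF" "q \<in> points M" for A q
    using that Z by (simp add: metric_apply_apply g_add_right VF_tangent)
  have v: "vf_apply C (metric_apply g A ?Z) p = vf_apply C (metric_apply g A Z) p + vf_apply C (metric_apply g A Z') p"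
    "vf_apply C (metric_apply g ?Z A) p = vf_apply C (metric_apply g Z A) p + vf_apply C (metric_apply g Z' A) p"
    if A: "A \<in> VF" and C: "C \<in> VF" for A C
  proof -
    have "vf_apply C (metric_apply g A ?Z) p = vf_apply C (\<lambda>q. metric_apply g A Z q + metric_apply g A Z' q) p"
      by (rule vf_apply_cong[OF C p m[OF A]])
    then show 1: "vf_apply C (metric_apply g A ?Z) p = vf_apply C (metric_apply g A Z) p + vf_apply C (metric_apply g A Z') p"
      by (simp add: vf_apply_apply tangent_add[OF VF_tangent[OF C p]] g_smooth A Z)
    have "vf_apply C (metric_apply g D A) p = vf_apply C (metric_apply g A D) p" if "D \<in> VF" for D
      by (rule vf_apply_cong[OF C p metric_apply_sym[OF that A]])
    with 1 show "vf_apply C (metric_apply g ?Z A) p = vf_apply C (metric_apply g Z A) p + vf_apply C (metric_apply g Z' A) p"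
      using Z Zp by simp
  qed
  have b: "metric_apply g A (lie_bracket C ?Z) p = metric_apply g A (lie_bracket C Z) p + metric_apply g A (lie_bracket C Z') p"
    "metric_apply g A (lie_bracket ?Z C) p = metric_apply g A (lie_bracket Z C) p + metric_apply g A (lie_bracket Z' C) p"
    if A: "A \<in> VF" and C: "C \<in> VF" for A C
  proof -
    show 1: "metric_apply g A (lie_bracket C ?Z) p = metric_apply g A (lie_bracket C Z) p + metric_apply g A (lie_bracket C Z') p"
      using p by (simp add: metric_apply_apply lie_bracket_add_right[OF C Z p] g_add_right VF_tangent VF_bracket A C Z)
    have "metric_apply g A (lie_bracket D C) p = - metric_apply g A (lie_bracket C D) p" if "D \<in> VF" for D
      using p by (simp add: metric_apply_apply lie_bracket_antisym[of D C p] g_minus_right VF_tangent VF_bracket A C that)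
    with 1 show "metric_apply g A (lie_bracket ?Z C) p = metric_apply g A (lie_bracket Z C) p + metric_apply g A (lie_bracket Z' C) p"
      using Z Zp by simp
  qed
  have c: "metric_apply g ?Z A p = metric_apply g Z A p + metric_apply g Z' A p" if "A \<in> VF" for A
    using m[OF that p] metric_apply_sym[OF that _ p] Z Zp by simp
  have z: "vf_apply ?Z (metric_apply g X Y) p = vf_apply Z (metric_apply g X Y) p + vf_apply Z' (metric_apply g X Y) p"
    by (simp add: vf_apply_def)
  show "koszul g X Y ?Z p = koszul g X Y Z p + koszul g X Y Z' p"
    unfolding koszul_def v(1)[OF Y X] v(2)[OF X Y] b(1)[OF X Y] b(2)[OF Y X] c[OF VF_bracket[OF X Y]] z
    by (simp add: field_simps)
next
  fix f Z p assume f: "f \<in> Sm" and Z: "Z \<in> VF" and p: "p \<in> points M"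
  let ?Z = "\<lambda>p h. f p * Z p h"
  have Zp: "?Z \<in> VF" by (rule VF_mult[OF f Z])
  have m: "metric_apply g A ?Z q = f q * metric_apply g A Z q" if "A \<in> VF" "q \<in> points M" for A q
    using that Z by (simp add: metric_apply_apply g_scale_right VF_tangent)
  have v: "vf_apply C (metric_apply g A ?Z) p = f p * vf_apply C (metric_apply g A Z) p + metric_apply g A Z p * C p f"
    "vf_apply C (metric_apply g ?Z A) p = f p * vf_apply C (metric_apply g Z A) p + metric_apply g A Z p * C p f"
    if A: "A \<in> VF" and C: "C \<in> VF" for A C
  proof -
    have "vf_apply C (metric_apply g A ?Z) p = vf_apply C (\<lambda>q. f q * metric_apply g A Z q) p"
      by (rule vf_apply_cong[OF C p m[OF A]])
    then show 1: "vf_apply C (metric_apply g A ?Z) p = f p * vf_apply C (metric_apply g A Z) p + metric_apply g A Z p * C p f"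
      by (simp add: vf_apply_apply tangent_mult[OF VF_tangent[OF C p]] g_smooth A Z f)
    have "vf_apply C (metric_apply g D A) p = vf_apply C (metric_apply g A D) p" if "D \<in> VF" for D
      by (rule vf_apply_cong[OF C p metric_apply_sym[OF that A]])
    with 1 show "vf_apply C (metric_apply g ?Z A) p = f p * vf_apply C (metric_apply g Z A) p + metric_apply g A Z p * C p f"
      using Z Zp by simp
  qed
  have b: "metric_apply g A (lie_bracket C ?Z) p = f p * metric_apply g A (lie_bracket C Z) p + C p f * metric_apply g A Z p"
    "metric_apply g A (lie_bracket ?Z C) p = f p * metric_apply g A (lie_bracket Z C) p - C p f * metric_apply g A Z p"
    if A: "A \<in> VF" and C: "C \<in> VF" for A C
  proof -
    show 1: "metric_apply g A (lie_bracket C ?Z) p = f p * metric_apply g A (lie_bracket C Z) p + C p f * metric_apply g A Z p"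
      using p by (simp add: metric_apply_apply lie_bracket_mult_right[OF C Z f p] g_add_right g_scale_right
          tangent_scale VF_tangent VF_bracket A C Z)
    have "metric_apply g A (lie_bracket D C) p = - metric_apply g A (lie_bracket C D) p" if "D \<in> VF" for D
      using p by (simp add: metric_apply_apply lie_bracket_antisym[of D C p] g_minus_right VF_tangent VF_bracket A C that)
    with 1 show "metric_apply g A (lie_bracket ?Z C) p = f p * metric_apply g A (lie_bracket Z C) p - C p f * metric_apply g A Z p"
      using Z Zp by simp
  qed
  have c: "metric_apply g ?Z A p = f p * metric_apply g Z A p" if "A \<in> VF" for A
    using m[OF that p] metric_apply_sym[OF that _ p] Z Zp by simp
  show "koszul g X Y ?Z p = f p * koszul g X Y Z p"
    using v[OF Y X] v[OF X Y] b[OF X Y] b[OF Y X] c[OF VF_bracket[OF X Y]]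
    unfolding koszul_def by (simp add: vf_apply_apply[of ?Z] vf_apply_apply[of Z] field_simps)
next
  fix Z Z' p assume "Z \<in> VF" "Z' \<in> VF" "\<forall>p\<in>points M. Z p = Z' p" "p \<in> points M"
  then show "koszul g X Y Z p = koszul g X Y Z' p"
    using X Y by (intro koszul_cong) auto
qed (rule koszul_smooth[OF X Y])

lemma ssm_koszul_tensorial:
  assumes X: "X \<in> VF" and Y: "Y \<in> VF" and P: "P \<in> VF"
  shows "tensorial (ssm_koszul g P X Y)"
proof -
  note K = koszul_tensorial[OF X Y] and X' = metric_apply_tensorial[OF X] and P' = metric_apply_tensorial[OF P]
  show ?thesis
    unfolding tensorial_def ssm_koszul_def
  proof (intro conjI ballI impI)
    fix Z assume "Z \<in> VF"
    then show "(\<lambda>p. koszul g X Y Z p + metric_apply g Y P p * metric_apply g X Z p -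
            metric_apply g X Y p * metric_apply g P Z p) \<in> Sm"
      by (intro smooth_intros koszul_smooth g_smooth X Y P)
  next
    fix Z Z' p assume Z: "Z \<in> VF" "Z' \<in> VF" "\<forall>p\<in>points M. Z p = Z' p" "p \<in> points M"
    then show "koszul g X Y Z p + metric_apply g Y P p * metric_apply g X Z p -
          metric_apply g X Y p * metric_apply g P Z p =
          koszul g X Y Z' p + metric_apply g Y P p * metric_apply g X Z' p -
          metric_apply g X Y p * metric_apply g P Z' p"
      using tensorial_cong[OF K Z(1,2)] by (simp add: metric_apply_apply)
  qed (simp_all add: tensorial_add[OF K] tensorial_add[OF X'] tensorial_add[OF P']
      tensorial_mult[OF K] tensorial_mult[OF X'] tensorial_mult[OF P'] algebra_simps)
qed

end

section \<open>Contraction and rank\<close>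

text \<open>\<open>metric_rank\<close> is a dimension in a space of functions. An injective linear
  map takes a basis to a basis, which moves the rank into a Euclidean space where dimension theory
  is available.\<close>

lemma (in vector_space_pair) dim_injective_image:
  assumes f: "Vector_Spaces.linear s1 s2 f" and inj: "inj_on f (vs1.span S)"
  shows "vs2.dim (f ` S) = vs1.dim S"
proof -
  obtain B where B: "B \<subseteq> S" "vs1.independent B" "S \<subseteq> vs1.span B" "card B = vs1.dim S"
    by (rule vs1.basis_exists)
  have "vs1.span B = vs1.span S"
    using B(1,3) by (simp add: vs1.span_eq vs1.span_base subset_eq)
  then have "vs2.span (f ` B) = vs2.span (f ` S)"
    by (simp add: linear_span_image[OF f])
  moreover have "vs2.independent (f ` B)"
    using \<open>vs1.span B = vs1.span S\<close> linear_independent_injective_image[OF f B(2)] inj by simp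
  ultimately have "vs2.dim (f ` S) = card (f ` B)" by (rule vs2.dim_eq_card)
  also have "\<dots> = card B"
    using inj_on_subset[OF inj] B(1) vs1.span_superset by (blast intro: card_image)
  finally show ?thesis using B(4) by simp
qed

section \<open>Smooth dependence of solutions of linear systems\<close>

lemma sum_elimination_step:
  fixes a c k :: "'b \<Rightarrow> real"
  shows "(\<Sum>j\<in>J. (a j - b * (c j / d)) * k j) = (\<Sum>j\<in>J. a j * k j) - b / d * (\<Sum>j\<in>J. c j * k j)"
proof -
  have "(a j - b * (c j / d)) * k j = a j * k j - b / d * (c j * k j)" for j
    by (simp add: algebra_simps)
  then show ?thesis by (simp only: sum_subtractf sum_distrib_left)
qed

context mfd
begin

lemma smooth_preimage_open:
  assumes f: "f \<in> Sm" and S: "open S"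
  shows "openin T {q\<in>points M. f q \<in> S}"
proof (subst openin_subopen, intro ballI)
  fix p assume p: "p \<in> {q\<in>points M. f q \<in> S}"
  then obtain U \<phi> where U: "(U, \<phi>) \<in> atlas M" "p \<in> U" using obtain_chart by blast
  obtain R h where R: "open R" "\<phi> p \<in> R" "cinf_on R h" "\<And>q. q \<in> U \<Longrightarrow> \<phi> q \<in> R \<Longrightarrow> f q = h (\<phi> q)"
    using smooth_in_chartE[OF f U] by metis
  have "open (R \<inter> h -` S)"
    by (rule continuous_open_preimage[OF cinf_on_continuous[OF R(3)] R(1) S])
  from openin_T_chart_preimage[OF U(1) this]
  show "\<exists>N. openin T N \<and> p \<in> N \<and> N \<subseteq> {q\<in>points M. f q \<in> S}"
    by (rule exI[of _ "{q\<in>U. \<phi> q \<in> R \<inter> h -` S}", OF conjI])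
      (use p U R chart_subset[OF U(1)] in auto)
qed

text \<open>Gaussian elimination, by induction on the unknowns. A possibly overdetermined system
  with trivial kernel at \<open>p\<close> has a pivot that is nonzero near \<open>p\<close>;
  dividing by it and substituting expresses each unknown by smooth functions, however the solutions
  were chosen pointwise.\<close>

lemma smooth_linear_solution:
  assumes J: "finite J" and N: "openin T N" "p \<in> N"
    and A: "\<And>i j. i \<in> I \<Longrightarrow> j \<in> J \<Longrightarrow> smooth_at M p (A i j)"
    and w: "\<And>i. i \<in> I \<Longrightarrow> smooth_at M p (w i)"
    and eq: "\<And>q i. q \<in> N \<Longrightarrow> i \<in> I \<Longrightarrow> (\<Sum>j\<in>J. A i j q * c j q) = w i q"
    and ind: "\<And>k. (\<And>i. i \<in> I \<Longrightarrow> (\<Sum>j\<in>J. A i j p * k j) = 0) \<Longrightarrow> \<forall>j\<in>J. k j = 0"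
    and j: "j \<in> J"
  shows "smooth_at M p (c j)"
  using J N A w eq ind j
proof (induction J arbitrary: A w N j rule: finite_induct)
  case (insert j0 J A w N)
  have p: "p \<in> points M" using insert.prems(1,2) openin_T_subset by blast
  \<comment> \<open>If the column of \<open>j0\<close> vanished at \<open>p\<close>, the unit vector
    at \<open>j0\<close> would lie in the kernel.\<close>
  have "\<exists>i0\<in>I. A i0 j0 p \<noteq> 0"
  proof (rule ccontr)
    assume "\<not> ?thesis"
    then have "(\<Sum>j\<in>insert j0 J. A i j p * (if j = j0 then 1 else 0)) = 0" if "i \<in> I" for i
      using that insert.hyps by (auto intro!: sum.neutral)
    from insert.prems(6)[OF this] show False by simp
  qed
  then obtain i0 where i0: "i0 \<in> I" "A i0 j0 p \<noteq> 0" by blast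
  have sA0: "smooth_at M p (A i0 j0)" using insert.prems(3) i0 by blast
  obtain h N0 where h: "h \<in> Sm" "openin T N0" "p \<in> N0" "\<And>q. q \<in> N0 \<Longrightarrow> h q = A i0 j0 q"
    using smooth_at_globalize[OF sA0] by metis
  let ?N = "N \<inter> (N0 \<inter> {q\<in>points M. h q \<in> - {0}})"
  have N: "openin T ?N"
    using insert.prems(1) h(2) smooth_preimage_open[OF h(1), of "- {0}"] by (intro openin_Int) auto
  have pN: "p \<in> ?N" using insert.prems(2) h i0 p by auto
  have nz: "A i0 j0 q \<noteq> 0" if "q \<in> ?N" for q using that h(4) by auto
  let ?A = "\<lambda>i j q. A i j q - A i j0 q * (A i0 j q / A i0 j0 q)"
  let ?w = "\<lambda>i q. w i q - A i j0 q * (w i0 q / A i0 j0 q)"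
  have c0: "c j0 q = (w i0 q - (\<Sum>j\<in>J. A i0 j q * c j q)) / A i0 j0 q" if "q \<in> ?N" for q
  proof -
    have "A i0 j0 q * c j0 q + (\<Sum>j\<in>J. A i0 j q * c j q) = w i0 q"
      using insert.prems(5)[of q i0] that i0(1) insert.hyps by simp
    then show ?thesis using nz[OF that] by (simp add: field_simps)
  qed
  have IH: "smooth_at M p (c j)" if "j \<in> J" for j
  proof (rule insert.IH[OF N pN _ _ _ _ that])
    show "smooth_at M p (?A i j)" if "i \<in> I" "j \<in> J" for i j
      using that insert.prems(3) i0
      by (intro smooth_at_diff smooth_at_mult smooth_at_divide) auto
    show "smooth_at M p (?w i)" if "i \<in> I" for i
      using that insert.prems(3,4) i0
      by (intro smooth_at_diff smooth_at_mult smooth_at_divide) auto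
    show "(\<Sum>j\<in>J. ?A i j q * c j q) = ?w i q" if q: "q \<in> ?N" and i: "i \<in> I" for q i
    proof -
      have "A i j0 q * c j0 q + (\<Sum>j\<in>J. A i j q * c j q) = w i q"
        using insert.prems(5)[of q i] q i insert.hyps by simp
      then have e: "(\<Sum>j\<in>J. A i j q * c j q) = w i q - A i j0 q * c j0 q" by simp
      show ?thesis unfolding sum_elimination_step e c0[OF q] using nz[OF q] by (simp add: field_simps)
    qed
    show "\<forall>j\<in>J. k j = 0" if k: "\<And>i. i \<in> I \<Longrightarrow> (\<Sum>j\<in>J. ?A i j p * k j) = 0" for k
    proof -
      \<comment> \<open>A kernel vector of the reduced system is completed to one of the full
        system: \<open>?k0\<close> is the value that row \<open>i0\<close> forces on the eliminated
        unknown.\<close>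
      let ?k0 = "- (\<Sum>j\<in>J. A i0 j p * k j) / A i0 j0 p"
      let ?k = "\<lambda>j. if j = j0 then ?k0 else k j"
      have J: "(\<Sum>j\<in>J. f j * ?k j) = (\<Sum>j\<in>J. f j * k j)" for f :: "'b \<Rightarrow> real"
        using insert.hyps by (intro sum.cong) auto
      have "(\<Sum>j\<in>insert j0 J. A i j p * ?k j) = 0" if "i \<in> I" for i
      proof -
        have "(\<Sum>j\<in>J. A i j p * k j) = A i j0 p / A i0 j0 p * (\<Sum>j\<in>J. A i0 j p * k j)"
          using k[OF that] unfolding sum_elimination_step by simp
        then show ?thesis
          using insert.hyps J[of "\<lambda>j. A i j p"] by simp
      qed
      from insert.prems(6)[OF this] have "\<forall>j\<in>insert j0 J. ?k j = 0" .
      then have "?k j = 0" if "j \<in> J" for j using that by blast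
      moreover have "?k j = k j" if "j \<in> J" for j using that insert.hyps(2) by auto
      ultimately show ?thesis by simp
    qed
  qed
  have "smooth_at M p (\<lambda>q. (w i0 q - (\<Sum>j\<in>J. A i0 j q * c j q)) / A i0 j0 q)"
    using insert.prems(3,4) i0 IH p
    by (intro smooth_at_divide smooth_at_diff smooth_at_sum smooth_at_mult) auto
  then have "smooth_at M p (c j0)"
    by (rule smooth_at_local[OF _ N pN]) (simp add: c0)
  then show ?case using IH insert.prems(7) by auto
qed simp

end

section \<open>Representing vectors of 1-forms and the rank as a Euclidean dimension\<close>

text \<open>A witness that the value of the form at \<open>p\<close> lies in the image of
  \<open>flat\<close>, determined only up to the radical. It bypasses the \<open>THE\<close> in
  \<open>covector_at\<close> and the \<open>SOME\<close> in \<open>inner_bullet\<close>.\<close>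

definition (in metric_mfd) represents :: "'a oneform \<Rightarrow> 'a tvec \<Rightarrow> 'a \<Rightarrow> bool" where
  "represents \<omega> v p \<longleftrightarrow> v \<in> TS p \<and> (\<forall>Z\<in>VF. \<omega> Z p = g p v (Z p))"

context metric_mfd
begin

lemma represents_tangent: "represents \<omega> v p \<Longrightarrow> v \<in> TS p"
  and represents_apply: "represents \<omega> v p \<Longrightarrow> Z \<in> VF \<Longrightarrow> \<omega> Z p = g p v (Z p)"
  unfolding represents_def by blast+

text \<open>Uniqueness in the definite description holds because each tangent vector at
  \<open>p\<close> is the value of some vector field.\<close>

lemma covector_at_eq:
  assumes p: "p \<in> points M" and r: "represents \<omega> v p"
  shows "covector_at M \<omega> p = flat M g p v"
  unfolding covector_at_def
proof (rule the_equality)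
  show "(\<forall>Z\<in>VF. flat M g p v (Z p) = \<omega> Z p) \<and> (\<forall>u. u \<notin> TS p \<longrightarrow> flat M g p v u = 0)"
    using r VF_tangent p unfolding represents_def flat_def by auto
  fix \<alpha> assume \<alpha>: "(\<forall>Z\<in>VF. \<alpha> (Z p) = \<omega> Z p) \<and> (\<forall>u. u \<notin> TS p \<longrightarrow> \<alpha> u = 0)"
  show "\<alpha> = flat M g p v"
  proof
    fix u show "\<alpha> u = flat M g p v u"
    proof (cases "u \<in> TS p")
      case True
      then obtain Z where Z: "Z \<in> VF" "Z p = u" using tangent_extension[OF p] by metis
      have "\<alpha> u = \<omega> Z p" using \<alpha> Z by blast
      also have "\<dots> = g p v u" using r Z unfolding represents_def by blast
      finally show ?thesis using True by (simp add: flat_def)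
    qed (use \<alpha> in \<open>simp add: flat_def\<close>)
  qed
qed

text \<open>Vectors with the same \<open>flat\<close> pair equally with every tangent vector, so by
  symmetry of \<open>g\<close> the chosen preimages can be exchanged one after the other.\<close>

lemma inner_bullet_flat:
  assumes p: "p \<in> points M" and v: "v \<in> TS p" and w: "w \<in> TS p"
  shows "inner_bullet M g p (flat M g p v) (flat M g p w) = g p v w"
proof -
  let ?v = "SOME u. u \<in> TS p \<and> flat M g p u = flat M g p v"
  let ?w = "SOME u. u \<in> TS p \<and> flat M g p u = flat M g p w"
  have v': "?v \<in> TS p" "flat M g p ?v = flat M g p v"
    using someI[of "\<lambda>u. u \<in> TS p \<and> flat M g p u = flat M g p v" v] v by auto
  have w': "?w \<in> TS p" "flat M g p ?w = flat M g p w"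
    using someI[of "\<lambda>u. u \<in> TS p \<and> flat M g p u = flat M g p w" w] w by auto
  have "g p ?v ?w = g p v ?w" using fun_cong[OF v'(2), of ?w] w'(1) by (simp add: flat_def)
  also have "\<dots> = g p ?w v" using g_sym[OF p v w'(1)] .
  also have "\<dots> = g p w v" using fun_cong[OF w'(2), of v] v by (simp add: flat_def)
  also have "\<dots> = g p v w" using g_sym[OF p w v] .
  finally show ?thesis by (simp add: inner_bullet_def)
qed

lemma pointwise_contraction_eq:
  assumes p: "p \<in> points M" and "represents \<omega> v p" "represents \<tau> w p"
  shows "pointwise_contraction M g \<omega> \<tau> p = g p v w"
  unfolding pointwise_contraction_def covector_at_eq[OF p assms(2)] covector_at_eq[OF p assms(3)]
  by (rule inner_bullet_flat[OF p represents_tangent[OF assms(2)] represents_tangent[OF assms(3)]])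

text \<open>A covector in the image of \<open>flat\<close> is determined by its values on vectors
  spanning the tangent space. The family \<open>L\<close> is only required to span:
  \<open>Basis\<close> of the chart type may be larger than the dimension.\<close>

lemma metric_rank_eq:
  fixes L :: "'k::euclidean_space \<Rightarrow> 'a tvec"
  assumes p: "p \<in> points M" and L: "\<And>b. b \<in> Basis \<Longrightarrow> L b \<in> TS p"
    and span: "\<And>v. v \<in> TS p \<Longrightarrow> \<exists>c. v = (\<lambda>f. \<Sum>b\<in>Basis. c b * L b f)"
  shows "metric_rank M g p = dim ((\<lambda>v. \<Sum>b\<in>Basis. g p v (L b) *\<^sub>R b) ` TS p)"
proof -
  interpret A: vector_space "\<lambda>(c::real) (\<alpha>::'a covec) v. c * \<alpha> v"
    by unfold_locales (auto simp: fun_eq_iff algebra_simps)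
  interpret AB: vector_space_pair "\<lambda>(c::real) (\<alpha>::'a covec) v. c * \<alpha> v" "scaleR :: real \<Rightarrow> 'k \<Rightarrow> 'k"
    by unfold_locales
  let ?\<Phi> = "\<lambda>\<alpha>::'a covec. \<Sum>b\<in>Basis. \<alpha> (L b) *\<^sub>R b"
  have lin: "Vector_Spaces.linear (\<lambda>(c::real) (\<alpha>::'a covec) v. c * \<alpha> v) scaleR ?\<Phi>"
    by unfold_locales
      (auto simp: scaleR_left_distrib sum.distrib scaleR_sum_right)
  have sub: "A.subspace (cotangent_bullet M g p)"
    unfolding A.subspace_def cotangent_bullet_def
  proof (intro conjI ballI allI)
    show "0 \<in> flat M g p ` TS p"
      by (rule image_eqI[OF _ tangent_zero]) (auto simp: flat_def g_zero_left p fun_eq_iff)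
    fix \<alpha> assume "\<alpha> \<in> flat M g p ` TS p"
    then obtain v where v: "v \<in> TS p" "\<alpha> = flat M g p v" by auto
    show "(\<lambda>u. c * \<alpha> u) \<in> flat M g p ` TS p" for c
      by (rule image_eqI[OF _ tangent_scale[OF v(1), of c]])
        (auto simp: flat_def g_scale_left p v fun_eq_iff)
    fix \<beta> assume "\<beta> \<in> flat M g p ` TS p"
    then obtain w where w: "w \<in> TS p" "\<beta> = flat M g p w" by auto
    show "\<alpha> + \<beta> \<in> flat M g p ` TS p"
      by (rule image_eqI[OF _ tangent_plus[OF v(1) w(1)]])
        (auto simp: flat_def g_add_left p v w fun_eq_iff)
  qed
  have ext: "\<alpha> = 0" if \<alpha>: "\<alpha> \<in> cotangent_bullet M g p" "?\<Phi> \<alpha> = 0" for \<alpha>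
  proof
    obtain v where v: "v \<in> TS p" "\<alpha> = flat M g p v" using \<alpha>(1) by (auto simp: cotangent_bullet_def)
    fix u
    show "\<alpha> u = 0 u"
    proof (cases "u \<in> TS p")
      case True
      obtain c where c: "u = (\<lambda>f. \<Sum>b\<in>Basis. c b * L b f)" using span[OF True] by blast
      have \<alpha>L: "\<alpha> (L b) = ?\<Phi> \<alpha> \<bullet> b" if "b \<in> Basis" for b
        using that by (simp add: inner_sum_left inner_Basis if_distrib cong: if_cong)
      have "g p v (L b) = 0" if "b \<in> Basis" for b
      proof -
        have "g p v (L b) = \<alpha> (L b)" using that L v by (simp add: flat_def)
        then show ?thesis unfolding \<alpha>L[OF that] \<alpha>(2) by simp
      qed
      then show ?thesis
        using True v(1) L by (simp add: v(2) flat_def c g_sum_right[OF p v(1)] g_scale_right[OF p] tangent_scale)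
    qed (simp add: v(2) flat_def)
  qed
  have inj: "inj_on ?\<Phi> (A.span (cotangent_bullet M g p))"
    using AB.linear_inj_on_iff_eq_0[OF lin sub] ext by (simp add: A.span_eq_iff[THEN iffD2, OF sub])
  have "vector_space.dim scaleR (?\<Phi> ` cotangent_bullet M g p) = metric_rank M g p"
    unfolding metric_rank_def by (rule AB.dim_injective_image[OF lin inj])
  moreover have "?\<Phi> ` cotangent_bullet M g p = (\<lambda>v. \<Sum>b\<in>Basis. g p v (L b) *\<^sub>R b) ` TS p"
    unfolding cotangent_bullet_def image_image using L by (simp add: flat_def cong: sum.cong)
  ultimately show ?thesis by (simp add: dim_raw_def)
qed

text \<open>The Gram matrix of the frame, extended from \<open>model M\<close> to all of \<open>'e\<close>.\<close>

definition frame_vector :: "('e \<Rightarrow> 'a vfield) \<Rightarrow> 'a \<Rightarrow> 'e \<Rightarrow> 'a tvec" where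
  "frame_vector E q u = (\<lambda>f. \<Sum>d\<in>model_basis. (u \<bullet> d) * E d q f)"

definition gram :: "('e \<Rightarrow> 'a vfield) \<Rightarrow> 'a \<Rightarrow> 'e \<Rightarrow> 'e" where
  "gram E q u = (\<Sum>b\<in>Basis. g q (frame_vector E q u) (frame_vector E q b) *\<^sub>R b)"

lemma frame_vector_tangent:
  assumes F: "local_frame N E x" and q: "q \<in> N"
  shows "frame_vector E q u \<in> TS q"
proof -
  have "q \<in> points M" using q local_frame_open[OF F] openin_T_subset by blast
  then show ?thesis
    unfolding frame_vector_def
    by (intro tangent_sum_vec tangent_scale VF_tangent[OF local_frame_VF[OF F]])
qed

lemma frame_vector_surj:
  assumes F: "local_frame N E x" and q: "q \<in> N" and v: "v \<in> TS q"
  shows "v = frame_vector E q (\<Sum>d\<in>model_basis. v (x d) *\<^sub>R d)"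
proof
  fix f
  have "(\<Sum>d\<in>model_basis. v (x d) *\<^sub>R d) \<bullet> d' = v (x d')" if "d' \<in> model_basis" for d'
    using that by (simp add: inner_sum_left model_basis_inner if_distrib finite_model_basis cong: sum.cong if_cong)
  then show "v f = frame_vector E q (\<Sum>d\<in>model_basis. v (x d) *\<^sub>R d) f"
    unfolding frame_vector_def using local_frame_expand[OF F q v, of f] by simp
qed

lemma frame_vector_coord:
  assumes F: "local_frame N E x" and q: "q \<in> N" and d: "d \<in> model_basis"
  shows "frame_vector E q u (x d) = u \<bullet> d"
proof -
  have "frame_vector E q u (x d) = (\<Sum>d'\<in>model_basis. if d' = d then u \<bullet> d' else 0)"
    unfolding frame_vector_def by (rule sum.cong) (simp_all add: local_frame_dual[OF F q _ d])
  then show ?thesis using d by (simp add: finite_model_basis)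
qed

lemma frame_vector_model_basis:
  assumes "d \<in> model_basis"
  shows "frame_vector E q d = E d q"
proof
  fix f
  have "frame_vector E q d f = (\<Sum>d'\<in>model_basis. if d' = d then E d' q f else 0)"
    unfolding frame_vector_def by (rule sum.cong) (auto simp: model_basis_inner[OF assms])
  then show "frame_vector E q d f = E d q f" using assms by (simp add: finite_model_basis)
qed

lemma frame_vector_linear:
  "frame_vector E q (a *\<^sub>R u + c *\<^sub>R w) = (\<lambda>f. a * frame_vector E q u f + c * frame_vector E q w f)"
  by (simp add: frame_vector_def inner_add_left algebra_simps sum.distrib sum_distrib_left)

lemma frame_vector_basis:
  "frame_vector E q u = (\<lambda>f. \<Sum>b\<in>Basis. (u \<bullet> b) * frame_vector E q b f)"
proof
  fix f
  have ub: "(\<Sum>b\<in>Basis. (u \<bullet> b) * (b \<bullet> d)) = u \<bullet> d" for d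
    by (subst (3) euclidean_inner) (simp add: inner_commute)
  have "(\<Sum>b\<in>Basis. (u \<bullet> b) * frame_vector E q b f) =
      (\<Sum>d\<in>model_basis. (\<Sum>b\<in>Basis. (u \<bullet> b) * (b \<bullet> d)) * E d q f)"
    unfolding frame_vector_def sum_distrib_left sum_distrib_right
    by (subst sum.swap) (simp add: mult_ac)
  also have "\<dots> = frame_vector E q u f"
    by (simp add: frame_vector_def ub)
  finally have "(\<Sum>b\<in>Basis. (u \<bullet> b) * frame_vector E q b f) = frame_vector E q u f" .
  then show "frame_vector E q u f = (\<Sum>b\<in>Basis. (u \<bullet> b) * frame_vector E q b f)" by simp
qed

lemma gram_linear:
  assumes F: "local_frame N E x" and q: "q \<in> N"
  shows "linear (gram E q)"
proof (rule linearI)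
  have p: "q \<in> points M" using q local_frame_open[OF F] openin_T_subset by blast
  note t = frame_vector_tangent[OF F q]
  have "gram E q (a *\<^sub>R u + c *\<^sub>R w) = a *\<^sub>R gram E q u + c *\<^sub>R gram E q w" for a c u w
    unfolding gram_def frame_vector_linear
    by (simp add: g_lincomb[OF p t t t] scaleR_left_distrib sum.distrib scaleR_sum_right)
  from this[of 1 _ 1] this[of _ _ 0] show "gram E q (u + w) = gram E q u + gram E q w"
    "gram E q (a *\<^sub>R u) = a *\<^sub>R gram E q u" for a u w
    by simp_all
qed

lemma metric_rank_gram:
  assumes F: "local_frame N E x" and q: "q \<in> N"
  shows "metric_rank M g q = dim (range (gram E q))"
proof -
  have p: "q \<in> points M" using q local_frame_open[OF F] openin_T_subset by blast
  have "metric_rank M g q = dim ((\<lambda>v. \<Sum>b\<in>Basis. g q v (frame_vector E q b) *\<^sub>R b) ` TS q)"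
    by (rule metric_rank_eq[OF p frame_vector_tangent[OF F q]])
      (metis frame_vector_surj[OF F q] frame_vector_basis)
  also have "TS q = range (frame_vector E q)"
    using frame_vector_surj[OF F q] frame_vector_tangent[OF F q] by blast
  also have "(\<lambda>v. \<Sum>b\<in>Basis. g q v (frame_vector E q b) *\<^sub>R b) ` range (frame_vector E q) = range (gram E q)"
    by (simp add: image_image gram_def)
  finally show ?thesis .
qed

lemma gram_expand:
  assumes F: "local_frame N E x" and q: "q \<in> N"
  shows "gram E q u = (\<Sum>b\<in>Basis. (\<Sum>d\<in>model_basis. \<Sum>d'\<in>model_basis.
    (u \<bullet> d) * (b \<bullet> d') * metric_apply g (E d) (E d') q) *\<^sub>R b)"
proof -
  have p: "q \<in> points M" using q local_frame_open[OF F] openin_T_subset by blast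
  have t: "E d q \<in> TS q" if "d \<in> model_basis" for d using VF_tangent[OF local_frame_VF[OF F that] p] .
  have "g q (frame_vector E q u) (frame_vector E q b) = (\<Sum>d\<in>model_basis. \<Sum>d'\<in>model_basis.
    (u \<bullet> d) * (b \<bullet> d') * metric_apply g (E d) (E d') q)" for b
  proof -
    have "g q (frame_vector E q u) (frame_vector E q b) =
        (\<Sum>d\<in>model_basis. (u \<bullet> d) * g q (E d q) (frame_vector E q b))"
      unfolding frame_vector_def[of E q u]
      by (simp add: g_sum_left[OF p frame_vector_tangent[OF F q]] tangent_scale t
          g_scale_left[OF p _ frame_vector_tangent[OF F q]])
    also have "\<dots> = (\<Sum>d\<in>model_basis. (u \<bullet> d) * (\<Sum>d'\<in>model_basis. (b \<bullet> d') * g q (E d q) (E d' q)))"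
      unfolding frame_vector_def[of E q b]
      by (intro sum.cong refl) (simp add: g_sum_right[OF p t] tangent_scale t g_scale_right[OF p _ t])
    finally show ?thesis by (simp add: sum_distrib_left metric_apply_apply mult_ac)
  qed
  then show ?thesis by (simp add: gram_def)
qed

section \<open>Semicontinuity of the rank and density of the points of constant rank\<close>

text \<open>On a subspace \<open>?W\<close> of dimension equal to the rank at \<open>p\<close>, the
  Gram map at \<open>p\<close> is bounded below by some \<open>e\<close>. Gram maps at nearby points
  differ from it by less than \<open>e\<close> in norm, so they stay injective on
  \<open>?W\<close>.\<close>

lemma metric_rank_lower_semicontinuous:
  assumes p: "p \<in> points M"
  obtains N where "openin T N" "p \<in> N" "\<And>q. q \<in> N \<Longrightarrow> metric_rank M g p \<le> metric_rank M g q"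
proof -
  obtain N E x where F: "local_frame N E x" and N: "p \<in> N" by (rule obtain_frame[OF p])
  let ?G = "gram E"
  have lin: "linear (?G p)" by (rule gram_linear[OF F N])
  obtain C where C: "C \<subseteq> range (?G p)" "independent C" "range (?G p) \<subseteq> span C" "card C = dim (range (?G p))"
    by (rule basis_exists)
  \<comment> \<open>Preimages of a basis of the range; their span is a complement of the kernel of
    the Gram map at \<open>p\<close>.\<close>
  define h where "h y = (SOME u. ?G p u = y)" for y
  have h: "?G p (h y) = y" if "y \<in> C" for y
    unfolding h_def using C(1) that by (metis (mono_tags) imageE someI subsetD)
  have hC: "?G p ` h ` C = C" using h by (force simp: image_iff)
  have hinj: "inj_on (?G p) (h ` C)" by (rule inj_onI) (use h in force)
  let ?W = "span (h ` C)"
  have inj: "inj_on (?G p) ?W"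
    by (rule linear_inj_on_span_independent_image[OF lin _ hinj]) (simp add: hC C(2))
  have "dim (?G p ` ?W) = dim ?W" by (rule dim_image_eq[OF lin]) (simp add: inj span_span)
  moreover have "?G p ` ?W = span C" using linear_span_image[OF lin, of "h ` C"] hC by simp
  ultimately have dimW: "dim ?W = metric_rank M g p"
    using metric_rank_gram[OF F N] C(2,4) by (simp add: dim_eq_card_independent)
  have "\<forall>u\<in>?W. ?G p u = 0 \<longrightarrow> u = 0"
    using inj linear_0[OF lin] span_0 by (metis inj_on_def)
  then obtain e where e: "e > 0" "\<And>u. u \<in> ?W \<Longrightarrow> norm (?G p u) \<ge> e * norm u"
    using injective_imp_isometric[OF closed_subspace[OF subspace_span] subspace_span, of "?G p" "h ` C"]
      lin linear_conv_bounded_linear by blast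
  let ?\<gamma> = "\<lambda>d d'. metric_apply g (E d) (E d')"
  \<comment> \<open>The number of summands in the estimate of \<open>?G q u - ?G p u\<close>, each
    bounded by \<open>\<epsilon> * norm u\<close>.\<close>
  let ?D = "real DIM('e) * real (card model_basis) * real (card model_basis)"
  define \<epsilon> where "\<epsilon> = e / (?D + 1)"
  have \<epsilon>: "\<epsilon> > 0" "\<epsilon> * ?D < e" using e(1) by (auto simp: \<epsilon>_def field_simps add_pos_nonneg)
  \<comment> \<open>A sum of squares is one smooth function controlling all Gram entries, so the
    required neighbourhood is an open preimage.\<close>
  let ?s = "\<lambda>q. \<Sum>d\<in>model_basis. \<Sum>d'\<in>model_basis. (?\<gamma> d d' q - ?\<gamma> d d' p)\<^sup>2"
  have s: "?s \<in> Sm"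
    by (intro smooth_intros g_smooth local_frame_VF[OF F])
  let ?N = "N \<inter> {q\<in>points M. ?s q \<in> {..<\<epsilon>\<^sup>2}}"
  show ?thesis
  proof
    show "openin T ?N"
      by (rule openin_Int[OF local_frame_open[OF F] smooth_preimage_open[OF s open_lessThan]])
    show "p \<in> ?N" using N p \<epsilon> by simp
    fix q assume q: "q \<in> ?N"
    then have qN: "q \<in> N" by simp
    have small: "\<bar>?\<gamma> d d' q - ?\<gamma> d d' p\<bar> \<le> \<epsilon>" if "d \<in> model_basis" "d' \<in> model_basis" for d d'
    proof -
      have "(?\<gamma> d d' q - ?\<gamma> d d' p)\<^sup>2 \<le> (\<Sum>d'\<in>model_basis. (?\<gamma> d d' q - ?\<gamma> d d' p)\<^sup>2)"
        by (rule member_le_sum[OF that(2)]) (auto simp: finite_model_basis)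
      also have "\<dots> \<le> ?s q"
        by (rule member_le_sum[OF that(1), of "\<lambda>d. \<Sum>d'\<in>model_basis. (?\<gamma> d d' q - ?\<gamma> d d' p)\<^sup>2"])
          (auto simp: finite_model_basis intro: sum_nonneg)
      finally have "(?\<gamma> d d' q - ?\<gamma> d d' p)\<^sup>2 \<le> \<epsilon>\<^sup>2" using q by simp
      then show ?thesis using \<epsilon>(1) by (simp add: abs_le_square_iff[symmetric])
    qed
    have close: "norm (?G q u - ?G p u) \<le> \<epsilon> * ?D * norm u" for u
    proof -
      let ?c = "\<lambda>b. \<Sum>d\<in>model_basis. \<Sum>d'\<in>model_basis. (u \<bullet> d) * (b \<bullet> d') * (?\<gamma> d d' q - ?\<gamma> d d' p)"
      have diff: "?G q u - ?G p u = (\<Sum>b\<in>Basis. ?c b *\<^sub>R b)"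
        unfolding gram_expand[OF F qN] gram_expand[OF F N]
        by (simp add: sum_subtractf[symmetric] scaleR_left_diff_distrib[symmetric] right_diff_distrib)
      have "norm (?G q u - ?G p u) \<le> (\<Sum>b\<in>(Basis::'e set). \<bar>?c b\<bar>)"
        unfolding diff by (rule sum_norm_le) simp
      also have "\<dots> \<le> (\<Sum>b\<in>(Basis::'e set). \<Sum>d\<in>model_basis. \<Sum>d'\<in>model_basis. norm u * \<epsilon>)"
      proof (rule sum_mono)
        fix b :: 'e assume b: "b \<in> Basis"
        have "\<bar>(u \<bullet> d) * (b \<bullet> d') * (?\<gamma> d d' q - ?\<gamma> d d' p)\<bar> \<le> norm u * \<epsilon>"
          if d: "d \<in> model_basis" "d' \<in> model_basis" for d d'
        proof -
          have ud: "\<bar>u \<bullet> d\<bar> \<le> norm u"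
            using Cauchy_Schwarz_ineq2[of u d] unfolding model_basis(3)[OF d(1)] mult_1_right .
          have bd: "\<bar>b \<bullet> d'\<bar> \<le> 1"
            using Cauchy_Schwarz_ineq2[of b d'] unfolding model_basis(3)[OF d(2)] norm_Basis[OF b] mult_1_right .
          have "\<bar>u \<bullet> d\<bar> * \<bar>b \<bullet> d'\<bar> \<le> norm u"
            using mult_mono[OF ud bd norm_ge_zero abs_ge_zero] by simp
          then have "\<bar>u \<bullet> d\<bar> * \<bar>b \<bullet> d'\<bar> * \<bar>?\<gamma> d d' q - ?\<gamma> d d' p\<bar> \<le> norm u * \<epsilon>"
            by (rule mult_mono[OF _ small[OF d] norm_ge_zero abs_ge_zero])
          then show ?thesis by (simp add: abs_mult)
        qed
        then have "(\<Sum>d\<in>model_basis. \<Sum>d'\<in>model_basis. \<bar>(u \<bullet> d) * (b \<bullet> d') * (?\<gamma> d d' q - ?\<gamma> d d' p)\<bar>)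
            \<le> (\<Sum>d\<in>model_basis. \<Sum>d'\<in>model_basis. norm u * \<epsilon>)"
          by (intro sum_mono)
        moreover have "\<bar>?c b\<bar> \<le> (\<Sum>d\<in>model_basis. \<bar>\<Sum>d'\<in>model_basis. (u \<bullet> d) * (b \<bullet> d') * (?\<gamma> d d' q - ?\<gamma> d d' p)\<bar>)"
          by (rule sum_abs)
        moreover have "\<dots> \<le> (\<Sum>d\<in>model_basis. \<Sum>d'\<in>model_basis. \<bar>(u \<bullet> d) * (b \<bullet> d') * (?\<gamma> d d' q - ?\<gamma> d d' p)\<bar>)"
          by (intro sum_mono sum_abs)
        ultimately show "\<bar>?c b\<bar> \<le> (\<Sum>d\<in>model_basis. \<Sum>d'\<in>model_basis. norm u * \<epsilon>)"
          by linarith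
      qed
      also have "\<dots> = \<epsilon> * ?D * norm u" by simp
      finally show ?thesis .
    qed
    have linq: "linear (?G q)" by (rule gram_linear[OF F qN])
    have "u = 0" if u: "u \<in> ?W" "?G q u = 0" for u
    proof (rule ccontr)
      assume "u \<noteq> 0"
      then have "\<epsilon> * ?D * norm u < e * norm u" using \<epsilon>(2) by simp
      then show False using close[of u] u e(2)[OF u(1)] by simp
    qed
    then have "inj_on (?G q) ?W"
      using linear_inj_on_iff_eq_0[OF linq subspace_span] by blast
    then have "dim (?G q ` ?W) = dim ?W" by (intro dim_image_eq[OF linq]) (simp add: span_span)
    moreover have "dim (?G q ` ?W) \<le> dim (range (?G q))" by (rule dim_subset) auto
    ultimately show "metric_rank M g p \<le> metric_rank M g q"
      using metric_rank_gram[OF F qN] dimW by simp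
  qed
qed

lemma metric_rank_bound:
  assumes "p \<in> points M"
  shows "metric_rank M g p \<le> DIM('e)"
proof -
  obtain N E x where F: "local_frame N E x" and N: "p \<in> N" by (rule obtain_frame[OF assms])
  show ?thesis unfolding metric_rank_gram[OF F N] by (rule dim_subset_UNIV)
qed

text \<open>The rank is bounded, so it attains a maximum on \<open>N\<close>; at a maximum lower
  semicontinuity leaves no room to vary nearby.\<close>

lemma constant_rank_points_dense:
  assumes N: "openin T N" "N \<noteq> {}"
  shows "\<exists>q\<in>N. q \<in> constant_rank_points M g"
proof -
  have fin: "finite (metric_rank M g ` N)"
    using metric_rank_bound openin_T_subset[OF N(1)] by (intro finite_subset[OF _ finite_atMost]) auto
  then have "Max (metric_rank M g ` N) \<in> metric_rank M g ` N"
    using N(2) by (intro Max_in) auto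
  then obtain p where p: "p \<in> N" "metric_rank M g p = Max (metric_rank M g ` N)"
    by (metis imageE)
  have pM: "p \<in> points M" using p(1) openin_T_subset[OF N(1)] by blast
  obtain N' where N': "openin T N'" "p \<in> N'" "\<And>q. q \<in> N' \<Longrightarrow> metric_rank M g p \<le> metric_rank M g q"
    using metric_rank_lower_semicontinuous[OF pM] by metis
  have "metric_rank M g q = metric_rank M g p" if "q \<in> N \<inter> N'" for q
    using Max_ge[OF fin, of "metric_rank M g q"] N'(3)[of q] that p(2) by fastforce
  then have "p \<in> constant_rank_points M g"
    unfolding constant_rank_points_def using pM p(1) N' openin_Int[OF N(1) N'(1)] by blast
  with p(1) show ?thesis by blast
qed

lemma smooth_eq_if_eq_constant_rank:
  assumes f: "f \<in> Sm" and h: "h \<in> Sm" and eq: "\<And>q. q \<in> constant_rank_points M g \<Longrightarrow> f q = h q"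
    and p: "p \<in> points M"
  shows "f p = h p"
proof (rule ccontr)
  assume ne: "f p \<noteq> h p"
  have "openin T {q\<in>points M. f q - h q \<in> - {0}}"
    by (rule smooth_preimage_open[OF smooth_functions_diff[OF f h]]) auto
  from constant_rank_points_dense[OF this] show False using p ne eq by auto
qed

text \<open>\<open>contraction\<close> is some extension, not a given one. Two smooth functions that
  agree at all points of constant rank agree by density, so any explicit extension computes
  it.\<close>

lemma contraction_eq:
  assumes "extends_contraction M g \<omega> \<tau> f" and p: "p \<in> points M"
  shows "contraction M g \<omega> \<tau> p = f p"
proof -
  have "extends_contraction M g \<omega> \<tau> (contraction M g \<omega> \<tau>)"
    unfolding contraction_def by (rule someI[of "extends_contraction M g \<omega> \<tau>", OF assms(1)])
  then show ?thesis
    using assms smooth_eq_if_eq_constant_rank unfolding extends_contraction_def by metis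
qed

section \<open>Non-degenerate metrics\<close>

lemma nondegenerate_gram_inj:
  assumes nd: "nondegenerate M g" and F: "local_frame N E x" and q: "q \<in> N"
    and u: "u \<in> model M" and 0: "\<And>d. d \<in> model_basis \<Longrightarrow> g q (frame_vector E q u) (E d q) = 0"
  shows "u = 0"
proof -
  have p: "q \<in> points M" using q local_frame_open[OF F] openin_T_subset by blast
  have t: "E d q \<in> TS q" if "d \<in> model_basis" for d using VF_tangent[OF local_frame_VF[OF F that] p] .
  note fu = frame_vector_tangent[OF F q, of u]
  have "g q (frame_vector E q u) w = 0" if w: "w \<in> TS q" for w
  proof -
    have "w = (\<lambda>f. \<Sum>d\<in>model_basis. w (x d) * E d q f)"
      using local_frame_expand[OF F q w] by blast
    then have "g q (frame_vector E q u) w = g q (frame_vector E q u) (\<lambda>f. \<Sum>d\<in>model_basis. w (x d) * E d q f)"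
      by simp
    also have "\<dots> = 0"
      by (simp add: g_sum_right[OF p fu] tangent_scale t g_scale_right[OF p t fu] 0)
    finally show ?thesis .
  qed
  then have "frame_vector E q u = (\<lambda>f. 0)"
    using nd p fu unfolding nondegenerate_def by blast
  then have "u \<bullet> d = 0" if "d \<in> model_basis" for d
    using frame_vector_coord[OF F q that, of u] by simp
  then show "u = 0" using model_basis_expand[OF u] by simp
qed

text \<open>The Gram map is injective on \<open>model M\<close>, and \<open>model M\<close> already
  yields the whole range, as a vector enters only through its inner products with
  \<open>model_basis\<close>. On the base this makes the rank constant, so that a change of rank on
  the warped product can only come from the fibres.\<close>

lemma nondegenerate_metric_rank:
  assumes nd: "nondegenerate M g" and p: "p \<in> points M"
  shows "metric_rank M g p = dim (model M)"
proof -
  obtain N E x where F: "local_frame N E x" and N: "p \<in> N" by (rule obtain_frame[OF p])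
  note lin = gram_linear[OF F N]
  have t: "E d p \<in> TS p" if "d \<in> model_basis" for d using VF_tangent[OF local_frame_VF[OF F that] p] .
  have "u = 0" if u: "u \<in> model M" "gram E p u = 0" for u
  proof (rule nondegenerate_gram_inj[OF nd F N u(1)])
    fix d assume d: "d \<in> model_basis"
    have b: "g p (frame_vector E p u) (frame_vector E p b) = gram E p u \<bullet> b" if "b \<in> Basis" for b
      unfolding gram_def using that by (simp add: inner_sum_left inner_Basis if_distrib cong: if_cong)
    have "E d p = frame_vector E p d" using frame_vector_model_basis[OF d] by simp
    also have "\<dots> = (\<lambda>f. \<Sum>b\<in>Basis. (d \<bullet> b) * frame_vector E p b f)" by (rule frame_vector_basis)
    finally have "g p (frame_vector E p u) (E d p) =
        g p (frame_vector E p u) (\<lambda>f. \<Sum>b\<in>Basis. (d \<bullet> b) * frame_vector E p b f)" by simp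
    also have "\<dots> = 0"
      using b u(2) by (simp add: g_sum_right[OF p] g_scale_right[OF p] frame_vector_tangent[OF F N] tangent_scale)
    finally show "g p (frame_vector E p u) (E d p) = 0" .
  qed
  then have "inj_on (gram E p) (model M)"
    using linear_inj_on_iff_eq_0[OF lin subspace_model] by blast
  then have "dim (gram E p ` model M) = dim (model M)"
    by (intro dim_image_eq[OF lin]) (simp add: span_eq_iff[THEN iffD2, OF subspace_model])
  moreover have "gram E p ` model M = range (gram E p)"
  proof -
    have "gram E p u \<in> gram E p ` model M" for u
    proof -
      let ?u = "\<Sum>d\<in>model_basis. (u \<bullet> d) *\<^sub>R d"
      have "frame_vector E p u = frame_vector E p ?u"
        using frame_vector_surj[OF F N frame_vector_tangent[OF F N], of u] frame_vector_coord[OF F N, of _ u]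
        by simp
      then have "gram E p u = gram E p ?u" by (simp add: gram_def)
      moreover have "?u \<in> model M"
        using model_basis(1) by (intro subspace_sum[OF subspace_model] subspace_scale[OF subspace_model]) auto
      ultimately show ?thesis by blast
    qed
    then show ?thesis by blast
  qed
  ultimately show ?thesis using metric_rank_gram[OF F N] by simp
qed

text \<open>Non-degeneracy gives an injective linear endomorphism of the finite-dimensional
  \<open>model M\<close>, which is therefore onto. The second claim expresses the vector in a given
  frame, so that its coefficients can be followed from point to point.\<close>

lemma nondegenerate_represents:
  assumes nd: "nondegenerate M g" and \<omega>: "tensorial \<omega>" and p: "p \<in> points M"
  shows "\<exists>v. represents \<omega> v p"
    and "local_frame N E x \<Longrightarrow> p \<in> N \<Longrightarrow> \<exists>u\<in>model M. represents \<omega> (frame_vector E p u) p"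
proof -
  show *: "\<exists>u\<in>model M. represents \<omega> (frame_vector E p u) p" if F: "local_frame N E x" and N: "p \<in> N" for N E x
  proof -
    have t: "E d p \<in> TS p" if "d \<in> model_basis" for d using VF_tangent[OF local_frame_VF[OF F that] p] .
    define G where "G u = (\<Sum>d\<in>model_basis. g p (frame_vector E p u) (E d p) *\<^sub>R d)" for u
    have lin: "linear G"
    proof (rule linearI)
      have "G (a *\<^sub>R u + c *\<^sub>R w) = a *\<^sub>R G u + c *\<^sub>R G w" for a c u w
        unfolding G_def frame_vector_linear
        by (simp add: g_lincomb[OF p frame_vector_tangent[OF F N] frame_vector_tangent[OF F N] t]
            scaleR_left_distrib sum.distrib scaleR_sum_right)
      from this[of 1 _ 1] this[of _ _ 0] show "G (u + w) = G u + G w" "G (a *\<^sub>R u) = a *\<^sub>R G u" for a u w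
        by simp_all
    qed
    have Gd: "G u \<bullet> d = g p (frame_vector E p u) (E d p)" if "d \<in> model_basis" for u d
      unfolding G_def using that
      by (simp add: inner_sum_left model_basis_inner if_distrib finite_model_basis cong: sum.cong if_cong)
    have "inj_on G (model M)"
      unfolding linear_inj_on_iff_eq_0[OF lin subspace_model]
    proof (intro ballI impI)
      fix u assume "u \<in> model M" "G u = 0"
      then show "u = 0" using Gd by (intro nondegenerate_gram_inj[OF nd F N]) (simp_all add: Gd[symmetric])
    qed
    then have "dim (G ` model M) = dim (model M)"
      by (intro dim_image_eq[OF lin]) (simp add: span_eq_iff[THEN iffD2, OF subspace_model])
    moreover have "G ` model M \<subseteq> model M"
      unfolding G_def using model_basis(1)
      by (auto intro!: subspace_sum[OF subspace_model] subspace_scale[OF subspace_model])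
    ultimately have surj: "G ` model M = model M"
      using subspace_dim_equal[OF linear_subspace_image[OF lin subspace_model] subspace_model] by simp
    let ?w = "\<Sum>d\<in>model_basis. \<omega> (E d) p *\<^sub>R d"
    have "?w \<in> model M"
      using model_basis(1) by (auto intro!: subspace_sum[OF subspace_model] subspace_scale[OF subspace_model])
    then have "?w \<in> G ` model M" unfolding surj .
    then obtain u where u: "?w = G u" "u \<in> model M" by (rule imageE)
    have e: "\<omega> (E d) p = g p (frame_vector E p u) (E d p)" if "d \<in> model_basis" for d
      unfolding Gd[OF that, symmetric] u(1)[symmetric] using that
      by (simp add: inner_sum_left model_basis_inner if_distrib finite_model_basis cong: sum.cong if_cong)
    have "\<omega> Z p = g p (frame_vector E p u) (Z p)" if Z: "Z \<in> VF" for Z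
    proof -
      have "\<omega> Z p = (\<Sum>d\<in>model_basis. Z p (x d) * \<omega> (E d) p)"
        if "tensorial \<omega>" for \<omega>
      proof (rule tensorial_frame[OF that local_frame_open[OF F] N local_frame_VF[OF F] _ Z])
        show "(\<lambda>q. Z q (x d)) \<in> Sm" if "d \<in> model_basis" for d
          by (rule VF_apply_smooth[OF Z local_frame_coord_smooth[OF F that]])
        show "Z q f = (\<Sum>d\<in>model_basis. Z q (x d) * E d q f)" if "q \<in> N" for q f
          using local_frame_expand[OF F that VF_tangent[OF Z]] openin_T_subset[OF local_frame_open[OF F]] that
          by blast
      qed
      from this[OF \<omega>] have "\<omega> Z p = (\<Sum>d\<in>model_basis. Z p (x d) * g p (frame_vector E p u) (E d p))"
        by (simp add: e)
      also have "\<dots> = g p (frame_vector E p u) (\<lambda>f. \<Sum>d\<in>model_basis. Z p (x d) * E d p f)"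
        by (simp add: g_sum_right[OF p frame_vector_tangent[OF F N]] tangent_scale t
            g_scale_right[OF p t frame_vector_tangent[OF F N]])
      also have "(\<lambda>f. \<Sum>d\<in>model_basis. Z p (x d) * E d p f) = Z p"
        by (rule ext) (rule local_frame_expand[OF F N VF_tangent[OF Z p], symmetric])
      finally show ?thesis .
    qed
    then have "represents \<omega> (frame_vector E p u) p"
      unfolding represents_def using frame_vector_tangent[OF F N] by blast
    with u(2) show ?thesis by blast
  qed
  obtain N E x where "local_frame N E x" "p \<in> N" by (rule obtain_frame[OF p])
  from *[OF this] show "\<exists>v. represents \<omega> v p" by blast
qed

text \<open>The coefficients of the representing vectors solve a linear system whose matrix is the
  Gram matrix, so they are smooth by \<open>smooth_linear_solution\<close> although they are picked
  separately at each point.\<close>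

lemma nondegenerate_contraction_smooth:
  assumes nd: "nondegenerate M g" and \<omega>: "tensorial \<omega>" and \<tau>: "tensorial \<tau>"
  shows "pointwise_contraction M g \<omega> \<tau> \<in> Sm"
proof (rule smooth_functions_intro)
  fix p assume p: "p \<in> points M"
  obtain N E x where F: "local_frame N E x" and N: "p \<in> N" by (rule obtain_frame[OF p])
  have NM: "q \<in> points M" if "q \<in> N" for q using that local_frame_open[OF F] openin_T_subset by blast
  have t: "E d q \<in> TS q" if "d \<in> model_basis" "q \<in> N" for d q
    using VF_tangent[OF local_frame_VF[OF F that(1)] NM[OF that(2)]] .
  have "\<forall>q\<in>N. \<exists>u\<in>model M. represents \<omega> (frame_vector E q u) q"
    using nondegenerate_represents(2)[OF nd \<omega> NM F] by blast
  then have "\<exists>u. \<forall>q\<in>N. u q \<in> model M \<and> represents \<omega> (frame_vector E q (u q)) q"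
    by (intro bchoice) blast
  then obtain u where u: "\<And>q. q \<in> N \<Longrightarrow> u q \<in> model M \<and> represents \<omega> (frame_vector E q (u q)) q"
    by blast
  have gfv: "g q (frame_vector E q w) v = (\<Sum>d\<in>model_basis. (w \<bullet> d) * g q (E d q) v)"
    if "q \<in> N" "v \<in> TS q" for q w v
    unfolding frame_vector_def using that
    by (simp add: g_sum_left[OF NM] tangent_scale t g_scale_left[OF NM])
  have c: "smooth_at M p (\<lambda>q. u q \<bullet> d)" if d: "d \<in> model_basis" for d
  proof (rule smooth_linear_solution[where I = model_basis and J = model_basis and c = "\<lambda>d q. u q \<bullet> d"
        and A = "\<lambda>i j. metric_apply g (E j) (E i)" and w = "\<lambda>i. \<omega> (E i)",
        OF finite_model_basis local_frame_open[OF F] N])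
    show "smooth_at M p (metric_apply g (E j) (E i))" if "i \<in> model_basis" "j \<in> model_basis" for i j
      by (intro smooth_functionsD[OF _ p] g_smooth local_frame_VF[OF F] that)
    show "smooth_at M p (\<omega> (E i))" if "i \<in> model_basis" for i
      by (intro smooth_functionsD[OF _ p] tensorial_smooth[OF \<omega>] local_frame_VF[OF F] that)
    show "(\<Sum>j\<in>model_basis. metric_apply g (E j) (E i) q * (u q \<bullet> j)) = \<omega> (E i) q"
      if q: "q \<in> N" and i: "i \<in> model_basis" for q i
      using u[OF q] local_frame_VF[OF F i] gfv[OF q t[OF i q], of "u q"]
      by (simp add: represents_def metric_apply_apply mult.commute)
    show "\<forall>j\<in>model_basis. k j = 0"
      if k: "\<And>i. i \<in> model_basis \<Longrightarrow> (\<Sum>j\<in>model_basis. metric_apply g (E j) (E i) p * k j) = 0" for k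
    proof -
      let ?w = "\<Sum>d\<in>model_basis. k d *\<^sub>R d"
      have wd: "?w \<bullet> d = k d" if "d \<in> model_basis" for d
        using that by (simp add: inner_sum_left model_basis_inner if_distrib finite_model_basis cong: sum.cong if_cong)
      have "?w = 0"
      proof (rule nondegenerate_gram_inj[OF nd F N])
        show "?w \<in> model M"
          using model_basis(1) by (auto intro!: subspace_sum[OF subspace_model] subspace_scale[OF subspace_model])
        show "g p (frame_vector E p ?w) (E d p) = 0" if "d \<in> model_basis" for d
          using k[OF that] gfv[OF N t[OF that N], of ?w] wd by (simp add: metric_apply_apply mult.commute)
      qed
      then show ?thesis using wd by (metis inner_zero_left)
    qed
  qed (rule d)
  have "smooth_at M p (\<lambda>q. \<Sum>d\<in>model_basis. (u q \<bullet> d) * \<tau> (E d) q)"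
    by (intro smooth_at_sum[OF p] smooth_at_mult c smooth_functionsD[OF _ p] tensorial_smooth[OF \<tau>]
        local_frame_VF[OF F])
  then show "smooth_at M p (pointwise_contraction M g \<omega> \<tau>)"
  proof (rule smooth_at_local[OF _ local_frame_open[OF F] N])
    fix q assume q: "q \<in> N"
    obtain w where w: "represents \<tau> w q" using nondegenerate_represents(1)[OF nd \<tau> NM[OF q]] by blast
    have wt: "w \<in> TS q" using w by (simp add: represents_def)
    have "\<tau> (E d) q = g q (E d q) w" if "d \<in> model_basis" for d
      using w local_frame_VF[OF F that] g_sym[OF NM[OF q] wt t[OF that q]] by (simp add: represents_def)
    then show "(\<Sum>d\<in>model_basis. (u q \<bullet> d) * \<tau> (E d) q) = pointwise_contraction M g \<omega> \<tau> q"
      using pointwise_contraction_eq[OF NM[OF q] conjunct2[OF u[OF q]] w] gfv[OF q wt, of "u q"] by simp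
  qed
qed

end

lemma (in mfd) tangent_linear: "v \<in> TS p \<Longrightarrow> f \<in> Sm \<Longrightarrow> h \<in> Sm \<Longrightarrow>
    v (\<lambda>q. a * f q + c * h q) = a * v f + c * v h"
  unfolding tangent_space_def by blast

lemma (in metric_mfd) g_bilinear_sum:
  assumes p: "p \<in> points M" and u: "\<And>i. i \<in> I \<Longrightarrow> u i \<in> TS p" and w: "\<And>j. j \<in> I' \<Longrightarrow> w j \<in> TS p"
  shows "g p (\<lambda>f. \<Sum>i\<in>I. a i * u i f) (\<lambda>f. \<Sum>j\<in>I'. c j * w j f) =
    (\<Sum>i\<in>I. \<Sum>j\<in>I'. a i * c j * g p (u i) (w j))"
proof -
  have W: "(\<lambda>f. \<Sum>j\<in>I'. c j * w j f) \<in> TS p" by (intro tangent_sum_vec tangent_scale w)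
  have "g p (\<lambda>f. \<Sum>i\<in>I. a i * u i f) (\<lambda>f. \<Sum>j\<in>I'. c j * w j f) =
      (\<Sum>i\<in>I. a i * g p (u i) (\<lambda>f. \<Sum>j\<in>I'. c j * w j f))"
    by (simp add: g_sum_left[OF p W] tangent_scale u g_scale_left[OF p _ W])
  also have "\<dots> = (\<Sum>i\<in>I. a i * (\<Sum>j\<in>I'. c j * g p (u i) (w j)))"
    by (intro sum.cong refl) (simp add: g_sum_right[OF p u] tangent_scale w g_scale_right[OF p w u])
  finally show ?thesis by (simp add: sum_distrib_left mult.assoc)
qed

section \<open>Factors of a product manifold\<close>

text \<open>\<open>\<pi>\<close> projects \<open>M\<close> to its factor \<open>A\<close>, and \<open>\<iota> p\<close> includes \<open>A\<close> as the slice through \<open>p\<close>.\<close>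

locale factor = A: mfd A + M: mfd M
  for A :: "('b, 'd::euclidean_space) manifold" and M :: "('a, 'e::euclidean_space) manifold" +
  fixes \<pi> :: "'a \<Rightarrow> 'b" and \<iota> :: "'a \<Rightarrow> 'b \<Rightarrow> 'a" and J :: "'d \<Rightarrow> 'e"
  assumes proj_points: "\<And>p. p \<in> points M \<Longrightarrow> \<pi> p \<in> points A"
    and incl_points: "\<And>p z. p \<in> points M \<Longrightarrow> z \<in> points A \<Longrightarrow> \<iota> p z \<in> points M"
    and proj_incl: "\<And>p z. \<pi> (\<iota> p z) = z"
    and incl_proj: "\<And>p. \<iota> p (\<pi> p) = p"
    and incl_incl: "\<And>p z z'. \<iota> (\<iota> p z) z' = \<iota> p z'"
    and proj_open: "\<And>N. openin (manifold_topology A) N \<Longrightarrow> openin (manifold_topology M) {q\<in>points M. \<pi> q \<in> N}"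
    and proj_smooth: "\<And>f. f \<in> smooth_functions A \<Longrightarrow> (\<lambda>q. f (\<pi> q)) \<in> smooth_functions M"
    and linear_J: "bounded_linear J"
    and chart_compat: "\<And>p0. p0 \<in> points M \<Longrightarrow> \<exists>U \<phi> W \<Phi>. (U, \<phi>) \<in> atlas A \<and> (W, \<Phi>) \<in> atlas M \<and> p0 \<in> W \<and>
      (\<forall>p\<in>W. \<pi> p \<in> U) \<and> (\<forall>p\<in>W. \<forall>z\<in>U. \<iota> p z \<in> W \<and> \<Phi> (\<iota> p z) = \<Phi> p + J (\<phi> z - \<phi> (\<pi> p)))"
begin

abbreviation "proj_vec \<equiv> differential M A \<pi>"
abbreviation "lift_vec p \<equiv> differential A M (\<iota> p)"
abbreviation "lift Z \<equiv> (\<lambda>p. lift_vec p (Z (\<pi> p)))"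

lemma J_zero: "J 0 = 0"
  by (rule linear_0[OF bounded_linear.linear[OF linear_J]])

lemma obtain_chart_compat:
  assumes "p0 \<in> points M"
  obtains U \<phi> W \<Phi> where "(U, \<phi>) \<in> atlas A" "(W, \<Phi>) \<in> atlas M" "p0 \<in> W" "\<forall>p\<in>W. \<pi> p \<in> U"
    "\<forall>p\<in>W. \<forall>z\<in>U. \<iota> p z \<in> W \<and> \<Phi> (\<iota> p z) = \<Phi> p + J (\<phi> z - \<phi> (\<pi> p))"
  using chart_compat[OF assms] that by (elim exE conjE) blast

lemma slice_preimage_open: "open S \<Longrightarrow> open {u. a + J (u - c) \<in> S}"
  using open_vimage[of S "\<lambda>u. a + J (u - c)"]
  by (simp add: vimage_def continuous_intros bounded_linear.continuous_on[OF linear_J])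

text \<open>In compatible charts the inclusion of a slice is the affine map
  \<open>u \<mapsto> a + J (u - c)\<close>; smoothness along slices reduces to this case.\<close>

lemma cinf_on_slice:
  assumes h: "cinf_on S h" and S: "open S"
  shows "cinf_on {u. a + J (u - c) \<in> S} (\<lambda>u. h (a + J (u - c)))"
proof -
  let ?S = "{u. a + J (u - c) \<in> S}"
  have o: "open ?S" by (rule slice_preimage_open[OF S])
  have "cinf_on ?S (\<lambda>u. (a - J c) + J u)"
    by (intro cinf_on_add[OF o] cinf_on_const[OF o] cinf_on_bounded_linear[OF o linear_J])
  moreover have "(a - J c) + J u = a + J (u - c)" for u
    by (simp add: linear_diff[OF bounded_linear.linear[OF linear_J]])
  ultimately have "cinf_on ?S (\<lambda>u. a + J (u - c))" by simp
  then show ?thesis by (rule cinf_on_compose[OF o _ h]) auto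
qed

text \<open>Continuity of the inclusion of a slice. It restricts neighbourhoods of constant rank in
  the product to the base and to single fibres.\<close>

lemma incl_open:
  assumes p: "p \<in> points M" and N: "openin (manifold_topology M) N"
  shows "openin (manifold_topology A) {z\<in>points A. \<iota> p z \<in> N}"
proof (subst openin_subopen, intro ballI)
  fix z0 assume "z0 \<in> {z\<in>points A. \<iota> p z \<in> N}"
  then have z0: "z0 \<in> points A" and pN: "\<iota> p z0 \<in> N" by auto
  let ?p = "\<iota> p z0"
  have "?p \<in> points M" by (rule incl_points[OF p z0])
  then obtain U \<phi> W \<Phi> where U: "(U, \<phi>) \<in> atlas A" and W: "(W, \<Phi>) \<in> atlas M" "?p \<in> W"
    and UW: "\<forall>p\<in>W. \<pi> p \<in> U" "\<forall>p\<in>W. \<forall>z\<in>U. \<iota> p z \<in> W \<and> \<Phi> (\<iota> p z) = \<Phi> p + J (\<phi> z - \<phi> (\<pi> p))"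
    by (rule obtain_chart_compat)
  obtain r where r: "r > 0" "\<And>q. q \<in> W \<Longrightarrow> \<Phi> q \<in> ball (\<Phi> ?p) r \<Longrightarrow> q \<in> N"
    by (rule M.openin_T_ball[OF W(1) N pN W(2)]) blast
  let ?S = "{u. \<Phi> ?p + J (u - \<phi> z0) \<in> ball (\<Phi> ?p) r}"
  have "z0 \<in> {z\<in>U. \<phi> z \<in> ?S}"
    using bspec[OF UW(1) W(2)] r(1) by (simp add: proj_incl J_zero)
  moreover have "{z\<in>U. \<phi> z \<in> ?S} \<subseteq> {z\<in>points A. \<iota> p z \<in> N}"
  proof
    fix z assume z: "z \<in> {z\<in>U. \<phi> z \<in> ?S}"
    then have "\<iota> ?p z \<in> W \<and> \<Phi> (\<iota> ?p z) = \<Phi> ?p + J (\<phi> z - \<phi> (\<pi> ?p))"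
      using UW(2) W(2) by blast
    then have "\<iota> ?p z \<in> N" using r(2)[of "\<iota> ?p z"] z by (simp add: proj_incl)
    then show "z \<in> {z\<in>points A. \<iota> p z \<in> N}" using z A.chart_subset[OF U] by (auto simp: incl_incl)
  qed
  moreover have "openin (manifold_topology A) {z\<in>U. \<phi> z \<in> ?S}"
    by (rule A.openin_T_chart_preimage[OF U slice_preimage_open[OF open_ball]])
  ultimately show "\<exists>N'. openin (manifold_topology A) N' \<and> z0 \<in> N' \<and> N' \<subseteq> {z\<in>points A. \<iota> p z \<in> N}"
    by blast
qed

lemma incl_smooth:
  assumes p: "p \<in> points M" and f: "f \<in> M.Sm"
  shows "(\<lambda>z. f (\<iota> p z)) \<in> A.Sm"
proof (rule A.smooth_functions_intro)
  fix z0 assume z0: "z0 \<in> points A"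
  let ?p = "\<iota> p z0"
  have "?p \<in> points M" by (rule incl_points[OF p z0])
  then obtain U \<phi> W \<Phi> where U: "(U, \<phi>) \<in> atlas A" and W: "(W, \<Phi>) \<in> atlas M" "?p \<in> W"
    and UW': "\<forall>p\<in>W. \<pi> p \<in> U" "\<forall>p\<in>W. \<forall>z\<in>U. \<iota> p z \<in> W \<and> \<Phi> (\<iota> p z) = \<Phi> p + J (\<phi> z - \<phi> (\<pi> p))"
    by (rule obtain_chart_compat)
  have UW: "\<And>p. p \<in> W \<Longrightarrow> \<pi> p \<in> U"
      "\<And>p z. p \<in> W \<Longrightarrow> z \<in> U \<Longrightarrow> \<iota> p z \<in> W \<and> \<Phi> (\<iota> p z) = \<Phi> p + J (\<phi> z - \<phi> (\<pi> p))"
    using UW' by blast+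
  have z0U: "z0 \<in> U" using UW(1)[OF W(2)] by (simp add: proj_incl)
  obtain S h where S: "open S" "\<Phi> ?p \<in> S" "cinf_on S h" "\<And>q. q \<in> W \<Longrightarrow> \<Phi> q \<in> S \<Longrightarrow> f q = h (\<Phi> q)"
    by (rule M.smooth_in_chartE[OF f W]) blast
  have "smooth_in_chart U \<phi> z0 (\<lambda>z. f (\<iota> p z))"
    unfolding smooth_in_chart_def
  proof (intro exI[of _ "{u. \<Phi> ?p + J (u - \<phi> z0) \<in> S}"] exI[of _ "\<lambda>u. h (\<Phi> ?p + J (u - \<phi> z0))"] conjI ballI impI)
    show "open {u. \<Phi> ?p + J (u - \<phi> z0) \<in> S}" by (rule slice_preimage_open[OF S(1)])
    show "\<phi> z0 \<in> {u. \<Phi> ?p + J (u - \<phi> z0) \<in> S}" using S(2) by (simp add: J_zero)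
    show "cinf_on {u. \<Phi> ?p + J (u - \<phi> z0) \<in> S} (\<lambda>u. h (\<Phi> ?p + J (u - \<phi> z0)))"
      by (rule cinf_on_slice[OF S(3,1)])
    fix z assume z: "z \<in> U" "\<phi> z \<in> {u. \<Phi> ?p + J (u - \<phi> z0) \<in> S}"
    from UW(2)[OF W(2) z(1)] show "f (\<iota> p z) = h (\<Phi> ?p + J (\<phi> z - \<phi> z0))"
      using S(4)[of "\<iota> ?p z"] z(2) by (simp add: proj_incl incl_incl)
  qed
  with U z0U show "smooth_at A z0 (\<lambda>z. f (\<iota> p z))" by (rule A.smooth_atI)
qed

lemma lift_vec_apply: "f \<in> M.Sm \<Longrightarrow> lift_vec p w f = w (\<lambda>z. f (\<iota> p z))"
  by (simp add: differential_def comp_def)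

lemma proj_vec_apply: "f \<in> A.Sm \<Longrightarrow> proj_vec v f = v (\<lambda>q. f (\<pi> q))"
  by (simp add: differential_def comp_def)

lemma lift_vec_tangent:
  assumes p: "p \<in> points M" and w: "w \<in> A.TS (\<pi> p)"
  shows "lift_vec p w \<in> M.TS p"
  unfolding tangent_space_def
proof (intro CollectI conjI ballI allI impI)
  fix f h a c assume fh: "f \<in> M.Sm" "h \<in> M.Sm"
  note s = incl_smooth[OF p fh(1)] incl_smooth[OF p fh(2)]
  show "lift_vec p w (\<lambda>q. a * f q + c * h q) = a * lift_vec p w f + c * lift_vec p w h"
    using A.tangent_linear[OF w s] fh by (simp add: lift_vec_apply M.smooth_intros)
  show "lift_vec p w (\<lambda>q. f q * h q) = f p * lift_vec p w h + h p * lift_vec p w f"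
    using A.tangent_mult[OF w s] fh by (simp add: lift_vec_apply M.smooth_intros incl_proj)
qed (simp add: differential_def)

lemma proj_vec_tangent:
  assumes p: "p \<in> points M" and v: "v \<in> M.TS p"
  shows "proj_vec v \<in> A.TS (\<pi> p)"
  unfolding tangent_space_def
proof (intro CollectI conjI ballI allI impI)
  fix f h a c assume fh: "f \<in> A.Sm" "h \<in> A.Sm"
  note s = proj_smooth[OF fh(1)] proj_smooth[OF fh(2)]
  show "proj_vec v (\<lambda>q. a * f q + c * h q) = a * proj_vec v f + c * proj_vec v h"
    using M.tangent_linear[OF v s] fh by (simp add: proj_vec_apply A.smooth_intros)
  show "proj_vec v (\<lambda>q. f q * h q) = f (\<pi> p) * proj_vec v h + h (\<pi> p) * proj_vec v f"
    using M.tangent_mult[OF v s] fh by (simp add: proj_vec_apply A.smooth_intros)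
qed (simp add: differential_def)

lemma proj_vec_lincomb: "proj_vec (\<lambda>f. a * u f + c * v f) = (\<lambda>f. a * proj_vec u f + c * proj_vec v f)"
  by (auto simp: differential_def)

lemma proj_vec_add: "proj_vec (\<lambda>f. u f + v f) = (\<lambda>f. proj_vec u f + proj_vec v f)"
  by (auto simp: differential_def)

lemma proj_vec_sum: "proj_vec (\<lambda>f. \<Sum>i\<in>I. u i f) = (\<lambda>f. \<Sum>i\<in>I. proj_vec (u i) f)"
  by (auto simp: differential_def)

lemma proj_vec_zero: "proj_vec (\<lambda>f. 0) = (\<lambda>f. 0)"
  by (auto simp: differential_def)

lemma lift_vec_lincomb: "lift_vec p (\<lambda>f. a * u f + c * v f) = (\<lambda>f. a * lift_vec p u f + c * lift_vec p v f)"
  by (auto simp: differential_def)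

lemma proj_lift_vec:
  assumes p: "p \<in> points M" and w: "w \<in> A.TS (\<pi> p)"
  shows "proj_vec (lift_vec p w) = w"
proof
  fix f show "proj_vec (lift_vec p w) f = w f"
    using A.tangent_nonsmooth[OF w]
    by (cases "f \<in> A.Sm") (simp_all add: proj_vec_apply lift_vec_apply proj_smooth proj_incl, simp add: differential_def)
qed

text \<open>A lifted vector differentiates along its slice only. Functions that are not smooth are
  covered by the default value 0 of \<open>differential\<close>.\<close>

lemma lift_vec_const:
  assumes p: "p \<in> points M" and w: "w \<in> A.TS (\<pi> p)"
    and const: "\<And>z. z \<in> points A \<Longrightarrow> f (\<iota> p z) = c"
  shows "lift_vec p w f = 0"
proof (cases "f \<in> M.Sm")
  case True
  have "w (\<lambda>z. f (\<iota> p z)) = w (\<lambda>z. c)"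
    by (rule A.tangent_cong[OF w proj_points[OF p]]) (rule const)
  then show ?thesis using A.tangent_const[OF w] lift_vec_apply[OF True] by simp
qed (simp add: differential_def)

text \<open>The function \<open>f \<circ> \<iota> q\<close> to which the vector is applied changes
  with \<open>q\<close>, so smoothness of \<open>Z\<close> alone does not suffice. In compatible
  charts its derivative along \<open>d\<close> is the derivative of one fixed representative
  \<open>h\<close> at \<open>\<Phi> q\<close> in direction \<open>J d\<close>, which is smooth in
  \<open>q\<close>.\<close>

lemma lift_VF:
  assumes Z: "Z \<in> A.VF"
  shows "lift Z \<in> M.VF"
proof (rule M.VF_intro)
  show "lift Z p \<in> M.TS p" if "p \<in> points M" for p
    by (rule lift_vec_tangent[OF that A.VF_tangent[OF Z proj_points[OF that]]])
  fix f p0 assume f: "f \<in> M.Sm" and p0: "p0 \<in> points M"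
  obtain U \<phi> W \<Phi> where U: "(U, \<phi>) \<in> atlas A" and W: "(W, \<Phi>) \<in> atlas M" "p0 \<in> W"
    and UW': "\<forall>p\<in>W. \<pi> p \<in> U" "\<forall>p\<in>W. \<forall>z\<in>U. \<iota> p z \<in> W \<and> \<Phi> (\<iota> p z) = \<Phi> p + J (\<phi> z - \<phi> (\<pi> p))"
    by (rule obtain_chart_compat[OF p0])
  have UW: "\<And>p. p \<in> W \<Longrightarrow> \<pi> p \<in> U"
      "\<And>p z. p \<in> W \<Longrightarrow> z \<in> U \<Longrightarrow> \<iota> p z \<in> W \<and> \<Phi> (\<iota> p z) = \<Phi> p + J (\<phi> z - \<phi> (\<pi> p))"
    using UW' by blast+
  have "\<pi> p0 \<in> U" using UW(1) W(2) by blast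
  then obtain N E x where F: "A.local_frame N E x" and N: "\<pi> p0 \<in> N" "N \<subseteq> U"
    "\<And>d q. d \<in> A.model_basis \<Longrightarrow> q \<in> N \<Longrightarrow> E d q = A.coord_vector U \<phi> d q"
    by (rule A.chart_frame[OF U]) blast
  obtain S h where S: "open S" "\<Phi> p0 \<in> S" "cinf_on S h" "\<And>q. q \<in> W \<Longrightarrow> \<Phi> q \<in> S \<Longrightarrow> f q = h (\<Phi> q)"
    by (rule M.smooth_in_chartE[OF f W]) blast
  let ?O = "{q\<in>W. \<Phi> q \<in> S} \<inter> {q\<in>points M. \<pi> q \<in> N}"
  let ?k = "\<lambda>q. \<Sum>d\<in>A.model_basis. vf_apply Z (x d) (\<pi> q) * frechet_derivative h (at (\<Phi> q)) (J d)"
  have "smooth_at M p0 ?k"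
  proof (intro M.smooth_at_sum[OF p0] M.smooth_at_mult)
    fix d assume d: "d \<in> A.model_basis"
    show "smooth_at M p0 (\<lambda>q. vf_apply Z (x d) (\<pi> q))"
      by (rule M.smooth_functionsD[OF proj_smooth[OF A.VF_smooth[OF Z A.local_frame_coord_smooth[OF F d]]] p0])
    have "smooth_in_chart W \<Phi> p0 (\<lambda>q. frechet_derivative h (at (\<Phi> q)) (J d))"
      unfolding smooth_in_chart_def
      by (rule exI[of _ S], rule exI[of _ "\<lambda>u. frechet_derivative h (at u) (J d)"])
        (simp add: S(1,2) cinf_on_frechet[OF S(3)])
    with W show "smooth_at M p0 (\<lambda>q. frechet_derivative h (at (\<Phi> q)) (J d))" by (rule M.smooth_atI)
  qed
  then show "smooth_at M p0 (\<lambda>q. lift Z q f)"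
  proof (rule M.smooth_at_local)
    show "openin (manifold_topology M) ?O"
      by (intro openin_Int M.openin_T_chart_preimage[OF W(1) S(1)] proj_open[OF A.local_frame_open[OF F]])
    show "p0 \<in> ?O" using W S N p0 by simp
    fix q assume q: "q \<in> ?O"
    then have qM: "q \<in> points M" and qW: "q \<in> W" and qS: "\<Phi> q \<in> S" and qN: "\<pi> q \<in> N" by auto
    note fs = incl_smooth[OF qM f]
    have der: "A.coord_vector U \<phi> d (\<pi> q) (\<lambda>z. f (\<iota> q z)) = frechet_derivative h (at (\<Phi> q)) (J d)"
      if d: "d \<in> A.model_basis" for d
    proof -
      let ?S = "{u. \<Phi> q + J (u - \<phi> (\<pi> q)) \<in> S}"
      let ?h = "\<lambda>u. h (\<Phi> q + J (u - \<phi> (\<pi> q)))"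
      have "chart_deriv U \<phi> d (\<pi> q) (\<lambda>z. f (\<iota> q z)) = frechet_derivative ?h (at (\<phi> (\<pi> q))) d"
      proof (rule A.chart_deriv_eq[OF U _ _ slice_preimage_open[OF S(1)] _ cinf_on_slice[OF S(3,1)]])
        show "\<pi> q \<in> U" using UW(1) qW by blast
        show "d \<in> model A" using d A.model_basis(1) by blast
        show "\<phi> (\<pi> q) \<in> ?S" using qS by (simp add: J_zero)
        fix z assume z: "z \<in> U" "\<phi> z \<in> ?S"
        from UW(2)[OF qW z(1)] show "f (\<iota> q z) = ?h (\<phi> z)" using S(4)[of "\<iota> q z"] z(2) by simp
      qed
      also have "frechet_derivative ?h (at (\<phi> (\<pi> q))) = (\<lambda>v. frechet_derivative h (at (\<Phi> q)) (J v))"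
      proof (rule frechet_derivative_at[symmetric])
        have dJ: "((\<lambda>u. \<Phi> q + J (u - \<phi> (\<pi> q))) has_derivative J) (at (\<phi> (\<pi> q)))"
        proof -
          have "((\<lambda>u. u - \<phi> (\<pi> q)) has_derivative (\<lambda>v. v)) (at (\<phi> (\<pi> q)))"
            by (auto intro!: derivative_eq_intros)
          from has_derivative_add[OF has_derivative_const bounded_linear.has_derivative[OF linear_J this]]
          show ?thesis by simp
        qed
        have "(h has_derivative frechet_derivative h (at (\<Phi> q))) (at (\<Phi> q + J (\<phi> (\<pi> q) - \<phi> (\<pi> q))))"
          using cinf_on_has_derivative[OF S(3) qS] by (simp add: J_zero)
        from has_derivative_compose[OF dJ this]
        show "(?h has_derivative (\<lambda>v. frechet_derivative h (at (\<Phi> q)) (J v))) (at (\<phi> (\<pi> q)))" .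
      qed
      finally show ?thesis using fs by (simp add: A.coord_vector_def)
    qed
    have "lift Z q f = Z (\<pi> q) (\<lambda>z. f (\<iota> q z))" by (rule lift_vec_apply[OF f])
    also have "\<dots> = (\<Sum>d\<in>A.model_basis. Z (\<pi> q) (x d) * E d (\<pi> q) (\<lambda>z. f (\<iota> q z)))"
      by (rule A.local_frame_expand[OF F qN A.VF_tangent[OF Z proj_points[OF qM]]])
    also have "\<dots> = ?k q"
      by (rule sum.cong) (simp_all add: N(3)[OF _ qN] der vf_apply_def)
    finally show "?k q = lift Z q f" by simp
  qed
qed

text \<open>The projections of a field on \<open>M\<close> need not form a field on
  \<open>A\<close>, so smoothness of \<open>g\<close> on fields does not apply directly. In a local
  frame of \<open>A\<close> the expression becomes a sum of Gram entries with coefficients that are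
  smooth on \<open>M\<close>.\<close>

lemma smooth_proj_metric:
  assumes g: "metric_mfd A g" and X: "X \<in> M.VF" and Y: "Y \<in> M.VF"
  shows "(\<lambda>q. g (\<pi> q) (proj_vec (X q)) (proj_vec (Y q))) \<in> M.Sm"
proof (rule M.smooth_functions_intro)
  interpret g: metric_mfd A g by (rule g)
  fix p assume p: "p \<in> points M"
  obtain N E x where F: "A.local_frame N E x" and N: "\<pi> p \<in> N" by (rule A.obtain_frame[OF proj_points[OF p]])
  let ?k = "\<lambda>q. \<Sum>d\<in>A.model_basis. \<Sum>d'\<in>A.model_basis.
    vf_apply X (\<lambda>q. x d (\<pi> q)) q * vf_apply Y (\<lambda>q. x d' (\<pi> q)) q * metric_apply g (E d) (E d') (\<pi> q)"
  have "smooth_at M p ?k"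
    by (intro M.smooth_functionsD[OF _ p] M.smooth_intros M.VF_smooth X Y proj_smooth g.g_smooth
        A.local_frame_VF[OF F] A.local_frame_coord_smooth[OF F])
  then show "smooth_at M p (\<lambda>q. g (\<pi> q) (proj_vec (X q)) (proj_vec (Y q)))"
  proof (rule M.smooth_at_local[OF _ proj_open[OF A.local_frame_open[OF F]]])
    show "p \<in> {q\<in>points M. \<pi> q \<in> N}" using p N by simp
    fix q assume "q \<in> {q\<in>points M. \<pi> q \<in> N}"
    then have q: "q \<in> points M" "\<pi> q \<in> N" by auto
    have qA: "\<pi> q \<in> points A" by (rule proj_points[OF q(1)])
    have t: "E d (\<pi> q) \<in> A.TS (\<pi> q)" if "d \<in> A.model_basis" for d
      by (rule A.VF_tangent[OF A.local_frame_VF[OF F that] qA])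
    have expand: "proj_vec (X q) = (\<lambda>f. \<Sum>d\<in>A.model_basis. vf_apply X (\<lambda>q. x d (\<pi> q)) q * E d (\<pi> q) f)"
      if X: "X \<in> M.VF" for X
    proof
      fix f
      have "proj_vec (X q) f = (\<Sum>d\<in>A.model_basis. proj_vec (X q) (x d) * E d (\<pi> q) f)"
        by (rule A.local_frame_expand[OF F q(2) proj_vec_tangent[OF q(1) M.VF_tangent[OF X q(1)]]])
      also have "\<dots> = (\<Sum>d\<in>A.model_basis. vf_apply X (\<lambda>q. x d (\<pi> q)) q * E d (\<pi> q) f)"
        by (rule sum.cong) (simp_all add: proj_vec_apply A.local_frame_coord_smooth[OF F] vf_apply_apply)
      finally show "proj_vec (X q) f = (\<Sum>d\<in>A.model_basis. vf_apply X (\<lambda>q. x d (\<pi> q)) q * E d (\<pi> q) f)" .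
    qed
    show "?k q = g (\<pi> q) (proj_vec (X q)) (proj_vec (Y q))"
      unfolding expand[OF X] expand[OF Y]
      by (simp add: g.g_bilinear_sum[OF qA t t] metric_apply_apply)
  qed
qed

end

section \<open>Products of manifolds\<close>

definition prod_chart :: "('a \<Rightarrow> 'd) \<Rightarrow> ('m::finite \<Rightarrow> 'c \<Rightarrow> 'e) \<Rightarrow> 'a \<times> ('m \<Rightarrow> 'c) \<Rightarrow> 'd \<times> ('e ^ 'm)" where
  "prod_chart \<phi> \<psi> = (\<lambda>(x, y). (\<phi> x, \<chi> j. \<psi> j (y j)))"

lemma prod_chart_apply: "prod_chart \<phi> \<psi> p = (\<phi> (fst p), \<chi> j. \<psi> j (snd p j))"
  by (simp add: prod_chart_def split_beta)

text \<open>Boxes of points; \<open>vec_box\<close> plays the same role for chart values, where the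
  fibre components form a vector instead of a function.\<close>

definition pbox :: "'a set \<Rightarrow> ('m \<Rightarrow> 'c set) \<Rightarrow> ('a \<times> ('m \<Rightarrow> 'c)) set" where
  "pbox U V = U \<times> {y. \<forall>j. y j \<in> V j}"

definition vec_box :: "'d set \<Rightarrow> ('m::finite \<Rightarrow> 'e set) \<Rightarrow> ('d \<times> ('e ^ 'm)) set" where
  "vec_box S W = S \<times> {v. \<forall>j. v $ j \<in> W j}"

lemma mem_pbox: "p \<in> pbox U V \<longleftrightarrow> fst p \<in> U \<and> (\<forall>j. snd p j \<in> V j)"
  by (cases p) (simp add: pbox_def)

lemma mem_vec_box: "z \<in> vec_box S W \<longleftrightarrow> fst z \<in> S \<and> (\<forall>j. snd z $ j \<in> W j)"
  by (cases z) (simp add: vec_box_def)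

lemma pbox_Int: "pbox U V \<inter> pbox U' V' = pbox (U \<inter> U') (\<lambda>j. V j \<inter> V' j)"
  by (auto simp: mem_pbox)

lemma prod_chart_image: "prod_chart \<phi> \<psi> ` pbox U V = vec_box (\<phi> ` U) (\<lambda>j. \<psi> j ` V j)"
proof
  show "prod_chart \<phi> \<psi> ` pbox U V \<subseteq> vec_box (\<phi> ` U) (\<lambda>j. \<psi> j ` V j)"
    by (auto simp: mem_pbox mem_vec_box prod_chart_apply)
  show "vec_box (\<phi> ` U) (\<lambda>j. \<psi> j ` V j) \<subseteq> prod_chart \<phi> \<psi> ` pbox U V"
  proof
    fix z assume z: "z \<in> vec_box (\<phi> ` U) (\<lambda>j. \<psi> j ` V j)"
    then obtain x where x: "x \<in> U" "fst z = \<phi> x" by (auto simp: mem_vec_box)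
    have "\<forall>j. \<exists>t. t \<in> V j \<and> snd z $ j = \<psi> j t" using z by (auto simp: mem_vec_box)
    then obtain y where y: "\<forall>j. y j \<in> V j \<and> snd z $ j = \<psi> j (y j)" by (rule exE[OF choice])
    have "z = prod_chart \<phi> \<psi> (x, y)"
      using x y by (simp add: prod_chart_apply prod_eq_iff vec_eq_iff)
    moreover have "(x, y) \<in> pbox U V" using x y by (simp add: mem_pbox)
    ultimately show "z \<in> prod_chart \<phi> \<psi> ` pbox U V" by blast
  qed
qed

lemma prod_chart_inj:
  assumes "inj_on \<phi> U" "\<And>j. inj_on (\<psi> j) (V j)"
  shows "inj_on (prod_chart \<phi> \<psi>) (pbox U V)"
proof (rule inj_onI)
  fix p q assume pq: "p \<in> pbox U V" "q \<in> pbox U V" "prod_chart \<phi> \<psi> p = prod_chart \<phi> \<psi> q"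
  have "fst p = fst q" using inj_onD[OF assms(1)] pq by (auto simp: mem_pbox prod_chart_apply)
  moreover have "snd p j = snd q j" for j
    using inj_onD[OF assms(2)[of j]] pq by (auto simp: mem_pbox prod_chart_apply vec_eq_iff)
  ultimately show "p = q" by (simp add: prod_eq_iff fun_eq_iff)
qed

lemma open_vec_box:
  fixes S :: "'d::topological_space set" and W :: "'m::finite \<Rightarrow> 'e::topological_space set"
  assumes "open S" "\<And>j. open (W j)"
  shows "open (vec_box S W)"
  unfolding vec_box_def by (intro open_Times open_vector_box assms allI)

lemma openin_vec_box:
  assumes "openin (top_of_set A) S" "\<And>j. openin (top_of_set (C j)) (W j)"
  shows "openin (top_of_set (vec_box A C)) (vec_box S W)"
proof -
  obtain S' where S': "open S'" "S = A \<inter> S'" using assms(1) by (auto simp: openin_open)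
  have "\<forall>j. \<exists>W'. open W' \<and> W j = C j \<inter> W'" using assms(2) by (auto simp: openin_open)
  then obtain W' where W': "\<forall>j. open (W' j) \<and> W j = C j \<inter> W' j" by (rule exE[OF choice])
  have "open (vec_box S' W')" using S' W' by (intro open_vec_box) auto
  moreover have "vec_box S W = vec_box A C \<inter> vec_box S' W'"
    using S' W' by (auto simp: mem_vec_box)
  ultimately show ?thesis by (auto simp: openin_open)
qed

lemma bounded_linear_axis: "bounded_linear (axis j :: 'e::euclidean_space \<Rightarrow> 'e ^ 'm::finite)"
  by (rule linear_conv_bounded_linear[THEN iffD1], rule linearI) (auto simp: axis_def vec_eq_iff)

lemma bounded_linear_Pair_0: "bounded_linear (\<lambda>u::'d::euclidean_space. (u, 0::'e::euclidean_space))"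
  and bounded_linear_0_Pair: "bounded_linear (\<lambda>w::'e. (0::'d, w))"
  by (intro bounded_linear_Pair bounded_linear_ident bounded_linear_zero)+

lemma cinf_on_prod:
  fixes f :: "'k::euclidean_space \<Rightarrow> 'd::euclidean_space" and g :: "'m::finite \<Rightarrow> 'k \<Rightarrow> 'e::euclidean_space"
  assumes S: "open S" and f: "cinf_on S f" and g: "\<And>j. cinf_on S (g j)"
  shows "cinf_on S (\<lambda>z. (f z, \<chi> j. g j z))"
proof -
  have "cinf_on S (\<lambda>z. (f z, 0) + (\<Sum>j\<in>UNIV. (0, axis j (g j z))))"
    by (intro cinf_on_add[OF S] cinf_on_sum[OF S] cinf_on_linear_comp[OF S bounded_linear_Pair_0]
        cinf_on_linear_comp[OF S bounded_linear_0_Pair] cinf_on_linear_comp[OF S bounded_linear_axis] f g)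
  moreover have "(f z, 0) + (\<Sum>j\<in>UNIV. (0, axis j (g j z))) = (f z, \<chi> j. g j z)" for z
  proof -
    have "(\<Sum>j\<in>UNIV. axis j (g j z)) = (\<chi> j. g j z)"
      by (simp add: vec_eq_iff axis_def)
    then show ?thesis by (simp add: prod_eq_iff fst_sum snd_sum)
  qed
  ultimately show ?thesis by simp
qed

locale product_mfd = B: mfd B for B :: "('a, 'd::euclidean_space) manifold" +
  fixes F :: "'m::finite \<Rightarrow> ('c, 'e::euclidean_space) manifold"
  assumes F_mfd: "\<And>l. mfd (F l)"
begin

sublocale F: mfd "F l" for l by (rule F_mfd)

abbreviation "PM \<equiv> product_manifold B F"

lemma points_PM: "points PM = pbox (points B) (\<lambda>j. points (F j))"
  by (simp add: product_manifold_def pbox_def)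

lemma model_PM: "model PM = vec_box (model B) (\<lambda>j. model (F j))"
  by (simp add: product_manifold_def vec_box_def)

lemma atlas_PM: "(W, \<Phi>) \<in> atlas PM \<longleftrightarrow> (\<exists>U \<phi> V \<psi>. W = pbox U V \<and> \<Phi> = prod_chart \<phi> \<psi> \<and>
    (U, \<phi>) \<in> atlas B \<and> (\<forall>j. (V j, \<psi> j) \<in> atlas (F j)))"
  by (simp add: product_manifold_def pbox_def prod_chart_def)

lemma atlas_PM_E:
  assumes "(W, \<Phi>) \<in> atlas PM"
  obtains U \<phi> V \<psi> where "W = pbox U V" "\<Phi> = prod_chart \<phi> \<psi>" "(U, \<phi>) \<in> atlas B" "\<forall>j. (V j, \<psi> j) \<in> atlas (F j)"
  using assms unfolding atlas_PM by blast

lemma obtain_prod_chart: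
  assumes "p \<in> points PM"
  obtains U \<phi> V \<psi> where "(U, \<phi>) \<in> atlas B" "\<forall>j. (V j, \<psi> j) \<in> atlas (F j)" "p \<in> pbox U V"
    "(pbox U V, prod_chart \<phi> \<psi>) \<in> atlas PM"
proof -
  have p: "fst p \<in> points B" "\<forall>j. snd p j \<in> points (F j)" using assms by (auto simp: points_PM mem_pbox)
  obtain U \<phi> where U: "(U, \<phi>) \<in> atlas B" "fst p \<in> U" by (rule B.obtain_chart[OF p(1)])
  have "\<forall>j. \<exists>c. c \<in> atlas (F j) \<and> snd p j \<in> fst c"
    using F.obtain_chart p(2) by (metis fst_conv)
  then obtain c where c: "\<forall>j. c j \<in> atlas (F j) \<and> snd p j \<in> fst (c j)" by (rule exE[OF choice])
  have V: "\<forall>j. (fst (c j), snd (c j)) \<in> atlas (F j)" using c by simp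
  have "(pbox U (\<lambda>j. fst (c j)), prod_chart \<phi> (\<lambda>j. snd (c j))) \<in> atlas PM"
    unfolding atlas_PM using U V by blast
  then show ?thesis using that[OF U(1) V] U(2) c by (simp add: mem_pbox)
qed

lemma chart_inj_PM: "(W, \<Phi>) \<in> atlas PM \<Longrightarrow> inj_on \<Phi> W"
  by (erule atlas_PM_E) (auto intro!: prod_chart_inj B.chart_inj F.chart_inj)

lemma openin_PM: "openin (manifold_topology PM) S \<longleftrightarrow> S \<subseteq> points PM \<and>
     (\<forall>(W, \<Phi>)\<in>atlas PM. openin (top_of_set (model PM)) (\<Phi> ` (S \<inter> W)))"
  by (rule openin_manifold_topology_if_inj) (rule chart_inj_PM)

lemma openin_pbox:
  assumes N: "openin (manifold_topology B) N" and N': "\<And>j. openin (manifold_topology (F j)) (N' j)"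
  shows "openin (manifold_topology PM) (pbox N N')"
  unfolding openin_PM
proof (intro conjI ballI)
  show "pbox N N' \<subseteq> points PM"
    using subsetD[OF B.openin_T_subset[OF N]] subsetD[OF F.openin_T_subset[OF N']]
    by (auto simp: points_PM mem_pbox)
  fix c assume "c \<in> atlas PM"
  then obtain W \<Phi> where c: "c = (W, \<Phi>)" "(W, \<Phi>) \<in> atlas PM" by (cases c) auto
  obtain U \<phi> V \<psi> where W: "W = pbox U V" "\<Phi> = prod_chart \<phi> \<psi>" "(U, \<phi>) \<in> atlas B" "\<forall>j. (V j, \<psi> j) \<in> atlas (F j)"
    by (rule atlas_PM_E[OF c(2)])
  have "openin (top_of_set (model B)) (\<phi> ` (N \<inter> U))" using N W(3) unfolding B.openin_T by auto
  moreover have "openin (top_of_set (model (F j))) (\<psi> j ` (N' j \<inter> V j))" for j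
    using N'[of j] W(4) unfolding F.openin_T by auto
  ultimately have "openin (top_of_set (model PM)) (\<Phi> ` (pbox N N' \<inter> W))"
    unfolding W(1,2) pbox_Int prod_chart_image model_PM by (rule openin_vec_box)
  then show "case c of (W, \<Phi>) \<Rightarrow> openin (top_of_set (model PM)) (\<Phi> ` (pbox N N' \<inter> W))"
    by (simp add: c(1))
qed

text \<open>Smooth extensions of the transition maps of the factors, one for each factor, are
  combined on a box; finiteness of the index type keeps the box open.\<close>

lemma prod_transition_smooth:
  assumes U: "(U, \<phi>) \<in> atlas B" "(U', \<phi>') \<in> atlas B"
    and V: "\<forall>j. (V j, \<psi> j) \<in> atlas (F j)" "\<forall>j. (V' j, \<psi>' j) \<in> atlas (F j)"
  shows "smooth_on (prod_chart \<phi> \<psi> ` (pbox U V \<inter> pbox U' V'))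
    (prod_chart \<phi>' \<psi>' \<circ> inv_into (pbox U V) (prod_chart \<phi> \<psi>))"
  unfolding smooth_on_def
proof
  fix z assume "z \<in> prod_chart \<phi> \<psi> ` (pbox U V \<inter> pbox U' V')"
  then obtain p where p: "p \<in> pbox U V" "p \<in> pbox U' V'" "z = prod_chart \<phi> \<psi> p" by auto
  have "\<phi> (fst p) \<in> \<phi> ` (U \<inter> U')" using p by (auto simp: mem_pbox)
  then obtain S0 h0 where S0: "open S0" "\<phi> (fst p) \<in> S0" "cinf_on S0 h0"
    "\<forall>u\<in>\<phi> ` (U \<inter> U') \<inter> S0. h0 u = (\<phi>' \<circ> inv_into U \<phi>) u"
    using B.transition[OF U] unfolding smooth_on_def cinf_on_def by blast
  have "\<exists>S h. open S \<and> \<psi> j (snd p j) \<in> S \<and> cinf_on S h \<and>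
      (\<forall>u\<in>\<psi> j ` (V j \<inter> V' j) \<inter> S. h u = (\<psi>' j \<circ> inv_into (V j) (\<psi> j)) u)" for j
  proof -
    have "\<psi> j (snd p j) \<in> \<psi> j ` (V j \<inter> V' j)" using p by (auto simp: mem_pbox)
    then show ?thesis
      using F.transition[OF spec[OF V(1), of j] spec[OF V(2), of j]]
      unfolding smooth_on_def cinf_on_def by blast
  qed
  then have "\<forall>j. \<exists>c. open (fst c) \<and> \<psi> j (snd p j) \<in> fst c \<and> cinf_on (fst c) (snd c) \<and>
      (\<forall>u\<in>\<psi> j ` (V j \<inter> V' j) \<inter> fst c. snd c u = (\<psi>' j \<circ> inv_into (V j) (\<psi> j)) u)"
    by (metis fst_conv snd_conv)
  then obtain c where c: "\<forall>j. open (fst (c j)) \<and> \<psi> j (snd p j) \<in> fst (c j) \<and> cinf_on (fst (c j)) (snd (c j)) \<and>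
      (\<forall>u\<in>\<psi> j ` (V j \<inter> V' j) \<inter> fst (c j). snd (c j) u = (\<psi>' j \<circ> inv_into (V j) (\<psi> j)) u)"
    by (rule exE[OF choice])
  let ?S = "vec_box S0 (\<lambda>j. fst (c j))"
  let ?h = "\<lambda>z. (h0 (fst z), \<chi> j. snd (c j) (snd z $ j))"
  have oS: "open ?S" using S0 c by (intro open_vec_box) auto
  have "cinf_on ?S ?h"
  proof (rule cinf_on_prod[OF oS])
    show "cinf_on ?S (\<lambda>z. h0 (fst z))"
      by (rule cinf_on_compose[OF oS cinf_on_bounded_linear[OF oS bounded_linear_fst] S0(3)])
        (auto simp: mem_vec_box)
    have bl: "bounded_linear (\<lambda>z::'d \<times> ('e ^ 'm). snd z $ j)" for j
      by (intro bounded_linear_compose[OF bounded_linear_vec_nth] bounded_linear_snd)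
    show "cinf_on ?S (\<lambda>z. snd (c j) (snd z $ j))" for j
      by (rule cinf_on_compose[OF oS cinf_on_bounded_linear[OF oS bl]])
        (use c in \<open>auto simp: mem_vec_box\<close>)
  qed
  moreover have "z \<in> ?S" using p(3) S0(2) c by (simp add: mem_vec_box prod_chart_apply)
  moreover have "?h z' = (prod_chart \<phi>' \<psi>' \<circ> inv_into (pbox U V) (prod_chart \<phi> \<psi>)) z'"
    if z': "z' \<in> prod_chart \<phi> \<psi> ` (pbox U V \<inter> pbox U' V') \<inter> ?S" for z'
  proof -
    obtain q where q: "q \<in> pbox U V" "q \<in> pbox U' V'" "z' = prod_chart \<phi> \<psi> q" using z' by auto
    have inv: "inv_into (pbox U V) (prod_chart \<phi> \<psi>) z' = q"
      unfolding q(3) using V(1)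
      by (intro inv_into_f_f prod_chart_inj B.chart_inj[OF U(1)] F.chart_inj q(1)) auto
    have "h0 (\<phi> (fst q)) = \<phi>' (inv_into U \<phi> (\<phi> (fst q)))"
      using S0(4) q z' by (auto simp: mem_pbox mem_vec_box prod_chart_apply)
    then have 0: "h0 (\<phi> (fst q)) = \<phi>' (fst q)"
      using q(1) B.chart_inj[OF U(1)] by (simp add: mem_pbox inv_into_f_f)
    have "snd (c j) (\<psi> j (snd q j)) = \<psi>' j (inv_into (V j) (\<psi> j) (\<psi> j (snd q j)))" for j
    proof -
      have "\<psi> j (snd q j) \<in> \<psi> j ` (V j \<inter> V' j) \<inter> fst (c j)"
        using q z' by (auto simp: mem_pbox mem_vec_box prod_chart_apply)
      then show ?thesis using c by auto
    qed
    then have "snd (c j) (\<psi> j (snd q j)) = \<psi>' j (snd q j)" for j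
      using q(1) F.chart_inj[OF spec[OF V(1)], of j] by (simp add: mem_pbox inv_into_f_f)
    then show ?thesis using 0 unfolding comp_apply inv by (simp add: q(3) prod_chart_apply)
  qed
  ultimately show "\<exists>S h. open S \<and> z \<in> S \<and> (\<forall>k. ck_on k S h) \<and>
    (\<forall>z'\<in>prod_chart \<phi> \<psi> ` (pbox U V \<inter> pbox U' V') \<inter> S. h z' = (prod_chart \<phi>' \<psi>' \<circ> inv_into (pbox U V) (prod_chart \<phi> \<psi>)) z')"
    using oS unfolding cinf_on_def by blast
qed

lemma Hausdorff_PM: "Hausdorff_space (manifold_topology PM)"
proof -
  have top: "topspace (manifold_topology PM) \<subseteq> points PM"
    using openin_PM[of "topspace (manifold_topology PM)"] openin_topspace by blast
  show ?thesis
    unfolding Hausdorff_space_def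
  proof (intro allI impI)
    fix p q assume pq: "p \<in> topspace (manifold_topology PM) \<and> q \<in> topspace (manifold_topology PM) \<and> p \<noteq> q"
    then have pM: "p \<in> points PM" "q \<in> points PM" using top by auto
    then have pts: "fst p \<in> points B" "fst q \<in> points B" "\<And>j. snd p j \<in> points (F j)" "\<And>j. snd q j \<in> points (F j)"
      by (auto simp: points_PM mem_pbox)
    have "fst p \<noteq> fst q \<or> (\<exists>j. snd p j \<noteq> snd q j)" using pq by (auto simp: prod_eq_iff)
    then show "\<exists>U V. openin (manifold_topology PM) U \<and> openin (manifold_topology PM) V \<and> p \<in> U \<and> q \<in> V \<and> disjnt U V"
    proof
      assume "fst p \<noteq> fst q"
      then obtain N N' where N: "openin (manifold_topology B) N" "openin (manifold_topology B) N'"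
        "fst p \<in> N" "fst q \<in> N'" "disjnt N N'"
        using B.Hausdorff pts(1,2) unfolding Hausdorff_space_def B.topspace_T by blast
      let ?b = "\<lambda>N. pbox N (\<lambda>j. points (F j))"
      have "openin (manifold_topology PM) (?b N)" "openin (manifold_topology PM) (?b N')"
        by (intro openin_pbox N F.openin_T_points)+
      moreover have "p \<in> ?b N" "q \<in> ?b N'" "disjnt (?b N) (?b N')"
        using N pts by (auto simp: mem_pbox disjnt_iff)
      ultimately show ?thesis by blast
    next
      assume "\<exists>j. snd p j \<noteq> snd q j"
      then obtain j where "snd p j \<noteq> snd q j" by blast
      then obtain N N' where N: "openin (manifold_topology (F j)) N" "openin (manifold_topology (F j)) N'"
        "snd p j \<in> N" "snd q j \<in> N'" "disjnt N N'"
        using F.Hausdorff[of j] pts(3,4)[of j] unfolding Hausdorff_space_def F.topspace_T by blast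
      let ?b = "\<lambda>N. pbox (points B) (\<lambda>i. if i = j then N else points (F i))"
      have "openin (manifold_topology PM) (?b N)" "openin (manifold_topology PM) (?b N')"
        using N F.openin_T_points by (intro openin_pbox B.openin_T_points; simp)+
      moreover have "p \<in> ?b N" "q \<in> ?b N'" using N pts by (auto simp: mem_pbox)
      moreover have "disjnt (?b N) (?b N')"
        unfolding disjnt_iff
      proof
        fix z :: "'a \<times> ('m \<Rightarrow> 'c)"
        have "\<not> (snd z j \<in> N \<and> snd z j \<in> N')" using N(5) by (auto simp: disjnt_iff)
        moreover have "snd z j \<in> N" if "z \<in> ?b N" for N :: "'c set" using that by (auto simp: mem_pbox split: if_splits dest: spec[of _ j])
        ultimately show "\<not> (z \<in> ?b N \<and> z \<in> ?b N')" by blast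
      qed
      ultimately show ?thesis by blast
    qed
  qed
qed

lemma mfd_PM: "mfd PM"
proof
  show "subspace (model PM)"
  proof -
    have "subspace {v. \<forall>j. v $ j \<in> model (F j)}"
      using F.subspace_model by (auto simp: subspace_def)
    then show ?thesis unfolding model_PM vec_box_def using B.subspace_model by (intro subspace_Times)
  qed
  show "(\<Union>(W, \<Phi>)\<in>atlas PM. W) = points PM"
  proof
    show "(\<Union>(W, \<Phi>)\<in>atlas PM. W) \<subseteq> points PM"
    proof
      fix p assume "p \<in> (\<Union>(W, \<Phi>)\<in>atlas PM. W)"
      then obtain W \<Phi> where W: "(W, \<Phi>) \<in> atlas PM" "p \<in> W" by auto
      from W(1) obtain U \<phi> V \<psi> where c: "W = pbox U V" "\<Phi> = prod_chart \<phi> \<psi>" "(U, \<phi>) \<in> atlas B"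
        "\<forall>j. (V j, \<psi> j) \<in> atlas (F j)" by (rule atlas_PM_E)
      have "snd p j \<in> points (F j)" for j
        using F.chart_subset[OF spec[OF c(4), of j]] W(2) c(1) by (auto simp: mem_pbox)
      then show "p \<in> points PM"
        using B.chart_subset[OF c(3)] W(2) c(1) by (auto simp: points_PM mem_pbox)
    qed
    show "points PM \<subseteq> (\<Union>(W, \<Phi>)\<in>atlas PM. W)"
      by (rule subsetI, erule obtain_prod_chart) blast
  qed
  fix W \<Phi> assume W: "(W, \<Phi>) \<in> atlas PM"
  from W obtain U \<phi> V \<psi> where c: "W = pbox U V" "\<Phi> = prod_chart \<phi> \<psi>" "(U, \<phi>) \<in> atlas B"
    "\<forall>j. (V j, \<psi> j) \<in> atlas (F j)" by (rule atlas_PM_E)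
  have "openin (top_of_set (model PM)) (\<Phi> ` W)"
    unfolding c(1,2) prod_chart_image model_PM using c(3,4)
    by (intro openin_vec_box B.chart_image_openin F.chart_image_openin) auto
  then show "inj_on \<Phi> W \<and> openin (top_of_set (model PM)) (\<Phi> ` W)"
    using chart_inj_PM[OF W] by simp
  fix W' \<Phi>' assume W': "(W', \<Phi>') \<in> atlas PM"
  from W' obtain U' \<phi>' V' \<psi>' where c': "W' = pbox U' V'" "\<Phi>' = prod_chart \<phi>' \<psi>'" "(U', \<phi>') \<in> atlas B"
    "\<forall>j. (V' j, \<psi>' j) \<in> atlas (F j)" by (rule atlas_PM_E)
  have "openin (top_of_set (model PM)) (\<Phi> ` (W \<inter> W'))"
    unfolding c(1,2) c'(1) pbox_Int prod_chart_image model_PM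
  proof (rule openin_vec_box)
    show "openin (top_of_set (model B)) (\<phi> ` (U \<inter> U'))" using B.transition[OF c(3) c'(3)] by blast
    show "openin (top_of_set (model (F j))) (\<psi> j ` (V j \<inter> V' j))" for j
      using F.transition[OF spec[OF c(4), of j] spec[OF c'(4), of j]] by blast
  qed
  moreover have "smooth_on (\<Phi> ` (W \<inter> W')) (\<Phi>' \<circ> inv_into W \<Phi>)"
    unfolding c(1,2) c'(1,2) by (rule prod_transition_smooth[OF c(3) c'(3) c(4) c'(4)])
  ultimately show "openin (top_of_set (model PM)) (\<Phi> ` (W \<inter> W')) \<and>
      smooth_on (\<Phi> ` (W \<inter> W')) (\<Phi>' \<circ> inv_into W \<Phi>)" by simp
qed (rule Hausdorff_PM)

sublocale PM: mfd PM by (rule mfd_PM)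

lemma smooth_fst:
  assumes f: "f \<in> smooth_functions B"
  shows "(\<lambda>q. f (fst q)) \<in> smooth_functions PM"
proof (rule PM.smooth_functions_intro)
  fix p assume p: "p \<in> points PM"
  obtain U \<phi> V \<psi> where c: "(U, \<phi>) \<in> atlas B" "\<forall>j. (V j, \<psi> j) \<in> atlas (F j)" "p \<in> pbox U V"
    "(pbox U V, prod_chart \<phi> \<psi>) \<in> atlas PM" by (rule obtain_prod_chart[OF p])
  have "fst p \<in> U" using c(3) by (simp add: mem_pbox)
  then obtain S h where S: "open S" "\<phi> (fst p) \<in> S" "cinf_on S h" "\<And>q. q \<in> U \<Longrightarrow> \<phi> q \<in> S \<Longrightarrow> f q = h (\<phi> q)"
    using B.smooth_in_chartE[OF f c(1)] by metis
  have o: "open (S \<times> (UNIV :: ('e ^ 'm) set))" using S(1) by (intro open_Times) auto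
  have "smooth_in_chart (pbox U V) (prod_chart \<phi> \<psi>) p (\<lambda>q. f (fst q))"
    unfolding smooth_in_chart_def
  proof (intro exI[of _ "S \<times> (UNIV :: ('e ^ 'm) set)"] exI[of _ "\<lambda>z. h (fst z)"] conjI ballI impI o)
    show "cinf_on (S \<times> (UNIV :: ('e ^ 'm) set)) (\<lambda>z. h (fst z))"
      by (rule cinf_on_compose[OF o cinf_on_bounded_linear[OF o bounded_linear_fst] S(3)]) auto
  qed (use S in \<open>auto simp: prod_chart_apply mem_pbox\<close>)
  with c(4,3) show "smooth_at PM p (\<lambda>q. f (fst q))" by (rule PM.smooth_atI)
qed

lemma smooth_snd:
  assumes f: "f \<in> smooth_functions (F j)"
  shows "(\<lambda>q. f (snd q j)) \<in> smooth_functions PM"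
proof (rule PM.smooth_functions_intro)
  fix p assume p: "p \<in> points PM"
  obtain U \<phi> V \<psi> where c: "(U, \<phi>) \<in> atlas B" "\<forall>j. (V j, \<psi> j) \<in> atlas (F j)" "p \<in> pbox U V"
    "(pbox U V, prod_chart \<phi> \<psi>) \<in> atlas PM" by (rule obtain_prod_chart[OF p])
  have "snd p j \<in> V j" using c(3) by (simp add: mem_pbox)
  then obtain S h where S: "open S" "\<psi> j (snd p j) \<in> S" "cinf_on S h"
    "\<And>q. q \<in> V j \<Longrightarrow> \<psi> j q \<in> S \<Longrightarrow> f q = h (\<psi> j q)"
    using F.smooth_in_chartE[OF f spec[OF c(2), of j]] by metis
  have bl: "bounded_linear (\<lambda>z::'d \<times> ('e ^ 'm). snd z $ j)"
    by (intro bounded_linear_compose[OF bounded_linear_vec_nth] bounded_linear_snd)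
  let ?S = "(\<lambda>z::'d \<times> ('e ^ 'm). snd z $ j) -` S"
  have o: "open ?S" by (rule open_vimage[OF S(1)]) (rule linear_continuous_on[OF bl])
  have "smooth_in_chart (pbox U V) (prod_chart \<phi> \<psi>) p (\<lambda>q. f (snd q j))"
    unfolding smooth_in_chart_def
  proof (intro exI[of _ ?S] exI[of _ "\<lambda>z. h (snd z $ j)"] conjI ballI impI o)
    show "cinf_on ?S (\<lambda>z. h (snd z $ j))"
      by (rule cinf_on_compose[OF o cinf_on_bounded_linear[OF o bl] S(3)]) auto
  qed (use S in \<open>auto simp: prod_chart_apply mem_pbox\<close>)
  with c(4,3) show "smooth_at PM p (\<lambda>q. f (snd q j))" by (rule PM.smooth_atI)
qed

sublocale base: factor B PM fst "\<lambda>p x. (x, snd p)" "\<lambda>u. (u, 0)"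
proof (rule factor.intro[OF B.mfd_axioms PM.mfd_axioms factor_axioms.intro])
  show "openin (manifold_topology PM) {q\<in>points PM. fst q \<in> N}" if N: "openin (manifold_topology B) N" for N
  proof -
    have "{q\<in>points PM. fst q \<in> N} = pbox N (\<lambda>j. points (F j))"
      using B.openin_T_subset[OF N] by (auto simp: points_PM mem_pbox)
    then show ?thesis using openin_pbox[OF N F.openin_T_points] by simp
  qed
  show "bounded_linear (\<lambda>u::'d. (u, 0::'e ^ 'm))" by (rule bounded_linear_Pair_0)
  fix p assume p: "p \<in> points PM"
  obtain U \<phi> V \<psi> where c: "(U, \<phi>) \<in> atlas B" "\<forall>j. (V j, \<psi> j) \<in> atlas (F j)" "p \<in> pbox U V"
    "(pbox U V, prod_chart \<phi> \<psi>) \<in> atlas PM" by (rule obtain_prod_chart[OF p])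
  show "\<exists>U \<phi> W \<Phi>. (U, \<phi>) \<in> atlas B \<and> (W, \<Phi>) \<in> atlas PM \<and> p \<in> W \<and> (\<forall>p\<in>W. fst p \<in> U) \<and>
      (\<forall>p\<in>W. \<forall>z\<in>U. (z, snd p) \<in> W \<and> \<Phi> (z, snd p) = \<Phi> p + (\<phi> z - \<phi> (fst p), 0))"
    using c by (intro exI[of _ U] exI[of _ \<phi>] exI[of _ "pbox U V"] exI[of _ "prod_chart \<phi> \<psi>"])
      (auto simp: mem_pbox prod_chart_apply)
qed (auto simp: points_PM mem_pbox smooth_fst)

sublocale fib: factor "F j" PM "\<lambda>q. snd q j" "\<lambda>p z. (fst p, (snd p)(j := z))" "\<lambda>w. (0, axis j w)" for j
proof (rule factor.intro[OF F.mfd_axioms PM.mfd_axioms factor_axioms.intro])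
  show "openin (manifold_topology PM) {q\<in>points PM. snd q j \<in> N}" if N: "openin (manifold_topology (F j)) N" for N
  proof -
    have "{q\<in>points PM. snd q j \<in> N} = pbox (points B) (\<lambda>i. if i = j then N else points (F i))"
      using subsetD[OF F.openin_T_subset[OF N]] by (intro set_eqI) (simp add: points_PM mem_pbox, metis)
    moreover have "openin (manifold_topology PM) \<dots>"
      by (rule openin_pbox[OF B.openin_T_points]) (use N F.openin_T_points in auto)
    ultimately show ?thesis by simp
  qed
  show "bounded_linear (\<lambda>w::'e. (0::'d, axis j w :: 'e ^ 'm))"
    by (rule bounded_linear_compose[OF bounded_linear_0_Pair bounded_linear_axis])
  fix p assume p: "p \<in> points PM"
  obtain U \<phi> V \<psi> where c: "(U, \<phi>) \<in> atlas B" "\<forall>j. (V j, \<psi> j) \<in> atlas (F j)" "p \<in> pbox U V"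
    "(pbox U V, prod_chart \<phi> \<psi>) \<in> atlas PM" by (rule obtain_prod_chart[OF p])
  have "prod_chart \<phi> \<psi> (fst p, (snd p)(j := z)) = prod_chart \<phi> \<psi> p + (0, axis j (\<psi> j z - \<psi> j (snd p j)))" for p z
    by (simp add: prod_chart_apply vec_eq_iff axis_def)
  then show "\<exists>U \<phi> W \<Phi>. (U, \<phi>) \<in> atlas (F j) \<and> (W, \<Phi>) \<in> atlas PM \<and> p \<in> W \<and> (\<forall>p\<in>W. snd p j \<in> U) \<and>
      (\<forall>p\<in>W. \<forall>z\<in>U. (fst p, (snd p)(j := z)) \<in> W \<and>
        \<Phi> (fst p, (snd p)(j := z)) = \<Phi> p + (0, axis j (\<phi> z - \<phi> (snd p j))))"
    using c by (intro exI[of _ "V j"] exI[of _ "\<psi> j"] exI[of _ "pbox U V"] exI[of _ "prod_chart \<phi> \<psi>"])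
      (auto simp: mem_pbox)
qed (auto simp: points_PM mem_pbox smooth_snd)

end

text \<open>All directions \<open>a\<close> are treated on one neighbourhood, because the basis of
  the model space of a product is chosen arbitrarily and is not adapted to the factors: its
  components in a factor can be any vectors.\<close>

lemma (in mfd) chart_linear_functions:
  assumes U: "(U, \<phi>) \<in> atlas M" "p \<in> U"
  obtains N k where "openin T N" "p \<in> N" "\<And>a. k a \<in> Sm" "\<And>a q. q \<in> N \<Longrightarrow> k a q = \<phi> q \<bullet> a"
proof -
  obtain \<rho> K N where \<rho>: "\<rho> \<in> Sm" "closedin T K" "K \<subseteq> U" "\<And>q. q \<notin> K \<Longrightarrow> \<rho> q = 0"
    "openin T N" "p \<in> N" "N \<subseteq> U" "\<And>q. q \<in> N \<Longrightarrow> \<rho> q = 1"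
    using bump_function[OF openin_T_chart[OF U(1)] U(2)] by metis
  let ?k = "\<lambda>a q. if q \<in> U then \<rho> q * (\<phi> q \<bullet> a) else 0"
  have "?k a \<in> Sm" for a
    by (rule smooth_cutoff_extension[OF \<rho>(1-4) openin_T_chart[OF U(1)]])
      (assumption | rule smooth_atI[OF U(1) _ smooth_in_chart_linear[OF bounded_linear_inner_left]])+
  moreover have "?k a q = \<phi> q \<bullet> a" if "q \<in> N" for a q using that \<rho>(7,8) by auto
  ultimately show ?thesis using that[of N ?k] \<rho>(5,6) by blast
qed

section \<open>Splitting of tangent vectors of the product\<close>

context product_mfd
begin

abbreviation "dB \<equiv> differential PM B fst"
abbreviation "dF j \<equiv> differential PM (F j) (\<lambda>q. snd q j)"
abbreviation "liB p \<equiv> differential B PM (\<lambda>x. (x, snd p))"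
abbreviation "liF j p \<equiv> differential (F j) PM (\<lambda>z. (fst p, (snd p)(j := z)))"
abbreviation "LB \<equiv> lift_base B F"
abbreviation "LF \<equiv> lift_fibre B F"

lemma lift_base_eq: "LB X = (\<lambda>p. liB p (X (fst p)))"
  by (rule ext) (simp add: lift_base_def split_beta)

lemma lift_fibre_eq: "LF j V = (\<lambda>p. liF j p (V (snd p j)))"
  by (rule ext) (simp add: lift_fibre_def split_beta)

lemma LB_VF: "X \<in> vector_fields B \<Longrightarrow> LB X \<in> PM.VF"
  unfolding lift_base_eq by (rule base.lift_VF)

lemma LF_VF: "V \<in> vector_fields (F j) \<Longrightarrow> LF j V \<in> PM.VF"
  unfolding lift_fibre_eq by (rule fib.lift_VF)

lemma points_fst: "p \<in> points PM \<Longrightarrow> fst p \<in> points B"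
  and points_snd: "p \<in> points PM \<Longrightarrow> snd p j \<in> points (F j)"
  by (auto simp: points_PM mem_pbox)

lemma dF_liB:
  assumes p: "p \<in> points PM" and w: "w \<in> tangent_space B (fst p)"
  shows "dF j (liB p w) = (\<lambda>f. 0)"
proof
  fix f show "dF j (liB p w) f = 0"
  proof (cases "f \<in> smooth_functions (F j)")
    case True
    then have "dF j (liB p w) f = liB p w (\<lambda>q. f (snd q j))" by (rule fib.proj_vec_apply)
    also have "\<dots> = 0" by (rule base.lift_vec_const[OF p w, where c = "f (snd p j)"]) simp
    finally show ?thesis .
  qed (simp add: differential_def)
qed

lemma dB_liF:
  assumes p: "p \<in> points PM" and w: "w \<in> tangent_space (F j) (snd p j)"
  shows "dB (liF j p w) = (\<lambda>f. 0)"
proof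
  fix f show "dB (liF j p w) f = 0"
  proof (cases "f \<in> smooth_functions B")
    case True
    then have "dB (liF j p w) f = liF j p w (\<lambda>q. f (fst q))" by (rule base.proj_vec_apply)
    also have "\<dots> = 0" by (rule fib.lift_vec_const[OF p w, where c = "f (fst p)"]) simp
    finally show ?thesis .
  qed (simp add: differential_def)
qed

lemma dF_liF:
  assumes p: "p \<in> points PM" and w: "w \<in> tangent_space (F j) (snd p j)"
  shows "dF i (liF j p w) = (if i = j then w else (\<lambda>f. 0))"
proof (cases "i = j")
  case True
  then show ?thesis using fib.proj_lift_vec[OF p w] by simp
next
  case False
  have "dF i (liF j p w) f = 0" for f
  proof (cases "f \<in> smooth_functions (F i)")
    case True
    then have "dF i (liF j p w) f = liF j p w (\<lambda>q. f (snd q i))" by (rule fib.proj_vec_apply)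
    also have "\<dots> = 0" by (rule fib.lift_vec_const[OF p w, where c = "f (snd p i)"]) (use \<open>i \<noteq> j\<close> in simp)
    finally show ?thesis .
  qed (simp add: differential_def)
  with False show ?thesis by auto
qed

text \<open>Each coordinate of a product chart is a sum of pullbacks of coordinates on the factors.
  These are annihilated by \<open>u\<close>, and \<open>tangent_coords\<close> makes
  \<open>u\<close> depend on its values on coordinates only.\<close>

lemma tangent_PM_zero:
  assumes p: "p \<in> points PM" and u: "u \<in> PM.TS p" and dB: "dB u = (\<lambda>f. 0)" and dF: "\<And>j. dF j u = (\<lambda>f. 0)"
  shows "u = (\<lambda>f. 0)"
proof
  fix f
  obtain U \<phi> V \<psi> where c: "(U, \<phi>) \<in> atlas B" "\<forall>j. (V j, \<psi> j) \<in> atlas (F j)" "p \<in> pbox U V"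
    "(pbox U V, prod_chart \<phi> \<psi>) \<in> atlas PM" by (rule obtain_prod_chart[OF p])
  have "fst p \<in> U" using c(3) by (simp add: mem_pbox)
  then obtain N0 k0 where 0: "openin (manifold_topology B) N0" "fst p \<in> N0" "\<And>a. k0 a \<in> smooth_functions B"
    "\<And>a q. q \<in> N0 \<Longrightarrow> k0 a q = \<phi> q \<bullet> a"
    by (rule B.chart_linear_functions[OF c(1)]) blast
  have "\<exists>N k. openin (manifold_topology (F j)) N \<and> snd p j \<in> N \<and> (\<forall>a. k a \<in> smooth_functions (F j)) \<and>
      (\<forall>a. \<forall>q\<in>N. k a q = \<psi> j q \<bullet> a)" for j
  proof -
    have "snd p j \<in> V j" using c(3) by (simp add: mem_pbox)
    then show ?thesis by (rule F.chart_linear_functions[OF spec[OF c(2), of j]]) blast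
  qed
  then have "\<forall>j. \<exists>n. openin (manifold_topology (F j)) (fst n) \<and> snd p j \<in> fst n \<and>
      (\<forall>a. snd n a \<in> smooth_functions (F j)) \<and> (\<forall>a. \<forall>q\<in>fst n. snd n a q = \<psi> j q \<bullet> a)"
    by (metis fst_conv snd_conv)
  then obtain n where n: "\<forall>j. openin (manifold_topology (F j)) (fst (n j)) \<and> snd p j \<in> fst (n j) \<and>
      (\<forall>a. snd (n j) a \<in> smooth_functions (F j)) \<and> (\<forall>a. \<forall>q\<in>fst (n j). snd (n j) a q = \<psi> j q \<bullet> a)"
    by (rule exE[OF choice])
  let ?xb = "\<lambda>(d :: 'd \<times> ('e ^ 'm)) q. k0 (fst d) (fst q)" and ?xj = "\<lambda>(d :: 'd \<times> ('e ^ 'm)) j q. snd (n j) (snd d $ j) (snd q j)"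
  let ?x = "\<lambda>d q. ?xb d q + (\<Sum>j\<in>UNIV. ?xj d j q)"
  let ?N = "pbox N0 (\<lambda>j. fst (n j))"
  have s0: "?xb d \<in> PM.Sm" for d by (rule smooth_fst[OF 0(3)])
  have sj: "?xj d j \<in> PM.Sm" for d j by (rule smooth_snd) (use n in blast)
  have oN: "openin (manifold_topology PM) ?N" by (rule openin_pbox[OF 0(1)]) (use n in blast)
  have pN: "p \<in> ?N" using 0(2) n by (simp add: mem_pbox)
  have xs: "?x d \<in> PM.Sm" for d
    by (intro PM.smooth_functions_add PM.smooth_functions_sum s0 sj)
  have xN: "?x d q = prod_chart \<phi> \<psi> q \<bullet> d" if q: "q \<in> ?N" for d q
  proof -
    have "snd (n j) (snd d $ j) (snd q j) = \<psi> j (snd q j) \<bullet> (snd d $ j)" for j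
      using n q by (simp add: mem_pbox)
    moreover have "k0 (fst d) (fst q) = \<phi> (fst q) \<bullet> fst d" using 0(4) q by (simp add: mem_pbox)
    ultimately show ?thesis by (simp add: prod_chart_apply inner_prod_def inner_vec_def)
  qed
  have ux: "u (?x d) = 0" for d
  proof -
    have "u (?xb d) = dB u (k0 (fst d))" by (rule base.proj_vec_apply[OF 0(3), symmetric])
    moreover have "u (?xj d j) = dF j u (snd (n j) (snd d $ j))" for j
      by (rule fib.proj_vec_apply[symmetric]) (use n in blast)
    ultimately show ?thesis
      by (simp add: PM.tangent_add[OF u s0 PM.smooth_functions_sum[OF sj]] PM.tangent_sum[OF u sj] dB dF)
  qed
  show "u f = 0"
  proof (cases "f \<in> PM.Sm")
    case True
    have "u f = (\<Sum>d\<in>PM.model_basis. u (?x d) * PM.coord_vector (pbox U V) (prod_chart \<phi> \<psi>) d p f)"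
      by (rule PM.tangent_coords[OF c(4,3) xs oN pN xN u True])
    then show ?thesis by (simp add: ux)
  next
    case False
    then show ?thesis by (rule PM.tangent_nonsmooth[OF u])
  qed
qed

lemma tangent_PM_eqI:
  assumes p: "p \<in> points PM" and u: "u \<in> PM.TS p" and v: "v \<in> PM.TS p" and dB: "dB u = dB v"
    and dF: "\<And>j. dF j u = dF j v"
  shows "u = v"
proof -
  have "(\<lambda>f. 1 * u f + (-1) * v f) = (\<lambda>f. 0)"
    by (rule tangent_PM_zero[OF p PM.tangent_lincomb[OF u v]])
      (simp_all only: base.proj_vec_lincomb fib.proj_vec_lincomb dB dF, simp_all)
  then show ?thesis by (auto simp: fun_eq_iff)
qed

definition vec :: "'a \<times> ('m \<Rightarrow> 'c) \<Rightarrow> 'a tvec \<Rightarrow> ('m \<Rightarrow> 'c tvec) \<Rightarrow> ('a \<times> ('m \<Rightarrow> 'c)) tvec" where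
  "vec p u v = (\<lambda>f. liB p u f + (\<Sum>j\<in>UNIV. liF j p (v j) f))"

context
  fixes p u v
  assumes p: "p \<in> points PM" and u: "u \<in> tangent_space B (fst p)"
    and v: "\<And>j. v j \<in> tangent_space (F j) (snd p j)"
begin

lemma vec_tangent: "vec p u v \<in> PM.TS p"
  unfolding vec_def
  by (intro PM.tangent_plus PM.tangent_sum_vec base.lift_vec_tangent[OF p u] fib.lift_vec_tangent[OF p v])

lemma dB_vec: "dB (vec p u v) = u"
  unfolding vec_def base.proj_vec_add base.proj_vec_sum
  by (simp add: base.proj_lift_vec[OF p u] dB_liF[OF p v])

lemma dF_vec: "dF i (vec p u v) = v i"
proof
  fix f
  have "dF i (vec p u v) f = (\<Sum>j\<in>UNIV. dF i (liF j p (v j)) f)"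
    unfolding vec_def fib.proj_vec_add fib.proj_vec_sum by (simp add: dF_liB[OF p u])
  also have "\<dots> = (\<Sum>j\<in>UNIV. if j = i then v i f else 0)"
    by (rule sum.cong) (auto simp: dF_liF[OF p v])
  finally show "dF i (vec p u v) f = v i f" by simp
qed

end

lemma tangent_decomposition:
  assumes p: "p \<in> points PM" and v: "v \<in> PM.TS p"
  shows "v = vec p (dB v) (\<lambda>j. dF j v)"
proof -
  note t = base.proj_vec_tangent[OF p v] fib.proj_vec_tangent[OF p v]
  show ?thesis
    by (rule tangent_PM_eqI[OF p v vec_tangent[OF p t]]) (simp_all add: dB_vec[OF p t] dF_vec[OF p t])
qed

text \<open>A field on the product is in general no sum of lifts, but its value at one point is, and
  a tensorial form sees only that value. Thus such forms need to be tested on lifts only.\<close>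

lemma tensorial_PM_expand:
  assumes \<omega>: "PM.tensorial \<omega>" and Z: "Z \<in> PM.VF" and p: "p \<in> points PM"
  obtains Z0 Z' where "Z0 \<in> vector_fields B" "\<And>j. Z' j \<in> vector_fields (F j)"
    "Z0 (fst p) = dB (Z p)" "\<And>j. Z' j (snd p j) = dF j (Z p)"
    "\<omega> Z p = \<omega> (LB Z0) p + (\<Sum>j\<in>UNIV. \<omega> (LF j (Z' j)) p)"
proof -
  note Zp = PM.VF_tangent[OF Z p]
  obtain Z0 where Z0: "Z0 \<in> vector_fields B" "Z0 (fst p) = dB (Z p)"
    by (rule B.tangent_extension[OF points_fst[OF p] base.proj_vec_tangent[OF p Zp]])
  have "\<forall>j. \<exists>Y. Y \<in> vector_fields (F j) \<and> Y (snd p j) = dF j (Z p)"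
    by (intro allI, rule F.tangent_extension[OF points_snd[OF p] fib.proj_vec_tangent[OF p Zp]]) blast
  then obtain Z' where Z': "\<forall>j. Z' j \<in> vector_fields (F j) \<and> Z' j (snd p j) = dF j (Z p)"
    by (rule exE[OF choice])
  have V: "LB Z0 \<in> PM.VF" "\<And>j. LF j (Z' j) \<in> PM.VF" using Z0 Z' by (auto intro: LB_VF LF_VF)
  let ?S = "\<lambda>p f. \<Sum>j\<in>UNIV. LF j (Z' j) p f"
  have S: "?S \<in> PM.VF" by (rule PM.VF_sum[OF V(2)])
  have "Z p = (\<lambda>f. LB Z0 p f + ?S p f)"
    by (subst tangent_decomposition[OF p Zp])
      (simp add: vec_def lift_base_eq lift_fibre_eq Z0(2) Z')
  then have "\<omega> Z p = \<omega> (\<lambda>p f. LB Z0 p f + ?S p f) p"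
    by (intro PM.tensorial_pointwise[OF \<omega> Z PM.VF_add[OF V(1) S] p])
  also have "\<dots> = \<omega> (LB Z0) p + (\<Sum>j\<in>UNIV. \<omega> (LF j (Z' j)) p)"
    by (simp add: PM.tensorial_add[OF \<omega> V(1) S p] PM.tensorial_sum[OF \<omega> p V(2)])
  finally show ?thesis using that[of Z0 Z'] Z0 Z' by blast
qed

lemma LB_fst: "f \<in> smooth_functions B \<Longrightarrow> vf_apply (LB X) (\<lambda>q. f (fst q)) p = vf_apply X f (fst p)"
  by (simp add: vf_apply_apply lift_base_eq base.lift_vec_apply smooth_fst)

lemma LF_snd_same: "f \<in> smooth_functions (F j) \<Longrightarrow>
    vf_apply (LF j V) (\<lambda>q. f (snd q j)) p = vf_apply V f (snd p j)"
  by (simp add: vf_apply_apply lift_fibre_eq fib.lift_vec_apply smooth_snd)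

lemma LB_snd: "X \<in> vector_fields B \<Longrightarrow> p \<in> points PM \<Longrightarrow> vf_apply (LB X) (\<lambda>q. h (snd q j)) p = 0"
  unfolding vf_apply_apply lift_base_eq
  by (rule base.lift_vec_const[OF _ B.VF_tangent[OF _ points_fst], where c = "h (snd p j)"]) simp_all

lemma LF_fst: "V \<in> vector_fields (F j) \<Longrightarrow> p \<in> points PM \<Longrightarrow> vf_apply (LF j V) (\<lambda>q. h (fst q)) p = 0"
  unfolding vf_apply_apply lift_fibre_eq
  by (rule fib.lift_vec_const[OF _ F.VF_tangent[OF _ points_snd], where c = "h (fst p)"]) simp_all

lemma LF_snd: "V \<in> vector_fields (F j) \<Longrightarrow> p \<in> points PM \<Longrightarrow> i \<noteq> j \<Longrightarrow>
    vf_apply (LF j V) (\<lambda>q. h (snd q i)) p = 0"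
  unfolding vf_apply_apply lift_fibre_eq
  by (rule fib.lift_vec_const[OF _ F.VF_tangent[OF _ points_snd], where c = "h (snd p i)"]) simp_all

end

section \<open>Lie brackets of lifts\<close>

lemma (in mfd) vf_apply_eq:
  "X \<in> VF \<Longrightarrow> p \<in> points M \<Longrightarrow> (\<And>q. q \<in> points M \<Longrightarrow> f q = h q) \<Longrightarrow> vf_apply X f p = vf_apply X h p"
  unfolding vf_apply_apply by (rule tangent_cong[OF VF_tangent])

lemma (in mfd) vf_apply_const: "X \<in> VF \<Longrightarrow> p \<in> points M \<Longrightarrow> vf_apply X (\<lambda>q. c) p = 0"
  unfolding vf_apply_apply by (rule tangent_const[OF VF_tangent])

lemma (in mfd) vf_apply_mult: "X \<in> VF \<Longrightarrow> p \<in> points M \<Longrightarrow> f \<in> Sm \<Longrightarrow> h \<in> Sm \<Longrightarrow>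
    vf_apply X (\<lambda>q. f q * h q) p = f p * vf_apply X h p + h p * vf_apply X f p"
  unfolding vf_apply_apply by (rule tangent_mult[OF VF_tangent])

context product_mfd
begin

lemma dB_bracket: "f \<in> smooth_functions B \<Longrightarrow> dB (lie_bracket A C p) f =
    vf_apply A (vf_apply C (\<lambda>q. f (fst q))) p - vf_apply C (vf_apply A (\<lambda>q. f (fst q))) p"
  by (simp add: base.proj_vec_apply lie_bracket_def)

lemma dF_bracket: "f \<in> smooth_functions (F j) \<Longrightarrow> dF j (lie_bracket A C p) f =
    vf_apply A (vf_apply C (\<lambda>q. f (snd q j))) p - vf_apply C (vf_apply A (\<lambda>q. f (snd q j))) p"
  by (simp add: fib.proj_vec_apply lie_bracket_def)

lemma dB_LB: "X \<in> vector_fields B \<Longrightarrow> p \<in> points PM \<Longrightarrow> dB (LB X p) = X (fst p)"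
  unfolding lift_base_eq by (rule base.proj_lift_vec[OF _ B.VF_tangent[OF _ points_fst]])

lemma dF_LB: "X \<in> vector_fields B \<Longrightarrow> p \<in> points PM \<Longrightarrow> dF j (LB X p) = (\<lambda>f. 0)"
  unfolding lift_base_eq by (rule dF_liB[OF _ B.VF_tangent[OF _ points_fst]])

lemma dB_LF: "V \<in> vector_fields (F j) \<Longrightarrow> p \<in> points PM \<Longrightarrow> dB (LF j V p) = (\<lambda>f. 0)"
  unfolding lift_fibre_eq by (rule dB_liF[OF _ F.VF_tangent[OF _ points_snd]])

lemma dF_LF: "V \<in> vector_fields (F j) \<Longrightarrow> p \<in> points PM \<Longrightarrow>
    dF i (LF j V p) = (if i = j then V (snd p j) else (\<lambda>f. 0))"
  unfolding lift_fibre_eq by (rule dF_liF[OF _ F.VF_tangent[OF _ points_snd]])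

text \<open>By \<open>tangent_PM_eqI\<close> a bracket is known once it has been applied to
  functions pulled back from the single factors, where the lifts act explicitly.\<close>

lemma bracket_PM_eqI:
  assumes VF: "A \<in> PM.VF" "C \<in> PM.VF" and p: "p \<in> points PM" and v: "v \<in> PM.TS p"
    and B: "\<And>f. f \<in> smooth_functions B \<Longrightarrow>
      vf_apply A (vf_apply C (\<lambda>q. f (fst q))) p - vf_apply C (vf_apply A (\<lambda>q. f (fst q))) p = dB v f"
    and F: "\<And>f j. f \<in> smooth_functions (F j) \<Longrightarrow>
      vf_apply A (vf_apply C (\<lambda>q. f (snd q j))) p - vf_apply C (vf_apply A (\<lambda>q. f (snd q j))) p = dF j v f"
  shows "lie_bracket A C p = v"
proof (rule tangent_PM_eqI[OF p PM.VF_tangent[OF PM.VF_bracket[OF VF] p] v])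
  show "dB (lie_bracket A C p) = dB v"
  proof
    fix f show "dB (lie_bracket A C p) f = dB v f"
      by (cases "f \<in> smooth_functions B") (simp add: dB_bracket B, simp add: differential_def)
  qed
  fix j show "dF j (lie_bracket A C p) = dF j v"
  proof
    fix f show "dF j (lie_bracket A C p) f = dF j v f"
      by (cases "f \<in> smooth_functions (F j)") (simp add: dF_bracket F, simp add: differential_def)
  qed
qed

context
  fixes p
  assumes p: "p \<in> points PM"
begin

lemma LB_LB_fst:
  assumes X: "X \<in> vector_fields B" and Y: "Y \<in> vector_fields B" and f: "f \<in> smooth_functions B"
  shows "vf_apply (LB X) (vf_apply (LB Y) (\<lambda>q. f (fst q))) p = vf_apply X (vf_apply Y f) (fst p)"
proof -
  have "vf_apply (LB X) (vf_apply (LB Y) (\<lambda>q. f (fst q))) p = vf_apply (LB X) (\<lambda>q. vf_apply Y f (fst q)) p"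
    by (rule PM.vf_apply_eq[OF LB_VF[OF X] p]) (rule LB_fst[OF f])
  also have "\<dots> = vf_apply X (vf_apply Y f) (fst p)" by (rule LB_fst[OF B.VF_smooth[OF Y f]])
  finally show ?thesis .
qed

lemma LF_LF_snd:
  assumes V: "V \<in> vector_fields (F j)" and W: "W \<in> vector_fields (F j)" and f: "f \<in> smooth_functions (F j)"
  shows "vf_apply (LF j V) (vf_apply (LF j W) (\<lambda>q. f (snd q j))) p = vf_apply V (vf_apply W f) (snd p j)"
proof -
  have "vf_apply (LF j V) (vf_apply (LF j W) (\<lambda>q. f (snd q j))) p = vf_apply (LF j V) (\<lambda>q. vf_apply W f (snd q j)) p"
    by (rule PM.vf_apply_eq[OF LF_VF[OF V] p]) (rule LF_snd_same[OF f])
  also have "\<dots> = vf_apply V (vf_apply W f) (snd p j)" by (rule LF_snd_same[OF F.VF_smooth[OF W f]])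
  finally show ?thesis .
qed

lemma vf_apply_zero_on_points:
  assumes A: "A \<in> PM.VF" and "\<And>q. q \<in> points PM \<Longrightarrow> h q = 0"
  shows "vf_apply A h p = 0"
  using PM.vf_apply_eq[OF A p, of h "\<lambda>q. 0"] assms(2) PM.vf_apply_const[OF A p, of 0] by simp

lemma bracket_LB_LB:
  assumes X: "X \<in> vector_fields B" and Y: "Y \<in> vector_fields B"
  shows "lie_bracket (LB X) (LB Y) p = LB (lie_bracket X Y) p"
proof (rule bracket_PM_eqI[OF LB_VF[OF X] LB_VF[OF Y] p PM.VF_tangent[OF LB_VF[OF B.VF_bracket[OF X Y]] p]])
  fix f assume "f \<in> smooth_functions B"
  then show "vf_apply (LB X) (vf_apply (LB Y) (\<lambda>q. f (fst q))) p -
      vf_apply (LB Y) (vf_apply (LB X) (\<lambda>q. f (fst q))) p = dB (LB (lie_bracket X Y) p) f"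
    unfolding dB_LB[OF B.VF_bracket[OF X Y] p] by (simp add: LB_LB_fst X Y lie_bracket_def)
next
  fix f j
  have "vf_apply (LB X) (vf_apply (LB Y) (\<lambda>q. f (snd q j))) p = 0"
    if "X \<in> vector_fields B" "Y \<in> vector_fields B" for X Y
    by (rule vf_apply_zero_on_points[OF LB_VF[OF that(1)]]) (rule LB_snd[OF that(2)])
  then show "vf_apply (LB X) (vf_apply (LB Y) (\<lambda>q. f (snd q j))) p -
      vf_apply (LB Y) (vf_apply (LB X) (\<lambda>q. f (snd q j))) p = dF j (LB (lie_bracket X Y) p) f"
    by (simp add: X Y dF_LB[OF B.VF_bracket[OF X Y] p])
qed

text \<open>On a function pulled back from one factor, one of the two lifts gives 0 and the other
  gives a function of the same factor, which the first then annihilates.\<close>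

lemma bracket_LB_LF:
  assumes X: "X \<in> vector_fields B" and V: "V \<in> vector_fields (F j)"
  shows "lie_bracket (LB X) (LF j V) p = (\<lambda>f. 0)"
proof (rule bracket_PM_eqI[OF LB_VF[OF X] LF_VF[OF V] p PM.tangent_zero])
  fix f assume f: "f \<in> smooth_functions B"
  have "vf_apply (LB X) (vf_apply (LF j V) (\<lambda>q. f (fst q))) p = 0"
    by (rule vf_apply_zero_on_points[OF LB_VF[OF X]]) (rule LF_fst[OF V])
  moreover have "vf_apply (LF j V) (vf_apply (LB X) (\<lambda>q. f (fst q))) p = 0"
    using PM.vf_apply_eq[OF LF_VF[OF V] p, of "vf_apply (LB X) (\<lambda>q. f (fst q))" "\<lambda>q. vf_apply X f (fst q)"]
      LB_fst[OF f, of X] LF_fst[OF V p] by simp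
  ultimately show "vf_apply (LB X) (vf_apply (LF j V) (\<lambda>q. f (fst q))) p -
      vf_apply (LF j V) (vf_apply (LB X) (\<lambda>q. f (fst q))) p = dB (\<lambda>f. 0) f"
    by (simp add: base.proj_vec_zero)
next
  fix f i assume f: "f \<in> smooth_functions (F i)"
  have "vf_apply (LF j V) (vf_apply (LB X) (\<lambda>q. f (snd q i))) p = 0"
    by (rule vf_apply_zero_on_points[OF LF_VF[OF V]]) (rule LB_snd[OF X])
  moreover have "vf_apply (LB X) (vf_apply (LF j V) (\<lambda>q. f (snd q i))) p = 0"
  proof (cases "i = j")
    case True
    then show ?thesis
      using PM.vf_apply_eq[OF LB_VF[OF X] p, of "vf_apply (LF j V) (\<lambda>q. f (snd q j))" "\<lambda>q. vf_apply V f (snd q j)"]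
        LF_snd_same[of f j V] f LB_snd[OF X p] by simp
  next
    case False
    show ?thesis by (rule vf_apply_zero_on_points[OF LB_VF[OF X]]) (rule LF_snd[OF V _ False])
  qed
  ultimately show "vf_apply (LB X) (vf_apply (LF j V) (\<lambda>q. f (snd q i))) p -
      vf_apply (LF j V) (vf_apply (LB X) (\<lambda>q. f (snd q i))) p = dF i (\<lambda>f. 0) f"
    by (simp add: fib.proj_vec_zero)
qed

lemma bracket_LF_LB:
  "X \<in> vector_fields B \<Longrightarrow> V \<in> vector_fields (F j) \<Longrightarrow> lie_bracket (LF j V) (LB X) p = (\<lambda>f. 0)"
  using bracket_LB_LF[of X V j] by (simp add: lie_bracket_def fun_eq_iff)

lemma bracket_LF_LF_same:
  assumes V: "V \<in> vector_fields (F j)" and W: "W \<in> vector_fields (F j)"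
  shows "lie_bracket (LF j V) (LF j W) p = LF j (lie_bracket V W) p"
proof (rule bracket_PM_eqI[OF LF_VF[OF V] LF_VF[OF W] p PM.VF_tangent[OF LF_VF[OF F.VF_bracket[OF V W]] p]])
  fix f
  have "vf_apply (LF j V) (vf_apply (LF j W) (\<lambda>q. f (fst q))) p = 0"
    if "V \<in> vector_fields (F j)" "W \<in> vector_fields (F j)" for V W
    by (rule vf_apply_zero_on_points[OF LF_VF[OF that(1)]]) (rule LF_fst[OF that(2)])
  then show "vf_apply (LF j V) (vf_apply (LF j W) (\<lambda>q. f (fst q))) p -
      vf_apply (LF j W) (vf_apply (LF j V) (\<lambda>q. f (fst q))) p = dB (LF j (lie_bracket V W) p) f"
    by (simp add: V W dB_LF[OF F.VF_bracket[OF V W] p])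
next
  fix f i assume f: "f \<in> smooth_functions (F i)"
  show "vf_apply (LF j V) (vf_apply (LF j W) (\<lambda>q. f (snd q i))) p -
      vf_apply (LF j W) (vf_apply (LF j V) (\<lambda>q. f (snd q i))) p = dF i (LF j (lie_bracket V W) p) f"
  proof (cases "i = j")
    case True
    then show ?thesis using f LF_LF_snd[OF V W] LF_LF_snd[OF W V]
      unfolding dF_LF[OF F.VF_bracket[OF V W] p] by (simp add: lie_bracket_def)
  next
    case False
    have "vf_apply (LF j V) (vf_apply (LF j W) (\<lambda>q. f (snd q i))) p = 0"
      if "V \<in> vector_fields (F j)" "W \<in> vector_fields (F j)" for V W
      by (rule vf_apply_zero_on_points[OF LF_VF[OF that(1)]]) (rule LF_snd[OF that(2) _ False])
    with False show ?thesis by (simp add: V W dF_LF[OF F.VF_bracket[OF V W] p])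
  qed
qed

lemma bracket_LF_LF_diff:
  assumes V: "V \<in> vector_fields (F i)" and W: "W \<in> vector_fields (F j)" and ne: "i \<noteq> j"
  shows "lie_bracket (LF i V) (LF j W) p = (\<lambda>f. 0)"
proof (rule bracket_PM_eqI[OF LF_VF[OF V] LF_VF[OF W] p PM.tangent_zero])
  fix f
  have "vf_apply (LF i V) (vf_apply (LF j W) (\<lambda>q. f (fst q))) p = 0"
    "vf_apply (LF j W) (vf_apply (LF i V) (\<lambda>q. f (fst q))) p = 0"
    by (rule vf_apply_zero_on_points[OF LF_VF[OF V]], rule LF_fst[OF W], assumption,
        rule vf_apply_zero_on_points[OF LF_VF[OF W]], rule LF_fst[OF V], assumption)
  then show "vf_apply (LF i V) (vf_apply (LF j W) (\<lambda>q. f (fst q))) p -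
      vf_apply (LF j W) (vf_apply (LF i V) (\<lambda>q. f (fst q))) p = dB (\<lambda>f. 0) f"
    by (simp add: base.proj_vec_zero)
next
  fix f k assume f: "f \<in> smooth_functions (F k)"
  have 0: "vf_apply (LF i V) (vf_apply (LF j W) (\<lambda>q. f (snd q k))) p = 0"
    if V: "V \<in> vector_fields (F i)" and W: "W \<in> vector_fields (F j)" and ne: "i \<noteq> j" for V W i j
  proof (cases "k = j")
    case True
    then show ?thesis
      using PM.vf_apply_eq[OF LF_VF[OF V] p, of "vf_apply (LF j W) (\<lambda>q. f (snd q j))" "\<lambda>q. vf_apply W f (snd q j)"]
        LF_snd_same[of f j W] f LF_snd[OF V p ne[symmetric]] by simp
  next
    case False
    show ?thesis by (rule vf_apply_zero_on_points[OF LF_VF[OF V]]) (rule LF_snd[OF W _ False])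
  qed
  show "vf_apply (LF i V) (vf_apply (LF j W) (\<lambda>q. f (snd q k))) p -
      vf_apply (LF j W) (vf_apply (LF i V) (\<lambda>q. f (snd q k))) p = dF k (\<lambda>f. 0) f"
    using 0[OF V W ne] 0[OF W V ne[symmetric]] by (simp add: fib.proj_vec_zero)
qed

end

end

section \<open>Multiply warped products\<close>

locale warped = product_mfd B F
  for B :: "('a, 'd::euclidean_space) manifold" and F :: "'m::finite \<Rightarrow> ('c, 'e::euclidean_space) manifold" +
  fixes gB :: "'a metric" and gF :: "'m \<Rightarrow> 'c metric" and b :: "'m \<Rightarrow> 'a \<Rightarrow> real"
  assumes gB: "metric_mfd B gB" and gF: "\<And>l. metric_mfd (F l) (gF l)"
    and b_smooth: "\<And>l. b l \<in> smooth_functions B"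
begin

sublocale GB: metric_mfd B gB by (rule gB)
sublocale GF: metric_mfd "F l" "gF l" for l by (rule gF)

abbreviation "G \<equiv> warped_metric B gB F gF b"

lemma G_apply: "G p u v = gB (fst p) (dB u) (dB v) + (\<Sum>j\<in>UNIV. (b j (fst p))\<^sup>2 * gF j (snd p j) (dF j u) (dF j v))"
  by (simp add: warped_metric_def Let_def)

lemma metric_mfd_G: "metric_mfd PM G"
proof (intro metric_mfd.intro mfd_PM metric_mfd_axioms.intro)
  fix p u v assume p: "p \<in> points PM" and u: "u \<in> PM.TS p" and v: "v \<in> PM.TS p"
  note tu = base.proj_vec_tangent[OF p u] fib.proj_vec_tangent[OF p u]
  note tv = base.proj_vec_tangent[OF p v] fib.proj_vec_tangent[OF p v]
  show "G p u v = G p v u"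
    unfolding G_apply GB.g_sym[OF points_fst[OF p] tu(1) tv(1)] GF.g_sym[OF points_snd[OF p] tu(2) tv(2)] ..
  fix w a c assume w: "w \<in> PM.TS p"
  note tw = base.proj_vec_tangent[OF p w] fib.proj_vec_tangent[OF p w]
  show "G p (\<lambda>f. a * u f + c * v f) w = a * G p u w + c * G p v w"
    unfolding G_apply base.proj_vec_lincomb fib.proj_vec_lincomb
      GB.g_lincomb[OF points_fst[OF p] tu(1) tv(1) tw(1)] GF.g_lincomb[OF points_snd[OF p] tu(2) tv(2) tw(2)]
    by (simp add: sum_distrib_left algebra_simps sum.distrib)
next
  fix X Y assume XY: "X \<in> PM.VF" "Y \<in> PM.VF"
  show "metric_apply G X Y \<in> PM.Sm"
    unfolding metric_apply_def G_apply
    by (intro PM.smooth_functions_add PM.smooth_functions_sum PM.smooth_functions_mult PM.smooth_functions_power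
        base.smooth_proj_metric[OF gB XY] fib.smooth_proj_metric[OF gF XY] smooth_fst b_smooth)
qed

sublocale G: metric_mfd PM G by (rule metric_mfd_G)

context
  fixes p
  assumes p: "p \<in> points PM"
begin

lemma G_LB_LB: "X \<in> vector_fields B \<Longrightarrow> Y \<in> vector_fields B \<Longrightarrow>
    metric_apply G (LB X) (LB Y) p = metric_apply gB X Y (fst p)"
  by (simp add: metric_apply_apply G_apply dB_LB dF_LB p GF.g_zero_left points_snd F.tangent_zero)

lemma G_LB_LF: "X \<in> vector_fields B \<Longrightarrow> V \<in> vector_fields (F j) \<Longrightarrow>
    metric_apply G (LB X) (LF j V) p = 0"
  by (simp add: metric_apply_apply G_apply dB_LB dB_LF dF_LB dF_LF p GF.g_zero_left GB.g_zero_right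
      points_snd points_fst F.tangent_zero F.VF_tangent B.VF_tangent)

lemma G_LF_LB: "X \<in> vector_fields B \<Longrightarrow> V \<in> vector_fields (F j) \<Longrightarrow>
    metric_apply G (LF j V) (LB X) p = 0"
  using G.metric_apply_sym[OF LF_VF LB_VF p] G_LB_LF by simp

lemma G_LF_LF_same:
  assumes V: "V \<in> vector_fields (F j)" and W: "W \<in> vector_fields (F j)"
  shows "metric_apply G (LF j V) (LF j W) p = (b j (fst p))\<^sup>2 * metric_apply (gF j) V W (snd p j)"
proof -
  have "(\<Sum>i\<in>UNIV. (b i (fst p))\<^sup>2 * gF i (snd p i) (dF i (LF j V p)) (dF i (LF j W p))) =
      (\<Sum>i\<in>UNIV. if i = j then (b j (fst p))\<^sup>2 * gF j (snd p j) (V (snd p j)) (W (snd p j)) else 0)"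
    by (rule sum.cong) (auto simp: dF_LF V W p GF.g_zero_left points_snd F.tangent_zero)
  then show ?thesis
    by (simp add: metric_apply_apply G_apply dB_LF[OF V p] dB_LF[OF W p] GB.g_zero_left points_fst[OF p] B.tangent_zero)
qed

lemma G_LF_LF_diff:
  assumes V: "V \<in> vector_fields (F i)" and W: "W \<in> vector_fields (F j)" and ne: "i \<noteq> j"
  shows "metric_apply G (LF i V) (LF j W) p = 0"
proof -
  have "(\<Sum>l\<in>UNIV. (b l (fst p))\<^sup>2 * gF l (snd p l) (dF l (LF i V p)) (dF l (LF j W p))) = 0"
  proof (rule sum.neutral, rule ballI)
    fix l
    show "(b l (fst p))\<^sup>2 * gF l (snd p l) (dF l (LF i V p)) (dF l (LF j W p)) = 0"
      using ne F.VF_tangent[OF V points_snd[OF p]] F.VF_tangent[OF W points_snd[OF p]]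
      by (cases "l = i") (simp_all add: dF_LF V W p GF.g_zero_left GF.g_zero_right points_snd F.tangent_zero)
  qed
  then show ?thesis
    by (simp add: metric_apply_apply G_apply dB_LF[OF V p] dB_LF[OF W p] GB.g_zero_left points_fst[OF p] B.tangent_zero)
qed

end

end

section \<open>The Koszul form of a multiply warped product\<close>

context metric_mfd
begin

text \<open>Tensoriality has been shown for the last slot only, while vanishing brackets of lifts
  enter the curvature through the first slot.\<close>

lemma koszul_zero_left:
  assumes Y: "Y \<in> VF" and Z: "Z \<in> VF" and p: "p \<in> points M"
  shows "koszul g (\<lambda>p f. 0) Y Z p = 0"
proof -
  have m: "metric_apply g (\<lambda>p f. 0) W q = 0" "metric_apply g W (\<lambda>p f. 0) q = 0"
    if "W \<in> VF" "q \<in> points M" for W q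
    using that by (simp_all add: metric_apply_apply g_zero_left g_zero_right VF_tangent)
  have v: "vf_apply A (metric_apply g (\<lambda>p f. 0) W) p = 0" "vf_apply A (metric_apply g W (\<lambda>p f. 0)) p = 0"
    if A: "A \<in> VF" and W: "W \<in> VF" for A W
    using vf_apply_eq[OF A p, of "metric_apply g (\<lambda>p f. 0) W" "\<lambda>q. 0"]
      vf_apply_eq[OF A p, of "metric_apply g W (\<lambda>p f. 0)" "\<lambda>q. 0"] m[OF W] vf_apply_const[OF A p, of 0]
    by simp_all
  have l: "lie_bracket (\<lambda>p f. 0) W p = (\<lambda>f. 0)" "lie_bracket W (\<lambda>p f. 0) p = (\<lambda>f. 0)" if W: "W \<in> VF" for W
  proof -
    have "vf_apply W (vf_apply (\<lambda>p f. 0) f) p = 0" for f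
      using vf_apply_const[OF W p, of 0] by (simp add: vf_apply_def)
    then show "lie_bracket (\<lambda>p f. 0) W p = (\<lambda>f. 0)" "lie_bracket W (\<lambda>p f. 0) p = (\<lambda>f. 0)"
      by (simp_all add: lie_bracket_def vf_apply_apply[of "\<lambda>p f. 0"])
  qed
  show ?thesis
    unfolding koszul_def
    by (simp add: v Y Z vf_apply_apply[of "\<lambda>p f. 0"] m p VF_bracket metric_apply_apply[of g Y]
        metric_apply_apply[of g Z] l g_zero_right VF_tangent)
qed

lemma ssm_koszul_zero_left:
  assumes "Y \<in> VF" "Z \<in> VF" "P \<in> VF" "p \<in> points M"
  shows "ssm_koszul g P (\<lambda>p f. 0) Y Z p = 0"
  using koszul_zero_left[OF assms(1,2,4)] assms
  by (simp add: ssm_koszul_def metric_apply_apply g_zero_left VF_tangent)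

lemma ssm_koszul_cong_left:
  assumes "X \<in> VF" "X' \<in> VF" "Y \<in> VF" "Z \<in> VF" "p \<in> points M" "\<And>q. q \<in> points M \<Longrightarrow> X q = X' q"
  shows "ssm_koszul g P X Y Z p = ssm_koszul g P X' Y Z p"
  using koszul_cong[OF assms(1,2,3,3,4,4,5,6)] assms(5,6) by (simp add: ssm_koszul_def metric_apply_apply)

end

section \<open>Derivatives of the warped metric and its Koszul form on lifts\<close>

context warped
begin

lemma LB_prod:
  assumes X: "X \<in> vector_fields B" and a: "a \<in> smooth_functions B" and h: "h \<in> smooth_functions (F j)"
    and p: "p \<in> points PM"
  shows "vf_apply (LB X) (\<lambda>q. a (fst q) * h (snd q j)) p = vf_apply X a (fst p) * h (snd p j)"
  by (simp add: PM.vf_apply_mult[OF LB_VF[OF X] p smooth_fst[OF a] smooth_snd[OF h]]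
      LB_fst[OF a] LB_snd[OF X p])

lemma LF_prod_same:
  assumes V: "V \<in> vector_fields (F j)" and a: "a \<in> smooth_functions B" and h: "h \<in> smooth_functions (F j)"
    and p: "p \<in> points PM"
  shows "vf_apply (LF j V) (\<lambda>q. a (fst q) * h (snd q j)) p = a (fst p) * vf_apply V h (snd p j)"
  by (simp add: PM.vf_apply_mult[OF LF_VF[OF V] p smooth_fst[OF a] smooth_snd[OF h]]
      LF_fst[OF V p] LF_snd_same[OF h])

lemma LF_prod_diff:
  assumes V: "V \<in> vector_fields (F i)" and a: "a \<in> smooth_functions B" and h: "h \<in> smooth_functions (F j)"
    and p: "p \<in> points PM" and ne: "j \<noteq> i"
  shows "vf_apply (LF i V) (\<lambda>q. a (fst q) * h (snd q j)) p = 0"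
  by (simp add: PM.vf_apply_mult[OF LF_VF[OF V] p smooth_fst[OF a] smooth_snd[OF h]]
      LF_fst[OF V p] LF_snd[OF V p ne])

lemma b_square_smooth: "(\<lambda>x. (b j x)\<^sup>2) \<in> smooth_functions B"
  by (rule B.smooth_functions_power[OF b_smooth])

lemma vf_apply_square:
  assumes X: "X \<in> vector_fields B" and x: "x \<in> points B" and f: "f \<in> smooth_functions B"
  shows "vf_apply X (\<lambda>x. (f x)\<^sup>2) x = 2 * f x * vf_apply X f x"
  using B.vf_apply_mult[OF X x f f] by (simp add: power2_eq_square)

context
  fixes p
  assumes p: "p \<in> points PM"
begin

lemma der_LB_LB_LB: "X \<in> vector_fields B \<Longrightarrow> Y \<in> vector_fields B \<Longrightarrow> Z \<in> vector_fields B \<Longrightarrow>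
    vf_apply (LB X) (metric_apply G (LB Y) (LB Z)) p = vf_apply X (metric_apply gB Y Z) (fst p)"
  using PM.vf_apply_eq[OF LB_VF p, of X "metric_apply G (LB Y) (LB Z)" "\<lambda>q. metric_apply gB Y Z (fst q)"]
    LB_fst[OF GB.g_smooth] G_LB_LB by simp

lemma der_LF_LB_LB: "V \<in> vector_fields (F j) \<Longrightarrow> Y \<in> vector_fields B \<Longrightarrow> Z \<in> vector_fields B \<Longrightarrow>
    vf_apply (LF j V) (metric_apply G (LB Y) (LB Z)) p = 0"
  using PM.vf_apply_eq[OF LF_VF p, of V j "metric_apply G (LB Y) (LB Z)" "\<lambda>q. metric_apply gB Y Z (fst q)"]
    LF_fst[OF _ p] G_LB_LB by simp

lemma der_LB_LF: "A \<in> PM.VF \<Longrightarrow> X \<in> vector_fields B \<Longrightarrow> V \<in> vector_fields (F j) \<Longrightarrow>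
    vf_apply A (metric_apply G (LB X) (LF j V)) p = 0"
  by (rule vf_apply_zero_on_points[OF p]) (simp_all add: G_LB_LF)

lemma der_LF_LB: "A \<in> PM.VF \<Longrightarrow> X \<in> vector_fields B \<Longrightarrow> V \<in> vector_fields (F j) \<Longrightarrow>
    vf_apply A (metric_apply G (LF j V) (LB X)) p = 0"
  by (rule vf_apply_zero_on_points[OF p]) (simp_all add: G_LF_LB)

lemma der_LF_LF_diff: "A \<in> PM.VF \<Longrightarrow> V \<in> vector_fields (F i) \<Longrightarrow> W \<in> vector_fields (F j) \<Longrightarrow> i \<noteq> j \<Longrightarrow>
    vf_apply A (metric_apply G (LF i V) (LF j W)) p = 0"
  by (rule vf_apply_zero_on_points[OF p]) (simp_all add: G_LF_LF_diff)

lemma der_LF_LF: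
  assumes A: "A \<in> PM.VF" and V: "V \<in> vector_fields (F j)" and W: "W \<in> vector_fields (F j)"
  shows "vf_apply A (metric_apply G (LF j V) (LF j W)) p =
    vf_apply A (\<lambda>q. (b j (fst q))\<^sup>2 * metric_apply (gF j) V W (snd q j)) p"
  by (rule PM.vf_apply_eq[OF A p]) (rule G_LF_LF_same[OF _ V W])

lemma der_LB_LF_LF:
  assumes X: "X \<in> vector_fields B" and V: "V \<in> vector_fields (F j)" and W: "W \<in> vector_fields (F j)"
  shows "vf_apply (LB X) (metric_apply G (LF j V) (LF j W)) p =
    2 * b j (fst p) * vf_apply X (b j) (fst p) * metric_apply (gF j) V W (snd p j)"
  unfolding der_LF_LF[OF LB_VF[OF X] V W] LB_prod[OF X b_square_smooth GF.g_smooth[OF V W] p]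
    vf_apply_square[OF X points_fst[OF p] b_smooth] ..

lemma der_LF_LF_LF:
  assumes U: "U \<in> vector_fields (F j)" and V: "V \<in> vector_fields (F j)" and W: "W \<in> vector_fields (F j)"
  shows "vf_apply (LF j U) (metric_apply G (LF j V) (LF j W)) p =
    (b j (fst p))\<^sup>2 * vf_apply U (metric_apply (gF j) V W) (snd p j)"
  unfolding der_LF_LF[OF LF_VF[OF U] V W] LF_prod_same[OF U b_square_smooth GF.g_smooth[OF V W] p] ..

lemma der_LF_LF_LF_diff:
  assumes U: "U \<in> vector_fields (F i)" and V: "V \<in> vector_fields (F j)" and W: "W \<in> vector_fields (F j)"
    and ne: "j \<noteq> i"
  shows "vf_apply (LF i U) (metric_apply G (LF j V) (LF j W)) p = 0"
  unfolding der_LF_LF[OF LF_VF[OF U] V W] LF_prod_diff[OF U b_square_smooth GF.g_smooth[OF V W] p ne] ..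

lemma G_bracket_LB_LB: "X \<in> vector_fields B \<Longrightarrow> Y \<in> vector_fields B \<Longrightarrow>
    metric_apply G A (lie_bracket (LB X) (LB Y)) p = metric_apply G A (LB (lie_bracket X Y)) p"
  by (simp add: metric_apply_apply bracket_LB_LB[OF p])

lemma G_bracket_LB_LF: "A \<in> PM.VF \<Longrightarrow> X \<in> vector_fields B \<Longrightarrow> V \<in> vector_fields (F j) \<Longrightarrow>
    metric_apply G A (lie_bracket (LB X) (LF j V)) p = 0"
  by (simp add: metric_apply_apply bracket_LB_LF[OF p] G.g_zero_right p PM.VF_tangent)

lemma G_bracket_LF_LB: "A \<in> PM.VF \<Longrightarrow> X \<in> vector_fields B \<Longrightarrow> V \<in> vector_fields (F j) \<Longrightarrow>
    metric_apply G A (lie_bracket (LF j V) (LB X)) p = 0"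
  by (simp add: metric_apply_apply bracket_LF_LB[OF p] G.g_zero_right p PM.VF_tangent)

lemma G_bracket_LF_LF: "V \<in> vector_fields (F j) \<Longrightarrow> W \<in> vector_fields (F j) \<Longrightarrow>
    metric_apply G A (lie_bracket (LF j V) (LF j W)) p = metric_apply G A (LF j (lie_bracket V W)) p"
  by (simp add: metric_apply_apply bracket_LF_LF_same[OF p])

lemma G_bracket_LF_LF_diff: "A \<in> PM.VF \<Longrightarrow> V \<in> vector_fields (F i) \<Longrightarrow> W \<in> vector_fields (F j) \<Longrightarrow> i \<noteq> j \<Longrightarrow>
    metric_apply G A (lie_bracket (LF i V) (LF j W)) p = 0"
  by (simp add: metric_apply_apply bracket_LF_LF_diff[OF p] G.g_zero_right p PM.VF_tangent)

lemmas G_lifts = G_LB_LB[OF p] G_LB_LF[OF p] G_LF_LB[OF p] G_LF_LF_same[OF p] G_LF_LF_diff[OF p]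

lemmas G_tables = G_lifts der_LB_LB_LB der_LF_LB_LB der_LB_LF der_LF_LB der_LF_LF_diff der_LB_LF_LF
  der_LF_LF_LF der_LF_LF_LF_diff G_bracket_LB_LB G_bracket_LB_LF G_bracket_LF_LB G_bracket_LF_LF
  G_bracket_LF_LF_diff LB_VF LF_VF B.VF_bracket F.VF_bracket

lemma koszul_LB_LB_LB: "X \<in> vector_fields B \<Longrightarrow> Y \<in> vector_fields B \<Longrightarrow> Z \<in> vector_fields B \<Longrightarrow>
    koszul G (LB X) (LB Y) (LB Z) p = koszul gB X Y Z (fst p)"
  by (simp add: koszul_def G_tables)

lemma koszul_LB_LB_LF: "X \<in> vector_fields B \<Longrightarrow> Y \<in> vector_fields B \<Longrightarrow> V \<in> vector_fields (F j) \<Longrightarrow>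
    koszul G (LB X) (LB Y) (LF j V) p = 0"
  by (simp add: koszul_def G_tables)

lemma koszul_LB_LF_LB: "X \<in> vector_fields B \<Longrightarrow> Y \<in> vector_fields B \<Longrightarrow> V \<in> vector_fields (F j) \<Longrightarrow>
    koszul G (LB X) (LF j V) (LB Y) p = 0"
  by (simp add: koszul_def G_tables)

lemma koszul_LF_LB_LB: "X \<in> vector_fields B \<Longrightarrow> Y \<in> vector_fields B \<Longrightarrow> V \<in> vector_fields (F j) \<Longrightarrow>
    koszul G (LF j V) (LB X) (LB Y) p = 0"
  by (simp add: koszul_def G_tables)

text \<open>All brackets vanish or pair to 0, and the only derivative left is half of X(b^2) = 2 b
  X(b).\<close>

lemma koszul_LB_LF_LF: "X \<in> vector_fields B \<Longrightarrow> V \<in> vector_fields (F j) \<Longrightarrow> W \<in> vector_fields (F j) \<Longrightarrow>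
    koszul G (LB X) (LF j V) (LF j W) p = b j (fst p) * vf_apply X (b j) (fst p) * metric_apply (gF j) V W (snd p j)"
  by (simp add: koszul_def G_tables)

lemma koszul_LB_LF_LF_diff: "X \<in> vector_fields B \<Longrightarrow> V \<in> vector_fields (F i) \<Longrightarrow> W \<in> vector_fields (F j) \<Longrightarrow>
    i \<noteq> j \<Longrightarrow> koszul G (LB X) (LF i V) (LF j W) p = 0"
  by (simp add: koszul_def G_tables)

lemma koszul_LF_LB_LF: "X \<in> vector_fields B \<Longrightarrow> V \<in> vector_fields (F j) \<Longrightarrow> W \<in> vector_fields (F j) \<Longrightarrow>
    koszul G (LF j V) (LB X) (LF j W) p = b j (fst p) * vf_apply X (b j) (fst p) * metric_apply (gF j) V W (snd p j)"
  using GF.metric_apply_sym[OF _ _ points_snd[OF p], of W j V] by (simp add: koszul_def G_tables)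

lemma koszul_LF_LB_LF_diff: "X \<in> vector_fields B \<Longrightarrow> V \<in> vector_fields (F i) \<Longrightarrow> W \<in> vector_fields (F j) \<Longrightarrow>
    i \<noteq> j \<Longrightarrow> koszul G (LF i V) (LB X) (LF j W) p = 0"
  by (simp add: koszul_def G_tables)

lemma koszul_LF_LF_LB: "X \<in> vector_fields B \<Longrightarrow> V \<in> vector_fields (F j) \<Longrightarrow> W \<in> vector_fields (F j) \<Longrightarrow>
    koszul G (LF j V) (LF j W) (LB X) p = - (b j (fst p) * vf_apply X (b j) (fst p) * metric_apply (gF j) V W (snd p j))"
  by (simp add: koszul_def G_tables)

lemma koszul_LF_LF_LB_diff: "X \<in> vector_fields B \<Longrightarrow> V \<in> vector_fields (F i) \<Longrightarrow> W \<in> vector_fields (F j) \<Longrightarrow>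
    i \<noteq> j \<Longrightarrow> koszul G (LF i V) (LF j W) (LB X) p = 0"
  by (simp add: koszul_def G_tables)

lemma koszul_LF_LF_LF: "U \<in> vector_fields (F j) \<Longrightarrow> V \<in> vector_fields (F j) \<Longrightarrow> W \<in> vector_fields (F j) \<Longrightarrow>
    koszul G (LF j U) (LF j V) (LF j W) p = (b j (fst p))\<^sup>2 * koszul (gF j) U V W (snd p j)"
  by (simp add: koszul_def G_tables field_simps)

lemma koszul_LF_LF_LF_diff: "U \<in> vector_fields (F k) \<Longrightarrow> V \<in> vector_fields (F i) \<Longrightarrow> W \<in> vector_fields (F j) \<Longrightarrow>
    \<not> (k = i \<and> i = j) \<Longrightarrow> koszul G (LF k U) (LF i V) (LF j W) p = 0"
  by (cases "k = i"; cases "i = j"; cases "k = j") (simp_all add: koszul_def G_tables)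

end

section \<open>The semi-symmetric metric Koszul form on lifts\<close>

context
  fixes P p
  assumes P: "P \<in> vector_fields B" and p: "p \<in> points PM"
begin

abbreviation "S \<equiv> ssm_koszul G (LB P)"
abbreviation "SB \<equiv> ssm_koszul gB P"

lemmas S_simps = ssm_koszul_def G_lifts[OF p] P

lemma S_LB_LB_LB: "X \<in> vector_fields B \<Longrightarrow> Y \<in> vector_fields B \<Longrightarrow> Z \<in> vector_fields B \<Longrightarrow>
    S (LB X) (LB Y) (LB Z) p = SB X Y Z (fst p)"
  by (simp add: S_simps koszul_LB_LB_LB[OF p])

lemma S_LB_LB_LF: "X \<in> vector_fields B \<Longrightarrow> Y \<in> vector_fields B \<Longrightarrow> V \<in> vector_fields (F j) \<Longrightarrow>
    S (LB X) (LB Y) (LF j V) p = 0"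
  by (simp add: S_simps koszul_LB_LB_LF[OF p])

lemma S_LB_LF_LB: "X \<in> vector_fields B \<Longrightarrow> Y \<in> vector_fields B \<Longrightarrow> V \<in> vector_fields (F j) \<Longrightarrow>
    S (LB X) (LF j V) (LB Y) p = 0"
  by (simp add: S_simps koszul_LB_LF_LB[OF p])

lemma S_LF_LB_LB: "X \<in> vector_fields B \<Longrightarrow> Y \<in> vector_fields B \<Longrightarrow> V \<in> vector_fields (F j) \<Longrightarrow>
    S (LF j V) (LB X) (LB Y) p = 0"
  by (simp add: S_simps koszul_LF_LB_LB[OF p])

lemma S_LB_LF_LF: "X \<in> vector_fields B \<Longrightarrow> V \<in> vector_fields (F j) \<Longrightarrow> W \<in> vector_fields (F j) \<Longrightarrow>
    S (LB X) (LF j V) (LF j W) p = b j (fst p) * vf_apply X (b j) (fst p) * metric_apply (gF j) V W (snd p j)"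
  by (simp add: S_simps koszul_LB_LF_LF[OF p])

lemma S_LB_LF_LF_diff: "X \<in> vector_fields B \<Longrightarrow> V \<in> vector_fields (F i) \<Longrightarrow> W \<in> vector_fields (F j) \<Longrightarrow>
    i \<noteq> j \<Longrightarrow> S (LB X) (LF i V) (LF j W) p = 0"
  by (simp add: S_simps koszul_LB_LF_LF_diff[OF p])

text \<open>As \<open>P\<close> comes from the base, the correction g(Y,P) g(X,Z) needs a base field
  in the second slot, and -g(X,Y) g(P,Z) one in the third. Among forms with fibre arguments this
  alters only the present one and \<open>S_LF_LF_LB\<close>.\<close>

lemma S_LF_LB_LF: "X \<in> vector_fields B \<Longrightarrow> V \<in> vector_fields (F j) \<Longrightarrow> W \<in> vector_fields (F j) \<Longrightarrow>
    S (LF j V) (LB X) (LF j W) p = (b j (fst p) * vf_apply X (b j) (fst p) + (b j (fst p))\<^sup>2 * metric_apply gB X P (fst p))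
      * metric_apply (gF j) V W (snd p j)"
  by (simp add: S_simps koszul_LF_LB_LF[OF p] algebra_simps)

lemma S_LF_LB_LF_diff: "X \<in> vector_fields B \<Longrightarrow> V \<in> vector_fields (F i) \<Longrightarrow> W \<in> vector_fields (F j) \<Longrightarrow>
    i \<noteq> j \<Longrightarrow> S (LF i V) (LB X) (LF j W) p = 0"
  by (simp add: S_simps koszul_LF_LB_LF_diff[OF p])

lemma S_LF_LF_LB: "X \<in> vector_fields B \<Longrightarrow> V \<in> vector_fields (F j) \<Longrightarrow> W \<in> vector_fields (F j) \<Longrightarrow>
    S (LF j V) (LF j W) (LB X) p = - ((b j (fst p) * vf_apply X (b j) (fst p) + (b j (fst p))\<^sup>2 * metric_apply gB P X (fst p))
      * metric_apply (gF j) V W (snd p j))"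
  by (simp add: S_simps koszul_LF_LF_LB[OF p] algebra_simps)

lemma S_LF_LF_LB_diff: "X \<in> vector_fields B \<Longrightarrow> V \<in> vector_fields (F i) \<Longrightarrow> W \<in> vector_fields (F j) \<Longrightarrow>
    i \<noteq> j \<Longrightarrow> S (LF i V) (LF j W) (LB X) p = 0"
  by (simp add: S_simps koszul_LF_LF_LB_diff[OF p])

lemma S_LF_LF_LF: "U \<in> vector_fields (F j) \<Longrightarrow> V \<in> vector_fields (F j) \<Longrightarrow> W \<in> vector_fields (F j) \<Longrightarrow>
    S (LF j U) (LF j V) (LF j W) p = (b j (fst p))\<^sup>2 * koszul (gF j) U V W (snd p j)"
  by (simp add: S_simps koszul_LF_LF_LF[OF p])

lemma S_LF_LF_LF_diff: "U \<in> vector_fields (F k) \<Longrightarrow> V \<in> vector_fields (F i) \<Longrightarrow> W \<in> vector_fields (F j) \<Longrightarrow>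
    \<not> (k = i \<and> i = j) \<Longrightarrow> S (LF k U) (LF i V) (LF j W) p = 0"
  by (simp add: S_simps koszul_LF_LF_LF_diff[OF p])

lemma S_bracket_LB_LB: "X \<in> vector_fields B \<Longrightarrow> Y \<in> vector_fields B \<Longrightarrow> A \<in> PM.VF \<Longrightarrow> C \<in> PM.VF \<Longrightarrow>
    S (lie_bracket (LB X) (LB Y)) A C p = S (LB (lie_bracket X Y)) A C p"
  by (rule G.ssm_koszul_cong_left) (simp_all add: PM.VF_bracket LB_VF B.VF_bracket bracket_LB_LB p)

lemma S_bracket_LF_LF: "V \<in> vector_fields (F j) \<Longrightarrow> W \<in> vector_fields (F j) \<Longrightarrow> A \<in> PM.VF \<Longrightarrow> C \<in> PM.VF \<Longrightarrow>
    S (lie_bracket (LF j V) (LF j W)) A C p = S (LF j (lie_bracket V W)) A C p"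
  by (rule G.ssm_koszul_cong_left) (simp_all add: PM.VF_bracket LF_VF F.VF_bracket bracket_LF_LF_same p)

text \<open>The bracket agrees with the zero field on \<open>points PM\<close> but need not be equal
  to it as a function, hence the passage through \<open>ssm_koszul_cong_left\<close>.\<close>

lemma S_bracket_zero:
  assumes "A' \<in> PM.VF" "C' \<in> PM.VF" "A \<in> PM.VF" "C \<in> PM.VF" "\<And>q. q \<in> points PM \<Longrightarrow> lie_bracket A' C' q = (\<lambda>f. 0)"
  shows "S (lie_bracket A' C') A C p = 0"
  using G.ssm_koszul_cong_left[OF PM.VF_bracket[OF assms(1,2)] PM.VF_zero assms(3,4) p, of "LB P"]
    G.ssm_koszul_zero_left[OF assms(3,4) LB_VF[OF P] p] assms(5) by simp

lemma S_bracket_LB_LF: "X \<in> vector_fields B \<Longrightarrow> V \<in> vector_fields (F j) \<Longrightarrow> A \<in> PM.VF \<Longrightarrow> C \<in> PM.VF \<Longrightarrow>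
    S (lie_bracket (LB X) (LF j V)) A C p = 0"
  by (rule S_bracket_zero) (simp_all add: LB_VF LF_VF bracket_LB_LF)

lemma S_bracket_LF_LF_diff: "V \<in> vector_fields (F i) \<Longrightarrow> W \<in> vector_fields (F j) \<Longrightarrow> i \<noteq> j \<Longrightarrow> A \<in> PM.VF \<Longrightarrow> C \<in> PM.VF \<Longrightarrow>
    S (lie_bracket (LF i V) (LF j W)) A C p = 0"
  by (rule S_bracket_zero) (simp_all add: LF_VF bracket_LF_LF_diff)

lemma S_tensorial: "A \<in> PM.VF \<Longrightarrow> C \<in> PM.VF \<Longrightarrow> PM.tensorial (S A C)"
  by (rule G.ssm_koszul_tensorial) (simp_all add: LB_VF P)

end

end

section \<open>The rank of a multiply warped product\<close>

text \<open>Induction over the set \<open>J\<close> of components allowed to be nonzero: admitting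
  one more component \<open>k\<close> adds the embedded copy of \<open>S k\<close> as a direct
  summand.\<close>

lemma dim_vec_prod:
  fixes S :: "'m::finite \<Rightarrow> 'e::euclidean_space set"
  assumes S: "\<And>j. subspace (S j)"
  shows "dim {v :: 'e ^ 'm. \<forall>j. v $ j \<in> S j} = (\<Sum>j\<in>UNIV. dim (S j))"
proof -
  let ?V = "\<lambda>J. {v :: 'e ^ 'm. \<forall>j. v $ j \<in> (if j \<in> J then S j else {0})}"
  have subV: "subspace (?V J)" for J
    using S by (auto simp: subspace_def)
  have lin: "linear (axis k :: 'e \<Rightarrow> 'e ^ 'm)" for k
    by (rule bounded_linear.linear[OF bounded_linear_axis])
  have "dim (?V J) = (\<Sum>j\<in>J. dim (S j))" for J
  proof (induction J rule: infinite_finite_induct)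
    case empty
    have "?V {} = {0}" by (auto simp: vec_eq_iff)
    then show ?case by simp
  next
    case (insert k J)
    let ?A = "axis k ` S k"
    have subA: "subspace ?A" by (rule linear_subspace_image[OF lin S])
    have "inj_on (axis k :: 'e \<Rightarrow> 'e ^ 'm) (span (S k))"
      by (rule inj_onI, drule arg_cong[where f = "\<lambda>v. v $ k"]) (simp add: axis_def)
    then have dimA: "dim ?A = dim (S k)" by (rule dim_image_eq[OF lin])
    have sums: "?V (insert k J) = {x + y |x y. x \<in> ?V J \<and> y \<in> ?A}"
    proof
      show "?V (insert k J) \<subseteq> {x + y |x y. x \<in> ?V J \<and> y \<in> ?A}"
      proof
        fix v assume v: "v \<in> ?V (insert k J)"
        have "v = (v - axis k (v $ k)) + axis k (v $ k)" by simp
        moreover have "v $ k \<in> S k" using v by (auto dest: spec[of _ k])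
        moreover have "v - axis k (v $ k) \<in> ?V J"
        proof (rule CollectI, rule allI)
          fix j
          have "v $ j \<in> (if j \<in> insert k J then S j else {0})" using v by blast
          then show "(v - axis k (v $ k)) $ j \<in> (if j \<in> J then S j else {0})"
            using insert.hyps(2) by (cases "j = k") (auto simp: axis_def)
        qed
        ultimately show "v \<in> {x + y |x y. x \<in> ?V J \<and> y \<in> ?A}" by blast
      qed
      show "{x + y |x y. x \<in> ?V J \<and> y \<in> ?A} \<subseteq> ?V (insert k J)"
      proof
        fix v assume "v \<in> {x + y |x y. x \<in> ?V J \<and> y \<in> ?A}"
        then obtain x s where x: "x \<in> ?V J" "s \<in> S k" "v = x + axis k s" by auto
        show "v \<in> ?V (insert k J)"
        proof (rule CollectI, rule allI)
          fix j
          have "x $ j \<in> (if j \<in> J then S j else {0})" using x by blast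
          then show "v $ j \<in> (if j \<in> insert k J then S j else {0})"
            using insert.hyps(2) x(2,3) by (cases "j = k") (auto simp: axis_def)
        qed
      qed
    qed
    have disj: "?V J \<inter> ?A = {0}"
    proof
      show "?V J \<inter> ?A \<subseteq> {0}"
      proof
        fix v assume "v \<in> ?V J \<inter> ?A"
        then obtain s where s: "v = axis k s" and "v $ k \<in> (if k \<in> J then S k else {0})" by blast
        then have "s = 0" using insert.hyps(2) by (simp add: axis_def)
        then show "v \<in> {0}" by (simp add: s axis_def vec_eq_iff)
      qed
      show "{0} \<subseteq> ?V J \<inter> ?A" using subspace_0[OF subV] subspace_0[OF subA] by blast
    qed
    have "dim (?V (insert k J)) + dim (?V J \<inter> ?A) = dim (?V J) + dim ?A"
      unfolding sums by (rule dim_sums_Int[OF subV subA])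
    then show ?case unfolding disj dimA insert.IH using insert.hyps by simp
  qed simp
  from this[of UNIV] show ?thesis by simp
qed

lemma linear_family_expand:
  fixes L :: "'k::euclidean_space \<Rightarrow> 'x \<Rightarrow> real"
  assumes "\<And>a c u w. L (a *\<^sub>R u + c *\<^sub>R w) = (\<lambda>f. a * L u f + c * L w f)"
  shows "L u = (\<lambda>f. \<Sum>b\<in>Basis. (u \<bullet> b) * L b f)"
proof
  fix f
  have lin: "linear (\<lambda>u. L u f)"
  proof (rule linearI)
    show "L (u + w) f = L u f + L w f" for u w using assms[of 1 u 1 w] by simp
    show "L (a *\<^sub>R u) f = a *\<^sub>R L u f" for a u using assms[of a u 0 u] by simp
  qed
  have "L (\<Sum>b\<in>Basis. (u \<bullet> b) *\<^sub>R b) f = (\<Sum>b\<in>Basis. (u \<bullet> b) * L b f)"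
    using linear_sum[OF lin, of "\<lambda>b. (u \<bullet> b) *\<^sub>R b" Basis] linear_scale[OF lin] by simp
  then show "L u f = (\<Sum>b\<in>Basis. (u \<bullet> b) * L b f)" by (simp only: euclidean_representation)
qed

context metric_mfd
begin

text \<open>A linear parametrisation of the tangent space by the whole chart type, onto but possibly
  with a kernel. Such maps for the factors combine componentwise into one for the product, whereas
  frames are tied to the chosen \<open>model_basis\<close>.\<close>

definition tangent_param :: "'a \<Rightarrow> ('e \<Rightarrow> 'a tvec) \<Rightarrow> bool" where
  "tangent_param p L \<longleftrightarrow> (\<forall>u. L u \<in> TS p) \<and> (\<forall>v\<in>TS p. \<exists>u. v = L u) \<and>
     (\<forall>a c u w. L (a *\<^sub>R u + c *\<^sub>R w) = (\<lambda>f. a * L u f + c * L w f))"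

lemma tangent_param_exists:
  assumes p: "p \<in> points M"
  shows "\<exists>L. tangent_param p L"
proof -
  obtain N E x where F: "local_frame N E x" and N: "p \<in> N" by (rule obtain_frame[OF p])
  have "tangent_param p (frame_vector E p)"
    unfolding tangent_param_def
    using frame_vector_tangent[OF F N] frame_vector_surj[OF F N] frame_vector_linear by blast
  then show ?thesis by blast
qed

definition gram_map :: "'a \<Rightarrow> ('e \<Rightarrow> 'a tvec) \<Rightarrow> 'e \<Rightarrow> 'e" where
  "gram_map p L u = (\<Sum>b\<in>Basis. g p (L u) (L b) *\<^sub>R b)"

lemma tangent_paramD:
  assumes "tangent_param p L"
  shows "L u \<in> TS p" "v \<in> TS p \<Longrightarrow> \<exists>u. v = L u"
    "L (a *\<^sub>R u + c *\<^sub>R w) = (\<lambda>f. a * L u f + c * L w f)"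
  using assms unfolding tangent_param_def by blast+

lemma tangent_param_zero: "tangent_param p L \<Longrightarrow> L 0 = (\<lambda>f. 0)"
  using tangent_paramD(3)[of p L 0 0 0 0] by simp

lemma metric_rank_param:
  assumes p: "p \<in> points M" and L: "tangent_param p L"
  shows "metric_rank M g p = dim (range (gram_map p L))"
proof -
  have "metric_rank M g p = dim ((\<lambda>v. \<Sum>b\<in>Basis. g p v (L b) *\<^sub>R b) ` TS p)"
  proof (rule metric_rank_eq[OF p tangent_paramD(1)[OF L]])
    fix v assume "v \<in> TS p"
    then obtain u where u: "v = L u" using tangent_paramD(2)[OF L] by blast
    show "\<exists>c. v = (\<lambda>f. \<Sum>b\<in>Basis. c b * L b f)"
      unfolding u by (rule exI, rule linear_family_expand) (rule tangent_paramD(3)[OF L])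
  qed
  moreover have "(\<lambda>v. \<Sum>b\<in>Basis. g p v (L b) *\<^sub>R b) ` TS p = range (gram_map p L)"
  proof -
    have "TS p = range L" using tangent_paramD(1,2)[OF L] by blast
    then show ?thesis by (simp add: image_image gram_map_def)
  qed
  ultimately show ?thesis by simp
qed

lemma gram_map_linear:
  assumes p: "p \<in> points M" and L: "tangent_param p L"
  shows "linear (gram_map p L)"
proof (rule linearI)
  note t = tangent_paramD(1)[OF L]
  have "gram_map p L (a *\<^sub>R u + c *\<^sub>R w) = a *\<^sub>R gram_map p L u + c *\<^sub>R gram_map p L w" for a c u w
    unfolding gram_map_def tangent_paramD(3)[OF L]
    by (simp add: g_lincomb[OF p t t t] scaleR_left_distrib sum.distrib scaleR_sum_right)
  from this[of 1 _ 1] this[of _ _ 0] show "gram_map p L (u + w) = gram_map p L u + gram_map p L w"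
    "gram_map p L (a *\<^sub>R u) = a *\<^sub>R gram_map p L u" for a u w
    by simp_all
qed

lemma metric_rank_zero:
  assumes p: "p \<in> points M" and 0: "metric_rank M g p = 0" and v: "v \<in> TS p" and w: "w \<in> TS p"
  shows "g p v w = 0"
proof -
  obtain L where L: "tangent_param p L" using tangent_param_exists[OF p] by blast
  obtain u where u: "v = L u" using tangent_paramD(2)[OF L v] by blast
  obtain u' where u': "w = L u'" using tangent_paramD(2)[OF L w] by blast
  have "range (gram_map p L) \<subseteq> {0}" using 0 metric_rank_param[OF p L] by (simp add: dim_eq_0)
  then have "gram_map p L u = 0" by blast
  have "g p (L u) (L b) = 0" if "b \<in> Basis" for b
  proof -
    have "gram_map p L u \<bullet> b = g p (L u) (L b)"
      unfolding gram_map_def using that by (simp add: inner_sum_left inner_Basis if_distrib cong: if_cong)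
    then show ?thesis by (simp add: \<open>gram_map p L u = 0\<close>)
  qed
  moreover have "w = (\<lambda>f. \<Sum>b\<in>Basis. (u' \<bullet> b) * L b f)"
    unfolding u' by (rule linear_family_expand) (rule tangent_paramD(3)[OF L])
  ultimately show ?thesis
    using tangent_paramD(1)[OF L] by (simp add: u g_sum_right[OF p] g_scale_right[OF p] tangent_scale)
qed

end

context warped
begin

lemma vec_lincomb: "vec p (\<lambda>f. a * u f + c * u' f) (\<lambda>j f. a * v j f + c * v' j f) =
    (\<lambda>f. a * vec p u v f + c * vec p u' v' f)"
  by (simp add: vec_def base.lift_vec_lincomb fib.lift_vec_lincomb sum.distrib sum_distrib_left algebra_simps)

lemma G_vec:
  assumes p: "p \<in> points PM" and u: "u \<in> tangent_space B (fst p)" "\<And>j. v j \<in> tangent_space (F j) (snd p j)"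
    and u': "u' \<in> tangent_space B (fst p)" "\<And>j. v' j \<in> tangent_space (F j) (snd p j)"
  shows "G p (vec p u v) (vec p u' v') = gB (fst p) u u' + (\<Sum>j\<in>UNIV. (b j (fst p))\<^sup>2 * gF j (snd p j) (v j) (v' j))"
  by (simp add: G_apply dB_vec[OF p u] dB_vec[OF p u'] dF_vec[OF p u] dF_vec[OF p u'])

text \<open>For the parametrisation \<open>K\<close> assembled from the factors, the Gram map is
  block diagonal, the block of fibre \<open>j\<close> being scaled by the square of
  \<open>b j\<close>. A nonzero scaling leaves the range of the block unchanged, a zero one erases
  it.\<close>

lemma metric_rank_PM:
  assumes p: "p \<in> points PM"
  shows "metric_rank PM G p = metric_rank B gB (fst p) +
    (\<Sum>j\<in>UNIV. if b j (fst p) = 0 then 0 else metric_rank (F j) (gF j) (snd p j))"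
proof -
  note pB = points_fst[OF p] and pF = points_snd[OF p]
  obtain L0 where L0: "GB.tangent_param (fst p) L0" using GB.tangent_param_exists[OF pB] by blast
  have "\<forall>j. \<exists>L. GF.tangent_param j (snd p j) L" using GF.tangent_param_exists[OF pF] by blast
  then obtain L where L': "\<forall>j. GF.tangent_param j (snd p j) (L j)" by (rule exE[OF choice])
  then have L: "GF.tangent_param j (snd p j) (L j)" for j by blast
  note t0 = GB.tangent_paramD(1)[OF L0] and tj = GF.tangent_paramD(1)[OF L]
  define K where "K w = vec p (L0 (fst w)) (\<lambda>j. L j (snd w $ j))" for w :: "'d \<times> ('e ^ 'm)"
  have Kt: "K w \<in> PM.TS p" for w unfolding K_def by (rule vec_tangent[OF p t0 tj])
  have Klin: "K (a *\<^sub>R u + c *\<^sub>R w) = (\<lambda>f. a * K u f + c * K w f)" for a c u w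
    unfolding K_def vec_lincomb[symmetric]
    by (simp add: GB.tangent_paramD(3)[OF L0] GF.tangent_paramD(3)[OF L])
  have Ksurj: "\<exists>w. v = K w" if v: "v \<in> PM.TS p" for v
  proof -
    obtain u0 where u0: "dB v = L0 u0" using GB.tangent_paramD(2)[OF L0 base.proj_vec_tangent[OF p v]] by blast
    have "\<forall>j. \<exists>u. dF j v = L j u" using GF.tangent_paramD(2)[OF L fib.proj_vec_tangent[OF p v]] by blast
    then obtain u where u: "\<forall>j. dF j v = L j (u j)" by (rule exE[OF choice])
    have "v = K (u0, \<chi> j. u j)"
      by (subst tangent_decomposition[OF p v]) (simp add: K_def u0 u)
    then show ?thesis by blast
  qed
  have KK: "G p (K w) (K w') = gB (fst p) (L0 (fst w)) (L0 (fst w')) +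
      (\<Sum>j\<in>UNIV. (b j (fst p))\<^sup>2 * gF j (snd p j) (L j (snd w $ j)) (L j (snd w' $ j)))" for w w'
    unfolding K_def by (rule G_vec[OF p t0 tj t0 tj])
  let ?\<Phi> = "\<lambda>w. \<Sum>c\<in>Basis. G p (K w) (K c) *\<^sub>R c"
  let ?R = "\<lambda>j u. (b j (fst p))\<^sup>2 *\<^sub>R GF.gram_map j (snd p j) (L j) u"
  have z0: "gB (fst p) (L0 u) (L0 0) = 0" for u
    unfolding GB.tangent_param_zero[OF L0] by (rule GB.g_zero_right[OF pB t0])
  have zj: "gF j (snd p j) (L j u) (L j 0) = 0" for j u
    unfolding GF.tangent_param_zero[OF L] by (rule GF.g_zero_right[OF pF tj])
  have \<Phi>: "?\<Phi> w = (GB.gram_map (fst p) L0 (fst w), \<chi> j. ?R j (snd w $ j))" for w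
  proof (rule euclidean_eqI)
    fix c :: "'d \<times> ('e ^ 'm)" assume c: "c \<in> Basis"
    have wc: "?\<Phi> w \<bullet> c = G p (K w) (K c)"
      using c by (simp add: inner_sum_left inner_Basis if_distrib cong: if_cong)
    consider a where "a \<in> Basis" "c = (a, 0)" | a j where "a \<in> Basis" "c = (0, axis j a)"
      using c by (auto simp: Basis_prod_def Basis_vec_def)
    then show "?\<Phi> w \<bullet> c = (GB.gram_map (fst p) L0 (fst w), \<chi> j. ?R j (snd w $ j)) \<bullet> c"
    proof cases
      case 1
      have "GB.gram_map (fst p) L0 (fst w) \<bullet> a = gB (fst p) (L0 (fst w)) (L0 a)"
        unfolding GB.gram_map_def using 1(1) by (simp add: inner_sum_left inner_Basis if_distrib cong: if_cong)
      then show ?thesis unfolding wc unfolding KK by (simp add: 1(2) zj)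
    next
      case 2
      have "(\<Sum>i\<in>UNIV. (b i (fst p))\<^sup>2 * gF i (snd p i) (L i (snd w $ i)) (L i (axis j a $ i))) =
          (\<Sum>i\<in>UNIV. if i = j then (b j (fst p))\<^sup>2 * gF j (snd p j) (L j (snd w $ j)) (L j a) else 0)"
        by (rule sum.cong) (auto simp: axis_def zj)
      moreover have "GF.gram_map j (snd p j) (L j) (snd w $ j) \<bullet> a = gF j (snd p j) (L j (snd w $ j)) (L j a)"
        unfolding GF.gram_map_def using 2(1) by (simp add: inner_sum_left inner_Basis if_distrib cong: if_cong)
      ultimately show ?thesis unfolding wc unfolding KK
        by (simp add: 2(2) z0 inner_axis)
    qed
  qed
  have Rlin: "linear (?R j)" for j
    by (rule linear_compose_scale_right[OF GF.gram_map_linear[OF pF L]])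
  have rank: "metric_rank PM G p = dim ((\<lambda>v. \<Sum>c\<in>Basis. G p v (K c) *\<^sub>R c) ` PM.TS p)"
  proof (rule G.metric_rank_eq[OF p Kt])
    fix v assume "v \<in> PM.TS p"
    then obtain w where w: "v = K w" using Ksurj by blast
    show "\<exists>c. v = (\<lambda>f. \<Sum>b\<in>Basis. c b * K b f)"
      unfolding w by (rule exI, rule linear_family_expand) (rule Klin)
  qed
  have "PM.TS p = range K" using Kt Ksurj by blast
  then have "(\<lambda>v. \<Sum>c\<in>Basis. G p v (K c) *\<^sub>R c) ` PM.TS p = range ?\<Phi>" by (simp add: image_image)
  also have "\<dots> = range (GB.gram_map (fst p) L0) \<times> {v. \<forall>j. v $ j \<in> range (?R j)}"
  proof
    show "range ?\<Phi> \<subseteq> range (GB.gram_map (fst p) L0) \<times> {v. \<forall>j. v $ j \<in> range (?R j)}"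
      unfolding \<Phi> by auto
    show "range (GB.gram_map (fst p) L0) \<times> {v. \<forall>j. v $ j \<in> range (?R j)} \<subseteq> range ?\<Phi>"
    proof
      fix z assume z: "z \<in> range (GB.gram_map (fst p) L0) \<times> {v. \<forall>j. v $ j \<in> range (?R j)}"
      then obtain u0 where u0: "fst z = GB.gram_map (fst p) L0 u0" by auto
      have "snd z $ j \<in> range (?R j)" for j using z by auto
      then have "\<forall>j. \<exists>u. snd z $ j = ?R j u" by blast
      then obtain u where u: "\<forall>j. snd z $ j = ?R j (u j)" by (rule exE[OF choice])
      have "z = ?\<Phi> (u0, \<chi> j. u j)" unfolding \<Phi> using u0 u by (simp add: prod_eq_iff vec_eq_iff)
      then show "z \<in> range ?\<Phi>" by blast
    qed
  qed
  finally have img: "(\<lambda>v. \<Sum>c\<in>Basis. G p v (K c) *\<^sub>R c) ` PM.TS p =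
      range (GB.gram_map (fst p) L0) \<times> {v. \<forall>j. v $ j \<in> range (?R j)}" .
  have subR: "subspace (range (?R j))" for j by (rule linear_subspace_image[OF Rlin subspace_UNIV])
  have sub: "subspace {v :: 'e ^ 'm. \<forall>j. v $ j \<in> range (?R j)}"
    using subspace_0[OF subR] subspace_add[OF subR] subspace_scale[OF subR]
    by (intro subspaceI) (simp_all del: scaleR_scaleR)
  have "dim (range (?R j)) = (if b j (fst p) = 0 then 0 else metric_rank (F j) (gF j) (snd p j))" for j
  proof (cases "b j (fst p) = 0")
    case True
    then have "range (?R j) = {0}" by auto
    then show ?thesis using True by simp
  next
    case False
    have "range (?R j) = range (GF.gram_map j (snd p j) (L j))"
    proof -
      have "GF.gram_map j (snd p j) (L j) u = ?R j ((1 / (b j (fst p))\<^sup>2) *\<^sub>R u)" for u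
        using False by (simp add: linear_scale[OF GF.gram_map_linear[OF pF L]])
      moreover have "?R j u = GF.gram_map j (snd p j) (L j) ((b j (fst p))\<^sup>2 *\<^sub>R u)" for u
        by (simp add: linear_scale[OF GF.gram_map_linear[OF pF L]])
      ultimately show ?thesis by (metis (no_types, lifting) rangeI range_eqI subsetI subset_antisym image_subset_iff)
    qed
    then show ?thesis using False GF.metric_rank_param[OF pF L] by simp
  qed
  then show ?thesis
    unfolding rank img
    by (simp add: dim_Times[OF linear_subspace_image[OF GB.gram_map_linear[OF pB L0] subspace_UNIV] sub]
        dim_vec_prod[OF subR] GB.metric_rank_param[OF pB L0])
qed

text \<open>Along the slice of fibre \<open>i\<close> through \<open>p\<close> all other summands of
  the rank are fixed, and the condition on \<open>b i\<close> keeps the summand of \<open>i\<close>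
  present.\<close>

lemma constant_rank_fibre:
  assumes p: "p \<in> constant_rank_points PM G" and b: "b i (fst p) \<noteq> 0"
  shows "snd p i \<in> constant_rank_points (F i) (gF i)"
proof -
  obtain N where pM: "p \<in> points PM" and N: "openin (manifold_topology PM) N" "p \<in> N"
    "\<forall>q\<in>N. metric_rank PM G q = metric_rank PM G p"
    using p unfolding constant_rank_points_def by blast
  let ?\<iota> = "\<lambda>z. (fst p, (snd p)(i := z))"
  let ?N = "{z\<in>points (F i). ?\<iota> z \<in> N}"
  have "openin (manifold_topology (F i)) ?N" by (rule fib.incl_open[OF pM N(1)])
  moreover have "snd p i \<in> ?N" using N(2) points_snd[OF pM] by simp
  moreover have "metric_rank (F i) (gF i) z = metric_rank (F i) (gF i) (snd p i)" if z: "z \<in> ?N" for z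
  proof -
    have zM: "?\<iota> z \<in> points PM" using z openin_PM N(1) by blast
    let ?r = "\<lambda>q j. if b j (fst q) = 0 then 0 else metric_rank (F j) (gF j) (snd q j)"
    have "(\<Sum>j\<in>UNIV. ?r (?\<iota> z) j) = (\<Sum>j\<in>UNIV. ?r p j)"
      using N(3) z metric_rank_PM[OF zM] metric_rank_PM[OF pM] by simp
    moreover have "(\<Sum>j\<in>UNIV - {i}. ?r (?\<iota> z) j) = (\<Sum>j\<in>UNIV - {i}. ?r p j)"
      by (rule sum.cong) auto
    ultimately have "?r (?\<iota> z) i = ?r p i" by (simp add: sum.remove[of UNIV i])
    then show ?thesis using b by simp
  qed
  ultimately show ?thesis unfolding constant_rank_points_def using points_snd[OF pM] by blast
qed

text \<open>Where a warping function vanishes without vanishing nearby, the rank jumps unless the fibre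
  metric is zero.\<close>

lemma constant_rank_base:
  assumes nd: "nondegenerate B gB" and p: "p \<in> constant_rank_points PM G" and b0: "b i (fst p) = 0"
  shows "(\<forall>X\<in>vector_fields B. vf_apply X (b i) (fst p) = 0) \<or>
    (\<forall>u\<in>tangent_space (F i) (snd p i). \<forall>v\<in>tangent_space (F i) (snd p i). gF i (snd p i) u v = 0)"
proof -
  obtain N where pM: "p \<in> points PM" and N: "openin (manifold_topology PM) N" "p \<in> N"
    "\<forall>q\<in>N. metric_rank PM G q = metric_rank PM G p"
    using p unfolding constant_rank_points_def by blast
  let ?J = "{j. b j (fst p) \<noteq> 0}"
  let ?N = "{x\<in>points B. (x, snd p) \<in> N}"
  \<comment> \<open>On \<open>?O\<close> the warping functions that are nonzero at
    \<open>fst p\<close> stay nonzero, so moving the base point within it can only add summands to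
    the rank.\<close>
  let ?O = "?N \<inter> (points B \<inter> (\<Inter>j\<in>?J. {x\<in>points B. b j x \<in> - {0}}))"
  have "openin (manifold_topology B) (points B \<inter> (\<Inter>j\<in>?J. {x\<in>points B. b j x \<in> - {0}}))"
  proof (rule openin_Int_Inter)
    show "finite ((\<lambda>j. {x\<in>points B. b j x \<in> - {0}}) ` ?J)" by simp
    show "openin (manifold_topology B) X" if "X \<in> (\<lambda>j. {x\<in>points B. b j x \<in> - {0}}) ` ?J" for X
      using that B.smooth_preimage_open[OF b_smooth, of "- {0}"] by auto
  qed (rule B.openin_T_points)
  then have O: "openin (manifold_topology B) ?O" by (rule openin_Int[OF base.incl_open[OF pM N(1)]])
  have pO: "fst p \<in> ?O" using N(2) points_fst[OF pM] by auto
  show ?thesis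
  proof (cases "\<exists>x\<in>?O. b i x \<noteq> 0")
    case True
    then obtain x where x: "x \<in> ?O" "b i x \<noteq> 0" by blast
    have xM: "(x, snd p) \<in> points PM" using x openin_PM N(1) by blast
    let ?r = "\<lambda>x j. if b j x = 0 then 0 else metric_rank (F j) (gF j) (snd p j)"
    \<comment> \<open>The total rank and the rank of the base are both constant here. As the other
      fibre summands do not decrease, the summand of \<open>i\<close>, which is 0 at
      \<open>fst p\<close>, cannot become positive at \<open>x\<close>.\<close>
    have "metric_rank B gB x = metric_rank B gB (fst p)"
      using GB.nondegenerate_metric_rank[OF nd] x points_fst[OF pM] by simp
    then have "(\<Sum>j\<in>UNIV. ?r x j) = (\<Sum>j\<in>UNIV. ?r (fst p) j)"
      using N(3) x metric_rank_PM[OF xM] metric_rank_PM[OF pM] by (simp cong: if_cong)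
    moreover have "(\<Sum>j\<in>UNIV - {i}. ?r (fst p) j) \<le> (\<Sum>j\<in>UNIV - {i}. ?r x j)"
      by (rule sum_mono) (use x in auto)
    ultimately have "?r x i \<le> ?r (fst p) i" by (simp add: sum.remove[of UNIV i])
    then have "metric_rank (F i) (gF i) (snd p i) = 0" using x(2) b0 by simp
    then show ?thesis using GF.metric_rank_zero[OF points_snd[OF pM]] by blast
  next
    case False
    \<comment> \<open>In this case \<open>b i\<close> vanishes on a whole neighbourhood of
      \<open>fst p\<close>.\<close>
    have "vf_apply X (b i) (fst p) = 0" if X: "X \<in> vector_fields B" for X
    proof -
      note t = B.VF_tangent[OF X points_fst[OF pM]]
      have "X (fst p) (b i) = X (fst p) (\<lambda>x. 0)"
        by (rule B.tangent_local[OF t O pO b_smooth B.smooth_functions_const]) (use False in blast)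
      then show ?thesis using B.tangent_const[OF t] by (simp add: vf_apply_apply)
    qed
    then show ?thesis by blast
  qed
qed

end

section \<open>Contractions on a multiply warped product\<close>

context metric_mfd
begin

text \<open>Membership of \<open>covector_at\<close> in the image of \<open>flat\<close> is
  informative only once the definite description is known to denote. Its value on \<open>u\<close>
  is that of the form on any field through \<open>u\<close>, which is well defined by
  \<open>tensorial_pointwise\<close>.\<close>

lemma represents_if_cotangent_bullet:
  assumes \<omega>: "tensorial \<omega>" and p: "p \<in> points M" and c: "covector_at M \<omega> p \<in> cotangent_bullet M g p"
  shows "\<exists>v. represents \<omega> v p"
proof -
  let ?P = "\<lambda>\<alpha>. (\<forall>Z\<in>VF. \<alpha> (Z p) = \<omega> Z p) \<and> (\<forall>v. v \<notin> TS p \<longrightarrow> \<alpha> v = 0)"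
  define \<alpha> where "\<alpha> u = (if u \<in> TS p then \<omega> (SOME Z. Z \<in> VF \<and> Z p = u) p else 0)" for u
  have "\<alpha> (Z p) = \<omega> Z p" if Z: "Z \<in> VF" for Z
  proof -
    let ?Z = "SOME Z'. Z' \<in> VF \<and> Z' p = Z p"
    have "?Z \<in> VF \<and> ?Z p = Z p" by (rule someI[of _ Z]) (simp add: Z)
    then show ?thesis
      using tensorial_pointwise[OF \<omega> _ Z p, of ?Z] VF_tangent[OF Z p] by (simp add: \<alpha>_def)
  qed
  then have P: "?P \<alpha>" by (simp add: \<alpha>_def)
  have "\<beta> = \<alpha>" if \<beta>: "?P \<beta>" for \<beta>
  proof
    fix u show "\<beta> u = \<alpha> u"
    proof (cases "u \<in> TS p")
      case True
      then obtain Z where "Z \<in> VF" "Z p = u" using tangent_extension[OF p] by metis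
      then show ?thesis using P \<beta> by metis
    qed (use P \<beta> in auto)
  qed
  then have eq: "covector_at M \<omega> p = \<alpha>" unfolding covector_at_def using P by (intro the_equality)
  obtain v where v: "v \<in> TS p" "\<alpha> = flat M g p v" using c unfolding eq cotangent_bullet_def by auto
  have "\<omega> Z p = g p v (Z p)" if Z: "Z \<in> VF" for Z
  proof -
    have "\<alpha> (Z p) = \<omega> Z p" using P Z by blast
    then show ?thesis using VF_tangent[OF Z p] unfolding v(2) by (simp add: flat_def)
  qed
  with v(1) show ?thesis unfolding represents_def by blast
qed

end

lemma (in mfd) d_fun_tensorial: "f \<in> Sm \<Longrightarrow> tensorial (d_fun f)"
  unfolding tensorial_def d_fun_def using VF_smooth by (simp add: vf_apply_apply)

locale warped_regular = warped B F gB gF b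
  for B :: "('a, 'd::euclidean_space) manifold" and F :: "'m::finite \<Rightarrow> ('c, 'e::euclidean_space) manifold"
    and gB gF b +
  fixes P
  assumes nd: "nondegenerate B gB" and sr: "\<And>l. semi_regular (F l) (gF l)" and P: "P \<in> vector_fields B"
begin

abbreviation "K \<equiv> ssm_koszul G (LB P)"
abbreviation "KB \<equiv> ssm_koszul gB P"
abbreviation "gstar \<equiv> pointwise_contraction B gB"

lemma KB_tensorial: "X \<in> vector_fields B \<Longrightarrow> Y \<in> vector_fields B \<Longrightarrow> B.tensorial (KB X Y)"
  by (rule GB.ssm_koszul_tensorial[OF _ _ P])

lemma koszul_represents_fibre:
  assumes "V \<in> vector_fields (F j)" "W \<in> vector_fields (F j)" "y \<in> points (F j)"
  shows "\<exists>v. GF.represents j (koszul (gF j) V W) v y"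
proof (rule GF.represents_if_cotangent_bullet[OF GF.koszul_tensorial[OF assms(1,2)] assms(3)])
  show "covector_at (F j) (koszul (gF j) V W) y \<in> cotangent_bullet (F j) (gF j) y"
    using sr[of j] assms unfolding semi_regular_def radical_stationary_def by blast
qed

lemma contraction_fibre:
  assumes "V \<in> vector_fields (F j)" "W \<in> vector_fields (F j)" "U \<in> vector_fields (F j)" "Q \<in> vector_fields (F j)"
  shows "contraction (F j) (gF j) (koszul (gF j) V W) (koszul (gF j) U Q) \<in> smooth_functions (F j)"
    and "y \<in> constant_rank_points (F j) (gF j) \<Longrightarrow>
      contraction (F j) (gF j) (koszul (gF j) V W) (koszul (gF j) U Q) y =
      pointwise_contraction (F j) (gF j) (koszul (gF j) V W) (koszul (gF j) U Q) y"
proof -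
  let ?E = "extends_contraction (F j) (gF j) (koszul (gF j) V W) (koszul (gF j) U Q)"
  have "\<exists>f. ?E f" using sr[of j] assms unfolding semi_regular_def smooth_contraction_def by blast
  then have "?E (contraction (F j) (gF j) (koszul (gF j) V W) (koszul (gF j) U Q))"
    unfolding contraction_def by (rule someI_ex)
  then show "contraction (F j) (gF j) (koszul (gF j) V W) (koszul (gF j) U Q) \<in> smooth_functions (F j)"
    "y \<in> constant_rank_points (F j) (gF j) \<Longrightarrow>
      contraction (F j) (gF j) (koszul (gF j) V W) (koszul (gF j) U Q) y =
      pointwise_contraction (F j) (gF j) (koszul (gF j) V W) (koszul (gF j) U Q) y"
    unfolding extends_contraction_def by blast+
qed

text \<open>Tensoriality reduces the test to lifts, and on lifts the warped metric of
  \<open>vec q u v\<close> splits into one term per factor.\<close>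

lemma represents_vec:
  assumes \<omega>: "PM.tensorial \<omega>" and q: "q \<in> points PM"
    and u: "u \<in> tangent_space B (fst q)" "\<And>j. v j \<in> tangent_space (F j) (snd q j)"
    and B: "\<And>Z. Z \<in> vector_fields B \<Longrightarrow> \<omega> (LB Z) q = gB (fst q) u (Z (fst q))"
    and F: "\<And>j Z. Z \<in> vector_fields (F j) \<Longrightarrow>
      \<omega> (LF j Z) q = (b j (fst q))\<^sup>2 * gF j (snd q j) (v j) (Z (snd q j))"
  shows "G.represents \<omega> (vec q u v) q"
  unfolding G.represents_def
proof (intro conjI ballI)
  show "vec q u v \<in> PM.TS q" by (rule vec_tangent[OF q u])
  fix Z assume Z: "Z \<in> PM.VF"
  obtain Z0 Z' where Z': "Z0 \<in> vector_fields B" "\<forall>j. Z' j \<in> vector_fields (F j)"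
    "Z0 (fst q) = dB (Z q)" "\<forall>j. Z' j (snd q j) = dF j (Z q)"
    "\<omega> Z q = \<omega> (LB Z0) q + (\<Sum>j\<in>UNIV. \<omega> (LF j (Z' j)) q)"
    by (rule tensorial_PM_expand[OF \<omega> Z q]) blast
  show "\<omega> Z q = G q (vec q u v) (Z q)"
    unfolding Z'(5) G_apply dB_vec[OF q u] dF_vec[OF q u] using Z'(1-4) B F by simp
qed

lemma represents_zero:
  assumes \<omega>: "PM.tensorial \<omega>" and q: "q \<in> points PM"
    and B: "\<And>Z. Z \<in> vector_fields B \<Longrightarrow> \<omega> (LB Z) q = 0"
    and F: "\<And>j Z. Z \<in> vector_fields (F j) \<Longrightarrow> \<omega> (LF j Z) q = 0"
  shows "G.represents \<omega> (\<lambda>f. 0) q"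
  unfolding G.represents_def
proof (intro conjI ballI PM.tangent_zero)
  fix Z assume Z: "Z \<in> PM.VF"
  obtain Z0 Z' where Z': "Z0 \<in> vector_fields B" "\<forall>j. Z' j \<in> vector_fields (F j)"
    "\<omega> Z q = \<omega> (LB Z0) q + (\<Sum>j\<in>UNIV. \<omega> (LF j (Z' j)) q)"
    by (rule tensorial_PM_expand[OF \<omega> Z q]) blast
  show "\<omega> Z q = G q (\<lambda>f. 0) (Z q)"
    unfolding Z'(3) using Z'(1,2) B F by (simp add: G.g_zero_left[OF q PM.VF_tangent[OF Z q]])
qed

text \<open>The work in each case consists of a smooth candidate \<open>h\<close> and, at each point
  of constant rank, one pair of representing vectors. Both orders are concluded because the
  curvature contains the mixed contractions either way round.\<close>

lemma contraction_PM_eq: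
  assumes h: "h \<in> PM.Sm" and p: "p \<in> points PM"
    and eq: "\<And>q. q \<in> constant_rank_points PM G \<Longrightarrow> q \<in> points PM \<Longrightarrow>
      \<exists>v w. G.represents \<omega> v q \<and> G.represents \<tau> w q \<and> G q v w = h q"
  shows "contraction PM G \<omega> \<tau> p = h p" "contraction PM G \<tau> \<omega> p = h p"
proof -
  have "h q = pointwise_contraction PM G \<omega> \<tau> q \<and> h q = pointwise_contraction PM G \<tau> \<omega> q"
    if q: "q \<in> constant_rank_points PM G" for q
  proof -
    have qM: "q \<in> points PM" using q by (simp add: constant_rank_points_def)
    obtain v w where vw: "G.represents \<omega> v q" "G.represents \<tau> w q" "G q v w = h q"
      using eq[OF q qM] by blast
    show ?thesis
      using G.pointwise_contraction_eq[OF qM vw(1,2)] G.pointwise_contraction_eq[OF qM vw(2,1)] vw(3)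
        G.g_sym[OF qM G.represents_tangent[OF vw(1)] G.represents_tangent[OF vw(2)]] by simp
  qed
  then have "extends_contraction PM G \<omega> \<tau> h" "extends_contraction PM G \<tau> \<omega> h"
    unfolding extends_contraction_def using h by blast+
  then show "contraction PM G \<omega> \<tau> p = h p" "contraction PM G \<tau> \<omega> p = h p"
    using G.contraction_eq p by blast+
qed

lemma contraction_zero:
  assumes p: "p \<in> points PM"
    and \<omega>: "\<And>q. q \<in> points PM \<Longrightarrow> G.represents \<omega> (\<lambda>f. 0) q"
    and \<tau>: "\<And>q. q \<in> points PM \<Longrightarrow> \<exists>w. G.represents \<tau> w q"
  shows "contraction PM G \<omega> \<tau> p = 0" "contraction PM G \<tau> \<omega> p = 0"
proof -
  have ex: "\<exists>v w. G.represents \<omega> v q \<and> G.represents \<tau> w q \<and> G q v w = 0" if q: "q \<in> points PM" for q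
  proof -
    obtain w where w: "G.represents \<tau> w q" using \<tau>[OF q] ..
    show ?thesis
      by (intro exI conjI, rule \<omega>[OF q], rule w, rule G.g_zero_left[OF q G.represents_tangent[OF w]])
  qed
  show "contraction PM G \<omega> \<tau> p = 0" by (rule contraction_PM_eq(1)[OF PM.smooth_functions_const p ex])
  show "contraction PM G \<tau> \<omega> p = 0" by (rule contraction_PM_eq(2)[OF PM.smooth_functions_const p ex])
qed

text \<open>The forms occurring in a contraction are of three kinds: \<open>K (LB X) (LB Y)\<close> is pulled back from the
  base; \<open>K (LB X) (LF j V)\<close> and \<open>K (LF j V) (LB X)\<close> are multiples of \<open>g\<^sub>j(V, \<cdot>)\<close>; and
  \<open>K (LF j V) (LF j W)\<close> has components on the base and on the fibre \<open>j\<close>. The coefficient \<open>h\<close> below must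
  vanish together with \<open>b j\<close> and \<open>d (b j)\<close>, as division by \<open>b j\<close> yields \<open>0\<close> there.\<close>

definition fibre_form :: "('a \<times> ('m \<Rightarrow> 'c)) oneform \<Rightarrow> 'm \<Rightarrow> ('a \<Rightarrow> real) \<Rightarrow> 'c vfield \<Rightarrow> bool" where
  "fibre_form \<omega> j h V \<longleftrightarrow> PM.tensorial \<omega> \<and> V \<in> vector_fields (F j) \<and> h \<in> smooth_functions B \<and>
     (\<forall>x\<in>points B. b j x = 0 \<longrightarrow> (\<forall>X\<in>vector_fields B. vf_apply X (b j) x = 0) \<longrightarrow> h x = 0) \<and>
     (\<forall>q\<in>points PM. (\<forall>Z\<in>vector_fields B. \<omega> (LB Z) q = 0) \<and>
       (\<forall>Z\<in>vector_fields (F j). \<omega> (LF j Z) q = b j (fst q) * h (fst q) * metric_apply (gF j) V Z (snd q j)) \<and>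
       (\<forall>i. i \<noteq> j \<longrightarrow> (\<forall>Z\<in>vector_fields (F i). \<omega> (LF i Z) q = 0)))"

definition fibre_vec :: "'a \<times> ('m \<Rightarrow> 'c) \<Rightarrow> 'm \<Rightarrow> 'a tvec \<Rightarrow> 'c tvec \<Rightarrow> ('a \<times> ('m \<Rightarrow> 'c)) tvec" where
  "fibre_vec q j u w = vec q u (\<lambda>i. if i = j then w else (\<lambda>f. 0))"

lemma G_fibre_vec:
  assumes q: "q \<in> points PM" and u: "u \<in> tangent_space B (fst q)" "u' \<in> tangent_space B (fst q)"
    and w: "w \<in> tangent_space (F i) (snd q i)" "w' \<in> tangent_space (F j) (snd q j)"
  shows "G q (fibre_vec q i u w) (fibre_vec q j u' w') =
    gB (fst q) u u' + (if i = j then (b j (fst q))\<^sup>2 * gF j (snd q j) w w' else 0)"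
proof -
  have t: "(if l = i then w else (\<lambda>f. 0)) \<in> tangent_space (F l) (snd q l)"
    "(if l = j then w' else (\<lambda>f. 0)) \<in> tangent_space (F l) (snd q l)" for l
    using w by (auto simp: F.tangent_zero)
  have "(\<Sum>l\<in>UNIV. (b l (fst q))\<^sup>2 * gF l (snd q l) (if l = i then w else (\<lambda>f. 0)) (if l = j then w' else (\<lambda>f. 0))) =
      (\<Sum>l\<in>UNIV. if l = j then (if i = j then (b j (fst q))\<^sup>2 * gF j (snd q j) w w' else 0) else 0)"
  proof (rule sum.cong)
    fix l
    show "(b l (fst q))\<^sup>2 * gF l (snd q l) (if l = i then w else (\<lambda>f. 0)) (if l = j then w' else (\<lambda>f. 0)) =
        (if l = j then (if i = j then (b j (fst q))\<^sup>2 * gF j (snd q j) w w' else 0) else 0)"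
      using w by (cases "l = i"; cases "l = j")
        (auto simp: GF.g_zero_left GF.g_zero_right points_snd[OF q] F.tangent_zero)
  qed simp
  then show ?thesis
    unfolding fibre_vec_def using G_vec[OF q u(1) t(1) u(2) t(2)] by simp
qed

lemma represents_base:
  assumes X: "X \<in> vector_fields B" and Y: "Y \<in> vector_fields B" and q: "q \<in> points PM"
    and u: "GB.represents (KB X Y) u (fst q)"
  shows "G.represents (K (LB X) (LB Y)) (fibre_vec q j u (\<lambda>f. 0)) q"
  unfolding fibre_vec_def
proof (rule represents_vec[OF S_tensorial[OF P q LB_VF[OF X] LB_VF[OF Y]] q GB.represents_tangent[OF u]])
  show "K (LB X) (LB Y) (LB Z) q = gB (fst q) u (Z (fst q))" if "Z \<in> vector_fields B" for Z
    using S_LB_LB_LB[OF P q X Y that] GB.represents_apply[OF u that] by simp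
  show "K (LB X) (LB Y) (LF i Z) q =
      (b i (fst q))\<^sup>2 * gF i (snd q i) (if i = j then (\<lambda>f. 0) else (\<lambda>f. 0)) (Z (snd q i))"
    if "Z \<in> vector_fields (F i)" for i Z
    using S_LB_LB_LF[OF P q X Y that] by (simp add: GF.g_zero_left points_snd q F.VF_tangent[OF that])
qed (simp add: F.tangent_zero)

text \<open>The factor of the representing vector. The product of \<open>coef j h x\<close> with the
  square of \<open>b j x\<close> is \<open>b j x * h x\<close> also where \<open>b j\<close>
  vanishes, both being 0 there.\<close>

definition coef :: "'m \<Rightarrow> ('a \<Rightarrow> real) \<Rightarrow> 'a \<Rightarrow> real" where
  "coef j h x = h x / b j x"

text \<open>The base component of the vector representing \<open>K (LF j V) (LF j W)\<close>: with
  \<open>m\<close> the value of the fibre metric on \<open>V\<close>, \<open>W\<close> and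
  \<open>u\<close> the gradient of \<open>b j\<close>, it is -m (b u + b^2 P).\<close>

definition base_part :: "'m \<Rightarrow> real \<Rightarrow> 'a \<Rightarrow> 'a tvec \<Rightarrow> 'a tvec" where
  "base_part j m x u = (\<lambda>f. - (m * b j x) * u f + - (m * (b j x)\<^sup>2) * P x f)"

lemma base_part_tangent:
  assumes "x \<in> points B" "u \<in> tangent_space B x"
  shows "base_part j m x u \<in> tangent_space B x"
  unfolding base_part_def by (rule B.tangent_lincomb[OF assms(2) B.VF_tangent[OF P assms(1)]])

lemma g_base_part:
  assumes x: "x \<in> points B" and u: "u \<in> tangent_space B x" and v: "v \<in> tangent_space B x"
  shows "gB x (base_part j m x u) v = - m * (b j x * gB x u v + (b j x)\<^sup>2 * gB x (P x) v)"
    and "gB x v (base_part j m x u) = - m * (b j x * gB x v u + (b j x)\<^sup>2 * gB x v (P x))"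
proof -
  note tP = B.VF_tangent[OF P x]
  show *: "gB x (base_part j m x u) v = - m * (b j x * gB x u v + (b j x)\<^sup>2 * gB x (P x) v)"
    unfolding base_part_def GB.g_lincomb[OF x u tP v] by (simp add: algebra_simps)
  show "gB x v (base_part j m x u) = - m * (b j x * gB x v u + (b j x)\<^sup>2 * gB x v (P x))"
    unfolding GB.g_sym[OF x v base_part_tangent[OF x u]] * GB.g_sym[OF x v u] GB.g_sym[OF x v tP] ..
qed

lemma represents_fibre_form:
  assumes \<omega>: "fibre_form \<omega> j h V" and q: "q \<in> points PM"
  shows "G.represents \<omega> (fibre_vec q j (\<lambda>f. 0) (\<lambda>f. coef j h (fst q) * V (snd q j) f)) q"
proof -
  note d = \<omega>[unfolded fibre_form_def]
  have V: "V \<in> vector_fields (F j)" using d by blast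
  note t = F.VF_tangent[OF V points_snd[OF q]]
  show ?thesis
    unfolding fibre_vec_def
  proof (rule represents_vec[OF conjunct1[OF d] q B.tangent_zero])
    show "(if i = j then (\<lambda>f. coef j h (fst q) * V (snd q j) f) else (\<lambda>f. 0)) \<in> tangent_space (F i) (snd q i)" for i
      using t by (auto simp: F.tangent_zero intro: F.tangent_scale)
    show "\<omega> (LB Z) q = gB (fst q) (\<lambda>f. 0) (Z (fst q))" if "Z \<in> vector_fields B" for Z
      using d that q by (simp add: GB.g_zero_left points_fst B.VF_tangent)
    fix i Z assume Z: "Z \<in> vector_fields (F i)"
    note tZ = F.VF_tangent[OF Z points_snd[OF q]]
    show "\<omega> (LF i Z) q = (b i (fst q))\<^sup>2 * gF i (snd q i)
        (if i = j then (\<lambda>f. coef j h (fst q) * V (snd q j) f) else (\<lambda>f. 0)) (Z (snd q i))"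
    proof (cases "i = j")
      case True
      have "\<omega> (LF j Z) q = b j (fst q) * h (fst q) * metric_apply (gF j) V Z (snd q j)"
        using d q Z True by blast
      then show ?thesis
        unfolding True using tZ[unfolded True]
        by (cases "b j (fst q) = 0")
          (simp_all add: GF.g_scale_left[OF points_snd[OF q] t] metric_apply_apply power2_eq_square,
            simp add: coef_def)
    next
      case False
      then have "\<omega> (LF i Z) q = 0" using d q Z by blast
      then show ?thesis using False tZ by (simp add: GF.g_zero_left points_snd q)
    qed
  qed
qed

text \<open>On the fibre, both the form and the warped metric carry the square of
  \<open>b j\<close>, so the vector \<open>k\<close> representing the Koszul form of the fibre can
  be used unchanged and no division occurs.\<close>

lemma represents_fibre_fibre:
  assumes V: "V \<in> vector_fields (F j)" and W: "W \<in> vector_fields (F j)" and q: "q \<in> points PM"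
    and u: "GB.represents (d_fun (b j)) u (fst q)" and k: "GF.represents j (koszul (gF j) V W) k (snd q j)"
  shows "G.represents (K (LF j V) (LF j W)) (fibre_vec q j
    (base_part j (metric_apply (gF j) V W (snd q j)) (fst q) u) k) q"
proof -
  note tu = GB.represents_tangent[OF u]
  note tk = GF.represents_tangent[OF k]
  show ?thesis
    unfolding fibre_vec_def
  proof (rule represents_vec[OF S_tensorial[OF P q LF_VF[OF V] LF_VF[OF W]] q base_part_tangent[OF points_fst[OF q] tu]])
    show "(if i = j then k else (\<lambda>f. 0)) \<in> tangent_space (F i) (snd q i)" for i
      using tk by (auto simp: F.tangent_zero)
    fix Z assume Z: "Z \<in> vector_fields B"
    have "gB (fst q) u (Z (fst q)) = vf_apply Z (b j) (fst q)"
      using GB.represents_apply[OF u Z] by (simp add: d_fun_def)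
    then show "K (LF j V) (LF j W) (LB Z) q =
        gB (fst q) (base_part j (metric_apply (gF j) V W (snd q j)) (fst q) u) (Z (fst q))"
      unfolding g_base_part(1)[OF points_fst[OF q] tu B.VF_tangent[OF Z points_fst[OF q]]] S_LF_LF_LB[OF P q Z V W]
      by (simp add: metric_apply_apply algebra_simps)
  next
    fix i Z assume Z: "Z \<in> vector_fields (F i)"
    note tZ = F.VF_tangent[OF Z points_snd[OF q]]
    show "K (LF j V) (LF j W) (LF i Z) q = (b i (fst q))\<^sup>2 * gF i (snd q i) (if i = j then k else (\<lambda>f. 0)) (Z (snd q i))"
      using S_LF_LF_LF[OF P q V W, of Z] S_LF_LF_LF_diff[OF P q V W Z] GF.represents_apply[OF k, of Z] Z tZ
      by (cases "i = j") (auto simp: GF.g_zero_left points_snd q)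
  qed
qed

lemma represents_fibre_fibre_diff:
  assumes V: "V \<in> vector_fields (F i)" and W: "W \<in> vector_fields (F j)" and ne: "i \<noteq> j" and q: "q \<in> points PM"
  shows "G.represents (K (LF i V) (LF j W)) (\<lambda>f. 0) q"
  by (rule represents_zero[OF S_tensorial[OF P q LF_VF[OF V] LF_VF[OF W]] q])
    (use ne in \<open>simp_all add: S_LF_LF_LB_diff[OF P q _ V W] S_LF_LF_LF_diff[OF P q V W]\<close>)

lemma base_representers:
  assumes "x \<in> points B"
  shows "X \<in> vector_fields B \<Longrightarrow> Y \<in> vector_fields B \<Longrightarrow> \<exists>u. GB.represents (KB X Y) u x"
    and "\<exists>u. GB.represents (d_fun (b j)) u x"
  using GB.nondegenerate_represents(1)[OF nd KB_tensorial assms]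
    GB.nondegenerate_represents(1)[OF nd B.d_fun_tensorial[OF b_smooth] assms] by blast+

lemma representable_lifts:
  assumes q: "q \<in> points PM"
  shows "X \<in> vector_fields B \<Longrightarrow> Y \<in> vector_fields B \<Longrightarrow> \<exists>w. G.represents (K (LB X) (LB Y)) w q"
    and "fibre_form \<omega> j h V \<Longrightarrow> \<exists>w. G.represents \<omega> w q"
    and "V \<in> vector_fields (F i) \<Longrightarrow> W \<in> vector_fields (F j) \<Longrightarrow> \<exists>w. G.represents (K (LF i V) (LF j W)) w q"
proof -
  show "\<exists>w. G.represents (K (LB X) (LB Y)) w q" if "X \<in> vector_fields B" "Y \<in> vector_fields B"
    using base_representers(1)[OF points_fst[OF q] that] represents_base[OF that q] by blast
  show "\<exists>w. G.represents \<omega> w q" if "fibre_form \<omega> j h V"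
    using represents_fibre_form[OF that q] by blast
  show "\<exists>w. G.represents (K (LF i V) (LF j W)) w q" if V: "V \<in> vector_fields (F i)" and W: "W \<in> vector_fields (F j)"
  proof (cases "i = j")
    case True
    note V = V[unfolded True]
    show ?thesis
      using base_representers(2)[OF points_fst[OF q], of j] koszul_represents_fibre[OF V W points_snd[OF q]]
        represents_fibre_fibre[OF V W q] True by blast
  next
    case False
    then show ?thesis using represents_fibre_fibre_diff[OF V W _ q] by blast
  qed
qed

lemma fibre_form_LB_LF:
  assumes X: "X \<in> vector_fields B" and V: "V \<in> vector_fields (F j)"
  shows "fibre_form (K (LB X) (LF j V)) j (vf_apply X (b j)) V"
  unfolding fibre_form_def
proof (intro conjI ballI allI impI V B.VF_smooth[OF X b_smooth])
  show "PM.tensorial (K (LB X) (LF j V))"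
    by (rule G.ssm_koszul_tensorial[OF LB_VF[OF X] LF_VF[OF V] LB_VF[OF P]])
qed (simp_all add: S_LB_LF_LB[OF P _ X _ V] S_LB_LF_LF[OF P _ X V] S_LB_LF_LF_diff[OF P _ X V] X)

text \<open>The term with \<open>P\<close> vanishes with \<open>b j\<close>, the other one with its
  differential; this is why \<open>fibre_form\<close> asks for zeros of the coefficient only where
  both vanish.\<close>

lemma fibre_form_LF_LB:
  assumes X: "X \<in> vector_fields B" and V: "V \<in> vector_fields (F j)"
  shows "fibre_form (K (LF j V) (LB X)) j (\<lambda>x. vf_apply X (b j) x + b j x * metric_apply gB X P x) V"
  unfolding fibre_form_def
proof (intro conjI ballI allI impI V)
  show "PM.tensorial (K (LF j V) (LB X))"
    by (rule G.ssm_koszul_tensorial[OF LF_VF[OF V] LB_VF[OF X] LB_VF[OF P]])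
  show "(\<lambda>x. vf_apply X (b j) x + b j x * metric_apply gB X P x) \<in> smooth_functions B"
    by (intro B.smooth_functions_add B.smooth_functions_mult B.VF_smooth[OF X b_smooth] b_smooth GB.g_smooth X P)
qed (simp_all add: S_LF_LB_LB[OF P _ X _ V] S_LF_LB_LF[OF P _ X V] S_LF_LB_LF_diff[OF P _ X V] X
    algebra_simps power2_eq_square)

lemma KB_contraction:
  assumes "X \<in> vector_fields B" "Y \<in> vector_fields B" "Z \<in> vector_fields B" "T \<in> vector_fields B" "x \<in> points B"
  shows "contraction B gB (KB X Y) (KB Z T) x = gstar (KB X Y) (KB Z T) x"
  by (rule GB.contraction_eq[OF _ assms(5)])
    (simp add: extends_contraction_def GB.nondegenerate_contraction_smooth[OF nd] KB_tensorial assms)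

text \<open>The inner product under the inverse metric of the base of the 1-forms b db + b^2
  g_B(P,.) taken for \<open>b i\<close> and for \<open>b j\<close>, expanded.\<close>

definition base_factor :: "'m \<Rightarrow> 'm \<Rightarrow> 'a \<Rightarrow> real" where
  "base_factor i j x = b i x * b j x * gstar (d_fun (b i)) (d_fun (b j)) x + b i x * (b j x)\<^sup>2 * vf_apply P (b i) x
     + b j x * (b i x)\<^sup>2 * vf_apply P (b j) x + (b i x)\<^sup>2 * (b j x)\<^sup>2 * metric_apply gB P P x"

section \<open>Contractions of the Koszul forms of lifts\<close>

context
  fixes p
  assumes p: "p \<in> points PM"
begin

lemma contraction_base_base:
  assumes X: "X \<in> vector_fields B" "Y \<in> vector_fields B" and Z: "Z \<in> vector_fields B" "T \<in> vector_fields B"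
  shows "contraction PM G (K (LB X) (LB Y)) (K (LB Z) (LB T)) p = gstar (KB X Y) (KB Z T) (fst p)"
proof (rule contraction_PM_eq(1)[OF _ p])
  show "(\<lambda>q. gstar (KB X Y) (KB Z T) (fst q)) \<in> PM.Sm"
    by (intro smooth_fst GB.nondegenerate_contraction_smooth[OF nd] KB_tensorial X Z)
  fix q assume q: "q \<in> points PM"
  note x = points_fst[OF q]
  obtain u w where u: "GB.represents (KB X Y) u (fst q)" and w: "GB.represents (KB Z T) w (fst q)"
    using base_representers(1)[OF x X] base_representers(1)[OF x Z] by blast
  \<comment> \<open>The fibre component is zero, so any index can serve in
    \<open>fibre_vec\<close>.\<close>
  fix j :: 'm
  have "G q (fibre_vec q j u (\<lambda>f. 0)) (fibre_vec q j w (\<lambda>f. 0)) = gstar (KB X Y) (KB Z T) (fst q)"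
    unfolding GB.pointwise_contraction_eq[OF x u w]
    by (simp add: G_fibre_vec[OF q] GB.represents_tangent[OF u] GB.represents_tangent[OF w] F.tangent_zero
        GF.g_zero_left points_snd[OF q])
  then show "\<exists>v w. G.represents (K (LB X) (LB Y)) v q \<and> G.represents (K (LB Z) (LB T)) w q \<and>
      G q v w = gstar (KB X Y) (KB Z T) (fst q)"
    using represents_base[OF X q u, of j] represents_base[OF Z q w, of j] by blast
qed

text \<open>The two representing vectors are tangent to different factors, which are
  orthogonal.\<close>

lemma contraction_base_fibre_form:
  assumes X: "X \<in> vector_fields B" "Y \<in> vector_fields B" and \<omega>: "fibre_form \<omega> j h V"
  shows "contraction PM G (K (LB X) (LB Y)) \<omega> p = 0" "contraction PM G \<omega> (K (LB X) (LB Y)) p = 0"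
proof -
  have ex: "\<exists>v w. G.represents (K (LB X) (LB Y)) v q \<and> G.represents \<omega> w q \<and> G q v w = 0"
    if q: "q \<in> points PM" for q
  proof -
    note x = points_fst[OF q]
    obtain u where u: "GB.represents (KB X Y) u (fst q)" using base_representers(1)[OF x X] by blast
    have V: "V (snd q j) \<in> tangent_space (F j) (snd q j)"
      using \<omega> F.VF_tangent points_snd[OF q] unfolding fibre_form_def by blast
    have "G q (fibre_vec q j u (\<lambda>f. 0)) (fibre_vec q j (\<lambda>f. 0) (\<lambda>f. coef j h (fst q) * V (snd q j) f)) = 0"
      using F.tangent_scale[OF V]
      by (simp add: G_fibre_vec[OF q] GB.represents_tangent[OF u] B.tangent_zero F.tangent_zero
          GF.g_zero_left points_snd[OF q] GB.g_zero_right x)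
    then show ?thesis using represents_base[OF X q u, of j] represents_fibre_form[OF \<omega> q] by blast
  qed
  show "contraction PM G (K (LB X) (LB Y)) \<omega> p = 0"
    by (rule contraction_PM_eq(1)[OF PM.smooth_functions_const p ex])
  show "contraction PM G \<omega> (K (LB X) (LB Y)) p = 0"
    by (rule contraction_PM_eq(2)[OF PM.smooth_functions_const p ex])
qed

text \<open>The fibre parts do not meet. The base part pairs the vector \<open>u\<close>
  representing \<open>KB X Y\<close> with the gradient of \<open>b j\<close>, giving
  \<open>gstar\<close>, and with \<open>P\<close>, giving \<open>KB X Y P\<close>.\<close>

lemma contraction_base_fibre:
  assumes X: "X \<in> vector_fields B" "Y \<in> vector_fields B" and V: "V \<in> vector_fields (F j)" "W \<in> vector_fields (F j)"
  shows "contraction PM G (K (LF j V) (LF j W)) (K (LB X) (LB Y)) p =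
    - (b j (fst p) * gstar (KB X Y) (d_fun (b j)) (fst p) + (b j (fst p))\<^sup>2 * KB X Y P (fst p))
      * metric_apply (gF j) V W (snd p j)"
proof (rule contraction_PM_eq(2)[OF _ p])
  note dt = B.d_fun_tensorial[OF b_smooth, of j]
  show "(\<lambda>q. - (b j (fst q) * gstar (KB X Y) (d_fun (b j)) (fst q) + (b j (fst q))\<^sup>2 * KB X Y P (fst q))
      * metric_apply (gF j) V W (snd q j)) \<in> PM.Sm"
    by (intro PM.smooth_functions_mult PM.smooth_functions_minus PM.smooth_functions_add PM.smooth_functions_power
        smooth_fst smooth_snd b_smooth GB.nondegenerate_contraction_smooth[OF nd] KB_tensorial X dt
        B.tensorial_smooth[OF KB_tensorial] P GF.g_smooth V)
  fix q assume q: "q \<in> points PM"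
  note x = points_fst[OF q]
  obtain u where u: "GB.represents (KB X Y) u (fst q)" using base_representers(1)[OF x X] by blast
  obtain d where d: "GB.represents (d_fun (b j)) d (fst q)" using base_representers(2)[OF x] by blast
  obtain k where k: "GF.represents j (koszul (gF j) V W) k (snd q j)"
    using koszul_represents_fibre[OF V points_snd[OF q]] by blast
  note tu = GB.represents_tangent[OF u] and td = GB.represents_tangent[OF d]
  note tk = GF.represents_tangent[OF k]
  let ?m = "metric_apply (gF j) V W (snd q j)"
  let ?d = "base_part j ?m (fst q) d"
  have "gB (fst q) u ?d = - ?m * (b j (fst q) * gB (fst q) u d + (b j (fst q))\<^sup>2 * gB (fst q) u (P (fst q)))"
    by (rule g_base_part(2)[OF x td tu])
  moreover have "gB (fst q) u (P (fst q)) = KB X Y P (fst q)" using GB.represents_apply[OF u P] by simp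
  ultimately have "G q (fibre_vec q j u (\<lambda>f. 0)) (fibre_vec q j ?d k) =
      - (b j (fst q) * gstar (KB X Y) (d_fun (b j)) (fst q) + (b j (fst q))\<^sup>2 * KB X Y P (fst q)) * ?m"
    unfolding GB.pointwise_contraction_eq[OF x u d]
    by (simp add: G_fibre_vec[OF q tu base_part_tangent[OF x td] F.tangent_zero tk]
        GF.g_zero_left[OF points_snd[OF q] tk] algebra_simps)
  then show "\<exists>v w. G.represents (K (LB X) (LB Y)) v q \<and> G.represents (K (LF j V) (LF j W)) w q \<and>
      G q v w = - (b j (fst q) * gstar (KB X Y) (d_fun (b j)) (fst q) + (b j (fst q))\<^sup>2 * KB X Y P (fst q)) * ?m"
    using represents_base[OF X q u, of j] represents_fibre_fibre[OF V q d k] by blast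
qed

text \<open>Where \<open>b j\<close> is nonzero its square cancels the two divisions. Where it
  vanishes, the inner product of the representing vectors is 0 while the claimed value may not be;
  at points of constant rank \<open>constant_rank_base\<close> forces it to be 0, through the
  coefficient or through the fibre metric. This is the case in which the extension really differs
  from a pointwise value.\<close>

lemma contraction_fibre_form_same:
  assumes \<omega>: "fibre_form \<omega> j h V" and \<tau>: "fibre_form \<tau> j k W"
  shows "contraction PM G \<omega> \<tau> p = h (fst p) * k (fst p) * metric_apply (gF j) V W (snd p j)"
proof (rule contraction_PM_eq(1)[OF _ p])
  note d = \<omega>[unfolded fibre_form_def] \<tau>[unfolded fibre_form_def]
  have V: "V \<in> vector_fields (F j)" and W: "W \<in> vector_fields (F j)" using d by blast+
  show "(\<lambda>q. h (fst q) * k (fst q) * metric_apply (gF j) V W (snd q j)) \<in> PM.Sm"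
    using d by (intro PM.smooth_functions_mult smooth_fst smooth_snd GF.g_smooth) blast+
  fix q assume qc: "q \<in> constant_rank_points PM G" and q: "q \<in> points PM"
  note x = points_fst[OF q] and y = points_snd[OF q]
  note tV = F.VF_tangent[OF V y] and tW = F.VF_tangent[OF W y]
  let ?h = "coef j h (fst q)" and ?k = "coef j k (fst q)"
  have "G q (fibre_vec q j (\<lambda>f. 0) (\<lambda>f. ?h * V (snd q j) f)) (fibre_vec q j (\<lambda>f. 0) (\<lambda>f. ?k * W (snd q j) f)) =
      (b j (fst q))\<^sup>2 * (?h * (?k * metric_apply (gF j) V W (snd q j)))"
    unfolding G_fibre_vec[OF q B.tangent_zero B.tangent_zero F.tangent_scale[OF tV] F.tangent_scale[OF tW]]
      GF.g_scale_left[OF y tV F.tangent_scale[OF tW]] GF.g_scale_right[OF y tW tV]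
    by (simp add: GB.g_zero_left x B.tangent_zero metric_apply_apply)
  also have "\<dots> = h (fst q) * k (fst q) * metric_apply (gF j) V W (snd q j)"
  proof (cases "b j (fst q) = 0")
    case True
    have "h (fst q) = 0 \<or> metric_apply (gF j) V W (snd q j) = 0"
      using constant_rank_base[OF nd qc True]
    proof
      assume "\<forall>X\<in>vector_fields B. vf_apply X (b j) (fst q) = 0"
      then show ?thesis using d(1) True x by blast
    qed (simp add: metric_apply_apply tV tW)
    then show ?thesis using True by auto
  qed (simp add: coef_def power2_eq_square)
  finally show "\<exists>v w. G.represents \<omega> v q \<and> G.represents \<tau> w q \<and>
      G q v w = h (fst q) * k (fst q) * metric_apply (gF j) V W (snd q j)"
    using represents_fibre_form[OF \<omega> q] represents_fibre_form[OF \<tau> q] by blast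
qed

lemma contraction_fibre_form_diff:
  assumes \<omega>: "fibre_form \<omega> i h V" and \<tau>: "fibre_form \<tau> j k W" and ne: "i \<noteq> j"
  shows "contraction PM G \<omega> \<tau> p = 0"
proof (rule contraction_PM_eq(1)[OF PM.smooth_functions_const p])
  fix q assume q: "q \<in> points PM"
  note x = points_fst[OF q] and y = points_snd[OF q]
  have t: "V (snd q i) \<in> tangent_space (F i) (snd q i)" "W (snd q j) \<in> tangent_space (F j) (snd q j)"
    using \<omega> \<tau> F.VF_tangent y unfolding fibre_form_def by blast+
  have "G q (fibre_vec q i (\<lambda>f. 0) (\<lambda>f. coef i h (fst q) * V (snd q i) f))
      (fibre_vec q j (\<lambda>f. 0) (\<lambda>f. coef j k (fst q) * W (snd q j) f)) = 0"
    unfolding G_fibre_vec[OF q B.tangent_zero B.tangent_zero F.tangent_scale[OF t(1)] F.tangent_scale[OF t(2)]]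
    using ne by (simp add: GB.g_zero_left x B.tangent_zero)
  then show "\<exists>v w. G.represents \<omega> v q \<and> G.represents \<tau> w q \<and> G q v w = 0"
    using represents_fibre_form[OF \<omega> q] represents_fibre_form[OF \<tau> q] by blast
qed

text \<open>Only one of the two vectors carries a division, so one factor \<open>b j\<close>
  survives and the formula holds at all points, both sides being 0 where \<open>b j\<close>
  vanishes. The base part of the second vector has no counterpart in the first.\<close>

lemma contraction_fibre_form_fibre:
  assumes \<omega>: "fibre_form \<omega> i h U" and V: "V \<in> vector_fields (F j)" "W \<in> vector_fields (F j)"
  shows "contraction PM G \<omega> (K (LF j V) (LF j W)) p =
      (if i = j then b j (fst p) * h (fst p) * koszul (gF j) V W U (snd p j) else 0)"
    and "contraction PM G (K (LF j V) (LF j W)) \<omega> p =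
      (if i = j then b j (fst p) * h (fst p) * koszul (gF j) V W U (snd p j) else 0)"
proof -
  let ?c = "\<lambda>q. if i = j then b j (fst q) * h (fst q) * koszul (gF j) V W U (snd q j) else 0"
  note d = \<omega>[unfolded fibre_form_def]
  have U: "U \<in> vector_fields (F i)" and h: "h \<in> smooth_functions B" using d by blast+
  have smooth: "?c \<in> PM.Sm"
  proof (cases "i = j")
    case True
    have "(\<lambda>q. b j (fst q) * h (fst q) * koszul (gF j) V W U (snd q j)) \<in> PM.Sm"
      by (intro PM.smooth_functions_mult smooth_fst smooth_snd b_smooth h GF.koszul_smooth V U[unfolded True])
    then show ?thesis using True by simp
  qed (simp add: PM.smooth_functions_const)
  have ex: "\<exists>v w. G.represents \<omega> v q \<and> G.represents (K (LF j V) (LF j W)) w q \<and> G q v w = ?c q"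
    if q: "q \<in> points PM" for q
  proof -
    note x = points_fst[OF q] and y = points_snd[OF q]
    obtain dd where dd: "GB.represents (d_fun (b j)) dd (fst q)" using base_representers(2)[OF x] by blast
    obtain k where k: "GF.represents j (koszul (gF j) V W) k (snd q j)"
      using koszul_represents_fibre[OF V y] by blast
    note td = GB.represents_tangent[OF dd] and tk = GF.represents_tangent[OF k]
    note tU = F.VF_tangent[OF U y]
    let ?m = "metric_apply (gF j) V W (snd q j)"
    let ?d = "base_part j ?m (fst q) dd"
    have "G q (fibre_vec q i (\<lambda>f. 0) (\<lambda>f. coef i h (fst q) * U (snd q i) f)) (fibre_vec q j ?d k) = ?c q"
    proof (cases "i = j")
      case True
      have "gF j (snd q j) (U (snd q j)) k = koszul (gF j) V W U (snd q j)"
        using GF.represents_apply[OF k U[unfolded True]] GF.g_sym[OF y tk tU[unfolded True]] by simp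
      then show ?thesis
        unfolding G_fibre_vec[OF q B.tangent_zero base_part_tangent[OF x td] F.tangent_scale[OF tU] tk]
        using True by (cases "b j (fst q) = 0", simp_all add: GB.g_zero_left[OF x base_part_tangent[OF x td]]
            GF.g_scale_left[OF y tU[unfolded True] tk] power2_eq_square, simp add: coef_def)
    next
      case False
      then show ?thesis
        unfolding G_fibre_vec[OF q B.tangent_zero base_part_tangent[OF x td] F.tangent_scale[OF tU] tk]
        by (simp add: GB.g_zero_left[OF x base_part_tangent[OF x td]])
    qed
    then show ?thesis using represents_fibre_form[OF \<omega> q] represents_fibre_fibre[OF V q dd k] by blast
  qed
  show "contraction PM G \<omega> (K (LF j V) (LF j W)) p = ?c p"
    by (rule contraction_PM_eq(1)[OF smooth p ex])
  show "contraction PM G (K (LF j V) (LF j W)) \<omega> p = ?c p"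
    by (rule contraction_PM_eq(2)[OF smooth p ex])
qed

text \<open>The base parts yield \<open>base_factor\<close>. The fibre parts meet only for equal
  indices: where \<open>b j\<close> is nonzero the point of the fibre is itself of constant rank, so
  the contraction of the fibre is pointwise there, and elsewhere its factor vanishes.\<close>

lemma contraction_fibre_fibre:
  assumes V: "V \<in> vector_fields (F i)" "W \<in> vector_fields (F i)" and U: "U \<in> vector_fields (F j)" "Q \<in> vector_fields (F j)"
  shows "contraction PM G (K (LF i V) (LF i W)) (K (LF j U) (LF j Q)) p =
    base_factor i j (fst p) * metric_apply (gF i) V W (snd p i) * metric_apply (gF j) U Q (snd p j) +
    (if i = j then (b j (fst p))\<^sup>2 * contraction (F j) (gF j) (koszul (gF j) V W) (koszul (gF j) U Q) (snd p j) else 0)"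
proof (rule contraction_PM_eq(1)[OF _ p])
  let ?c = "\<lambda>q. base_factor i j (fst q) * metric_apply (gF i) V W (snd q i) * metric_apply (gF j) U Q (snd q j) +
    (if i = j then (b j (fst q))\<^sup>2 * contraction (F j) (gF j) (koszul (gF j) V W) (koszul (gF j) U Q) (snd q j) else 0)"
  have "(\<lambda>q. base_factor i j (fst q) * metric_apply (gF i) V W (snd q i) * metric_apply (gF j) U Q (snd q j)) \<in> PM.Sm"
    unfolding base_factor_def
    by (intro PM.smooth_functions_mult PM.smooth_functions_add PM.smooth_functions_power smooth_fst smooth_snd
        b_smooth GB.nondegenerate_contraction_smooth[OF nd] B.d_fun_tensorial B.VF_smooth[OF P] GB.g_smooth P
        GF.g_smooth V U)
  moreover have "(\<lambda>q. if i = j then (b j (fst q))\<^sup>2 *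
      contraction (F j) (gF j) (koszul (gF j) V W) (koszul (gF j) U Q) (snd q j) else 0) \<in> PM.Sm"
  proof (cases "i = j")
    case True
    have "(\<lambda>q. (b j (fst q))\<^sup>2 *
        contraction (F j) (gF j) (koszul (gF j) V W) (koszul (gF j) U Q) (snd q j)) \<in> PM.Sm"
      by (intro PM.smooth_functions_mult PM.smooth_functions_power smooth_fst smooth_snd b_smooth
          contraction_fibre(1) V[unfolded True] U)
    then show ?thesis using True by simp
  qed (simp add: PM.smooth_functions_const)
  ultimately show "?c \<in> PM.Sm" by (rule PM.smooth_functions_add)
  fix q assume qc: "q \<in> constant_rank_points PM G" and q: "q \<in> points PM"
  note x = points_fst[OF q] and y = points_snd[OF q]
  obtain d where d: "GB.represents (d_fun (b i)) d (fst q)" using base_representers(2)[OF x] by blast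
  obtain e where e: "GB.represents (d_fun (b j)) e (fst q)" using base_representers(2)[OF x] by blast
  obtain k where k: "GF.represents i (koszul (gF i) V W) k (snd q i)" using koszul_represents_fibre[OF V y] by blast
  obtain l where l: "GF.represents j (koszul (gF j) U Q) l (snd q j)" using koszul_represents_fibre[OF U y] by blast
  note td = GB.represents_tangent[OF d] and te = GB.represents_tangent[OF e] and tP = B.VF_tangent[OF P x]
  note tk = GF.represents_tangent[OF k] and tl = GF.represents_tangent[OF l]
  let ?m = "metric_apply (gF i) V W (snd q i)" and ?n = "metric_apply (gF j) U Q (snd q j)"
  let ?d = "base_part i ?m (fst q) d"
  let ?e = "base_part j ?n (fst q) e"
  have "gB (fst q) d (P (fst q)) = vf_apply P (b i) (fst q)" "gB (fst q) e (P (fst q)) = vf_apply P (b j) (fst q)"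
    using GB.represents_apply[OF d P] GB.represents_apply[OF e P] by (simp_all add: d_fun_def)
  moreover have "gB (fst q) (P (fst q)) e = gB (fst q) e (P (fst q))" by (rule GB.g_sym[OF x tP te])
  moreover have "gB (fst q) d e = gstar (d_fun (b i)) (d_fun (b j)) (fst q)"
    using GB.pointwise_contraction_eq[OF x d e] by simp
  ultimately have base: "gB (fst q) ?d ?e = base_factor i j (fst q) * ?m * ?n"
    unfolding g_base_part(1)[OF x td base_part_tangent[OF x te]] g_base_part(2)[OF x te td] g_base_part(2)[OF x te tP] base_factor_def
    by (simp add: metric_apply_apply algebra_simps power2_eq_square)
  have fibre: "(b j (fst q))\<^sup>2 * gF j (snd q j) k l =
      (b j (fst q))\<^sup>2 * contraction (F j) (gF j) (koszul (gF j) V W) (koszul (gF j) U Q) (snd q j)" if ij: "i = j"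
  proof (cases "b j (fst q) = 0")
    case False
    show ?thesis
      using contraction_fibre(2)[OF V[unfolded ij] U constant_rank_fibre[OF qc False]]
        GF.pointwise_contraction_eq[OF y k[unfolded ij] l] by simp
  qed simp
  have "G q (fibre_vec q i ?d k) (fibre_vec q j ?e l) = ?c q"
    unfolding G_fibre_vec[OF q base_part_tangent[OF x td] base_part_tangent[OF x te] tk tl] base
    using fibre by simp
  then show "\<exists>v w. G.represents (K (LF i V) (LF i W)) v q \<and> G.represents (K (LF j U) (LF j Q)) w q \<and> G q v w = ?c q"
    using represents_fibre_fibre[OF V q d k] represents_fibre_fibre[OF U q e l] by blast
qed

end

end

section \<open>The curvature of a multiply warped product\<close>

context warped_regular
begin

abbreviation "R \<equiv> ssm_curvature PM G (LB P)"

lemma gstar_sym: "x \<in> points B \<Longrightarrow> gstar (d_fun (b i)) (d_fun (b j)) x = gstar (d_fun (b j)) (d_fun (b i)) x"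
proof -
  assume x: "x \<in> points B"
  obtain d where d: "GB.represents (d_fun (b i)) d x" using base_representers(2)[OF x] by blast
  obtain e where e: "GB.represents (d_fun (b j)) e x" using base_representers(2)[OF x] by blast
  show ?thesis
    unfolding GB.pointwise_contraction_eq[OF x d e] GB.pointwise_contraction_eq[OF x e d]
    by (rule GB.g_sym[OF x GB.represents_tangent[OF d] GB.represents_tangent[OF e]])
qed

text \<open>If \<open>u\<close> represents the Koszul form, then u + g(Y,P) X - g(X,Y) P represents
  \<open>KB X Y\<close>.\<close>

lemma gstar_KB:
  assumes X: "X \<in> vector_fields B" and Y: "Y \<in> vector_fields B" and x: "x \<in> points B"
  shows "gstar (KB X Y) (d_fun (b j)) x = gstar (koszul gB X Y) (d_fun (b j)) x
    + metric_apply gB Y P x * vf_apply X (b j) x - metric_apply gB X Y x * vf_apply P (b j) x"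
proof -
  obtain u where u: "GB.represents (koszul gB X Y) u x"
    using GB.nondegenerate_represents(1)[OF nd GB.koszul_tensorial[OF X Y] x] by blast
  obtain d where d: "GB.represents (d_fun (b j)) d x" using base_representers(2)[OF x] by blast
  note tu = GB.represents_tangent[OF u] and td = GB.represents_tangent[OF d]
  note tX = B.VF_tangent[OF X x] and tP = B.VF_tangent[OF P x]
  let ?c = "metric_apply gB Y P x" and ?e = "- metric_apply gB X Y x"
  define v where "v = (\<lambda>f. ?c * X x f + ?e * P x f)"
  have tv: "v \<in> tangent_space B x" unfolding v_def by (rule B.tangent_lincomb[OF tX tP])
  have gv: "gB x v w = ?c * gB x (X x) w + ?e * gB x (P x) w" if w: "w \<in> tangent_space B x" for w
    unfolding v_def by (rule GB.g_lincomb[OF x tX tP w])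
  have guv: "gB x (\<lambda>f. 1 * u f + 1 * v f) w = gB x u w + gB x v w" if w: "w \<in> tangent_space B x" for w
    unfolding GB.g_lincomb[OF x tu tv w] by simp
  have "GB.represents (KB X Y) (\<lambda>f. 1 * u f + 1 * v f) x"
    unfolding GB.represents_def
  proof (intro conjI ballI B.tangent_lincomb[OF tu tv])
    fix Z assume Z: "Z \<in> vector_fields B"
    note tZ = B.VF_tangent[OF Z x]
    show "KB X Y Z x = gB x (\<lambda>f. 1 * u f + 1 * v f) (Z x)"
      unfolding guv[OF tZ] gv[OF tZ] ssm_koszul_def GB.represents_apply[OF u Z]
      by (simp add: metric_apply_apply)
  qed
  moreover have "gB x (X x) d = vf_apply X (b j) x" "gB x (P x) d = vf_apply P (b j) x"
    using GB.represents_apply[OF d X] GB.represents_apply[OF d P] GB.g_sym[OF x tX td] GB.g_sym[OF x tP td]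
    by (simp_all add: d_fun_def)
  ultimately show ?thesis
    using GB.pointwise_contraction_eq[OF x _ d] GB.pointwise_contraction_eq[OF x u d] guv[OF td] gv[OF td]
    by simp
qed

text \<open>Metric compatibility trades K(X,Y,P) for X(g(P,Y)) - K(X,P,Y); the derivative term is
  the one that has to cancel in \<open>R_LB_LF_LF_LB\<close>.\<close>

lemma KB_P:
  assumes X: "X \<in> vector_fields B" and Y: "Y \<in> vector_fields B" and x: "x \<in> points B"
  shows "KB X Y P x = vf_apply X (metric_apply gB P Y) x - koszul gB X P Y x
    + metric_apply gB X P x * metric_apply gB Y P x - metric_apply gB X Y x * metric_apply gB P P x"
  using GB.koszul_compat[OF X P Y x] by (simp add: ssm_koszul_def)

section \<open>Derivatives of Koszul forms of lifts and the curvature case by case\<close>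

context
  fixes p
  assumes p: "p \<in> points PM"
begin

lemmas p_fst = points_fst[OF p]
lemmas p_snd = points_snd[OF p]

lemma der_LB_fst:
  assumes X: "X \<in> vector_fields B" and c: "c \<in> smooth_functions B" and eq: "\<And>q. q \<in> points PM \<Longrightarrow> h q = c (fst q)"
  shows "vf_apply (LB X) h p = vf_apply X c (fst p)"
  using PM.vf_apply_eq[OF LB_VF[OF X] p eq] LB_fst[OF c] by simp

lemma der_LB_prod:
  assumes X: "X \<in> vector_fields B" and c: "c \<in> smooth_functions B" and k: "k \<in> smooth_functions (F j)"
    and eq: "\<And>q. q \<in> points PM \<Longrightarrow> h q = c (fst q) * k (snd q j)"
  shows "vf_apply (LB X) h p = vf_apply X c (fst p) * k (snd p j)"
  using PM.vf_apply_eq[OF LB_VF[OF X] p eq] LB_prod[OF X c k p] by simp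

lemma der_LF_prod:
  assumes V: "V \<in> vector_fields (F i)" and c: "c \<in> smooth_functions B" and k: "k \<in> smooth_functions (F j)"
    and eq: "\<And>q. q \<in> points PM \<Longrightarrow> h q = c (fst q) * k (snd q j)"
  shows "vf_apply (LF i V) h p = (if i = j then c (fst p) * vf_apply V k (snd p j) else 0)"
  using PM.vf_apply_eq[OF LF_VF[OF V] p eq] LF_prod_same[OF _ c k p, of V] LF_prod_diff[OF V c k p] V
  by (cases "i = j") auto

text \<open>With fibre arguments these values are zero or a function of the base times a function of
  one fibre, which a field of another fibre annihilates.\<close>

lemma der_LF_zero:
  assumes A: "A \<in> vector_fields (F l)" and V: "V \<in> vector_fields (F i)" and W: "W \<in> vector_fields (F j)"
  shows "X \<in> vector_fields B \<Longrightarrow> \<not> (l = i \<and> i = j) \<Longrightarrow> vf_apply (LF l A) (K (LB X) (LF i V) (LF j W)) p = 0"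
    and "X \<in> vector_fields B \<Longrightarrow> \<not> (l = i \<and> i = j) \<Longrightarrow> vf_apply (LF l A) (K (LF i V) (LB X) (LF j W)) p = 0"
    and "U \<in> vector_fields (F k) \<Longrightarrow> \<not> (l = i \<and> i = j \<and> j = k) \<Longrightarrow>
      vf_apply (LF l A) (K (LF i V) (LF j W) (LF k U)) p = 0"
proof -
  note zero = vf_apply_zero_on_points[OF p LF_VF[OF A]]
  show "vf_apply (LF l A) (K (LB X) (LF i V) (LF j W)) p = 0"
    if X: "X \<in> vector_fields B" and ne: "\<not> (l = i \<and> i = j)"
  proof (cases "i = j")
    case True
    note V = V[unfolded True]
    have "vf_apply (LF l A) (K (LB X) (LF j V) (LF j W)) p =
        (if l = j then b j (fst p) * vf_apply X (b j) (fst p) * vf_apply A (metric_apply (gF j) V W) (snd p j) else 0)"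
      by (rule der_LF_prod[OF A B.smooth_functions_mult[OF b_smooth B.VF_smooth[OF X b_smooth]]
            GF.g_smooth[OF V W]]) (simp add: S_LB_LF_LF[OF P _ X V W])
    then show ?thesis using ne True by simp
  next
    case False
    show ?thesis by (rule zero) (rule S_LB_LF_LF_diff[OF P _ X V W False])
  qed
  show "vf_apply (LF l A) (K (LF i V) (LB X) (LF j W)) p = 0"
    if X: "X \<in> vector_fields B" and ne: "\<not> (l = i \<and> i = j)"
  proof (cases "i = j")
    case True
    note V = V[unfolded True]
    have c: "(\<lambda>x. b j x * vf_apply X (b j) x + (b j x)\<^sup>2 * metric_apply gB X P x) \<in> smooth_functions B"
      by (intro B.smooth_functions_add B.smooth_functions_mult B.VF_smooth[OF X b_smooth] b_smooth
          b_square_smooth GB.g_smooth X P)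
    have "vf_apply (LF l A) (K (LF j V) (LB X) (LF j W)) p =
        (if l = j then (b j (fst p) * vf_apply X (b j) (fst p) + (b j (fst p))\<^sup>2 * metric_apply gB X P (fst p)) *
          vf_apply A (metric_apply (gF j) V W) (snd p j) else 0)"
      by (rule der_LF_prod[OF A c GF.g_smooth[OF V W]]) (simp add: S_LF_LB_LF[OF P _ X V W])
    then show ?thesis using ne True by simp
  next
    case False
    show ?thesis by (rule zero) (rule S_LF_LB_LF_diff[OF P _ X V W False])
  qed
  show "vf_apply (LF l A) (K (LF i V) (LF j W) (LF k U)) p = 0"
    if U: "U \<in> vector_fields (F k)" and ne: "\<not> (l = i \<and> i = j \<and> j = k)"
  proof (cases "i = j \<and> j = k")
    case True
    then have ij: "i = k" "j = k" by simp_all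
    note V = V[unfolded ij] and W = W[unfolded ij]
    have "vf_apply (LF l A) (K (LF k V) (LF k W) (LF k U)) p =
        (if l = k then (b k (fst p))\<^sup>2 * vf_apply A (koszul (gF k) V W U) (snd p k) else 0)"
      by (rule der_LF_prod[OF A b_square_smooth GF.koszul_smooth[OF V W U]]) (rule S_LF_LF_LF[OF P _ V W U])
    then show ?thesis using ne ij by simp
  next
    case False
    show ?thesis by (rule zero) (rule S_LF_LF_LF_diff[OF P _ V W U False])
  qed
qed

text \<open>For fields of different fibres the form is represented by the zero vector, so only
  representability of the other form has to be supplied.\<close>

lemma contraction_diff:
  assumes V: "V \<in> vector_fields (F i)" and W: "W \<in> vector_fields (F j)" and ne: "i \<noteq> j"
  shows "X \<in> vector_fields B \<Longrightarrow> Y \<in> vector_fields B \<Longrightarrow>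
      contraction PM G (K (LF i V) (LF j W)) (K (LB X) (LB Y)) p = 0"
    and "fibre_form \<omega> k h U \<Longrightarrow> contraction PM G (K (LF i V) (LF j W)) \<omega> p = 0"
    and "fibre_form \<omega> k h U \<Longrightarrow> contraction PM G \<omega> (K (LF i V) (LF j W)) p = 0"
    and "U \<in> vector_fields (F k) \<Longrightarrow> Q \<in> vector_fields (F s) \<Longrightarrow>
      contraction PM G (K (LF i V) (LF j W)) (K (LF k U) (LF s Q)) p = 0"
    and "U \<in> vector_fields (F k) \<Longrightarrow> Q \<in> vector_fields (F s) \<Longrightarrow>
      contraction PM G (K (LF k U) (LF s Q)) (K (LF i V) (LF j W)) p = 0"
  by (rule contraction_zero(1)[OF p represents_fibre_fibre_diff[OF V W ne] representable_lifts(1)]; assumption)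
    (rule contraction_zero(1)[OF p represents_fibre_fibre_diff[OF V W ne] representable_lifts(2)]
      contraction_zero(2)[OF p represents_fibre_fibre_diff[OF V W ne] representable_lifts(2)]
      contraction_zero(1)[OF p represents_fibre_fibre_diff[OF V W ne] representable_lifts(3)]
      contraction_zero(2)[OF p represents_fibre_fibre_diff[OF V W ne] representable_lifts(3)]; assumption)+

lemmas R_def = ssm_curvature_def curvature_of_def

lemma R_LB_LB_LB_LB:
  assumes X: "X \<in> vector_fields B" and Y: "Y \<in> vector_fields B" and Z: "Z \<in> vector_fields B" and T: "T \<in> vector_fields B"
  shows "R (LB X) (LB Y) (LB Z) (LB T) p = ssm_curvature B gB P X Y Z T (fst p)"
proof -
  have d: "vf_apply (LB X) (K (LB Y) (LB Z) (LB T)) p = vf_apply X (KB Y Z T) (fst p)"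
    if X: "X \<in> vector_fields B" and Y: "Y \<in> vector_fields B" for X Y
    by (rule der_LB_fst[OF X B.tensorial_smooth[OF KB_tensorial[OF Y Z] T]]) (rule S_LB_LB_LB[OF P _ Y Z T])
  show ?thesis
    unfolding R_def d[OF X Y] d[OF Y X] S_bracket_LB_LB[OF P p X Y LB_VF[OF Z] LB_VF[OF T]]
      S_LB_LB_LB[OF P p B.VF_bracket[OF X Y] Z T] contraction_base_base[OF p X Z Y T] contraction_base_base[OF p Y Z X T]
      KB_contraction[OF X Z Y T p_fst] KB_contraction[OF Y Z X T p_fst] ..
qed

lemma R_LB_LB_LB_LF:
  assumes X: "X \<in> vector_fields B" and Y: "Y \<in> vector_fields B" and Z: "Z \<in> vector_fields B" and W: "W \<in> vector_fields (F j)"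
  shows "R (LB X) (LB Y) (LB Z) (LF j W) p = 0"
proof -
  have d: "vf_apply (LB X) (K (LB Y) (LB Z) (LF j W)) p = 0"
    if X: "X \<in> vector_fields B" and Y: "Y \<in> vector_fields B" for X Y
    by (rule vf_apply_zero_on_points[OF p LB_VF[OF X]]) (rule S_LB_LB_LF[OF P _ Y Z W])
  show ?thesis
    unfolding R_def d[OF X Y] d[OF Y X] S_bracket_LB_LB[OF P p X Y LB_VF[OF Z] LF_VF[OF W]]
      S_LB_LB_LF[OF P p B.VF_bracket[OF X Y] Z W]
      contraction_base_fibre_form(1)[OF p X Z fibre_form_LB_LF[OF Y W]]
      contraction_base_fibre_form(1)[OF p Y Z fibre_form_LB_LF[OF X W]] by simp
qed

lemma R_LB_LF_LB_LB:
  assumes X: "X \<in> vector_fields B" and Y: "Y \<in> vector_fields B" and Z: "Z \<in> vector_fields B" and W: "W \<in> vector_fields (F j)"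
  shows "R (LB Z) (LF j W) (LB X) (LB Y) p = 0"
proof -
  have d1: "vf_apply (LB Z) (K (LF j W) (LB X) (LB Y)) p = 0"
    by (rule vf_apply_zero_on_points[OF p LB_VF[OF Z]]) (rule S_LF_LB_LB[OF P _ X Y W])
  have d2: "vf_apply (LF j W) (K (LB Z) (LB X) (LB Y)) p = 0"
    using PM.vf_apply_eq[OF LF_VF[OF W] p S_LB_LB_LB[OF P _ Z X Y]] LF_fst[OF W p, of "KB Z X Y"] by simp
  show ?thesis
    unfolding R_def d1 d2 S_bracket_LB_LF[OF P p Z W LB_VF[OF X] LB_VF[OF Y]]
      contraction_base_fibre_form(1)[OF p Z X fibre_form_LF_LB[OF Y W]]
      contraction_base_fibre_form(2)[OF p Z Y fibre_form_LF_LB[OF X W]] by simp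
qed

text \<open>For equal indices the derivative terms leave b (XY(b) - YX(b)), which is the bracket
  term, and the contractions X(b) Y(b) and Y(b) X(b) cancel.\<close>

lemma R_LB_LB_LF_LF:
  assumes X: "X \<in> vector_fields B" and Y: "Y \<in> vector_fields B" and V: "V \<in> vector_fields (F i)" and W: "W \<in> vector_fields (F j)"
  shows "R (LB X) (LB Y) (LF i V) (LF j W) p = 0"
proof (cases "i = j")
  case True
  note V = V[unfolded True]
  let ?m = "metric_apply (gF j) V W (snd p j)"
  have d: "vf_apply (LB X) (K (LB Y) (LF j V) (LF j W)) p =
      (b j (fst p) * vf_apply X (vf_apply Y (b j)) (fst p) + vf_apply X (b j) (fst p) * vf_apply Y (b j) (fst p)) * ?m"
    if X: "X \<in> vector_fields B" and Y: "Y \<in> vector_fields B" for X Y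
    using der_LB_prod[OF X B.smooth_functions_mult[OF b_smooth B.VF_smooth[OF Y b_smooth]] GF.g_smooth[OF V W]
        S_LB_LF_LF[OF P _ Y V W]]
    unfolding B.vf_apply_mult[OF X p_fst b_smooth B.VF_smooth[OF Y b_smooth]] by simp
  have br: "vf_apply (lie_bracket X Y) (b j) (fst p) =
      vf_apply X (vf_apply Y (b j)) (fst p) - vf_apply Y (vf_apply X (b j)) (fst p)"
    by (simp add: lie_bracket_def vf_apply_apply)
  show ?thesis
    unfolding True R_def d[OF X Y] d[OF Y X] S_bracket_LB_LB[OF P p X Y LF_VF[OF V] LF_VF[OF W]]
      S_LB_LF_LF[OF P p B.VF_bracket[OF X Y] V W] br
      contraction_fibre_form_same[OF p fibre_form_LB_LF[OF X V] fibre_form_LB_LF[OF Y W]]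
      contraction_fibre_form_same[OF p fibre_form_LB_LF[OF Y V] fibre_form_LB_LF[OF X W]]
    by (simp add: algebra_simps)
next
  case False
  have d: "vf_apply (LB X) (K (LB Y) (LF i V) (LF j W)) p = 0"
    if X: "X \<in> vector_fields B" and Y: "Y \<in> vector_fields B" for X Y
    by (rule vf_apply_zero_on_points[OF p LB_VF[OF X]]) (rule S_LB_LF_LF_diff[OF P _ Y V W False])
  show ?thesis
    unfolding R_def d[OF X Y] d[OF Y X] S_bracket_LB_LB[OF P p X Y LF_VF[OF V] LF_VF[OF W]]
      S_LB_LF_LF_diff[OF P p B.VF_bracket[OF X Y] V W False]
      contraction_fibre_form_diff[OF p fibre_form_LB_LF[OF X V] fibre_form_LB_LF[OF Y W] False]
      contraction_fibre_form_diff[OF p fibre_form_LB_LF[OF Y V] fibre_form_LB_LF[OF X W] False]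
    by simp
qed

text \<open>For equal indices the two contractions have the same coefficients and agree by symmetry
  of the fibre metric; all other terms vanish.\<close>

lemma R_LF_LF_LB_LB:
  assumes X: "X \<in> vector_fields B" and Y: "Y \<in> vector_fields B" and V: "V \<in> vector_fields (F i)" and W: "W \<in> vector_fields (F j)"
  shows "R (LF i V) (LF j W) (LB X) (LB Y) p = 0"
proof -
  have d: "vf_apply (LF i V) (K (LF j W) (LB X) (LB Y)) p = 0"
    if V: "V \<in> vector_fields (F i)" and W: "W \<in> vector_fields (F j)" for i j V W
    by (rule vf_apply_zero_on_points[OF p LF_VF[OF V]]) (rule S_LF_LB_LB[OF P _ X Y W])
  show ?thesis
  proof (cases "i = j")
    case True
    note V = V[unfolded True]
    have sym: "metric_apply (gF j) W V (snd p j) = metric_apply (gF j) V W (snd p j)"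
      unfolding metric_apply_apply by (rule GF.g_sym[OF p_snd F.VF_tangent[OF W p_snd] F.VF_tangent[OF V p_snd]])
    show ?thesis
      unfolding True R_def d[OF V W] d[OF W V] S_bracket_LF_LF[OF P p V W LB_VF[OF X] LB_VF[OF Y]]
        S_LF_LB_LB[OF P p X Y F.VF_bracket[OF V W]]
        contraction_fibre_form_same[OF p fibre_form_LF_LB[OF X V] fibre_form_LF_LB[OF Y W]]
        contraction_fibre_form_same[OF p fibre_form_LF_LB[OF X W] fibre_form_LF_LB[OF Y V]] sym by simp
  next
    case False
    show ?thesis
      unfolding R_def d[OF V W] d[OF W V] S_bracket_LF_LF_diff[OF P p V W False LB_VF[OF X] LB_VF[OF Y]]
        contraction_fibre_form_diff[OF p fibre_form_LF_LB[OF X V] fibre_form_LF_LB[OF Y W] False]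
        contraction_fibre_form_diff[OF p fibre_form_LF_LB[OF X W] fibre_form_LF_LB[OF Y V] False[symmetric]] by simp
  qed
qed

lemma der_LF_LB_LF_LB:
  assumes X: "X \<in> vector_fields B" and Y: "Y \<in> vector_fields B" and V: "V \<in> vector_fields (F i)" and W: "W \<in> vector_fields (F j)"
  shows "vf_apply (LF i V) (K (LB X) (LF j W) (LB Y)) p = 0"
  by (rule vf_apply_zero_on_points[OF p LF_VF[OF V]]) (rule S_LB_LF_LB[OF P _ X Y W])

lemma R_LB_LF_LF_LB_diff:
  assumes X: "X \<in> vector_fields B" and Y: "Y \<in> vector_fields B" and V: "V \<in> vector_fields (F i)" and W: "W \<in> vector_fields (F j)"
    and ne: "i \<noteq> j"
  shows "R (LB X) (LF i V) (LF j W) (LB Y) p = 0"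
proof -
  have d: "vf_apply (LB X) (K (LF i V) (LF j W) (LB Y)) p = 0"
    by (rule vf_apply_zero_on_points[OF p LB_VF[OF X]]) (rule S_LF_LF_LB_diff[OF P _ Y V W ne])
  show ?thesis
    unfolding R_def d der_LF_LB_LF_LB[OF X Y V W] S_bracket_LB_LF[OF P p X V LF_VF[OF W] LB_VF[OF Y]]
      contraction_fibre_form_diff[OF p fibre_form_LB_LF[OF X W] fibre_form_LF_LB[OF Y V] ne[symmetric]]
      contraction_diff(1)[OF V W ne X Y] by simp
qed

text \<open>The derivative acts on \<open>- c\<close> times the fibre metric. Its part X(b) Y(b)
  cancels with the first contraction, b^2 X(g(P,Y)) cancels through \<open>KB_P\<close>, and of 2 b
  X(b) g(P,Y) one half is cancelled by the first contraction, the other by the second through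
  \<open>gstar_KB\<close>.\<close>

lemma R_LB_LF_LF_LB:
  assumes X: "X \<in> vector_fields B" and Y: "Y \<in> vector_fields B" and V: "V \<in> vector_fields (F j)" and W: "W \<in> vector_fields (F j)"
  shows "R (LB X) (LF j V) (LF j W) (LB Y) p =
    (b j (fst p) * gstar (koszul gB X Y) (d_fun (b j)) (fst p)
     - b j (fst p) * vf_apply X (vf_apply Y (b j)) (fst p)
     - (b j (fst p))\<^sup>2 * koszul gB X P Y (fst p)
     - b j (fst p) * vf_apply P (b j) (fst p) * metric_apply gB X Y (fst p)
     + (b j (fst p))\<^sup>2 * metric_apply gB X P (fst p) * metric_apply gB Y P (fst p)
     - (b j (fst p))\<^sup>2 * metric_apply gB X Y (fst p) * metric_apply gB P P (fst p))
    * metric_apply (gF j) V W (snd p j)"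
proof -
  let ?m = "metric_apply (gF j) V W (snd p j)"
  define c where "c = (\<lambda>x. b j x * vf_apply Y (b j) x + (b j x)\<^sup>2 * metric_apply gB P Y x)"
  have s: "(\<lambda>x. b j x * vf_apply Y (b j) x) \<in> smooth_functions B" "(\<lambda>x. (b j x)\<^sup>2 * metric_apply gB P Y x) \<in> smooth_functions B"
    by (intro B.smooth_functions_mult B.VF_smooth[OF Y b_smooth] b_smooth b_square_smooth GB.g_smooth Y P)+
  have c: "c \<in> smooth_functions B" unfolding c_def by (rule B.smooth_functions_add[OF s])
  have Xc: "vf_apply X c (fst p) = b j (fst p) * vf_apply X (vf_apply Y (b j)) (fst p) +
      vf_apply X (b j) (fst p) * vf_apply Y (b j) (fst p) +
      (b j (fst p))\<^sup>2 * vf_apply X (metric_apply gB P Y) (fst p) +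
      2 * b j (fst p) * vf_apply X (b j) (fst p) * metric_apply gB P Y (fst p)"
    unfolding c_def vf_apply_apply[of _ "\<lambda>x. _ x + _ x"] B.tangent_add[OF B.VF_tangent[OF X p_fst] s]
    unfolding vf_apply_apply[symmetric] B.vf_apply_mult[OF X p_fst b_smooth B.VF_smooth[OF Y b_smooth]]
      B.vf_apply_mult[OF X p_fst b_square_smooth GB.g_smooth[OF P Y]] vf_apply_square[OF X p_fst b_smooth] by simp
  have d: "vf_apply (LB X) (K (LF j V) (LF j W) (LB Y)) p = vf_apply X c (fst p) * - ?m"
    by (rule der_LB_prod[OF X c F.smooth_functions_minus[OF GF.g_smooth[OF V W]]])
      (simp add: S_LF_LF_LB[OF P _ Y V W] c_def)
  have sym: "metric_apply (gF j) W V (snd p j) = ?m"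
    unfolding metric_apply_apply by (rule GF.g_sym[OF p_snd F.VF_tangent[OF W p_snd] F.VF_tangent[OF V p_snd]])
  have symB: "metric_apply gB P Y (fst p) = metric_apply gB Y P (fst p)"
    unfolding metric_apply_apply by (rule GB.g_sym[OF p_fst B.VF_tangent[OF P p_fst] B.VF_tangent[OF Y p_fst]])
  show ?thesis
    unfolding R_def d Xc der_LF_LB_LF_LB[OF X Y V W] S_bracket_LB_LF[OF P p X V LF_VF[OF W] LB_VF[OF Y]]
      contraction_fibre_form_same[OF p fibre_form_LB_LF[OF X W] fibre_form_LF_LB[OF Y V]]
      contraction_base_fibre[OF p X Y V W] gstar_KB[OF X Y p_fst] KB_P[OF X Y p_fst] sym symB
    by (simp add: algebra_simps power2_eq_square)
qed

text \<open>For equal indices everything is b X(b) times K(V,W,U) + K(V,U,W) - V(g(W,U)) on the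
  fibre, which is 0 by \<open>koszul_compat\<close>. Otherwise every term vanishes
  separately.\<close>

lemma R_LB_LF_LF_LF:
  assumes X: "X \<in> vector_fields B" and V: "V \<in> vector_fields (F i)" and W: "W \<in> vector_fields (F j)" and U: "U \<in> vector_fields (F k)"
  shows "R (LB X) (LF i V) (LF j W) (LF k U) p = 0"
proof (cases "i = j \<and> j = k")
  case True
  then have ij: "i = j" "k = j" by simp_all
  note V = V[unfolded ij] and U = U[unfolded ij]
  have d1: "vf_apply (LB X) (K (LF j V) (LF j W) (LF j U)) p =
      2 * b j (fst p) * vf_apply X (b j) (fst p) * koszul (gF j) V W U (snd p j)"
    unfolding vf_apply_square[OF X p_fst b_smooth, symmetric]
    by (rule der_LB_prod[OF X b_square_smooth GF.koszul_smooth[OF V W U]]) (rule S_LF_LF_LF[OF P _ V W U])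
  have d2: "vf_apply (LF j V) (K (LB X) (LF j W) (LF j U)) p =
      (if j = j then b j (fst p) * vf_apply X (b j) (fst p) * vf_apply V (metric_apply (gF j) W U) (snd p j) else 0)"
    by (rule der_LF_prod[OF V B.smooth_functions_mult[OF b_smooth B.VF_smooth[OF X b_smooth]] GF.g_smooth[OF W U]])
      (rule S_LB_LF_LF[OF P _ X W U])
  show ?thesis
    unfolding ij R_def d1 d2 S_bracket_LB_LF[OF P p X V LF_VF[OF W] LF_VF[OF U]]
      contraction_fibre_form_fibre(1)[OF p fibre_form_LB_LF[OF X W] V U]
      contraction_fibre_form_fibre(2)[OF p fibre_form_LB_LF[OF X U] V W]
      GF.koszul_compat[OF V W U p_snd, symmetric] by (simp add: algebra_simps)
next
  case False
  have d1: "vf_apply (LB X) (K (LF i V) (LF j W) (LF k U)) p = 0"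
    by (rule vf_apply_zero_on_points[OF p LB_VF[OF X]]) (rule S_LF_LF_LF_diff[OF P _ V W U False])
  have c1: "contraction PM G (K (LB X) (LF j W)) (K (LF i V) (LF k U)) p = 0"
  proof (cases "i = k")
    case True
    then show ?thesis
      using contraction_fibre_form_fibre(1)[OF p fibre_form_LB_LF[OF X W] V U[folded True]] False by auto
  next
    case ne: False
    show ?thesis by (rule contraction_diff(3)[OF V U ne fibre_form_LB_LF[OF X W]])
  qed
  have c2: "contraction PM G (K (LF i V) (LF j W)) (K (LB X) (LF k U)) p = 0"
  proof (cases "i = j")
    case True
    then show ?thesis
      using contraction_fibre_form_fibre(2)[OF p fibre_form_LB_LF[OF X U] V W[folded True]] False by auto
  next
    case ne: False
    show ?thesis by (rule contraction_diff(2)[OF V W ne fibre_form_LB_LF[OF X U]])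
  qed
  show ?thesis
    unfolding R_def d1 der_LF_zero(1)[OF V W U X False] S_bracket_LB_LF[OF P p X V LF_VF[OF W] LF_VF[OF U]] c1 c2
    by simp
qed

text \<open>For equal indices a common coefficient from the base splits off. Two uses of
  \<open>koszul_compat\<close> turn the derivatives into Koszul forms, and what remains is
  \<open>koszul_torsion\<close>.\<close>

lemma R_LF_LF_LB_LF:
  assumes X: "X \<in> vector_fields B" and W: "W \<in> vector_fields (F i)" and U: "U \<in> vector_fields (F j)" and V: "V \<in> vector_fields (F k)"
  shows "R (LF i W) (LF j U) (LB X) (LF k V) p = 0"
proof (cases "i = j \<and> j = k")
  case True
  then have ij: "i = j" "k = j" by simp_all
  note V = V[unfolded ij] and W = W[unfolded ij]
  let ?h = "b j (fst p) * vf_apply X (b j) (fst p) + (b j (fst p))\<^sup>2 * metric_apply gB X P (fst p)"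
  have c: "(\<lambda>x. b j x * vf_apply X (b j) x + (b j x)\<^sup>2 * metric_apply gB X P x) \<in> smooth_functions B"
    by (intro B.smooth_functions_add B.smooth_functions_mult B.VF_smooth[OF X b_smooth] b_smooth
        b_square_smooth GB.g_smooth X P)
  have d: "vf_apply (LF j W) (K (LF j U) (LB X) (LF j V)) p =
      (if j = j then ?h * vf_apply W (metric_apply (gF j) U V) (snd p j) else 0)"
    if W: "W \<in> vector_fields (F j)" and U: "U \<in> vector_fields (F j)" for W U
    by (rule der_LF_prod[OF W c GF.g_smooth[OF U V]]) (rule S_LF_LB_LF[OF P _ X U V])
  show ?thesis
    unfolding ij R_def d[OF W U] d[OF U W] S_bracket_LF_LF[OF P p W U LB_VF[OF X] LF_VF[OF V]]
      S_LF_LB_LF[OF P p X F.VF_bracket[OF W U] V]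
      contraction_fibre_form_fibre(1)[OF p fibre_form_LF_LB[OF X W] U V]
      contraction_fibre_form_fibre(1)[OF p fibre_form_LF_LB[OF X U] W V]
      GF.koszul_compat[OF W U V p_snd, symmetric] GF.koszul_compat[OF U W V p_snd, symmetric]
      GF.koszul_torsion[OF W U V p_snd, symmetric] by (simp add: algebra_simps power2_eq_square)
next
  case False
  have br: "K (lie_bracket (LF i W) (LF j U)) (LB X) (LF k V) p = 0"
  proof (cases "i = j")
    case True
    then have ne: "j \<noteq> k" using False by simp
    show ?thesis
      unfolding True S_bracket_LF_LF[OF P p W[unfolded True] U LB_VF[OF X] LF_VF[OF V]]
      by (rule S_LF_LB_LF_diff[OF P p X F.VF_bracket[OF W[unfolded True] U] V ne])
  next
    case False
    show ?thesis by (rule S_bracket_LF_LF_diff[OF P p W U False LB_VF[OF X] LF_VF[OF V]])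
  qed
  have c: "contraction PM G (K (LF i W) (LB X)) (K (LF j U) (LF k V)) p = 0"
    if W: "W \<in> vector_fields (F i)" and U: "U \<in> vector_fields (F j)" and n: "\<not> (i = j \<and> j = k)" for i j W U
  proof (cases "j = k")
    case True
    then show ?thesis
      using contraction_fibre_form_fibre(1)[OF p fibre_form_LF_LB[OF X W] U V[folded True]] n by auto
  next
    case ne: False
    show ?thesis by (rule contraction_diff(3)[OF U V ne fibre_form_LF_LB[OF X W]])
  qed
  have False': "\<not> (j = i \<and> i = k)" using False by auto
  show ?thesis
    unfolding R_def der_LF_zero(2)[OF W U V X False] der_LF_zero(2)[OF U W V X False'] br c[OF W U False] c[OF U W False']
    by simp
qed

text \<open>The parts with the square of \<open>b j\<close> reassemble the defining formula of the
  curvature of the fibre; the base parts of the two contractions supply the rest.\<close>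

lemma R_LF_LF_LF_LF_same:
  assumes U: "U \<in> vector_fields (F j)" and V: "V \<in> vector_fields (F j)" and W: "W \<in> vector_fields (F j)" and Q: "Q \<in> vector_fields (F j)"
  shows "R (LF j U) (LF j V) (LF j W) (LF j Q) p = (b j (fst p))\<^sup>2 * curvature (F j) (gF j) U V W Q (snd p j) +
    base_factor j j (fst p) * (metric_apply (gF j) U W (snd p j) * metric_apply (gF j) V Q (snd p j)
      - metric_apply (gF j) V W (snd p j) * metric_apply (gF j) U Q (snd p j))"
proof -
  have d: "vf_apply (LF j U) (K (LF j V) (LF j W) (LF j Q)) p =
      (if j = j then (b j (fst p))\<^sup>2 * vf_apply U (koszul (gF j) V W Q) (snd p j) else 0)"
    if U: "U \<in> vector_fields (F j)" and V: "V \<in> vector_fields (F j)" for U V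
    by (rule der_LF_prod[OF U b_square_smooth GF.koszul_smooth[OF V W Q]]) (rule S_LF_LF_LF[OF P _ V W Q])
  show ?thesis
    unfolding R_def curvature_def d[OF U V] d[OF V U] S_bracket_LF_LF[OF P p U V LF_VF[OF W] LF_VF[OF Q]]
      S_LF_LF_LF[OF P p F.VF_bracket[OF U V] W Q] contraction_fibre_fibre[OF p U W V Q] contraction_fibre_fibre[OF p V W U Q]
    by (simp add: algebra_simps)
qed

text \<open>Without four equal indices the Koszul form in each derivative term either vanishes or
  lives on a fibre along which it is not differentiated, and the bracket term vanishes too.\<close>

lemma R_LF_LF_LF_LF:
  assumes U: "U \<in> vector_fields (F k)" and V: "V \<in> vector_fields (F i)" and W: "W \<in> vector_fields (F j)" and Q: "Q \<in> vector_fields (F s)"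
    and ne: "\<not> (i = j \<and> j = k \<and> k = s)"
  shows "R (LF k U) (LF i V) (LF j W) (LF s Q) p =
    contraction PM G (K (LF k U) (LF j W)) (K (LF i V) (LF s Q)) p
    - contraction PM G (K (LF i V) (LF j W)) (K (LF k U) (LF s Q)) p"
proof -
  have br: "K (lie_bracket (LF k U) (LF i V)) (LF j W) (LF s Q) p = 0"
  proof (cases "k = i")
    case True
    then have ne': "\<not> (i = j \<and> j = s)" using ne by auto
    show ?thesis
      unfolding True S_bracket_LF_LF[OF P p U[unfolded True] V LF_VF[OF W] LF_VF[OF Q]]
      by (rule S_LF_LF_LF_diff[OF P p F.VF_bracket[OF U[unfolded True] V] W Q ne'])
  next
    case False
    show ?thesis by (rule S_bracket_LF_LF_diff[OF P p U V False LF_VF[OF W] LF_VF[OF Q]])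
  qed
  have n: "\<not> (k = i \<and> i = j \<and> j = s)" "\<not> (i = k \<and> k = j \<and> j = s)" using ne by auto
  show ?thesis
    unfolding R_def br der_LF_zero(3)[OF U V W Q n(1)] der_LF_zero(3)[OF V U W Q n(2)] by simp
qed

text \<open>Only the contraction pairing equal indices survives. It comes with
  \<open>base_factor j i\<close>, so the symmetry \<open>gstar_sym\<close> is used to exchange the
  indices.\<close>

lemma R_LF_LF_LF_LF_pairs:
  assumes U: "U \<in> vector_fields (F j)" and V: "V \<in> vector_fields (F i)" and W: "W \<in> vector_fields (F j)" and Q: "Q \<in> vector_fields (F i)"
    and ne: "j \<noteq> i"
  shows "R (LF j U) (LF i V) (LF j W) (LF i Q) p =
    base_factor i j (fst p) * metric_apply (gF i) V Q (snd p i) * metric_apply (gF j) U W (snd p j)"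
proof -
  have ne': "\<not> (i = j \<and> j = j \<and> j = i)" "i \<noteq> j" using ne by auto
  show ?thesis
    unfolding R_LF_LF_LF_LF[OF U V W Q ne'(1)] contraction_fibre_fibre[OF p U W V Q]
      contraction_diff(4)[OF V W ne'(2) U Q]
    using ne gstar_sym[OF p_fst, of i j] by (simp add: base_factor_def algebra_simps)
qed

text \<open>A contraction can be nonzero only if each of its two forms takes both fields from one
  fibre: j = k and i = s for the first, i = j and k = s for the second. The excluded patterns are
  exactly these.\<close>

lemma R_LF_LF_LF_LF_zero:
  assumes U: "U \<in> vector_fields (F k)" and V: "V \<in> vector_fields (F i)" and W: "W \<in> vector_fields (F j)" and Q: "Q \<in> vector_fields (F s)"
    and ne: "\<not> (i = j \<and> j = k \<and> k = s)" "\<not> (j = k \<and> k \<noteq> i \<and> i = s)" "\<not> (i = j \<and> j \<noteq> k \<and> k = s)"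
  shows "R (LF k U) (LF i V) (LF j W) (LF s Q) p = 0"
proof -
  have z: "contraction PM G (K (LF k U) (LF j W)) (K (LF i V) (LF s Q)) p = 0"
    if U: "U \<in> vector_fields (F k)" and V: "V \<in> vector_fields (F i)" and n: "k \<noteq> j \<or> i \<noteq> s" for i k U V
    using n
  proof
    assume "k \<noteq> j" then show ?thesis by (rule contraction_diff(4)[OF U W _ V Q])
  next
    assume "i \<noteq> s" then show ?thesis by (rule contraction_diff(5)[OF V Q _ U W])
  qed
  have n: "k \<noteq> j \<or> i \<noteq> s" "i \<noteq> j \<or> k \<noteq> s" using ne by auto
  show ?thesis
    unfolding R_LF_LF_LF_LF[OF U V W Q ne(1)] z[OF U V n(1)] z[OF V U n(2)] by simp
qed

end

end

theorem theorem2p11: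
  fixes B :: "('a, 'd::euclidean_space) manifold"
    and gB :: "'a metric"
    and F :: "'m::finite \<Rightarrow> ('c, 'e::euclidean_space) manifold"
    and gF :: "'m \<Rightarrow> 'c metric"
    and b :: "'m \<Rightarrow> 'a \<Rightarrow> real"
    and P X Y Z T :: "'a vfield"
    and i j k s :: 'm
    and U V W Q :: "'c vfield"
    and x :: 'a and y :: "'m \<Rightarrow> 'c"
  assumes base: "singular_semi_riemannian B gB" "nondegenerate B gB"
    and fibres: "\<And>l. semi_regular (F l) (gF l)"
    and warping: "\<And>l. b l \<in> smooth_functions B"
    and P: "P \<in> vector_fields B"
    and XYZT: "X \<in> vector_fields B" "Y \<in> vector_fields B"
      "Z \<in> vector_fields B" "T \<in> vector_fields B"
    and UVWQ: "U \<in> vector_fields (F k)" "V \<in> vector_fields (F i)"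
      "W \<in> vector_fields (F j)" "Q \<in> vector_fields (F s)"
    and point: "(x, y) \<in> points (product_manifold B F)"
  shows
    "let LB = lift_base B F;
         LF = lift_fibre B F;
         R = (\<lambda>A1 A2 A3 A4. ssm_curvature (product_manifold B F) (warped_metric B gB F gF b)
                (LB P) A1 A2 A3 A4 (x, y));
         gb = (\<lambda>A C. metric_apply gB A C x);
         gf = (\<lambda>l A C. metric_apply (gF l) A C (y l));
         gstar = (\<lambda>\<omega> \<tau>. inverse_metric B gB \<omega> \<tau> x);
         db = (\<lambda>l. d_fun (b l));
         Pb = (\<lambda>l. vf_apply P (b l) x);
         bx = (\<lambda>l. b l x)
     in
      \<comment> \<open>(1)\<close>
      R (LB X) (LB Y) (LB Z) (LB T) = ssm_curvature B gB P X Y Z T x \<and>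
      \<comment> \<open>(2)\<close>
      R (LB X) (LB Y) (LB Z) (LF j W) = 0 \<and> R (LB Z) (LF j W) (LB X) (LB Y) = 0 \<and>
      \<comment> \<open>(3)\<close>
      (i = j \<longrightarrow>
        R (LB X) (LB Y) (LF i V) (LF j W) = 0 \<and> R (LF i V) (LF j W) (LB X) (LB Y) = 0) \<and>
      \<comment> \<open>(4)\<close>
      (i = j \<longrightarrow>
        R (LB X) (LF i V) (LF j W) (LB Y)
          = bx j * gstar (koszul gB X Y) (db j) * gf j V W
          - bx j * vf_apply X (vf_apply Y (b j)) x * gf j V W
          - (bx j)\<^sup>2 * gf j V W * koszul gB X P Y x
          - bx j * Pb j * gb X Y * gf j V W
          + (bx j)\<^sup>2 * gb X P * gb Y P * gf j V W
          - (bx j)\<^sup>2 * gb X Y * gb P P * gf j V W) \<and>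
      \<comment> \<open>(5)\<close>
      (i \<noteq> j \<longrightarrow>
        R (LB X) (LB Y) (LF i V) (LF j W) = 0 \<and> R (LF i V) (LF j W) (LB X) (LB Y) = 0 \<and>
        R (LB X) (LF i V) (LF j W) (LB Y) = 0) \<and>
      \<comment> \<open>(6)\<close>
      (i = j \<and> j = k \<longrightarrow>
        R (LB X) (LF i V) (LF j W) (LF k U) = 0 \<and> R (LF j W) (LF k U) (LB X) (LF i V) = 0) \<and>
      \<comment> \<open>(7)\<close>
      (i = j \<and> j \<noteq> k \<longrightarrow>
        R (LB X) (LF i V) (LF j W) (LF k U) = 0 \<and> R (LB X) (LF k U) (LF i V) (LF j W) = 0 \<and>
        R (LF j W) (LF k U) (LB X) (LF i V) = 0 \<and> R (LF i V) (LF j W) (LB X) (LF k U) = 0) \<and>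
      \<comment> \<open>(8)\<close>
      (i \<noteq> j \<and> j \<noteq> k \<and> i \<noteq> k \<longrightarrow>
        R (LB X) (LF i V) (LF j W) (LF k U) = 0 \<and> R (LF j W) (LF k U) (LB X) (LF i V) = 0) \<and>
      \<comment> \<open>(9)\<close>
      (i = j \<and> j = k \<and> k = s \<longrightarrow>
        R (LF k U) (LF i V) (LF j W) (LF s Q)
          = (bx j)\<^sup>2 * curvature (F j) (gF j) U V W Q (y j)
          + ((bx j)\<^sup>2 * gstar (db j) (db j) + 2 * (bx j) ^ 3 * Pb j + (bx j) ^ 4 * gb P P)
            * (gf j U W * gf j V Q - gf j V W * gf j U Q)) \<and>
      \<comment> \<open>(10)\<close>
      (i = j \<and> j = s \<and> s \<noteq> k \<longrightarrow>
        R (LF k U) (LF i V) (LF j W) (LF s Q) = 0 \<and> R (LF j W) (LF s Q) (LF k U) (LF i V) = 0) \<and>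
      \<comment> \<open>(11)\<close>
      (j = k \<and> k \<noteq> i \<and> i = s \<longrightarrow>
        R (LF k U) (LF i V) (LF j W) (LF s Q)
          = (bx i * bx j * gstar (db i) (db j) + bx i * (bx j)\<^sup>2 * Pb i + bx j * (bx i)\<^sup>2 * Pb j
             + (bx i)\<^sup>2 * (bx j)\<^sup>2 * gb P P) * gf i V Q * gf j U W) \<and>
      \<comment> \<open>(12); the last excluded index pattern is (11) with its first two arguments interchanged,
         on which R is skew\<close>
      (\<not> (i = j \<and> j = k \<and> k = s) \<and> \<not> (i = j \<and> j = s \<and> s \<noteq> k) \<and> \<not> (j = k \<and> k \<noteq> i \<and> i = s) \<and>
       \<not> (i = j \<and> j \<noteq> k \<and> k = s) \<longrightarrow>
        R (LF k U) (LF i V) (LF j W) (LF s Q) = 0)"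
proof -
  have F: "metric_mfd (F l) (gF l)" for l
    using fibres[of l] unfolding semi_regular_def radical_stationary_def
    by (intro singular_semi_riemannian_metric_mfd) blast
  note B = singular_semi_riemannian_metric_mfd[OF base(1)]
  interpret warped_regular B F gB gF b P
    by (intro warped_regular.intro warped.intro product_mfd.intro product_mfd_axioms.intro warped_axioms.intro
        warped_regular_axioms.intro metric_mfd.axioms(1)[OF B] metric_mfd.axioms(1)[OF F] B F warping base(2) fibres P)
  let ?p = "(x, y)"
  note X = XYZT(1) and Y = XYZT(2) and Z = XYZT(3) and T = XYZT(4)
  note U = UVWQ(1) and V = UVWQ(2) and W = UVWQ(3) and Q = UVWQ(4)
  note BBBB = R_LB_LB_LB_LB[OF point X Y Z T, unfolded fst_conv]
    and BBBF = R_LB_LB_LB_LF[OF point X Y Z W]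
    and BFBB = R_LB_LF_LB_LB[OF point X Y Z W]
    and BBFF = R_LB_LB_LF_LF[OF point X Y V W]
    and FFBB = R_LF_LF_LB_LB[OF point X Y V W]
    and BFFB = R_LB_LF_LF_LB_diff[OF point X Y V W]
    \<comment> \<open>The permuted second instances here and in \<open>FFBF\<close> serve the
      pattern of two equal indices, where further arrangements of the same fields are
      claimed.\<close>
    and BFFF = R_LB_LF_LF_LF[OF point X V W U] R_LB_LF_LF_LF[OF point X U V W]
    and FFBF = R_LF_LF_LB_LF[OF point X W U V] R_LF_LF_LB_LF[OF point X V W U]
  have 4: "R (LB X) (LF i V) (LF j W) (LB Y) ?p =
      b j x * gstar (koszul gB X Y) (d_fun (b j)) x * metric_apply (gF j) V W (y j)
      - b j x * vf_apply X (vf_apply Y (b j)) x * metric_apply (gF j) V W (y j)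
      - (b j x)\<^sup>2 * metric_apply (gF j) V W (y j) * koszul gB X P Y x
      - b j x * vf_apply P (b j) x * metric_apply gB X Y x * metric_apply (gF j) V W (y j)
      + (b j x)\<^sup>2 * metric_apply gB X P x * metric_apply gB Y P x * metric_apply (gF j) V W (y j)
      - (b j x)\<^sup>2 * metric_apply gB X Y x * metric_apply gB P P x * metric_apply (gF j) V W (y j)" if "i = j"
    unfolding that R_LB_LF_LF_LB[OF point X Y V[unfolded that] W] by (simp add: algebra_simps)
  have 9: "R (LF k U) (LF i V) (LF j W) (LF s Q) ?p =
      (b j x)\<^sup>2 * curvature (F j) (gF j) U V W Q (y j)
      + ((b j x)\<^sup>2 * gstar (d_fun (b j)) (d_fun (b j)) x + 2 * (b j x) ^ 3 * vf_apply P (b j) x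
         + (b j x) ^ 4 * metric_apply gB P P x)
        * (metric_apply (gF j) U W (y j) * metric_apply (gF j) V Q (y j)
           - metric_apply (gF j) V W (y j) * metric_apply (gF j) U Q (y j))" if "i = j \<and> j = k \<and> k = s"
  proof -
    have e: "i = j" "k = j" "s = j" using that by simp_all
    have f: "base_factor j j x = (b j x)\<^sup>2 * gstar (d_fun (b j)) (d_fun (b j)) x
        + 2 * (b j x) ^ 3 * vf_apply P (b j) x + (b j x) ^ 4 * metric_apply gB P P x"
      by (simp add: base_factor_def power2_eq_square power3_eq_cube power4_eq_xxxx algebra_simps)
    show ?thesis
      unfolding e R_LF_LF_LF_LF_same[OF point U[unfolded e] V[unfolded e] W Q[unfolded e]] f[symmetric] by simp
  qed
  have 10: "R (LF k U) (LF i V) (LF j W) (LF s Q) ?p = 0 \<and> R (LF j W) (LF s Q) (LF k U) (LF i V) ?p = 0"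
    if "i = j \<and> j = s \<and> s \<noteq> k"
    using that R_LF_LF_LF_LF_zero[OF point U V W Q] R_LF_LF_LF_LF_zero[OF point W Q U V] by auto
  have 11: "R (LF k U) (LF i V) (LF j W) (LF s Q) ?p =
      (b i x * b j x * gstar (d_fun (b i)) (d_fun (b j)) x + b i x * (b j x)\<^sup>2 * vf_apply P (b i) x
       + b j x * (b i x)\<^sup>2 * vf_apply P (b j) x + (b i x)\<^sup>2 * (b j x)\<^sup>2 * metric_apply gB P P x)
        * metric_apply (gF i) V Q (y i) * metric_apply (gF j) U W (y j)" if "j = k \<and> k \<noteq> i \<and> i = s"
  proof -
    have e: "k = j" "s = i" "j \<noteq> i" using that by auto
    show ?thesis
      unfolding e(1,2) R_LF_LF_LF_LF_pairs[OF point U[unfolded e(1)] V W Q[unfolded e(2)] e(3)]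
      by (simp add: base_factor_def)
  qed
  \<comment> \<open>The case of equal i, j, s and different k is handled separately above, although
    neither contraction pairs its indices there either.\<close>
  have 12: "R (LF k U) (LF i V) (LF j W) (LF s Q) ?p = 0"
    if "\<not> (i = j \<and> j = k \<and> k = s)" "\<not> (j = k \<and> k \<noteq> i \<and> i = s)" "\<not> (i = j \<and> j \<noteq> k \<and> k = s)"
    using R_LF_LF_LF_LF_zero[OF point U V W Q that] .
  show ?thesis
    unfolding Let_def
    by (intro conjI impI;
        (rule BBBB BBBF BFBB BBFF FFBB BFFF FFBF 4 BFFB 9 11 10[THEN conjunct1] 10[THEN conjunct2] 12; blast)?)
qed

end
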